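(* Let $k$ be an infinite field, and let $p:=\operatorname{char}k$ if this is positive and $p:=\infty$ otherwise. Let $G$ be a finite group such that $|G|$ is invertible in $k$ and $p\ge\frac38|G|+1$. Let $R$ be the regular representation of $G$ over $k$. Then $\beta_k(G)=\beta(k[R]^G)$.
   Context: For an $\mathbb N$-graded commutative ring $A=\bigoplus_{d\ge0}A_d$ put $\beta(A):=\inf\{n\in\mathbb N\mid A\text{ is generated as a ring by }\bigoplus_{d=0}^nA_d\}$ (with $\inf\emptyset=\infty$). $\beta_k(G):=\sup_A\beta(A^G)\in\mathbb N\cup\{\infty\}$, where $A$ runs through all $\mathbb N$-graded commutative $k$-algebras with a $G$-action (by degree-preserving $k$-algebra automorphisms) and with $\beta(A)\le1$; $A^G$ is the graded subring of invariants. $k[R]$ denotes the ring of polynomial functions on $R$, graded by degree. If $\operatorname{char}k=0$ the inequality on $p=\infty$ always holds. *)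

theory Defs
  imports "HOL-Algebra.Algebra" "HOL-Library.Extended_Nat" "HOL-Library.Extended_Real"
begin

text \<open>
  An \<open>\<nat>\<close>-graded commutative ring is a ring \<open>A\<close> together with the family \<open>D\<close> of its
  homogeneous components.
\<close>

definition graded_cring :: "('a, 'm) ring_scheme \<Rightarrow> (nat \<Rightarrow> 'a set) \<Rightarrow> bool" where
  "graded_cring A D \<longleftrightarrow>
     cring A \<and>
     (\<forall>d. additive_subgroup (D d) A) \<and>
     (\<forall>d e. \<forall>a \<in> D d. \<forall>b \<in> D e. a \<otimes>\<^bsub>A\<^esub> b \<in> D (d + e)) \<and>
     (\<forall>a \<in> carrier A. \<exists>!f. (\<forall>d. f d \<in> D d) \<and> finite {d. f d \<noteq> \<zero>\<^bsub>A\<^esub>} \<and>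
        a = (\<Oplus>\<^bsub>A\<^esub>d\<in>{d. f d \<noteq> \<zero>\<^bsub>A\<^esub>}. f d))"

definition sum_upto_deg :: "('a, 'm) ring_scheme \<Rightarrow> (nat \<Rightarrow> 'a set) \<Rightarrow> nat \<Rightarrow> 'a set" where
  "sum_upto_deg A D n = {(\<Oplus>\<^bsub>A\<^esub>d\<in>{..n}. f d) | f. f \<in> Pi {..n} D}"

definition gen_degree :: "('a, 'm) ring_scheme \<Rightarrow> (nat \<Rightarrow> 'a set) \<Rightarrow> enat" where
  "gen_degree A D = Inf {enat n | n. generate_ring A (sum_upto_deg A D n) = carrier A}"

definition graded_algebra ::
    "('k, 'l) ring_scheme \<Rightarrow> ('k, 'a, 'm) module_scheme \<Rightarrow> (nat \<Rightarrow> 'a set) \<Rightarrow> bool" where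
  "graded_algebra K A D \<longleftrightarrow>
     algebra K A \<and> graded_cring A D \<and>
     (\<forall>d. \<forall>c \<in> carrier K. \<forall>a \<in> D d. c \<odot>\<^bsub>A\<^esub> a \<in> D d)"

definition graded_G_algebra ::
    "('k, 'l) ring_scheme \<Rightarrow> ('g, 'h) monoid_scheme \<Rightarrow> ('k, 'a, 'm) module_scheme \<Rightarrow>
     (nat \<Rightarrow> 'a set) \<Rightarrow> ('g \<Rightarrow> 'a \<Rightarrow> 'a) \<Rightarrow> bool" where
  "graded_G_algebra K G A D \<phi> \<longleftrightarrow>
     graded_algebra K A D \<and> group_action G (carrier A) \<phi> \<and>
     (\<forall>g \<in> carrier G.
        \<phi> g \<in> ring_hom A A \<and>
        (\<forall>c \<in> carrier K. \<forall>a \<in> carrier A. \<phi> g (c \<odot>\<^bsub>A\<^esub> a) = c \<odot>\<^bsub>A\<^esub> \<phi> g a) \<and>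
        (\<forall>d. \<phi> g ` D d \<subseteq> D d))"

definition inv_ring ::
    "('g, 'h) monoid_scheme \<Rightarrow> ('a, 'm) ring_scheme \<Rightarrow> ('g \<Rightarrow> 'a \<Rightarrow> 'a) \<Rightarrow> ('a, 'm) ring_scheme" where
  "inv_ring G A \<phi> = A\<lparr>carrier := (\<Inter>g\<in>carrier G. invariants (carrier A) \<phi> g)\<rparr>"

definition inv_gen_degree ::
    "('g, 'h) monoid_scheme \<Rightarrow> ('a, 'm) ring_scheme \<Rightarrow> (nat \<Rightarrow> 'a set) \<Rightarrow>
     ('g \<Rightarrow> 'a \<Rightarrow> 'a) \<Rightarrow> enat" where
  "inv_gen_degree G A D \<phi> =
     gen_degree (inv_ring G A \<phi>) (\<lambda>d. D d \<inter> carrier (inv_ring G A \<phi>))"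

text \<open>
  HOL cannot quantify over types inside a definition, so the supremum \<open>\<beta>\<^sub>k(G)\<close> over all algebras
  takes a universe type \<open>'u\<close> as a parameter and ranges over the algebras whose elements lie in
  \<open>'u\<close>. For finite \<open>G\<close> and infinite \<open>K\<close> the value does not depend on \<open>'u\<close> as soon as \<open>'u\<close>
  contains a copy of \<open>K\<close> (otherwise only the zero algebra lives in \<open>'u\<close>): an invariant that is not
  generated in lower degrees already lies in a finitely generated \<open>G\<close>-stable graded subalgebra
  generated in degrees at most 1, and such a subalgebra has at most as many elements as \<open>K\<close>.
\<close>

definition noether_number ::
    "'u itself \<Rightarrow> ('k, 'l) ring_scheme \<Rightarrow> ('g, 'h) monoid_scheme \<Rightarrow> enat" where
  "noether_number U K G =
     Sup {inv_gen_degree G A D \<phi> | (A :: ('k, 'u) module) D \<phi>.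
            graded_G_algebra K G A D \<phi> \<and> gen_degree A D \<le> 1}"

definition char_or_inf :: "('k, 'l) ring_scheme \<Rightarrow> ereal" where
  "char_or_inf K =
     (if \<exists>n::nat. 0 < n \<and> [n] \<cdot>\<^bsub>K\<^esub> \<one>\<^bsub>K\<^esub> = \<zero>\<^bsub>K\<^esub>
      then ereal (real (LEAST n::nat. 0 < n \<and> [n] \<cdot>\<^bsub>K\<^esub> \<one>\<^bsub>K\<^esub> = \<zero>\<^bsub>K\<^esub>))
      else \<infinity>)"

text \<open>
  Polynomial functions on the coordinate space \<open>K\<^sup>I\<close>, for a finite index set \<open>I\<close>. Both the points of
  \<open>K\<^sup>I\<close> and the functions on it are extensional. A monomial is given by its exponent vector.
\<close>

definition coord_space :: "('k, 'l) ring_scheme \<Rightarrow> 'i set \<Rightarrow> ('i \<Rightarrow> 'k) set" where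
  "coord_space K I = I \<rightarrow>\<^sub>E carrier K"

definition exponents :: "'i set \<Rightarrow> nat set \<Rightarrow> ('i \<Rightarrow> nat) set" where
  "exponents I N = {\<alpha> \<in> I \<rightarrow>\<^sub>E UNIV. (\<Sum>i\<in>I. \<alpha> i) \<in> N}"

definition poly_fun ::
    "('k, 'l) ring_scheme \<Rightarrow> 'i set \<Rightarrow> nat set \<Rightarrow> (('i \<Rightarrow> nat) \<Rightarrow> 'k) \<Rightarrow> ('i \<Rightarrow> 'k) \<Rightarrow> 'k" where
  "poly_fun K I N c =
     (\<lambda>v \<in> coord_space K I.
        \<Oplus>\<^bsub>K\<^esub>\<alpha>\<in>exponents I N. c \<alpha> \<otimes>\<^bsub>K\<^esub> (\<Otimes>\<^bsub>K\<^esub>i\<in>I. v i [^]\<^bsub>K\<^esub> \<alpha> i))"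

definition poly_fun_ring :: "('k, 'l) ring_scheme \<Rightarrow> 'i set \<Rightarrow> ('k, ('i \<Rightarrow> 'k) \<Rightarrow> 'k) module" where
  "poly_fun_ring K I =
     \<lparr>carrier = {poly_fun K I {..n} c | n c. c \<in> exponents I {..n} \<rightarrow> carrier K},
      monoid.mult = (\<lambda>p q. \<lambda>v \<in> coord_space K I. p v \<otimes>\<^bsub>K\<^esub> q v),
      monoid.one = (\<lambda>v \<in> coord_space K I. \<one>\<^bsub>K\<^esub>),
      ring.zero = (\<lambda>v \<in> coord_space K I. \<zero>\<^bsub>K\<^esub>),
      ring.add = (\<lambda>p q. \<lambda>v \<in> coord_space K I. p v \<oplus>\<^bsub>K\<^esub> q v),
      module.smult = (\<lambda>a p. \<lambda>v \<in> coord_space K I. a \<otimes>\<^bsub>K\<^esub> p v)\<rparr>"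

definition homog_poly_funs :: "('k, 'l) ring_scheme \<Rightarrow> 'i set \<Rightarrow> nat \<Rightarrow> (('i \<Rightarrow> 'k) \<Rightarrow> 'k) set" where
  "homog_poly_funs K I d = {poly_fun K I {d} c | c. c \<in> exponents I {d} \<rightarrow> carrier K}"

text \<open>
  The regular representation \<open>R\<close> has a basis \<open>(e\<^sub>x)\<close> indexed by the elements of \<open>G\<close>, with
  \<open>g e\<^sub>x = e\<^sub>g\<^sub>x\<close>. A vector is given by its coordinates, so \<open>R\<close> is the coordinate space
  \<open>K\<^sup>G\<close> and \<open>(g v)(x) = v(g\<^sup>-\<^sup>1x)\<close>. The group acts on functions on \<open>R\<close> by
  \<open>(g p)(v) = p(g\<^sup>-\<^sup>1v)\<close>.
\<close>

definition regular_action ::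
    "('k, 'l) ring_scheme \<Rightarrow> ('g, 'h) monoid_scheme \<Rightarrow> 'g \<Rightarrow> ('g \<Rightarrow> 'k) \<Rightarrow> 'g \<Rightarrow> 'k" where
  "regular_action K G g =
     (\<lambda>v \<in> coord_space K (carrier G). \<lambda>x \<in> carrier G. v (inv\<^bsub>G\<^esub> g \<otimes>\<^bsub>G\<^esub> x))"

definition regular_poly_action ::
    "('k, 'l) ring_scheme \<Rightarrow> ('g, 'h) monoid_scheme \<Rightarrow> 'g \<Rightarrow>
     (('g \<Rightarrow> 'k) \<Rightarrow> 'k) \<Rightarrow> ('g \<Rightarrow> 'k) \<Rightarrow> 'k" where
  "regular_poly_action K G g =
     (\<lambda>p \<in> carrier (poly_fun_ring K (carrier G)).
        \<lambda>v \<in> coord_space K (carrier G). p (regular_action K G (inv\<^bsub>G\<^esub> g) v))"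

end

theory Submission
  imports "HOL-Computational_Algebra.Polynomial" Defs
begin

text \<open>
  Let \<open>N = \<beta>(K[R]\<^sup>G)\<close> be finite and let \<open>A\<close> be generated in degrees at most 1. Averaging shows that
  \<open>A\<^sup>G\<close> is spanned by transfers \<open>T(\<Prod>\<^sub>i\<^sub>\<in>\<^sub>D a\<^sub>i)\<close> with \<open>T a = \<Sum>\<^sub>g g a\<close> and factors \<open>a\<^sub>i\<close> of degree at
  most 1. If \<open>|D| > N\<close>, such a transfer is a linear combination, with universal coefficients in
  \<open>K\<close>, of products \<open>T(\<Prod>\<^sub>B y\<^sub>i a\<^sub>i) T(\<Prod>\<^sub>D\<^sub>-\<^sub>B y\<^sub>i a\<^sub>i)\<close> with \<open>y\<^sub>i \<in> G\<close> and \<open>\<emptyset> \<noteq> B \<subset> D\<close>; then \<open>A\<^sup>G\<close> is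
  generated in degrees at most \<open>N\<close> by induction on \<open>|D|\<close>.

  By duality, these coefficients exist iff the only \<open>G\<close>-invariant function on the words \<open>D \<rightarrow> G\<close> that
  annihilates all the products is 0. The space \<open>L\<close> of these functions is stable under \<open>G\<^sup>D\<close> and under
  the permutations of \<open>D\<close>. A symmetric function in \<open>L\<close> is a linear form on the polynomials of degree
  \<open>|D|\<close> in \<open>K[R]\<close> that vanishes on products of invariants of positive degree, so it is 0 as \<open>|D| > N\<close>.
  Whether \<open>L\<close> is 0 can be tested over the algebraic closure, and there \<open>L \<noteq> 0\<close> would contain a
  nonzero symmetric function: cutting \<open>L\<close> by a tensor product of primitive idempotents of the group
  algebra leaves a submodule of a permutation module of a Young subgroup of the symmetric group. In
  such a group every element is conjugate to its inverse, which forces each submodule to contain a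
  nonzero vector fixed by the stabilizer of a point \<open>w\<close>; the sum over the orbit of \<open>w\<close> yields the
  symmetric function.

  Conversely, \<open>K[R]\<close> is itself one of the algebras \<open>A\<close>, and it has as many elements as \<open>K\<close>.
\<close>

section \<open>Linear algebra over a field that is an ideal of a ring\<close>

text \<open>The number of permutations of \<open>D\<close> may be 0 in the field, so symmetric
  functions cannot be made by averaging over permutations, and modules of the Young subgroup need
  not be semisimple. Only the group algebra of \<open>G\<close> is, and its matrix units replace
  polarization. For the Young subgroup the argument is one of duality. The dual of a simple
  submodule \<open>C\<close> of a permutation module is a quotient of that module, hence generated
  by the image of some point \<open>x\<close>, which the stabilizer of \<open>x\<close> fixes. Over
  an algebraically closed field an element that is nonzero on \<open>C\<close> has a multiple of
  nonzero trace; since \<open>y\<close> and its inverse are conjugate, an element kills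
  \<open>C\<close> iff its adjoint does. So \<open>C\<close> is isomorphic to its dual and contains
  the fixed vector. The closure serves eigenvalue arguments only; functions over the field embed
  into functions over the closure. Field, closure and algebra live on carriers inside types, whereas
  finite sums, products and polynomials are handled best over a type of class
  \<open>comm_ring_1\<close>; this is why each of them is turned into an ideal of such a
  type.\<close>

text \<open>The field is the ideal generated by \<open>e\<close>, with unit \<open>e\<close>.\<close>
locale idem_field =
  fixes e :: "'a::comm_ring_1"
  assumes idem: "e * e = e" and e_nonzero: "e \<noteq> 0"
    and inverse_exists: "e * x = x \<Longrightarrow> x \<noteq> 0 \<Longrightarrow> \<exists>y. e * y = y \<and> x * y = e"
begin

lemma mult_nonzero: "e * x = x \<Longrightarrow> e * y = y \<Longrightarrow> x \<noteq> 0 \<Longrightarrow> y \<noteq> 0 \<Longrightarrow> x * y \<noteq> 0"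
proof
  assume x: "e * x = x" "x \<noteq> 0" and y: "e * y = y" "y \<noteq> 0" and xy: "x * y = 0"
  obtain z where "x * z = e" using inverse_exists[OF x] by blast
  then have "y = (x * z) * y" using y(1) by simp
  then have "y = z * (x * y)" by (simp only: ac_simps)
  then show False using xy y by simp
qed

text \<open>The empty product is 1, which need not lie in the field; the factor \<open>e\<close>
  brings every product back into it.\<close>

lemma prod_nonzero:
  assumes "finite I" "\<And>i. i \<in> I \<Longrightarrow> e * f i = f i \<and> f i \<noteq> 0"
  shows "e * (\<Prod>i\<in>I. f i) \<noteq> 0"
  using assms
proof (induction I rule: finite_induct)
  case empty then show ?case using e_nonzero by simp
next
  case (insert i I)
  then have "e * f i = f i" "f i \<noteq> 0" "e * (\<Prod>i\<in>I. f i) \<noteq> 0" by auto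
  then have "f i * (e * (\<Prod>i\<in>I. f i)) \<noteq> 0"
    using mult_nonzero[of "f i" "e * prod f I"] idem by (simp flip: mult.assoc)
  then show ?case using insert by (simp add: mult.left_commute)
qed

section \<open>Subspaces of coordinate spaces, dimension and dual bases\<close>

definition vecs :: "'x set \<Rightarrow> ('x \<Rightarrow> 'a) set" where
  "vecs \<Omega> = {f. (\<forall>x. e * f x = f x) \<and> (\<forall>x. x \<notin> \<Omega> \<longrightarrow> f x = 0)}"

text \<open>Scalars may be taken from the whole ring: on \<open>vecs \<Omega>\<close> the scalar
  \<open>t\<close> acts as \<open>e * t\<close>, so this is closure under scalars of the
  field.\<close>

definition subsp :: "'x set \<Rightarrow> ('x \<Rightarrow> 'a) set \<Rightarrow> bool" where
  "subsp \<Omega> C \<longleftrightarrow> C \<subseteq> vecs \<Omega> \<and> (\<lambda>_. 0) \<in> C \<and> (\<forall>f\<in>C. \<forall>g\<in>C. (\<lambda>x. f x + g x) \<in> C) \<and>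
     (\<forall>t. \<forall>f\<in>C. (\<lambda>x. t * f x) \<in> C)"

lemma vecsD: "f \<in> vecs \<Omega> \<Longrightarrow> e * f x = f x" "f \<in> vecs \<Omega> \<Longrightarrow> x \<notin> \<Omega> \<Longrightarrow> f x = 0"
  by (auto simp: vecs_def)

lemma subspD:
  assumes "subsp \<Omega> C"
  shows "f \<in> C \<Longrightarrow> f \<in> vecs \<Omega>" "(\<lambda>_. 0) \<in> C" "f \<in> C \<Longrightarrow> g \<in> C \<Longrightarrow> (\<lambda>x. f x + g x) \<in> C"
    "f \<in> C \<Longrightarrow> (\<lambda>x. t * f x) \<in> C"
  using assms by (auto simp: subsp_def)

lemma subsp_diff: "subsp \<Omega> C \<Longrightarrow> f \<in> C \<Longrightarrow> g \<in> C \<Longrightarrow> (\<lambda>x. f x - g x) \<in> C"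
  by (frule subspD(4)[of \<Omega> C g "-1"], assumption, drule subspD(3)[of \<Omega> C f "\<lambda>x. -1 * g x"]) simp_all

lemma subsp_sum:
  assumes "subsp \<Omega> C" "\<And>i. i \<in> I \<Longrightarrow> f i \<in> C"
  shows "(\<lambda>x. \<Sum>i\<in>I. f i x) \<in> C"
  using assms(2)
proof (induction I rule: infinite_finite_induct)
  case (insert i I)
  then show ?case using subspD(3)[OF assms(1), of "f i" "\<lambda>x. \<Sum>i\<in>I. f i x"] by simp
qed (use subspD(2)[OF assms(1)] in auto)

lemma subsp_lincomb:
  assumes "subsp \<Omega> C" "\<And>i. i \<in> I \<Longrightarrow> f i \<in> C"
  shows "(\<lambda>x. \<Sum>i\<in>I. t i * f i x) \<in> C"
  by (rule subsp_sum[OF assms(1)]) (rule subspD(4)[OF assms(1) assms(2)])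

lemma subsp_vecs: "subsp \<Omega> (vecs \<Omega>)"
  unfolding subsp_def vecs_def by (simp add: distrib_left mult.left_commute[of e])

definition separates :: "'x set \<Rightarrow> ('x \<Rightarrow> 'a) set \<Rightarrow> 'x set \<Rightarrow> bool" where
  "separates \<Omega> C X0 \<longleftrightarrow> X0 \<subseteq> \<Omega> \<and> (\<forall>f\<in>C. (\<forall>x\<in>X0. f x = 0) \<longrightarrow> f = (\<lambda>_. 0))"

text \<open>This is the dimension: a subspace of dimension n is determined by n suitable coordinates
  and by no fewer. Measured this way, it comes with coordinates in which the subspace has a dual
  basis.\<close>

definition vdim :: "'x set \<Rightarrow> ('x \<Rightarrow> 'a) set \<Rightarrow> nat" where
  "vdim \<Omega> C = (LEAST n. \<exists>X0. separates \<Omega> C X0 \<and> card X0 = n)"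

lemma separates_all: "subsp \<Omega> C \<Longrightarrow> separates \<Omega> C \<Omega>"
proof -
  assume C: "subsp \<Omega> C"
  have "f = (\<lambda>_. 0)" if "f \<in> C" "\<forall>x\<in>\<Omega>. f x = 0" for f
    using vecsD(2)[OF subspD(1)[OF C that(1)]] that(2) by (intro ext) blast
  then show ?thesis by (auto simp: separates_def)
qed

lemma vdim_le: "separates \<Omega> C X0 \<Longrightarrow> vdim \<Omega> C \<le> card X0"
  unfolding vdim_def by (rule Least_le) auto

lemma vdim_attained:
  assumes "subsp \<Omega> C" obtains X0 where "separates \<Omega> C X0" "card X0 = vdim \<Omega> C"
  using LeastI_ex[of "\<lambda>n. \<exists>X0. separates \<Omega> C X0 \<and> card X0 = n"] separates_all[OF assms]
  unfolding vdim_def by blast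

text \<open>Minimality of \<open>X0\<close> means that dropping a coordinate \<open>x\<close> loses
  something: a nonzero member of \<open>C\<close> vanishes on the rest of \<open>X0\<close>. It
  cannot vanish at \<open>x\<close> and is scaled to the value \<open>e\<close> there. The expansion
  holds because both sides agree on the separating set.\<close>

lemma minimal_separating_dual_basis:
  assumes \<Omega>: "finite \<Omega>" and C: "subsp \<Omega> C" and s: "separates \<Omega> C X0" and "card X0 = vdim \<Omega> C"
  obtains c where "\<And>x. x \<in> X0 \<Longrightarrow> c x \<in> C"
    "\<And>x y. x \<in> X0 \<Longrightarrow> y \<in> X0 \<Longrightarrow> c x y = (if x = y then e else 0)"
    "\<And>f y. f \<in> C \<Longrightarrow> f y = (\<Sum>x\<in>X0. f x * c x y)"
proof -
  have X0: "finite X0" "X0 \<subseteq> \<Omega>" using s \<Omega> finite_subset by (auto simp: separates_def)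
  have "\<exists>f\<in>C. \<forall>y\<in>X0. f y = (if x = y then e else 0)" if x: "x \<in> X0" for x
  proof -
    have "card (X0 - {x}) < vdim \<Omega> C" using x X0 assms(4) by (metis card_Diff1_less)
    then have "\<not> separates \<Omega> C (X0 - {x})" using vdim_le by (meson leD)
    then obtain f where f: "f \<in> C" "\<And>y. y \<in> X0 \<Longrightarrow> y \<noteq> x \<Longrightarrow> f y = 0" "f \<noteq> (\<lambda>_. 0)"
      using X0 by (auto simp: separates_def)
    then have "f x \<noteq> 0" using s unfolding separates_def by metis
    then obtain t where "f x * t = e"
      using inverse_exists vecsD(1)[OF subspD(1)[OF C f(1)]] by blast
    then show ?thesis using subspD(4)[OF C f(1), of t] f(2)
      by (intro bexI[of _ "\<lambda>x. t * f x"]) (auto simp: mult.commute)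
  qed
  then obtain c where c: "\<And>x. x \<in> X0 \<Longrightarrow> c x \<in> C"
    "\<And>x y. x \<in> X0 \<Longrightarrow> y \<in> X0 \<Longrightarrow> c x y = (if x = y then e else 0)" by metis
  show thesis
  proof (rule that[OF c])
    fix f y assume f: "f \<in> C"
    let ?g = "\<lambda>y. f y - (\<Sum>x\<in>X0. f x * c x y)"
    have g: "?g \<in> C" by (rule subsp_diff[OF C f subsp_lincomb[OF C c(1)]])
    have "?g z = 0" if "z \<in> X0" for z
    proof -
      have "(\<Sum>x\<in>X0. f x * c x z) = (\<Sum>x\<in>X0. if x = z then f x * e else 0)"
        using that c(2) by (intro sum.cong) auto
      then show ?thesis using that X0 vecsD(1)[OF subspD(1)[OF C f]]
        by (simp add: sum.delta mult.commute)
    qed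
    then have "?g = (\<lambda>_. 0)" using s g by (auto simp: separates_def)
    then show "f y = (\<Sum>x\<in>X0. f x * c x y)" by (metis eq_iff_diff_eq_0)
  qed auto
qed

lemma dual_basis:
  assumes "finite \<Omega>" "subsp \<Omega> C"
  obtains X0 c where "X0 \<subseteq> \<Omega>" "\<And>x. x \<in> X0 \<Longrightarrow> c x \<in> C"
    "\<And>x y. x \<in> X0 \<Longrightarrow> y \<in> X0 \<Longrightarrow> c x y = (if x = y then e else 0)"
    "\<And>f y. f \<in> C \<Longrightarrow> f y = (\<Sum>x\<in>X0. f x * c x y)"
proof -
  obtain X0 where s: "separates \<Omega> C X0" "card X0 = vdim \<Omega> C" using vdim_attained[OF assms(2)] .
  then have "X0 \<subseteq> \<Omega>" by (auto simp: separates_def)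
  then show thesis by (rule minimal_separating_dual_basis[OF assms s, OF that])
qed

text \<open>If the dimension of \<open>B\<close> were not smaller, a smallest separating set for
  \<open>C\<close> would be a smallest one for \<open>B\<close>. The dual basis taken in
  \<open>B\<close> then expands every member of \<open>C\<close>, which puts \<open>C\<close> inside
  \<open>B\<close>.\<close>

lemma vdim_strict_mono:
  assumes \<Omega>: "finite \<Omega>" and C: "subsp \<Omega> C" and B: "subsp \<Omega> B" and BC: "B \<subset> C"
  shows "vdim \<Omega> B < vdim \<Omega> C"
proof (rule ccontr)
  assume n: "\<not> vdim \<Omega> B < vdim \<Omega> C"
  obtain X0 where s: "separates \<Omega> C X0" "card X0 = vdim \<Omega> C" using vdim_attained[OF C] .
  have fin: "finite X0" using s(1) \<Omega> finite_subset by (auto simp: separates_def)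
  have sB: "separates \<Omega> B X0" using s BC by (auto simp: separates_def)
  have "card X0 = vdim \<Omega> B" using vdim_le[OF sB] s n by simp
  then obtain c where c: "\<And>x. x \<in> X0 \<Longrightarrow> c x \<in> B"
    "\<And>x y. x \<in> X0 \<Longrightarrow> y \<in> X0 \<Longrightarrow> c x y = (if x = y then e else 0)"
    using minimal_separating_dual_basis[OF \<Omega> B sB] by metis
  have "f \<in> B" if f: "f \<in> C" for f
  proof -
    let ?h = "\<lambda>y. \<Sum>x\<in>X0. f x * c x y"
    let ?g = "\<lambda>y. f y - ?h y"
    have h: "?h \<in> B" by (rule subsp_lincomb[OF B c(1)])
    have g: "?g \<in> C" using subsp_diff[OF C f] h BC by blast
    have "?g z = 0" if "z \<in> X0" for z
    proof -
      have "(\<Sum>x\<in>X0. f x * c x z) = (\<Sum>x\<in>X0. if x = z then f x * e else 0)"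
        using that c(2) by (intro sum.cong) auto
      then show ?thesis using that fin vecsD(1)[OF subspD(1)[OF C f]]
        by (simp add: sum.delta mult.commute)
    qed
    then have "?g = (\<lambda>_. 0)" using s g by (auto simp: separates_def)
    then have "f = ?h" by (metis eq_iff_diff_eq_0)
    then show ?thesis using h by simp
  qed
  then show False using BC by auto
qed

lemma minimal_subspace:
  assumes \<Omega>: "finite \<Omega>" and "\<And>C. P C \<Longrightarrow> subsp \<Omega> C" "P C0"
  obtains C where "P C" "C \<subseteq> C0" "\<And>B. P B \<Longrightarrow> B \<subseteq> C \<Longrightarrow> B = C"
proof -
  obtain C where C: "P C \<and> C \<subseteq> C0" "\<And>B. P B \<and> B \<subseteq> C0 \<Longrightarrow> vdim \<Omega> C \<le> vdim \<Omega> B"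
    using ex_has_least_nat[of "\<lambda>C. P C \<and> C \<subseteq> C0" C0 "vdim \<Omega>"] assms by auto
  have "B = C" if "P B" "B \<subseteq> C" for B
  proof (rule ccontr)
    assume "B \<noteq> C"
    then have "vdim \<Omega> B < vdim \<Omega> C"
      using vdim_strict_mono[OF \<Omega> assms(2) assms(2)] that C(1) by (simp add: psubset_eq)
    then show False using C(2)[of B] C(1) that by auto
  qed
  then show thesis using that C(1) by blast
qed

lemma maximal_subspace:
  assumes \<Omega>: "finite \<Omega>" and "\<And>C. P C \<Longrightarrow> subsp \<Omega> C" "P C0"
  obtains C where "P C" "\<And>B. P B \<Longrightarrow> C \<subseteq> B \<Longrightarrow> B = C"
proof -
  have "vdim \<Omega> C \<le> card \<Omega>" if "P C" for C using vdim_le separates_all assms(2) that by blast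
  then obtain C where C: "P C" "\<And>B. P B \<Longrightarrow> vdim \<Omega> B \<le> vdim \<Omega> C"
    using ex_has_greatest_nat[of P C0 "vdim \<Omega>" "Suc (card \<Omega>)"] assms(3) by (metis le_imp_less_Suc)
  have "B = C" if "P B" "C \<subseteq> B" for B
  proof (rule ccontr)
    assume "B \<noteq> C"
    then have "vdim \<Omega> C < vdim \<Omega> B"
      using vdim_strict_mono[OF \<Omega> assms(2) assms(2)] that C(1) by (simp add: psubset_eq)
    then show False using C(2)[of B] that by auto
  qed
  then show thesis using that C(1) by blast
qed

definition pairing :: "'x set \<Rightarrow> ('x \<Rightarrow> 'a) \<Rightarrow> ('x \<Rightarrow> 'a) \<Rightarrow> 'a" where
  "pairing \<Omega> f g = (\<Sum>x\<in>\<Omega>. f x * g x)"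

text \<open>The dual basis of \<open>C\<close> predicts a vector from its values on
  \<open>X0\<close>, and exactly so on \<open>C\<close>. The vector \<open>w\<close> differs from
  its prediction at some \<open>z\<close>, and the error at \<open>z\<close> is the
  functional.\<close>

lemma separating_functional:
  assumes \<Omega>: "finite \<Omega>" and C: "subsp \<Omega> C" and w: "w \<in> vecs \<Omega>" "w \<notin> C"
  obtains l where "l \<in> vecs \<Omega>" "\<And>f. f \<in> C \<Longrightarrow> pairing \<Omega> l f = 0" "pairing \<Omega> l w \<noteq> 0"
proof -
  obtain X0 c where X0: "X0 \<subseteq> \<Omega>" and c: "\<And>x. x \<in> X0 \<Longrightarrow> c x \<in> C"
    "\<And>x y. x \<in> X0 \<Longrightarrow> y \<in> X0 \<Longrightarrow> c x y = (if x = y then e else 0)"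
    "\<And>f y. f \<in> C \<Longrightarrow> f y = (\<Sum>x\<in>X0. f x * c x y)" using dual_basis[OF \<Omega> C] by blast
  let ?h = "\<lambda>y. \<Sum>x\<in>X0. w x * c x y"
  have h: "?h \<in> C" by (rule subsp_lincomb[OF C c(1)])
  have "w \<noteq> ?h" using h w by auto
  then obtain z where z: "w z \<noteq> ?h z" by blast
  have zX: "z \<in> \<Omega>" using z w h subspD(1)[OF C h] by (metis vecsD(2))
  have fin: "finite X0" using \<Omega> X0 finite_subset by auto
  have zX0: "z \<notin> X0"
  proof
    assume "z \<in> X0"
    then have "?h z = (\<Sum>x\<in>X0. if x = z then w x * e else 0)" using c(2) by (intro sum.cong) auto
    then show False using z \<open>z \<in> X0\<close> fin vecsD(1)[OF w(1)] by (simp add: sum.delta mult.commute)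
  qed
  \<comment> \<open>\<open>pairing \<Omega> ?l f\<close> is \<open>f z\<close> minus the value at
    \<open>z\<close> that is predicted from \<open>f\<close> on \<open>X0\<close>.\<close>
  let ?l = "\<lambda>y. if y = z then e else if y \<in> X0 then - c y z else 0"
  have pl: "pairing \<Omega> ?l f = f z - (\<Sum>x\<in>X0. f x * c x z)" if "f \<in> vecs \<Omega>" for f
  proof -
    have "pairing \<Omega> ?l f = (\<Sum>y\<in>\<Omega>. (if y = z then e * f y else 0) + (if y \<in> X0 then - (f y * c y z) else 0))"
      unfolding pairing_def using zX0 by (intro sum.cong) auto
    also have "\<dots> = f z + (\<Sum>y\<in>\<Omega>. (if y \<in> X0 then - (f y * c y z) else 0))"
      using \<Omega> zX vecsD(1)[OF that] by (simp add: sum.distrib sum.delta)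
    also have "(\<Sum>y\<in>\<Omega>. (if y \<in> X0 then - (f y * c y z) else 0)) = (\<Sum>y\<in>X0. - (f y * c y z))"
      using \<Omega> X0 by (simp add: sum.inter_restrict[symmetric] Int_absorb1)
    finally show ?thesis by (simp add: sum_negf)
  qed
  show thesis
  proof (rule that)
    show "?l \<in> vecs \<Omega>" using idem zX X0 vecsD(1)[OF subspD(1)[OF C c(1)]] by (auto simp: vecs_def)
    show "pairing \<Omega> ?l f = 0" if "f \<in> C" for f using pl[OF subspD(1)[OF C that]] c(3)[OF that, of z] by simp
    show "pairing \<Omega> ?l w \<noteq> 0" using pl[OF w(1)] z by simp
  qed
qed

section \<open>Linear operators and eigenvectors\<close>

definition linear_on :: "('x \<Rightarrow> 'a) set \<Rightarrow> (('x \<Rightarrow> 'a) \<Rightarrow> ('x \<Rightarrow> 'a)) \<Rightarrow> bool" where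
  "linear_on C T \<longleftrightarrow> (\<forall>f\<in>C. T f \<in> C) \<and> (\<forall>f\<in>C. \<forall>g\<in>C. T (\<lambda>x. f x + g x) = (\<lambda>x. T f x + T g x)) \<and>
     (\<forall>t. \<forall>f\<in>C. T (\<lambda>x. t * f x) = (\<lambda>x. t * T f x))"

lemma linear_on_zero:
  assumes "subsp \<Omega> C" "linear_on C T"
  shows "T (\<lambda>_. 0) = (\<lambda>_. 0)"
proof -
  have "\<forall>t. \<forall>f\<in>C. T (\<lambda>x. t * f x) = (\<lambda>x. t * T f x)" using assms(2) by (simp add: linear_on_def)
  from this[rule_format, OF subspD(2)[OF assms(1)], of 0] show ?thesis by simp
qed

lemma linear_on_sum:
  assumes C: "subsp \<Omega> C" and T: "linear_on C T" and "\<And>i. i \<in> I \<Longrightarrow> f i \<in> C"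
  shows "T (\<lambda>x. \<Sum>i\<in>I. t i * f i x) = (\<lambda>x. \<Sum>i\<in>I. t i * T (f i) x)"
  using assms(3)
proof (induction I rule: infinite_finite_induct)
  case (insert i I)
  have "T (\<lambda>x. t i * f i x + (\<Sum>i\<in>I. t i * f i x)) = (\<lambda>x. T (\<lambda>x. t i * f i x) x + T (\<lambda>x. \<Sum>i\<in>I. t i * f i x) x)"
    using T insert subspD(4)[OF C] subsp_lincomb[OF C, of I f t] by (simp add: linear_on_def)
  then show ?case using insert T by (simp add: linear_on_def)
qed (use linear_on_zero[OF C T] in simp_all)

end

text \<open>The coefficients \<open>a k\<close> range over the whole ring; the outer factor
  \<open>e\<close> reduces them to the field.\<close>

locale idem_alg_closed_field = idem_field +
  assumes root_exists: "0 < m \<Longrightarrow> \<exists>t. e * t = t \<and> e * (t ^ m + (\<Sum>k<m. a k * t ^ k)) = 0"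
begin

lemma monic_poly_root:
  assumes "Polynomial.coeff p (Polynomial.degree p) = 1" "Polynomial.degree p > 0"
  shows "\<exists>t. e * t = t \<and> e * poly p t = 0"
proof -
  obtain t where t: "e * t = t" "e * (t ^ Polynomial.degree p + (\<Sum>k<Polynomial.degree p. Polynomial.coeff p k * t ^ k)) = 0"
    using root_exists[OF assms(2)] by blast
  have "poly p t = t ^ Polynomial.degree p + (\<Sum>k<Polynomial.degree p. Polynomial.coeff p k * t ^ k)"
    using assms(1) by (simp add: poly_altdef lessThan_Suc_atMost[symmetric])
  then show ?thesis using t by metis
qed

text \<open>Take a monic polynomial \<open>p\<close> of least degree with \<open>p(T) v = 0\<close>
  and a root \<open>t\<close> of it in the field. Then \<open>p = (X - t) q + p(t)\<close> with
  \<open>q\<close> monic of smaller degree, so \<open>q(T) v\<close> is a nonzero eigenvector. The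
  polynomials have coefficients in the whole ring and leading coefficient 1 rather than
  \<open>e\<close>, so that synthetic division and degrees behave as over a domain.\<close>

lemma eigenvector:
  assumes \<Omega>: "finite \<Omega>" and C: "subsp \<Omega> C" and T: "linear_on C T" and v: "v \<in> C" "v \<noteq> (\<lambda>_. 0)"
  obtains t w where "w \<in> C" "w \<noteq> (\<lambda>_. 0)" "T w = (\<lambda>x. t * w x)" "e * t = t"
proof -
  define ev where "ev p = (\<lambda>x. \<Sum>k\<le>Polynomial.degree p. Polynomial.coeff p k * (T ^^ k) v x)" for p
  have Tk: "(T ^^ k) v \<in> C" for k using T v by (induction k) (auto simp: linear_on_def)
  have ev: "ev p = (\<lambda>x. \<Sum>k\<le>n. Polynomial.coeff p k * (T ^^ k) v x)" if "Polynomial.degree p \<le> n" for p n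
    unfolding ev_def
  proof
    fix x show "(\<Sum>k\<le>Polynomial.degree p. Polynomial.coeff p k * (T ^^ k) v x) = (\<Sum>k\<le>n. Polynomial.coeff p k * (T ^^ k) v x)"
      using that by (intro sum.mono_neutral_left) (auto simp: coeff_eq_0)
  qed
  \<comment> \<open>\<open>W m\<close> is the span of the first \<open>m\<close> iterates of
    \<open>v\<close>. If no iterate were in the span of its predecessors, the dimension of
    \<open>W m\<close> would be at least \<open>m\<close> for all \<open>m\<close>, beyond
    \<open>card \<Omega>\<close>.\<close>
  define W where "W m = {\<lambda>x. \<Sum>k<m. a k * (T ^^ k) v x | a. True}" for m
  have WI: "(\<lambda>x. \<Sum>k<m. a k * (T ^^ k) v x) \<in> W m" for m a
    unfolding W_def by (rule CollectI) (rule exI[of _ a], simp)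
  have W: "subsp \<Omega> (W m)" for m
    unfolding subsp_def
  proof (intro conjI ballI allI)
    show "W m \<subseteq> vecs \<Omega>" using subsp_lincomb[OF C, of "{..<m}" "\<lambda>k. (T ^^ k) v"] Tk subspD(1)[OF C]
      by (auto simp: W_def)
    show "(\<lambda>_. 0) \<in> W m" using WI[of "\<lambda>_. 0"] by simp
    show "(\<lambda>x. f x + g x) \<in> W m" if "f \<in> W m" "g \<in> W m" for f g
      using that by (auto simp: W_def sum.distrib[symmetric] distrib_right[symmetric])
    show "(\<lambda>x. t * f x) \<in> W m" if f: "f \<in> W m" for f t
    proof -
      obtain a where "f = (\<lambda>x. \<Sum>k<m. a k * (T ^^ k) v x)" using f by (auto simp: W_def)
      then have "(\<lambda>x. t * f x) = (\<lambda>x. \<Sum>k<m. (t * a k) * (T ^^ k) v x)"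
        by (simp add: sum_distrib_left mult.assoc)
      then show ?thesis using WI[of "\<lambda>k. t * a k"] by simp
    qed
  qed
  have mono: "W m \<subseteq> W (Suc m)" for m
  proof
    fix f assume "f \<in> W m"
    then obtain a where "f = (\<lambda>x. \<Sum>k<m. a k * (T ^^ k) v x)" by (auto simp: W_def)
    then have "f = (\<lambda>x. \<Sum>k<Suc m. (if k < m then a k else 0) * (T ^^ k) v x)" by simp
    then show "f \<in> W (Suc m)" using WI[of "\<lambda>k. if k < m then a k else 0" "Suc m"] by simp
  qed
  have last: "(T ^^ m) v \<in> W (Suc m)" for m
  proof -
    have "(T ^^ m) v = (\<lambda>x. \<Sum>k<Suc m. (if k = m then 1 else 0) * (T ^^ k) v x)" by simp
    then show ?thesis using WI[of "\<lambda>k. if k = m then 1 else 0" "Suc m"] by simp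
  qed
  have "\<exists>m. (T ^^ m) v \<in> W m"
  proof (rule ccontr)
    assume n: "\<nexists>m. (T ^^ m) v \<in> W m"
    have "m \<le> vdim \<Omega> (W m)" for m
    proof (induction m)
      case (Suc m)
      have "W m \<subset> W (Suc m)" using mono last n by blast
      then show ?case using vdim_strict_mono[OF \<Omega> W W] Suc by (metis Suc_leI le_less_trans)
    qed simp
    moreover have "vdim \<Omega> (W m) \<le> card \<Omega>" for m using vdim_le separates_all W by blast
    ultimately show False by (metis Suc_n_not_le_n le_trans)
  qed
  then obtain m a where a: "(T ^^ m) v = (\<lambda>x. \<Sum>k<m. a k * (T ^^ k) v x)" by (auto simp: W_def)
  have "\<exists>p. Polynomial.coeff p (Polynomial.degree p) = 1 \<and> ev p = (\<lambda>_. 0)"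
  proof -
    let ?q = "\<Sum>k<m. Polynomial.monom (- a k) k"
    have cq: "Polynomial.coeff ?q k = (if k < m then - a k else 0)" for k by (simp add: coeff_sum)
    let ?p = "Polynomial.monom 1 m + ?q"
    have cp: "Polynomial.coeff ?p k = (if k = m then 1 else if k < m then - a k else 0)" for k by (simp add: cq)
    have deg: "Polynomial.degree ?p = m"
      by (rule antisym[OF degree_le le_degree]) (simp_all only: cp, auto)
    have "ev ?p = (\<lambda>_. 0)"
    proof
      fix x
      have "ev ?p x = (T ^^ m) v x + (\<Sum>k<m. - a k * (T ^^ k) v x)"
        unfolding ev_def deg by (simp only: cp lessThan_Suc_atMost[symmetric]) simp
      also have "\<dots> = 0" by (subst a) (simp add: sum_negf)
      finally show "ev ?p x = 0" .
    qed
    then show ?thesis using deg cp by metis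
  qed
  then obtain p where p: "Polynomial.coeff p (Polynomial.degree p) = 1" "ev p = (\<lambda>_. 0)"
    and min: "\<And>q. Polynomial.coeff q (Polynomial.degree q) = 1 \<Longrightarrow> ev q = (\<lambda>_. 0) \<Longrightarrow> Polynomial.degree p \<le> Polynomial.degree q"
    using ex_has_least_nat[of "\<lambda>p. Polynomial.coeff p (Polynomial.degree p) = 1 \<and> ev p = (\<lambda>_. 0)" _ Polynomial.degree] by blast
  have "Polynomial.degree p > 0"
  proof (rule ccontr)
    assume "\<not> 0 < Polynomial.degree p"
    then have "ev p = v" using p(1) by (auto simp: ev_def)
    then show False using p v by simp
  qed
  then obtain n where n: "Polynomial.degree p = Suc n" using gr0_implies_Suc by blast
  obtain t where t: "e * t = t" "e * poly p t = 0" using monic_poly_root[OF p(1)] n by auto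
  define q where "q = synthetic_div p t"
  have sd: "p + Polynomial.smult t q = pCons (poly p t) q" unfolding q_def by (rule synthetic_div_correct)
  have dq: "Polynomial.degree q = n" using n by (simp add: q_def degree_synthetic_div)
  have "Polynomial.coeff (p + Polynomial.smult t q) (Suc n) = Polynomial.coeff q n" unfolding sd by simp
  then have lq: "Polynomial.coeff q (Polynomial.degree q) = 1" using p(1) n dq by (simp add: coeff_eq_0)
  let ?w = "ev q"
  have w0: "?w \<noteq> (\<lambda>_. 0)" using min[OF lq] n dq by auto
  have wC: "?w \<in> C" unfolding ev_def by (rule subsp_lincomb[OF C Tk])
  have Tw: "T ?w x = (\<Sum>k\<le>n. Polynomial.coeff q k * (T ^^ Suc k) v x)" for x
    unfolding ev_def dq by (subst linear_on_sum[OF C T Tk]) simp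
  have "T ?w x = t * ?w x" for x
  proof -
    have "ev p x + t * ?w x = (\<Sum>k\<le>Suc n. Polynomial.coeff (p + Polynomial.smult t q) k * (T ^^ k) v x)"
      using ev[of p "Suc n"] ev[of q "Suc n"] n dq
      by (simp del: sum.atMost_Suc add: sum_distrib_left sum.distrib distrib_right mult.assoc)
    also have "\<dots> = poly p t * v x + T ?w x"
      unfolding sd Tw by (simp add: sum.atMost_Suc_shift del: sum.atMost_Suc)
    \<comment> \<open>\<open>poly p t\<close> need not be 0 in the ring, but \<open>e\<close> kills
      it and \<open>v\<close> takes its values in the field.\<close>
    also have "poly p t * v x = 0"
      using arg_cong[OF t(2), of "\<lambda>z. z * v x"] vecsD(1)[OF subspD(1)[OF C v(1)], of x]
      by (simp add: mult.assoc mult.left_commute[of e])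
    finally show ?thesis using p(2) by simp
  qed
  then show thesis using that[OF wC w0 _ t(1)] by blast
qed

end

section \<open>Traces in coordinates\<close>

context idem_field
begin

text \<open>If \<open>c\<close> is a dual basis for the coordinates \<open>B\<close>, then
  \<open>T (c x) x\<close> is a diagonal entry of the matrix of \<open>T\<close>.\<close>

definition linear_trace :: "'x set \<Rightarrow> ('x \<Rightarrow> 'x \<Rightarrow> 'a) \<Rightarrow> (('x \<Rightarrow> 'a) \<Rightarrow> ('x \<Rightarrow> 'a)) \<Rightarrow> 'a" where
  "linear_trace B c T = (\<Sum>x\<in>B. T (c x) x)"

lemma linear_trace_commute:
  assumes C: "subsp \<Omega> C" and S: "linear_on C S" and T: "linear_on C T"
    and c: "\<And>x. x \<in> B \<Longrightarrow> c x \<in> C" and exp: "\<And>f y. f \<in> C \<Longrightarrow> f y = (\<Sum>x\<in>B. f x * c x y)"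
  shows "linear_trace B c (\<lambda>f. S (T f)) = linear_trace B c (\<lambda>f. T (S f))"
proof -
  have *: "P (Q (c x)) x = (\<Sum>y\<in>B. Q (c x) y * P (c y) x)"
    if P: "linear_on C P" and Q: "linear_on C Q" and x: "x \<in> B" for P Q x
  proof -
    have "Q (c x) \<in> C" using Q c[OF x] by (simp add: linear_on_def)
    then have "Q (c x) = (\<lambda>z. \<Sum>y\<in>B. Q (c x) y * c y z)" using exp by blast
    then have "P (Q (c x)) = P (\<lambda>z. \<Sum>y\<in>B. Q (c x) y * c y z)" by (rule arg_cong)
    also have "\<dots> = (\<lambda>z. \<Sum>y\<in>B. Q (c x) y * P (c y) z)" by (rule linear_on_sum[OF C P c])
    finally show ?thesis by simp
  qed
  have "linear_trace B c (\<lambda>f. S (T f)) = (\<Sum>x\<in>B. \<Sum>y\<in>B. T (c x) y * S (c y) x)"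
    unfolding linear_trace_def by (rule sum.cong[OF refl *[OF S T]])
  also have "\<dots> = (\<Sum>x\<in>B. \<Sum>y\<in>B. T (c y) x * S (c x) y)" by (rule sum.swap)
  also have "\<dots> = (\<Sum>x\<in>B. \<Sum>y\<in>B. S (c x) y * T (c y) x)" by (simp only: mult.commute)
  also have "\<dots> = linear_trace B c (\<lambda>f. T (S f))"
    unfolding linear_trace_def by (rule sum.cong[OF refl *[OF T S], symmetric])
  finally show ?thesis .
qed

end

section \<open>Permutation modules\<close>

locale fin_action = idem_field e + group Y for e :: "'a::comm_ring_1" and Y :: "('y, 'b) monoid_scheme" +
  fixes act :: "'y \<Rightarrow> 'x \<Rightarrow> 'x" and \<Omega> :: "'x set"
  assumes fin_Y: "finite (carrier Y)" and fin_\<Omega>: "finite \<Omega>"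
    and act_closed: "y \<in> carrier Y \<Longrightarrow> x \<in> \<Omega> \<Longrightarrow> act y x \<in> \<Omega>"
    and act_one: "x \<in> \<Omega> \<Longrightarrow> act \<one>\<^bsub>Y\<^esub> x = x"
    and act_mult: "y \<in> carrier Y \<Longrightarrow> z \<in> carrier Y \<Longrightarrow> x \<in> \<Omega> \<Longrightarrow> act (y \<otimes>\<^bsub>Y\<^esub> z) x = act y (act z x)"
begin

definition shift :: "'y \<Rightarrow> ('x \<Rightarrow> 'a) \<Rightarrow> ('x \<Rightarrow> 'a)" where
  "shift y f = (\<lambda>x. if x \<in> \<Omega> then f (act (inv\<^bsub>Y\<^esub> y) x) else 0)"

definition lact :: "('y \<Rightarrow> 'a) \<Rightarrow> ('x \<Rightarrow> 'a) \<Rightarrow> ('x \<Rightarrow> 'a)" where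
  "lact a f = (\<lambda>x. \<Sum>y\<in>carrier Y. a y * shift y f x)"

text \<open>Values outside \<open>carrier Y\<close> are set to 0; in the regular case convolution
  and \<open>lact\<close> then coincide as total functions.\<close>

definition conv :: "('y \<Rightarrow> 'a) \<Rightarrow> ('y \<Rightarrow> 'a) \<Rightarrow> ('y \<Rightarrow> 'a)" where
  "conv a b = (\<lambda>z. \<Sum>y\<in>carrier Y. a y * (if z \<in> carrier Y then b (inv\<^bsub>Y\<^esub> y \<otimes>\<^bsub>Y\<^esub> z) else 0))"

text \<open>The involution of the group algebra that is adjoint to the action with respect to
  \<open>pairing\<close>, see \<open>pairing_lact\<close>.\<close>

definition adj :: "('y \<Rightarrow> 'a) \<Rightarrow> ('y \<Rightarrow> 'a)" where
  "adj a = (\<lambda>y. a (inv\<^bsub>Y\<^esub> y))"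

definition delta :: "'z \<Rightarrow> 'z \<Rightarrow> 'a" where
  "delta y = (\<lambda>z. if z = y then e else 0)"

definition stable :: "('x \<Rightarrow> 'a) set \<Rightarrow> bool" where
  "stable C \<longleftrightarrow> subsp \<Omega> C \<and> (\<forall>y\<in>carrier Y. \<forall>f\<in>C. shift y f \<in> C)"

definition simple :: "('x \<Rightarrow> 'a) set \<Rightarrow> bool" where
  "simple C \<longleftrightarrow> stable C \<and> C \<noteq> {\<lambda>_. 0} \<and> (\<forall>B. stable B \<longrightarrow> B \<subseteq> C \<longrightarrow> B = {\<lambda>_. 0} \<or> B = C)"

lemma delta_vecs: "y \<in> A \<Longrightarrow> delta y \<in> vecs A"
  using idem by (auto simp: delta_def vecs_def)

lemma shift_vecs: "f \<in> vecs \<Omega> \<Longrightarrow> shift y f \<in> vecs \<Omega>"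
  by (auto simp: shift_def vecs_def)

lemma shift_one: "f \<in> vecs \<Omega> \<Longrightarrow> shift \<one>\<^bsub>Y\<^esub> f = f"
  by (auto simp: shift_def vecs_def act_one fun_eq_iff)

lemma shift_mult:
  assumes "y \<in> carrier Y" "z \<in> carrier Y"
  shows "shift (y \<otimes>\<^bsub>Y\<^esub> z) f = shift y (shift z f)"
  using assms by (auto simp: shift_def fun_eq_iff inv_mult_group act_mult act_closed)

lemma shift_add: "shift y (\<lambda>x. f x + g x) = (\<lambda>x. shift y f x + shift y g x)"
  by (auto simp: shift_def)

lemma shift_scale: "shift y (\<lambda>x. t * f x) = (\<lambda>x. t * shift y f x)"
  by (auto simp: shift_def)

lemma shift_sum: "shift y (\<lambda>x. \<Sum>i\<in>I. t i * f i x) = (\<lambda>x. \<Sum>i\<in>I. t i * shift y (f i) x)"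
  by (auto simp: shift_def)

lemma stableD: "stable C \<Longrightarrow> subsp \<Omega> C" "stable C \<Longrightarrow> y \<in> carrier Y \<Longrightarrow> f \<in> C \<Longrightarrow> shift y f \<in> C"
  by (auto simp: stable_def)

lemma lact_in: "stable C \<Longrightarrow> f \<in> C \<Longrightarrow> lact a f \<in> C"
  unfolding lact_def by (rule subsp_lincomb[OF stableD(1)]) (auto intro: stableD(2))

lemma stable_vecs: "stable (vecs \<Omega>)"
  using subsp_vecs shift_vecs by (auto simp: stable_def)

lemma linear_on_shift: "stable C \<Longrightarrow> y \<in> carrier Y \<Longrightarrow> linear_on C (shift y)"
  using stableD(2) by (auto simp: linear_on_def shift_add shift_scale)

lemma lact_add: "lact a (\<lambda>x. f x + g x) = (\<lambda>x. lact a f x + lact a g x)"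
  by (simp add: lact_def shift_add distrib_left sum.distrib)

lemma lact_scale: "lact a (\<lambda>x. t * f x) = (\<lambda>x. t * lact a f x)"
  by (simp add: lact_def shift_scale sum_distrib_left mult.left_commute)

lemma linear_on_lact: "stable C \<Longrightarrow> linear_on C (lact a)"
  using lact_in by (auto simp: linear_on_def lact_add lact_scale)

lemma lact_coeff_add: "lact (\<lambda>y. a y + b y) f = (\<lambda>x. lact a f x + lact b f x)"
  by (simp add: lact_def distrib_right sum.distrib)

lemma lact_coeff_scale: "lact (\<lambda>y. t * a y) f = (\<lambda>x. t * lact a f x)"
  by (simp add: lact_def sum_distrib_left mult.assoc)

lemma lact_coeff_diff: "lact (\<lambda>y. a y - b y) f = (\<lambda>x. lact a f x - lact b f x)"
  by (simp add: lact_def left_diff_distrib sum_subtractf)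

lemma lact_cong: "(\<And>y. y \<in> carrier Y \<Longrightarrow> a y = b y) \<Longrightarrow> lact a f = lact b f"
  by (simp add: lact_def)

lemma lact_delta:
  assumes "f \<in> vecs \<Omega>" "y \<in> carrier Y"
  shows "lact (delta y) f = shift y f"
proof
  fix x
  have "lact (delta y) f x = (\<Sum>z\<in>carrier Y. if z = y then e * shift z f x else 0)"
    unfolding lact_def delta_def by (intro sum.cong) auto
  then show "lact (delta y) f x = shift y f x"
    using fin_Y assms vecsD(1)[OF shift_vecs[OF assms(1)]] by simp
qed

lemma bij_mult_left: "y \<in> carrier Y \<Longrightarrow> bij_betw (\<lambda>z. y \<otimes>\<^bsub>Y\<^esub> z) (carrier Y) (carrier Y)"
  by (rule bij_betw_byWitness[of _ "\<lambda>z. inv\<^bsub>Y\<^esub> y \<otimes>\<^bsub>Y\<^esub> z"]) (auto simp: m_assoc[symmetric])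

lemma bij_inv: "bij_betw (\<lambda>z. inv\<^bsub>Y\<^esub> z) (carrier Y) (carrier Y)"
  by (rule bij_betw_byWitness[of _ "\<lambda>z. inv\<^bsub>Y\<^esub> z"]) auto

lemma lact_conv: "lact (conv a b) f = lact a (lact b f)"
proof
  fix x
  have inner: "(\<Sum>z\<in>carrier Y. b (inv\<^bsub>Y\<^esub> y \<otimes>\<^bsub>Y\<^esub> z) * shift z f x) =
      (\<Sum>z\<in>carrier Y. b z * shift y (shift z f) x)" if y: "y \<in> carrier Y" for y
  proof -
    have "(\<Sum>z\<in>carrier Y. b (inv\<^bsub>Y\<^esub> y \<otimes>\<^bsub>Y\<^esub> z) * shift z f x) =
        (\<Sum>z\<in>carrier Y. b (inv\<^bsub>Y\<^esub> y \<otimes>\<^bsub>Y\<^esub> (y \<otimes>\<^bsub>Y\<^esub> z)) * shift (y \<otimes>\<^bsub>Y\<^esub> z) f x)"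
      by (rule sum.reindex_bij_betw[OF bij_mult_left[OF y], symmetric])
    also have "\<dots> = (\<Sum>z\<in>carrier Y. b z * shift y (shift z f) x)"
      using y by (intro sum.cong) (auto simp: m_assoc[symmetric] shift_mult)
    finally show ?thesis .
  qed
  have "lact (conv a b) f x =
      (\<Sum>z\<in>carrier Y. \<Sum>y\<in>carrier Y. a y * (b (inv\<^bsub>Y\<^esub> y \<otimes>\<^bsub>Y\<^esub> z) * shift z f x))"
    by (simp add: lact_def conv_def sum_distrib_right mult.assoc)
  also have "\<dots> = (\<Sum>y\<in>carrier Y. \<Sum>z\<in>carrier Y. a y * (b (inv\<^bsub>Y\<^esub> y \<otimes>\<^bsub>Y\<^esub> z) * shift z f x))"
    by (rule sum.swap)
  also have "\<dots> = (\<Sum>y\<in>carrier Y. a y * (\<Sum>z\<in>carrier Y. b z * shift y (shift z f) x))"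
    by (simp add: inner sum_distrib_left[symmetric])
  also have "\<dots> = lact a (lact b f) x"
    by (simp add: lact_def shift_sum)
  finally show "lact (conv a b) f x = lact a (lact b f) x" .
qed

lemma adj_conv:
  assumes z: "z \<in> carrier Y"
  shows "conv (adj b) (adj a) z = adj (conv a b) z"
proof -
  have "conv (adj b) (adj a) z = (\<Sum>u\<in>carrier Y. b (inv\<^bsub>Y\<^esub> u) * a (inv\<^bsub>Y\<^esub> z \<otimes>\<^bsub>Y\<^esub> u))"
    using z by (simp add: conv_def adj_def inv_mult_group)
  also have "\<dots> = (\<Sum>y\<in>carrier Y. b (inv\<^bsub>Y\<^esub> (z \<otimes>\<^bsub>Y\<^esub> y)) * a (inv\<^bsub>Y\<^esub> z \<otimes>\<^bsub>Y\<^esub> (z \<otimes>\<^bsub>Y\<^esub> y)))"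
    by (rule sum.reindex_bij_betw[OF bij_mult_left[OF z], symmetric])
  also have "\<dots> = adj (conv a b) z"
    unfolding conv_def adj_def using z
    by (intro sum.cong) (auto simp: inv_mult_group m_assoc[symmetric] mult.commute)
  finally show ?thesis .
qed

lemma pairing_shift:
  assumes y: "y \<in> carrier Y"
  shows "pairing \<Omega> (shift y f) g = pairing \<Omega> f (shift (inv\<^bsub>Y\<^esub> y) g)"
proof -
  have bij: "bij_betw (act y) \<Omega> \<Omega>"
    using y by (intro bij_betw_byWitness[of _ "act (inv\<^bsub>Y\<^esub> y)"])
      (auto simp: act_mult[symmetric] act_one act_closed)
  have "pairing \<Omega> (shift y f) g = (\<Sum>x\<in>\<Omega>. shift y f (act y x) * g (act y x))"
    unfolding pairing_def by (rule sum.reindex_bij_betw[OF bij, symmetric])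
  also have "\<dots> = pairing \<Omega> f (shift (inv\<^bsub>Y\<^esub> y) g)"
    unfolding pairing_def shift_def using y
    by (intro sum.cong) (auto simp: act_closed act_mult[symmetric] act_one)
  finally show ?thesis .
qed

lemma pairing_lact: "pairing \<Omega> (lact a f) g = pairing \<Omega> f (lact (adj a) g)"
proof -
  have "pairing \<Omega> (lact a f) g = (\<Sum>y\<in>carrier Y. a y * pairing \<Omega> (shift y f) g)"
    unfolding pairing_def lact_def
    by (simp add: sum_distrib_left sum_distrib_right mult.assoc) (rule sum.swap)
  also have "\<dots> = (\<Sum>y\<in>carrier Y. a y * pairing \<Omega> f (shift (inv\<^bsub>Y\<^esub> y) g))"
    by (simp add: pairing_shift)
  also have "\<dots> = (\<Sum>y\<in>carrier Y. a (inv\<^bsub>Y\<^esub> y) * pairing \<Omega> f (shift (inv\<^bsub>Y\<^esub> (inv\<^bsub>Y\<^esub> y)) g))"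
    by (rule sum.reindex_bij_betw[OF bij_inv, symmetric])
  also have "\<dots> = pairing \<Omega> f (lact (adj a) g)"
    unfolding pairing_def lact_def adj_def
    by (simp add: sum_distrib_left mult.left_commute) (rule sum.swap)
  finally show ?thesis .
qed

lemma stable_orbit:
  assumes "f \<in> vecs \<Omega>"
  shows "stable {lact a f | a. True}"
  unfolding stable_def subsp_def
proof (intro conjI ballI allI)
  show "{lact a f |a. True} \<subseteq> vecs \<Omega>" using lact_in[OF stable_vecs assms] by auto
  have "lact (\<lambda>_. 0) f = (\<lambda>_. 0)" by (simp add: lact_def)
  then show "(\<lambda>_. 0) \<in> {lact a f |a. True}" by (intro CollectI exI[of _ "\<lambda>_. 0"]) simp
  show "(\<lambda>x. g x + h x) \<in> {lact a f |a. True}" if gh: "g \<in> {lact a f |a. True}" "h \<in> {lact a f |a. True}" for g h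
  proof -
    obtain a b where "g = lact a f" "h = lact b f" using gh by blast
    then show ?thesis using lact_coeff_add[of a b f, symmetric] by blast
  qed
  show "(\<lambda>x. t * g x) \<in> {lact a f |a. True}" if g: "g \<in> {lact a f |a. True}" for t g
  proof -
    obtain a where "g = lact a f" using g by blast
    then show ?thesis using lact_coeff_scale[of t a f, symmetric] by blast
  qed
  show "shift y g \<in> {lact a f |a. True}" if y: "y \<in> carrier Y" and g: "g \<in> {lact a f |a. True}" for y g
  proof -
    obtain a where "g = lact a f" using g by blast
    then have "shift y g = lact (conv (delta y) a) f"
      using lact_conv lact_delta[OF lact_in[OF stable_vecs assms] y] by simp
    then show ?thesis by blast
  qed
qed

lemma simple_cyclic:
  assumes C: "simple C" and f: "f \<in> C" "f \<noteq> (\<lambda>_. 0)" and g: "g \<in> C"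
  obtains a where "lact a f = g"
proof -
  have st: "stable C" using C by (simp add: simple_def)
  have fv: "f \<in> vecs \<Omega>" using subspD(1)[OF stableD(1)[OF st] f(1)] .
  let ?B = "{lact a f | a. True}"
  have "?B \<subseteq> C" using lact_in[OF st f(1)] by auto
  moreover have "f \<in> ?B" using lact_delta[OF fv one_closed] shift_one[OF fv]
    by (intro CollectI exI[of _ "delta \<one>\<^bsub>Y\<^esub>"]) simp
  ultimately have "?B = C" using C stable_orbit[OF fv] f(2) unfolding simple_def by blast
  then show thesis using g that by blast
qed

lemma minimal_stable:
  assumes P: "\<And>C. P C \<Longrightarrow> stable C" "P C0"
  obtains C where "P C" "C \<subseteq> C0" "\<And>B. P B \<Longrightarrow> B \<subseteq> C \<Longrightarrow> B = C"
  using minimal_subspace[OF fin_\<Omega>, of P C0] stableD(1) P by blast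

lemma simple_subspace:
  assumes "stable C0" "C0 \<noteq> {\<lambda>_. 0}"
  obtains C where "simple C" "C \<subseteq> C0"
proof -
  obtain C where C: "stable C \<and> C \<noteq> {\<lambda>_. 0}" "C \<subseteq> C0"
    "\<And>B. stable B \<and> B \<noteq> {\<lambda>_. 0} \<Longrightarrow> B \<subseteq> C \<Longrightarrow> B = C"
    using minimal_stable[of "\<lambda>C. stable C \<and> C \<noteq> {\<lambda>_. 0}" C0] assms by blast
  have "simple C" unfolding simple_def
  proof (intro conjI allI impI)
    show "stable C" "C \<noteq> {\<lambda>_. 0}" using C(1) by auto
    show "B = {\<lambda>_. 0} \<or> B = C" if "stable B" "B \<subseteq> C" for B using C(3)[of B] that by auto
  qed
  then show thesis using C(2) by (rule that)
qed

lemma nonzero_element: "subsp \<Omega> C \<Longrightarrow> C \<noteq> {\<lambda>_. 0} \<Longrightarrow> \<exists>f\<in>C. f \<noteq> (\<lambda>_. 0)"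
  using subspD(2)[of \<Omega> C] by auto

end

section \<open>Simple submodules over an algebraically closed field\<close>

locale closed_action = fin_action + idem_alg_closed_field
begin

text \<open>This is the part of Burnside's theorem that is needed. Choose \<open>a\<close> with a
  maximal kernel among the elements that do not kill \<open>C\<close>. For each \<open>b\<close>,
  the operator \<open>a b\<close> has an eigenvector in the image of \<open>a\<close>, say with
  eigenvalue \<open>t\<close>; then \<open>a b a - t a\<close> has a strictly larger kernel and so
  kills \<open>C\<close>. Hence \<open>a b a\<close> is a multiple of \<open>a\<close> on
  \<open>C\<close> for every \<open>b\<close>.\<close>

lemma rank_one_element:
  assumes C: "simple C"
  obtains r c0 f0 where "c0 \<in> C" "c0 \<noteq> (\<lambda>_. 0)" "f0 \<in> C" "lact r f0 = c0"
    "\<And>f. f \<in> C \<Longrightarrow> \<exists>t. lact r f = (\<lambda>x. t * c0 x)"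
proof -
  have st: "stable C" and sC: "subsp \<Omega> C" using C stableD by (auto simp: simple_def)
  have lz: "lact a (\<lambda>_. 0) = (\<lambda>_. 0)" for a by (simp add: lact_def shift_def)
  define ker where "ker a = {f \<in> C. lact a f = (\<lambda>_. 0)}" for a
  have ker: "subsp \<Omega> (ker a)" for a
    using sC by (auto simp: subsp_def ker_def lz lact_add lact_scale)
  obtain f where f: "f \<in> C" "f \<noteq> (\<lambda>_. 0)" using nonzero_element sC C by (auto simp: simple_def)
  have fv: "f \<in> vecs \<Omega>" using subspD(1)[OF sC f(1)] .
  have "f \<notin> ker (delta \<one>\<^bsub>Y\<^esub>)"
    using f lact_delta[OF fv one_closed] shift_one[OF fv] by (simp add: ker_def)
  then have ex: "ker (delta \<one>\<^bsub>Y\<^esub>) \<noteq> C" using f by blast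
  obtain K where K: "\<exists>a. K = ker a \<and> ker a \<noteq> C"
    and Kmax: "\<And>B. \<exists>a. B = ker a \<and> ker a \<noteq> C \<Longrightarrow> K \<subseteq> B \<Longrightarrow> B = K"
    using maximal_subspace[OF fin_\<Omega>, of "\<lambda>B. \<exists>a. B = ker a \<and> ker a \<noteq> C" "ker (delta \<one>\<^bsub>Y\<^esub>)"] ker ex
    by blast
  obtain a where a: "K = ker a" "ker a \<noteq> C" using K by blast
  obtain f0 where f0: "f0 \<in> C" "lact a f0 \<noteq> (\<lambda>_. 0)" using a(2) by (auto simp: ker_def)
  define c0 where "c0 = lact a f0"
  have c0: "c0 \<in> C" "c0 \<noteq> (\<lambda>_. 0)" using f0 lact_in[OF st] by (auto simp: c0_def)
  have eig: "\<exists>t. \<forall>g\<in>C. lact a (lact b (lact a g)) = (\<lambda>x. t * lact a g x)" for b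
  proof -
    define Z where "Z = {lact a g | g. g \<in> C}"
    have Z: "subsp \<Omega> Z" unfolding subsp_def
    proof (intro conjI ballI allI)
      show "Z \<subseteq> vecs \<Omega>" using lact_in[OF st] subspD(1)[OF sC] by (auto simp: Z_def)
      show "(\<lambda>_. 0) \<in> Z" unfolding Z_def using lz[of a] subspD(2)[OF sC] by (intro CollectI exI[of _ "\<lambda>_. 0"]) simp
      show "(\<lambda>x. g x + h x) \<in> Z" if gh: "g \<in> Z" "h \<in> Z" for g h
      proof -
        obtain g' h' where "g = lact a g'" "h = lact a h'" "g' \<in> C" "h' \<in> C" using gh by (auto simp: Z_def)
        then show ?thesis using lact_add[of a g' h', symmetric] subspD(3)[OF sC] unfolding Z_def by blast
      qed
      show "(\<lambda>x. t * g x) \<in> Z" if g: "g \<in> Z" for t g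
      proof -
        obtain g' where "g = lact a g'" "g' \<in> C" using g by (auto simp: Z_def)
        then show ?thesis using lact_scale[of a t g', symmetric] subspD(4)[OF sC] unfolding Z_def by blast
      qed
    qed
    have lin: "linear_on Z (\<lambda>g. lact a (lact b g))"
      unfolding linear_on_def
    proof (intro conjI ballI allI)
      show "lact a (lact b g) \<in> Z" if "g \<in> Z" for g
        using that lact_in[OF st] by (auto simp: Z_def)
    qed (simp_all add: lact_add lact_scale)
    have "c0 \<in> Z" using f0 by (auto simp: Z_def c0_def)
    then obtain t w where w: "w \<in> Z" "w \<noteq> (\<lambda>_. 0)" "lact a (lact b w) = (\<lambda>x. t * w x)"
      using eigenvector[OF fin_\<Omega> Z lin _ c0(2)] by blast
    then obtain g where g: "g \<in> C" "w = lact a g" by (auto simp: Z_def)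
    define a' where "a' = (\<lambda>y. conv a (conv b a) y - t * a y)"
    have a': "lact a' h = (\<lambda>x. lact a (lact b (lact a h)) x - t * lact a h x)" for h
      by (simp add: a'_def lact_coeff_diff lact_coeff_scale lact_conv)
    have sub: "ker a \<subseteq> ker a'" by (auto simp: ker_def a' lz)
    have "g \<in> ker a'" "g \<notin> ker a" using g w by (auto simp: ker_def a')
    then have "ker a' \<noteq> ker a" by blast
    then have "ker a' = C" using Kmax[of "ker a'"] a(1) sub by blast
    then have "lact a' h = (\<lambda>_. 0)" if "h \<in> C" for h using that by (auto simp: ker_def)
    then show ?thesis unfolding a' by (intro exI[of _ t]) (auto simp: fun_eq_iff)
  qed
  \<comment> \<open>Write \<open>g = b c0\<close> with \<open>c0 = a f0\<close>; then
    \<open>a g = a b a f0\<close> is a multiple of \<open>a f0\<close>.\<close>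
  have "\<exists>t. lact a g = (\<lambda>x. t * c0 x)" if g: "g \<in> C" for g
  proof -
    obtain b where "lact b c0 = g" using simple_cyclic[OF C c0 g] .
    then show ?thesis using eig[of b] f0(1) unfolding c0_def by metis
  qed
  then show thesis using that[OF c0 f0(1)] c0_def by blast
qed

text \<open>The trace form is nondegenerate on the operators that the group algebra induces on
  \<open>C\<close>. Multiplying \<open>a\<close> from both sides produces a rank one operator
  \<open>q\<close> with \<open>q c0 = c0\<close>, whose trace cannot be 0; cyclicity of the trace
  then moves \<open>a\<close> to the front.\<close>

lemma nonzero_trace:
  assumes C: "simple C" and a: "\<exists>f\<in>C. lact a f \<noteq> (\<lambda>_. 0)"
    and c: "\<And>x. x \<in> B \<Longrightarrow> c x \<in> C" and exp: "\<And>f y. f \<in> C \<Longrightarrow> f y = (\<Sum>x\<in>B. f x * c x y)"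
  obtains b where "linear_trace B c (\<lambda>f. lact a (lact b f)) \<noteq> 0"
proof -
  have st: "stable C" and sC: "subsp \<Omega> C" using C stableD by (auto simp: simple_def)
  obtain c0 f0 r where c0: "c0 \<in> C" "c0 \<noteq> (\<lambda>_. 0)" and f0: "f0 \<in> C" "lact r f0 = c0"
    and r: "\<And>f. f \<in> C \<Longrightarrow> \<exists>t. lact r f = (\<lambda>x. t * c0 x)" by (rule rank_one_element[OF C]) (rule that)
  obtain f1 where f1: "f1 \<in> C" "lact a f1 \<noteq> (\<lambda>_. 0)" using a by blast
  obtain b2 where b2: "lact b2 c0 = f1" using simple_cyclic[OF C c0 f1(1)] .
  obtain b3 where b3: "lact b3 (lact a f1) = f0" using simple_cyclic[OF C lact_in[OF st f1(1)] f1(2) f0(1)] .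
  \<comment> \<open>\<open>b2\<close> takes \<open>c0\<close> to \<open>f1\<close>,
    \<open>b3\<close> takes \<open>a f1\<close> to \<open>f0\<close>, and \<open>r\<close> takes
    \<open>f0\<close> back to \<open>c0\<close>.\<close>
  define q where "q = (\<lambda>f. lact r (lact b3 (lact a (lact b2 f))))"
  have qc0: "q c0 = c0" using b2 b3 f0 by (simp add: q_def)
  have qlin: "linear_on C q"
    using lact_in[OF st] by (auto simp: linear_on_def q_def lact_add lact_scale)
  have "\<exists>t. q (c x) = (\<lambda>y. t * c0 y)" if "x \<in> B" for x
    unfolding q_def using r lact_in[OF st] c[OF that] by auto
  then obtain \<gamma> where \<gamma>: "\<And>x. x \<in> B \<Longrightarrow> q (c x) = (\<lambda>y. \<gamma> x * c0 y)" by metis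
  have "linear_trace B c q = (\<Sum>x\<in>B. c0 x * \<gamma> x)"
    unfolding linear_trace_def using \<gamma> by (intro sum.cong) (auto simp: mult.commute)
  moreover have "(\<Sum>x\<in>B. c0 x * \<gamma> x) \<noteq> 0"
  proof
    assume z: "(\<Sum>x\<in>B. c0 x * \<gamma> x) = 0"
    have "c0 y = 0" for y
    proof -
      have "c0 = (\<lambda>y. \<Sum>x\<in>B. c0 x * c x y)" using exp[OF c0(1)] by blast
      then have "q c0 = q (\<lambda>y. \<Sum>x\<in>B. c0 x * c x y)" by (rule arg_cong)
      also have "\<dots> = (\<lambda>y. \<Sum>x\<in>B. c0 x * q (c x) y)" by (rule linear_on_sum[OF sC qlin c])
      finally have "q c0 y = (\<Sum>x\<in>B. c0 x * q (c x) y)" by simp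
      also have "\<dots> = (\<Sum>x\<in>B. c0 x * \<gamma> x) * c0 y"
        using \<gamma> by (simp add: sum_distrib_right mult.assoc)
      finally show ?thesis using z qc0 by simp
    qed
    then show False using c0(2) by auto
  qed
  ultimately have "linear_trace B c (\<lambda>f. lact r (lact b3 (lact a (lact b2 f)))) \<noteq> 0" by (simp add: q_def)
  also have "linear_trace B c (\<lambda>f. lact r (lact b3 (lact a (lact b2 f)))) =
      linear_trace B c (\<lambda>f. lact (conv r b3) (lact (conv a b2) f))" by (simp add: lact_conv)
  also have "\<dots> = linear_trace B c (\<lambda>f. lact (conv a b2) (lact (conv r b3) f))"
    by (rule linear_trace_commute[OF sC linear_on_lact[OF st] linear_on_lact[OF st] c exp])
  also have "\<dots> = linear_trace B c (\<lambda>f. lact a (lact (conv b2 (conv r b3)) f))" by (simp add: lact_conv)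
  finally show thesis using that by blast
qed

text \<open>As \<open>y\<close> is conjugate to \<open>y\<^sup>-\<^sup>1\<close>, an element of the group algebra and its adjoint have the same trace.\<close>
lemma annihilator_adj:
  assumes C: "simple C" and amb: "\<And>y. y \<in> carrier Y \<Longrightarrow> \<exists>z\<in>carrier Y. z \<otimes>\<^bsub>Y\<^esub> y \<otimes>\<^bsub>Y\<^esub> inv\<^bsub>Y\<^esub> z = inv\<^bsub>Y\<^esub> y"
    and a: "\<And>f. f \<in> C \<Longrightarrow> lact (adj a) f = (\<lambda>_. 0)" and f: "f \<in> C"
  shows "lact a f = (\<lambda>_. 0)"
proof (rule ccontr)
  assume "lact a f \<noteq> (\<lambda>_. 0)"
  then have ex: "\<exists>f\<in>C. lact a f \<noteq> (\<lambda>_. 0)" using f by blast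
  have st: "stable C" and sC: "subsp \<Omega> C" using C stableD by (auto simp: simple_def)
  obtain B c where c: "\<And>x. x \<in> B \<Longrightarrow> c x \<in> C"
    and exp: "\<And>f y. f \<in> C \<Longrightarrow> f y = (\<Sum>x\<in>B. f x * c x y)"
    by (rule dual_basis[OF fin_\<Omega> sC]) (rule that)
  obtain b where b: "linear_trace B c (\<lambda>f. lact a (lact b f)) \<noteq> 0" using nonzero_trace[OF C ex c exp] .
  let ?tr = "linear_trace B c"
  have tr_lact: "?tr (lact h) = (\<Sum>y\<in>carrier Y. h y * ?tr (shift y))" for h
    unfolding linear_trace_def lact_def by (simp add: sum_distrib_left) (rule sum.swap)
  have tr_inv: "?tr (shift (inv\<^bsub>Y\<^esub> y)) = ?tr (shift y)" if y: "y \<in> carrier Y" for y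
  proof -
    \<comment> \<open>Moving the factor \<open>z\<close> to the other end of the product shows that
      conjugate elements have the same trace.\<close>
    obtain z where z: "z \<in> carrier Y" "z \<otimes>\<^bsub>Y\<^esub> y \<otimes>\<^bsub>Y\<^esub> inv\<^bsub>Y\<^esub> z = inv\<^bsub>Y\<^esub> y" using amb[OF y] by blast
    have "?tr (shift (inv\<^bsub>Y\<^esub> y)) = ?tr (\<lambda>f. shift z (shift (y \<otimes>\<^bsub>Y\<^esub> inv\<^bsub>Y\<^esub> z) f))"
      using z y by (simp add: shift_mult[symmetric] m_assoc[symmetric] z(2))
    also have "\<dots> = ?tr (\<lambda>f. shift (y \<otimes>\<^bsub>Y\<^esub> inv\<^bsub>Y\<^esub> z) (shift z f))"
      using z y by (intro linear_trace_commute[OF sC linear_on_shift[OF st] linear_on_shift[OF st] c exp]) auto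
    also have "\<dots> = ?tr (shift y)"
      using z y by (simp add: shift_mult[symmetric] m_assoc)
    finally show ?thesis .
  qed
  have tr_adj: "?tr (lact (adj h)) = ?tr (lact h)" for h
  proof -
    have "?tr (lact (adj h)) = (\<Sum>y\<in>carrier Y. h (inv\<^bsub>Y\<^esub> y) * ?tr (shift (inv\<^bsub>Y\<^esub> y)))"
      unfolding tr_lact adj_def by (intro sum.cong) (auto simp: tr_inv)
    also have "\<dots> = (\<Sum>y\<in>carrier Y. h y * ?tr (shift y))"
      by (rule sum.reindex_bij_betw[OF bij_inv])
    finally show ?thesis unfolding tr_lact .
  qed
  \<comment> \<open>The product of \<open>a\<close> and \<open>b\<close> has the same trace as its
    adjoint, in which \<open>adj a\<close> acts first and kills \<open>C\<close>.\<close>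
  have "?tr (\<lambda>f. lact a (lact b f)) = ?tr (lact (adj (conv a b)))"
    unfolding tr_adj by (simp add: linear_trace_def lact_conv)
  also have "lact (adj (conv a b)) = lact (conv (adj b) (adj a))"
    by (rule ext, rule lact_cong) (simp add: adj_conv)
  also have "?tr \<dots> = 0"
    unfolding linear_trace_def using a c by (simp add: lact_conv) (simp add: lact_def shift_def)
  finally show False using b by simp
qed

text \<open>Modulo the orthogonal complement of a simple \<open>C\<close>, the function space is the
  dual of \<open>C\<close>. It is generated by the class of \<open>r\<close> applied to a point
  function \<open>delta x\<close>, and sending \<open>b (r (delta x))\<close> to \<open>b c0\<close>
  is well defined because annihilators are closed under \<open>adj\<close>; this identifies the dual
  with \<open>C\<close>. The class of \<open>delta x\<close> is fixed by the stabilizer of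
  \<open>x\<close>, hence so is its image \<open>f\<close>.\<close>

lemma fixed_by_stabilizer:
  assumes C0: "stable C0" "C0 \<noteq> {\<lambda>_. 0}"
    and amb: "\<And>y. y \<in> carrier Y \<Longrightarrow> \<exists>z\<in>carrier Y. z \<otimes>\<^bsub>Y\<^esub> y \<otimes>\<^bsub>Y\<^esub> inv\<^bsub>Y\<^esub> z = inv\<^bsub>Y\<^esub> y"
  obtains x f where "x \<in> \<Omega>" "f \<in> C0" "f \<noteq> (\<lambda>_. 0)"
    "\<And>y. y \<in> carrier Y \<Longrightarrow> act y x = x \<Longrightarrow> shift y f = f"
proof -
  obtain C where C: "simple C" and CC0: "C \<subseteq> C0" using simple_subspace[OF C0] .
  have st: "stable C" and sC: "subsp \<Omega> C" using C stableD by (auto simp: simple_def)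
  have lz: "lact a (\<lambda>_. 0) = (\<lambda>_. 0)" for a by (simp add: lact_def shift_def)
  obtain c0 f0 r where c0: "c0 \<in> C" "c0 \<noteq> (\<lambda>_. 0)" and f0: "f0 \<in> C" "lact r f0 = c0"
    and r: "\<And>f. f \<in> C \<Longrightarrow> \<exists>t. lact r f = (\<lambda>x. t * c0 x)" by (rule rank_one_element[OF C]) (rule that)
  have ann: "(\<forall>f\<in>C. lact (adj a) f = (\<lambda>_. 0)) \<longleftrightarrow> (\<forall>f\<in>C. lact a f = (\<lambda>_. 0))" for a
  proof -
    have "lact (adj (adj a)) f = lact a f" for f by (rule lact_cong) (simp add: adj_def)
    then have "lact (adj a) f = (\<lambda>_. 0)" if "\<forall>f\<in>C. lact a f = (\<lambda>_. 0)" "f \<in> C" for f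
      using that by (intro annihilator_adj[OF C _ _ that(2)]) (auto intro: amb)
    moreover have "lact a f = (\<lambda>_. 0)" if "\<forall>f\<in>C. lact (adj a) f = (\<lambda>_. 0)" "f \<in> C" for f
      using that by (intro annihilator_adj[OF C _ _ that(2)]) (auto intro: amb)
    ultimately show ?thesis by blast
  qed
  have "\<not> (\<forall>f\<in>C. lact (adj r) f = (\<lambda>_. 0))" unfolding ann using f0 c0 by metis
  then obtain c1 where c1: "c1 \<in> C" "lact (adj r) c1 \<noteq> (\<lambda>_. 0)" by blast
  have rc1: "lact (adj r) c1 \<in> C" by (rule lact_in[OF st c1(1)])
  \<comment> \<open>For this \<open>x\<close> the function \<open>r (delta x)\<close> has a nonzero
    pairing with \<open>c1\<close>, so its class in the dual of \<open>C\<close> is not 0.\<close>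
  obtain x where xz: "lact (adj r) c1 x \<noteq> 0" using c1(2) by auto
  then have x: "x \<in> \<Omega>" using vecsD(2)[OF subspD(1)[OF sC rc1]] by blast
  let ?d = "delta x :: 'd \<Rightarrow> 'a"
  have dv: "?d \<in> vecs \<Omega>" by (rule delta_vecs[OF x])
  have pd: "pairing \<Omega> f ?d = f x" if "f \<in> vecs \<Omega>" for f
  proof -
    have "pairing \<Omega> f ?d = (\<Sum>z\<in>\<Omega>. if z = x then f z * e else 0)"
      unfolding pairing_def delta_def by (intro sum.cong) auto
    then show ?thesis using fin_\<Omega> x vecsD(1)[OF that, of x] by (simp add: mult.commute)
  qed
  have psym: "pairing \<Omega> f g = pairing \<Omega> g f" for f g :: "'d \<Rightarrow> 'a" by (simp add: pairing_def mult.commute)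
  let ?rd = "lact r ?d"
  have rdv: "?rd \<in> vecs \<Omega>" by (rule lact_in[OF stable_vecs dv])
  have prd: "pairing \<Omega> ?rd f = lact (adj r) f x" if "f \<in> C" for f
    using pairing_lact[of r ?d f] pd[OF subspD(1)[OF sC lact_in[OF st that]]] psym by metis
  define perp where "perp = {f \<in> vecs \<Omega>. \<forall>g\<in>C. pairing \<Omega> f g = 0}"
  have padd: "pairing \<Omega> (\<lambda>x. f x + g x) h = pairing \<Omega> f h + pairing \<Omega> g h"
    and pscale: "pairing \<Omega> (\<lambda>x. t * f x) h = t * pairing \<Omega> f h"
    and pzero: "pairing \<Omega> (\<lambda>_. 0) h = 0" for f g h :: "'d \<Rightarrow> 'a" and t
    by (auto simp: pairing_def distrib_right sum.distrib sum_distrib_left mult.assoc)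
  have perp: "subsp \<Omega> perp"
    using subsp_vecs[of \<Omega>] unfolding subsp_def perp_def by (auto simp: padd pscale pzero)
  \<comment> \<open>The preimage in the function space of the submodule that the class of
    \<open>r (delta x)\<close> generates in the dual of \<open>C\<close>.\<close>
  define N where "N = {\<lambda>z. lact a ?rd z + n z | a n. n \<in> perp}"
  have NI: "(\<lambda>z. lact a ?rd z + n z) \<in> N" if "n \<in> perp" for a n
    unfolding N_def using that by (intro CollectI exI conjI) (rule refl)
  have NE: "\<exists>a n. g = (\<lambda>z. lact a ?rd z + n z) \<and> n \<in> perp" if "g \<in> N" for g
    using that unfolding N_def by (rule CollectD)
  have N: "subsp \<Omega> N" unfolding subsp_def
  proof (intro conjI ballI allI)
    show "N \<subseteq> vecs \<Omega>"
      using subspD(3)[OF subsp_vecs lact_in[OF stable_vecs rdv]] by (auto simp: N_def perp_def)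
    have "(\<lambda>_. 0) = (\<lambda>z. lact (\<lambda>_. 0) ?rd z + (\<lambda>_. 0) z)" by (simp add: lact_def)
    then show "(\<lambda>_. 0) \<in> N" using NI[OF subspD(2)[OF perp]] by metis
    show "(\<lambda>x. g x + h x) \<in> N" if "g \<in> N" "h \<in> N" for g h
    proof -
      obtain a m b n where gh: "g = (\<lambda>z. lact a ?rd z + m z)" "h = (\<lambda>z. lact b ?rd z + n z)" "m \<in> perp" "n \<in> perp"
        using NE[OF \<open>g \<in> N\<close>] NE[OF \<open>h \<in> N\<close>] by metis
      have "(\<lambda>x. g x + h x) = (\<lambda>z. lact (\<lambda>y. a y + b y) ?rd z + (\<lambda>z. m z + n z) z)"
        by (simp add: gh lact_coeff_add add_ac)
      then show ?thesis by (rule ssubst) (rule NI[OF subspD(3)[OF perp gh(3,4)]])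
    qed
    show "(\<lambda>x. t * g x) \<in> N" if "g \<in> N" for t g
    proof -
      obtain a m where g: "g = (\<lambda>z. lact a ?rd z + m z)" "m \<in> perp" using NE[OF \<open>g \<in> N\<close>] by metis
      have "(\<lambda>x. t * g x) = (\<lambda>z. lact (\<lambda>y. t * a y) ?rd z + (\<lambda>z. t * m z) z)"
        by (simp add: g lact_coeff_scale distrib_left)
      then show ?thesis by (rule ssubst) (rule NI[OF subspD(4)[OF perp g(2)]])
    qed
  qed
  have "?d \<in> N"
  proof (rule ccontr)
    \<comment> \<open>A functional that vanishes on \<open>N\<close> vanishes on
      \<open>perp\<close>, so it lies in \<open>C\<close> by double orthogonality. Being nonzero, it
      can be moved to \<open>c1\<close> inside \<open>C\<close>, which makes \<open>c1\<close>
      orthogonal to \<open>r (delta x)\<close>, against the choice of \<open>x\<close>.\<close>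
    assume "?d \<notin> N"
    then obtain l where l: "l \<in> vecs \<Omega>" "\<And>f. f \<in> N \<Longrightarrow> pairing \<Omega> l f = 0" "pairing \<Omega> l ?d \<noteq> 0"
      using separating_functional[OF fin_\<Omega> N dv] by blast
    have lperp: "pairing \<Omega> l f = 0" if "f \<in> perp" for f
    proof -
      have "f = (\<lambda>z. lact (\<lambda>_. 0) ?rd z + f z)" by (simp add: lact_def)
      then show ?thesis using l(2)[OF NI[OF that, of "\<lambda>_. 0"]] by metis
    qed
    have lC: "l \<in> C"
    proof (rule ccontr)
      assume "l \<notin> C"
      then obtain m where m: "m \<in> vecs \<Omega>" "\<And>f. f \<in> C \<Longrightarrow> pairing \<Omega> m f = 0" "pairing \<Omega> m l \<noteq> 0"
        using separating_functional[OF fin_\<Omega> sC l(1)] by blast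
      then show False using lperp[of m] psym[of m l] by (simp add: perp_def)
    qed
    have l0: "l \<noteq> (\<lambda>_. 0)" using l(3) by (auto simp: pairing_def)
    obtain b where b: "lact b l = c1" using simple_cyclic[OF C lC l0 c1(1)] .
    have "lact (adj b) ?rd = (\<lambda>z. lact (adj b) ?rd z + (\<lambda>_. 0) z)" by simp
    then have "lact (adj b) ?rd \<in> N" using NI[OF subspD(2)[OF perp], of "adj b"] by metis
    then have "pairing \<Omega> l (lact (adj b) ?rd) = 0" by (rule l(2))
    then have "pairing \<Omega> c1 ?rd = 0" using pairing_lact[of b l ?rd] b by simp
    then show False using prd[OF c1(1)] psym xz by metis
  qed
  then obtain a n where an: "?d = (\<lambda>z. lact a ?rd z + n z)" "n \<in> perp" using NE by metis
  define f where "f = lact a c0"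
  have fC: "f \<in> C" using lact_in[OF st c0(1)] by (simp add: f_def)
  \<comment> \<open>Well-definedness of the map from the dual to \<open>C\<close>. If
    \<open>b c0\<close> were not 0, some \<open>b'\<close> would return it to \<open>c0\<close>, so
    \<open>b' b r - r\<close> would kill \<open>C\<close>, and with it its adjoint. Pairing
    \<open>delta x\<close> with \<open>c1\<close> through this element contradicts the choice of
    \<open>x\<close>.\<close>
  have kill: "lact b c0 = (\<lambda>_. 0)" if b: "\<And>g. g \<in> C \<Longrightarrow> pairing \<Omega> (lact b ?rd) g = 0" for b
  proof (rule ccontr)
    assume n: "lact b c0 \<noteq> (\<lambda>_. 0)"
    obtain b' where b': "lact b' (lact b c0) = c0" using simple_cyclic[OF C lact_in[OF st c0(1)] n c0(1)] .
    define q where "q = (\<lambda>y. conv b' (conv b r) y - r y)"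
    have q: "lact q h = (\<lambda>x. lact b' (lact b (lact r h)) x - lact r h x)" for h
      by (simp add: q_def lact_coeff_diff lact_conv)
    have "lact q h = (\<lambda>_. 0)" if h: "h \<in> C" for h
    proof -
      obtain t where t: "lact r h = (\<lambda>x. t * c0 x)" using r[OF h] by blast
      show ?thesis unfolding q t by (simp add: lact_scale b')
    qed
    then have "lact (adj q) c1 = (\<lambda>_. 0)" using ann[of q] c1(1) by blast
    then have "pairing \<Omega> (lact q ?d) c1 = 0" by (subst pairing_lact) (simp add: pairing_def)
    moreover have "pairing \<Omega> (lact q ?d) c1 = pairing \<Omega> (lact b' (lact b ?rd)) c1 - pairing \<Omega> ?rd c1"
      unfolding q by (simp add: pairing_def left_diff_distrib sum_subtractf)
    moreover have "pairing \<Omega> (lact b' (lact b ?rd)) c1 = 0"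
      unfolding pairing_lact[of b'] by (rule b[OF lact_in[OF st c1(1)]])
    ultimately show False using prd[OF c1(1)] xz by simp
  qed
  have pard: "pairing \<Omega> (lact a ?rd) g = g x" if g: "g \<in> C" for g
  proof -
    have "pairing \<Omega> ?d g = pairing \<Omega> (lact a ?rd) g + pairing \<Omega> n g" by (subst an(1)) (rule padd)
    then show ?thesis using an(2) g pd[OF subspD(1)[OF sC g]] psym[of ?d g] by (simp add: perp_def)
  qed
  \<comment> \<open>If \<open>a c0\<close> were 0, then \<open>a r\<close> and hence its adjoint
    would kill \<open>C\<close>. But \<open>a (r (delta x))\<close> pairs with members of
    \<open>C\<close> as the evaluation at \<open>x\<close> does, by \<open>pard\<close>, and
    \<open>adj r\<close> applied to \<open>c1\<close> has a nonzero value there.\<close>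
  have "f \<noteq> (\<lambda>_. 0)"
  proof
    assume f0': "f = (\<lambda>_. 0)"
    have "lact (conv a r) h = (\<lambda>_. 0)" if h: "h \<in> C" for h
    proof -
      obtain t where t: "lact r h = (\<lambda>x. t * c0 x)" using r[OF h] by blast
      then show ?thesis using f0' by (simp add: lact_conv lact_scale f_def)
    qed
    then have "lact (adj (conv a r)) g = (\<lambda>_. 0)" if "g \<in> C" for g using ann[of "conv a r"] that by blast
    then have "pairing \<Omega> (lact (conv a r) ?d) g = 0" if "g \<in> C" for g
      using that by (subst pairing_lact) (simp add: pairing_def)
    then have "pairing \<Omega> (lact a ?rd) g = 0" if "g \<in> C" for g using that by (simp add: lact_conv)
    then show False using pard[OF rc1] rc1 xz by simp
  qed
  moreover have "shift y f = f" if y: "y \<in> carrier Y" "act y x = x" for y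
  proof -
    \<comment> \<open>Modulo \<open>perp\<close>, \<open>a (r (delta x))\<close> is
      \<open>delta x\<close>, which \<open>y\<close> fixes; so \<open>b (r (delta x))\<close> is
      orthogonal to \<open>C\<close> and \<open>kill\<close> applies.\<close>
    define b where "b = (\<lambda>z. conv (delta y) a z - a z)"
    have b: "lact b h = (\<lambda>z. shift y (lact a h) z - lact a h z)" if "h \<in> vecs \<Omega>" for h
      using lact_delta[OF lact_in[OF stable_vecs that] y(1)] by (simp add: b_def lact_coeff_diff lact_conv)
    have iy: "act (inv\<^bsub>Y\<^esub> (inv\<^bsub>Y\<^esub> y)) x = x" using y by simp
    have "pairing \<Omega> (lact b ?rd) g = 0" if g: "g \<in> C" for g
    proof -
      have gi: "shift (inv\<^bsub>Y\<^esub> y) g \<in> C" using stableD(2)[OF st _ g] y(1) by simp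
      have "pairing \<Omega> (lact b ?rd) g = pairing \<Omega> (shift y (lact a ?rd)) g - pairing \<Omega> (lact a ?rd) g"
        unfolding b[OF rdv] by (simp add: pairing_def left_diff_distrib sum_subtractf)
      also have "\<dots> = shift (inv\<^bsub>Y\<^esub> y) g x - g x"
        unfolding pairing_shift[OF y(1)] using pard[OF g] pard[OF gi] by simp
      also have "\<dots> = 0" using x iy by (simp add: shift_def)
      finally show ?thesis .
    qed
    then have "lact b c0 = (\<lambda>_. 0)" by (rule kill)
    then show ?thesis using b[OF subspD(1)[OF sC c0(1)]] by (simp add: f_def fun_eq_iff)
  qed
  ultimately show thesis using that[OF x] fC CC0 by blast
qed

end

section \<open>Matrix units in the group algebra\<close>

locale group_algebra = idem_field e + group M for e :: "'a::comm_ring_1" and M :: "('m, 'b) monoid_scheme" +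
  assumes fin_M: "finite (carrier M)"
begin

sublocale reg: fin_action e M "monoid.mult M" "carrier M"
  by unfold_locales (auto simp: fin_M m_assoc)

text \<open>The product of the group algebra is the action on the regular module, so the stable
  subspaces are the left ideals.\<close>

abbreviation star :: "('m \<Rightarrow> 'a) \<Rightarrow> ('m \<Rightarrow> 'a) \<Rightarrow> ('m \<Rightarrow> 'a)" (infixl "\<star>" 70) where
  "a \<star> b \<equiv> reg.lact a b"

abbreviation H :: "('m \<Rightarrow> 'a) set" where
  "H \<equiv> vecs (carrier M)"

abbreviation unity :: "'m \<Rightarrow> 'a" where
  "unity \<equiv> reg.delta \<one>\<^bsub>M\<^esub>"

lemma star_assoc: "a \<star> b \<star> c = a \<star> (b \<star> c)"
proof -
  have "reg.conv a b = a \<star> b"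
    unfolding reg.conv_def reg.lact_def reg.shift_def by (rule ext, rule sum.cong) auto
  then show ?thesis using reg.lact_conv[of a b c] by simp
qed

lemma star_closed: "b \<in> H \<Longrightarrow> a \<star> b \<in> H"
  by (rule reg.lact_in[OF reg.stable_vecs])

lemma unity_closed: "unity \<in> H"
  by (rule reg.delta_vecs) simp

lemma unity_star: "b \<in> H \<Longrightarrow> unity \<star> b = b"
  by (simp add: reg.lact_delta reg.shift_one)

lemma star_unity:
  assumes a: "a \<in> H"
  shows "a \<star> unity = a"
proof
  fix z
  show "(a \<star> unity) z = a z"
  proof (cases "z \<in> carrier M")
    case True
    have "(a \<star> unity) z = (\<Sum>y\<in>carrier M. if y = z then a y * e else 0)"
      unfolding reg.lact_def reg.shift_def reg.delta_def
    proof (rule sum.cong[OF refl])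
      fix y assume y: "y \<in> carrier M"
      have "inv\<^bsub>M\<^esub> y \<otimes>\<^bsub>M\<^esub> z = \<one>\<^bsub>M\<^esub> \<longleftrightarrow> y = z"
      proof
        assume "inv\<^bsub>M\<^esub> y \<otimes>\<^bsub>M\<^esub> z = \<one>\<^bsub>M\<^esub>"
        then have "y \<otimes>\<^bsub>M\<^esub> (inv\<^bsub>M\<^esub> y \<otimes>\<^bsub>M\<^esub> z) = y" using y by simp
        then show "y = z" using y True by (simp add: m_assoc[symmetric])
      qed (use y in simp)
      then show "a y * (if z \<in> carrier M then if inv\<^bsub>M\<^esub> y \<otimes>\<^bsub>M\<^esub> z = \<one>\<^bsub>M\<^esub> then e else 0 else 0) =
          (if y = z then a y * e else 0)" using True by simp
    qed
    then show ?thesis using True fin_M vecsD(1)[OF a, of z] by (simp add: mult.commute)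
  next
    case False
    then show ?thesis using vecsD(2)[OF a] by (simp add: reg.lact_def reg.shift_def)
  qed
qed

lemma star_zero: "a \<star> (\<lambda>_. 0) = (\<lambda>_. 0)" "(\<lambda>_. 0) \<star> a = (\<lambda>_. 0)"
  by (simp_all add: reg.lact_def reg.shift_def)

lemma star_sum_right: "a \<star> (\<lambda>x. \<Sum>i\<in>I. f i x) = (\<lambda>x. \<Sum>i\<in>I. (a \<star> f i) x)"
proof -
  have "reg.shift y (\<lambda>x. \<Sum>i\<in>I. f i x) = (\<lambda>x. \<Sum>i\<in>I. reg.shift y (f i) x)" for y
    by (auto simp: reg.shift_def)
  then show ?thesis unfolding reg.lact_def by (simp add: sum_distrib_left) (rule ext, rule sum.swap)
qed

lemma star_sum_left: "(\<lambda>x. \<Sum>i\<in>I. f i x) \<star> a = (\<lambda>x. \<Sum>i\<in>I. (f i \<star> a) x)"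
  unfolding reg.lact_def by (simp add: sum_distrib_right) (rule ext, rule sum.swap)

lemma star_diff_right: "a \<star> (\<lambda>x. f x - g x) = (\<lambda>x. (a \<star> f) x - (a \<star> g) x)"
proof -
  have "reg.shift y (\<lambda>x. f x - g x) = (\<lambda>x. reg.shift y f x - reg.shift y g x)" for y
    by (auto simp: reg.shift_def)
  then show ?thesis unfolding reg.lact_def by (simp add: right_diff_distrib sum_subtractf)
qed

section \<open>Left ideals and primitive idempotents\<close>

definition lideal :: "('m \<Rightarrow> 'a) \<Rightarrow> ('m \<Rightarrow> 'a) set" where
  "lideal f = {a \<star> f | a. True}"

lemma lideal_stable: "f \<in> H \<Longrightarrow> reg.stable (lideal f)"
  unfolding lideal_def by (rule reg.stable_orbit)

lemma lidealI: "a \<star> f \<in> lideal f"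
  by (auto simp: lideal_def)

lemma lidealE: "g \<in> lideal f \<Longrightarrow> \<exists>a. g = a \<star> f"
  by (auto simp: lideal_def)

lemma self_in_lideal: "f \<in> H \<Longrightarrow> f \<in> lideal f"
  using lidealI[of unity f] by (simp add: unity_star)

text \<open>Maschke's argument: a linear projection onto \<open>N\<close> is averaged over the
  group, with \<open>m\<close> as the inverse of the group order. The result commutes with left
  multiplication, so the image of 1 is a right unit of \<open>N\<close>.\<close>

lemma left_ideal_idempotent:
  assumes N: "reg.stable N" and n: "m * (of_nat (card (carrier M)) * e) = e"
  obtains \<epsilon> where "\<epsilon> \<in> N" "\<And>x. x \<in> N \<Longrightarrow> x \<star> \<epsilon> = x"
proof -
  have sN: "subsp (carrier M) N" by (rule reg.stableD(1)[OF N])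
  obtain B c where c: "\<And>x. x \<in> B \<Longrightarrow> c x \<in> N"
    and exp: "\<And>f y. f \<in> N \<Longrightarrow> f y = (\<Sum>x\<in>B. f x * c x y)"
    by (rule dual_basis[OF fin_M sN]) (rule that)
  \<comment> \<open>A linear projection onto \<open>N\<close>: keep the coordinates in
    \<open>B\<close> and expand with the dual basis.\<close>
  define p0 where "p0 f = (\<lambda>z. \<Sum>x\<in>B. f x * c x z)" for f :: "'m \<Rightarrow> 'a"
  define p where "p f = (\<lambda>z. \<Sum>g\<in>carrier M. m * reg.shift g (p0 (reg.shift (inv\<^bsub>M\<^esub> g) f)) z)" for f
  have p0N: "p0 f \<in> N" for f unfolding p0_def by (rule subsp_lincomb[OF sN c])
  have pN: "p f \<in> N" for f
    unfolding p_def by (rule subsp_lincomb[OF sN]) (rule reg.stableD(2)[OF N _ p0N])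
  have pid: "p f = f" if f: "f \<in> N" for f
  proof
    fix z
    have fv: "f \<in> H" by (rule subspD(1)[OF sN f])
    have "reg.shift g (p0 (reg.shift (inv\<^bsub>M\<^esub> g) f)) = f" if g: "g \<in> carrier M" for g
    proof -
      have "reg.shift (inv\<^bsub>M\<^esub> g) f \<in> N" using reg.stableD(2)[OF N _ f] g by simp
      then have "p0 (reg.shift (inv\<^bsub>M\<^esub> g) f) = reg.shift (inv\<^bsub>M\<^esub> g) f"
        unfolding p0_def by (intro ext exp[symmetric])
      then show ?thesis using g reg.shift_one[OF fv] by (simp add: reg.shift_mult[symmetric])
    qed
    then have "p f z = of_nat (card (carrier M)) * (m * f z)" by (simp add: p_def)
    also have "\<dots> = (m * (of_nat (card (carrier M)) * e)) * f z"
      using vecsD(1)[OF fv, of z] by (simp add: mult.assoc mult.left_commute)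
    finally show "p f z = f z" using n vecsD(1)[OF fv] by simp
  qed
  have pshift: "p (reg.shift y f) = reg.shift y (p f)" if y: "y \<in> carrier M" for y f
  proof
    fix z
    have "reg.shift y (p f) z = (\<Sum>g\<in>carrier M. m * reg.shift y (reg.shift g (p0 (reg.shift (inv\<^bsub>M\<^esub> g) f))) z)"
      unfolding p_def by (simp only: reg.shift_sum)
    also have "\<dots> = (\<Sum>g\<in>carrier M. m * reg.shift (y \<otimes>\<^bsub>M\<^esub> g) (p0 (reg.shift (inv\<^bsub>M\<^esub> (y \<otimes>\<^bsub>M\<^esub> g)) (reg.shift y f))) z)"
      using y by (intro sum.cong) (auto simp: reg.shift_mult[symmetric] inv_mult_group m_assoc)
    also have "\<dots> = p (reg.shift y f) z"
      unfolding p_def by (rule sum.reindex_bij_betw[OF reg.bij_mult_left[OF y]])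
    finally show "p (reg.shift y f) z = reg.shift y (p f) z" by simp
  qed
  have p_lin: "p (\<lambda>x. \<Sum>i\<in>I. t i * f i x) = (\<lambda>x. \<Sum>i\<in>I. t i * p (f i) x)" for I :: "'m set" and t f
  proof
    fix z
    have "p0 (\<lambda>x. \<Sum>i\<in>I. t i * f i x) = (\<lambda>x. \<Sum>i\<in>I. t i * p0 (f i) x)" for f
      unfolding p0_def by (simp add: sum_distrib_left sum_distrib_right mult.assoc) (rule ext, rule sum.swap)
    then have "p (\<lambda>x. \<Sum>i\<in>I. t i * f i x) z =
        (\<Sum>g\<in>carrier M. \<Sum>i\<in>I. t i * (m * reg.shift g (p0 (reg.shift (inv\<^bsub>M\<^esub> g) (f i))) z))"
      unfolding p_def reg.shift_sum by (simp add: sum_distrib_left mult.left_commute reg.shift_sum)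
    also have "\<dots> = (\<Sum>i\<in>I. t i * p (f i) z)"
      unfolding p_def by (subst sum.swap) (simp add: sum_distrib_left)
    finally show "p (\<lambda>x. \<Sum>i\<in>I. t i * f i x) z = (\<Sum>i\<in>I. t i * p (f i) z)" .
  qed
  have "x \<star> p unity = x" if x: "x \<in> N" for x
  proof -
    have xH: "x \<in> H" by (rule subspD(1)[OF sN x])
    have "x \<star> p unity = (\<lambda>z. \<Sum>y\<in>carrier M. x y * p (reg.shift y unity) z)"
      unfolding reg.lact_def by (intro ext sum.cong) (auto simp: pshift)
    also have "\<dots> = p (x \<star> unity)" unfolding reg.lact_def p_lin ..
    finally show ?thesis using pid[OF x] star_unity[OF xH] by simp
  qed
  then show thesis using that[OF pN[of unity]] by blast
qed

definition primitive :: "('m \<Rightarrow> 'a) \<Rightarrow> bool" where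
  "primitive \<epsilon> \<longleftrightarrow> \<epsilon> \<in> H \<and> \<epsilon> \<noteq> (\<lambda>_. 0) \<and> \<epsilon> \<star> \<epsilon> = \<epsilon> \<and> reg.simple (lideal \<epsilon>)"

text \<open>Among the finite sets of orthogonal primitive idempotents, one is chosen whose
  complementary idempotent \<open>\<eta>\<close> generates a left ideal of least dimension. If
  \<open>\<eta>\<close> is not 0, a simple left ideal below it supplies one more idempotent, and the
  complementary ideal shrinks.\<close>

lemma primitive_decomposition:
  assumes n: "m * (of_nat (card (carrier M)) * e) = e"
  obtains \<Lambda> where "finite \<Lambda>" "\<And>\<epsilon>. \<epsilon> \<in> \<Lambda> \<Longrightarrow> primitive \<epsilon>"
    "\<And>\<epsilon> \<delta>. \<epsilon> \<in> \<Lambda> \<Longrightarrow> \<delta> \<in> \<Lambda> \<Longrightarrow> \<epsilon> \<noteq> \<delta> \<Longrightarrow> \<epsilon> \<star> \<delta> = (\<lambda>_. 0)"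
    "(\<lambda>z. \<Sum>\<epsilon>\<in>\<Lambda>. \<epsilon> z) = unity"
proof -
  define P where "P \<Lambda> \<longleftrightarrow> finite \<Lambda> \<and> (\<forall>\<epsilon>\<in>\<Lambda>. primitive \<epsilon>) \<and>
    (\<forall>\<epsilon>\<in>\<Lambda>. \<forall>\<delta>\<in>\<Lambda>. \<epsilon> \<noteq> \<delta> \<longrightarrow> \<epsilon> \<star> \<delta> = (\<lambda>_. 0))" for \<Lambda>
  define \<eta> where "\<eta> \<Lambda> = (\<lambda>z. unity z - (\<Sum>\<epsilon>\<in>\<Lambda>. \<epsilon> z))" for \<Lambda> :: "('m \<Rightarrow> 'a) set"
  have P0: "P {}" by (simp add: P_def)
  obtain \<Lambda> where \<Lambda>: "P \<Lambda>"
    and min: "\<And>\<Lambda>'. P \<Lambda>' \<Longrightarrow> vdim (carrier M) (lideal (\<eta> \<Lambda>)) \<le> vdim (carrier M) (lideal (\<eta> \<Lambda>'))"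
    using ex_has_least_nat[of P "{}" "\<lambda>\<Lambda>. vdim (carrier M) (lideal (\<eta> \<Lambda>))"] P0 by blast
  have fin: "finite \<Lambda>" using \<Lambda> by (simp add: P_def)
  have inH: "\<epsilon> \<in> H" and idp: "\<epsilon> \<star> \<epsilon> = \<epsilon>" if "\<epsilon> \<in> \<Lambda>" for \<epsilon>
    using \<Lambda> that by (auto simp: P_def primitive_def)
  have orth: "\<epsilon> \<star> \<delta> = (if \<epsilon> = \<delta> then \<epsilon> else (\<lambda>_. 0))" if "\<epsilon> \<in> \<Lambda>" "\<delta> \<in> \<Lambda>" for \<epsilon> \<delta>
    using \<Lambda> that idp by (auto simp: P_def)
  let ?h = "\<eta> \<Lambda>"
  have \<eta>H: "\<eta> \<Lambda>' \<in> H" if "P \<Lambda>'" for \<Lambda>'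
  proof -
    have "(\<lambda>z. \<Sum>\<epsilon>\<in>\<Lambda>'. \<epsilon> z) \<in> H" using that by (intro subsp_sum[OF subsp_vecs]) (auto simp: P_def primitive_def)
    then show ?thesis unfolding \<eta>_def by (rule subsp_diff[OF subsp_vecs unity_closed])
  qed
  have hH: "?h \<in> H" by (rule \<eta>H[OF \<Lambda>])
  have dh: "\<delta> \<star> ?h = (\<lambda>_. 0)" if d: "\<delta> \<in> \<Lambda>" for \<delta>
  proof -
    have "\<delta> \<star> ?h = (\<lambda>z. \<delta> z - (\<Sum>\<epsilon>\<in>\<Lambda>. (\<delta> \<star> \<epsilon>) z))"
      by (simp add: \<eta>_def star_diff_right star_sum_right star_unity[OF inH[OF d]])
    also have "\<dots> = (\<lambda>z. \<delta> z - (\<Sum>\<epsilon>\<in>\<Lambda>. if \<delta> = \<epsilon> then \<epsilon> z else 0))"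
      using d by (intro ext arg_cong2[of _ _ _ _ minus] sum.cong) (auto simp: orth)
    finally show ?thesis using fin d by simp
  qed
  have hd: "?h \<star> \<delta> = (\<lambda>_. 0)" if d: "\<delta> \<in> \<Lambda>" for \<delta>
  proof -
    have "?h \<star> \<delta> = (\<lambda>z. \<delta> z - (\<Sum>\<epsilon>\<in>\<Lambda>. (\<epsilon> \<star> \<delta>) z))"
      by (simp add: \<eta>_def reg.lact_coeff_diff star_sum_left unity_star[OF inH[OF d]])
    also have "\<dots> = (\<lambda>z. \<delta> z - (\<Sum>\<epsilon>\<in>\<Lambda>. if \<epsilon> = \<delta> then \<epsilon> z else 0))"
      using d by (intro ext arg_cong2[of _ _ _ _ minus] sum.cong) (auto simp: orth)
    finally show ?thesis using fin d by simp
  qed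
  have hh: "?h \<star> ?h = ?h"
  proof -
    have "?h \<star> ?h = (\<lambda>z. (?h \<star> unity) z - (\<Sum>\<epsilon>\<in>\<Lambda>. (?h \<star> \<epsilon>) z))"
      by (subst (2) \<eta>_def) (simp only: star_diff_right star_sum_right)
    then show ?thesis by (simp add: hd star_unity[OF hH])
  qed
  have "?h = (\<lambda>_. 0)"
  proof (rule ccontr)
    assume h0: "?h \<noteq> (\<lambda>_. 0)"
    have "lideal ?h \<noteq> {\<lambda>_. 0}" using self_in_lideal[OF hH] h0 by auto
    then obtain N where N: "reg.simple N" "N \<subseteq> lideal ?h"
      using reg.simple_subspace[OF lideal_stable[OF hH]] by blast
    have Nst: "reg.stable N" and sN: "subsp (carrier M) N" using N reg.stableD by (auto simp: reg.simple_def)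
    obtain \<epsilon> where \<epsilon>: "\<epsilon> \<in> N" "\<And>x. x \<in> N \<Longrightarrow> x \<star> \<epsilon> = x" by (rule left_ideal_idempotent[OF Nst n]) (rule that)
    obtain f where f: "f \<in> N" "f \<noteq> (\<lambda>_. 0)"
      using reg.nonzero_element[OF sN] N by (auto simp: reg.simple_def)
    have \<epsilon>0: "\<epsilon> \<noteq> (\<lambda>_. 0)" using \<epsilon>(2)[OF f(1)] f(2) star_zero(1) by auto
    have \<epsilon>H: "\<epsilon> \<in> H" by (rule subspD(1)[OF sN \<epsilon>(1)])
    obtain a where a: "\<epsilon> = a \<star> ?h" using N(2) \<epsilon>(1) lidealE by blast
    have \<epsilon>h: "\<epsilon> \<star> ?h = \<epsilon>" by (simp only: a star_assoc hh)
    \<comment> \<open>So far only \<open>\<epsilon> \<star> ?h = \<epsilon>\<close> is known.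
      Multiplying by \<open>?h\<close> from the left stays inside the left ideal \<open>N\<close>
      and gives orthogonality to \<open>\<Lambda>\<close> on both sides.\<close>
    define \<epsilon>' where "\<epsilon>' = ?h \<star> \<epsilon>"
    have \<epsilon>'N: "\<epsilon>' \<in> N" unfolding \<epsilon>'_def by (rule reg.lact_in[OF Nst \<epsilon>(1)])
    have \<epsilon>'H: "\<epsilon>' \<in> H" by (rule subspD(1)[OF sN \<epsilon>'N])
    have ee: "\<epsilon> \<star> \<epsilon>' = \<epsilon>" unfolding \<epsilon>'_def by (simp only: star_assoc[symmetric] \<epsilon>h \<epsilon>(2)[OF \<epsilon>(1)])
    have \<epsilon>'0: "\<epsilon>' \<noteq> (\<lambda>_. 0)" using ee \<epsilon>0 star_zero(1) by auto
    have \<epsilon>'i: "\<epsilon>' \<star> \<epsilon>' = \<epsilon>'"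
    proof -
      have "\<epsilon>' \<star> \<epsilon>' = ?h \<star> (\<epsilon> \<star> \<epsilon>')" by (simp only: \<epsilon>'_def star_assoc)
      then show ?thesis by (simp only: ee) (simp only: \<epsilon>'_def)
    qed
    have h\<epsilon>': "?h \<star> \<epsilon>' = \<epsilon>'" by (simp only: \<epsilon>'_def star_assoc[symmetric] hh)
    have \<epsilon>'h: "\<epsilon>' \<star> ?h = \<epsilon>'" by (simp only: \<epsilon>'_def star_assoc \<epsilon>h)
    have "lideal \<epsilon>' = N"
    proof -
      have "lideal \<epsilon>' \<subseteq> N" using lidealE reg.lact_in[OF Nst \<epsilon>'N] by blast
      then show ?thesis using N(1) lideal_stable[OF \<epsilon>'H] self_in_lideal[OF \<epsilon>'H] \<epsilon>'0
        unfolding reg.simple_def by blast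
    qed
    then have prim: "primitive \<epsilon>'" using \<epsilon>'H \<epsilon>'0 \<epsilon>'i N(1) by (simp add: primitive_def)
    have o1: "\<delta> \<star> \<epsilon>' = (\<lambda>_. 0)" if "\<delta> \<in> \<Lambda>" for \<delta>
      by (simp only: \<epsilon>'_def star_assoc[symmetric] dh[OF that] star_zero)
    have o2: "\<epsilon>' \<star> \<delta> = (\<lambda>_. 0)" if "\<delta> \<in> \<Lambda>" for \<delta>
    proof -
      have "\<epsilon>' \<star> \<delta> = \<epsilon>' \<star> (?h \<star> \<delta>)" by (simp only: star_assoc[symmetric] \<epsilon>'h)
      then show ?thesis by (simp only: hd[OF that] star_zero)
    qed
    have nin: "\<epsilon>' \<notin> \<Lambda>" using o1 \<epsilon>'i \<epsilon>'0 by metis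
    have P': "P (insert \<epsilon>' \<Lambda>)" using \<Lambda> prim o1 o2 by (auto simp: P_def)
    let ?h' = "\<eta> (insert \<epsilon>' \<Lambda>)"
    have h': "?h' = (\<lambda>z. ?h z - \<epsilon>' z)" using fin nin by (simp add: \<eta>_def fun_eq_iff algebra_simps)
    have h'h: "?h' \<star> ?h = ?h'" by (simp add: h' reg.lact_coeff_diff hh \<epsilon>'h)
    have "lideal ?h' \<subset> lideal ?h"
    proof
      show "lideal ?h' \<subseteq> lideal ?h"
      proof
        fix g assume "g \<in> lideal ?h'"
        then obtain b where "g = b \<star> ?h'" using lidealE by blast
        then have "g = (b \<star> ?h') \<star> ?h" by (simp only: star_assoc h'h)
        then show "g \<in> lideal ?h" using lidealI by blast
      qed
      \<comment> \<open>Right multiplication by \<open>\<epsilon>'\<close> kills the smaller ideal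
        but not \<open>?h\<close>, so the inclusion is strict.\<close>
      have "?h \<notin> lideal ?h'"
      proof
        assume "?h \<in> lideal ?h'"
        then obtain b where b: "?h = b \<star> ?h'" using lidealE by blast
        have "?h' \<star> \<epsilon>' = (\<lambda>_. 0)" by (simp add: h' reg.lact_coeff_diff h\<epsilon>' \<epsilon>'i)
        then have "(b \<star> ?h') \<star> \<epsilon>' = (\<lambda>_. 0)" by (simp only: star_assoc star_zero)
        then show False using b h\<epsilon>' \<epsilon>'0 by metis
      qed
      then show "lideal ?h' \<noteq> lideal ?h" using self_in_lideal[OF hH] by blast
    qed
    then have "vdim (carrier M) (lideal ?h') < vdim (carrier M) (lideal ?h)"
      by (intro vdim_strict_mono[OF fin_M] reg.stableD(1) lideal_stable hH \<eta>H[OF P'])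
    then show False using min[OF P'] by simp
  qed
  then have "(\<lambda>z. \<Sum>\<epsilon>\<in>\<Lambda>. \<epsilon> z) = unity" by (simp add: \<eta>_def fun_eq_iff)
  then show thesis using that[of \<Lambda>] \<Lambda> unfolding P_def by blast
qed

end

section \<open>Schur's lemma and matrix units\<close>

locale closed_group_algebra = group_algebra + idem_alg_closed_field
begin

text \<open>Schur's lemma: right multiplication by
  \<open>\<epsilon> \<star> x \<star> \<epsilon>\<close> is an endomorphism of the simple left ideal
  of \<open>\<epsilon>\<close>. Its eigenspace is a nonzero submodule, hence the whole ideal, and in
  particular contains \<open>\<epsilon>\<close>.\<close>

lemma corner_scalar:
  assumes \<epsilon>: "primitive \<epsilon>" and x: "x \<in> H"
  obtains t where "e * t = t" "\<epsilon> \<star> x \<star> \<epsilon> = (\<lambda>z. t * \<epsilon> z)"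
proof -
  let ?N = "lideal \<epsilon>" and ?w = "\<epsilon> \<star> x \<star> \<epsilon>"
  have \<epsilon>H: "\<epsilon> \<in> H" and \<epsilon>0: "\<epsilon> \<noteq> (\<lambda>_. 0)" and \<epsilon>i: "\<epsilon> \<star> \<epsilon> = \<epsilon>" and simp: "reg.simple ?N"
    using \<epsilon> by (auto simp: primitive_def)
  have Nst: "reg.stable ?N" by (rule lideal_stable[OF \<epsilon>H])
  have sN: "subsp (carrier M) ?N" by (rule reg.stableD(1)[OF Nst])
  have lin: "linear_on ?N (\<lambda>f. f \<star> ?w)"
    unfolding linear_on_def
  proof (intro conjI ballI allI)
    show "f \<star> ?w \<in> ?N" for f using lidealI[of "f \<star> (\<epsilon> \<star> x)" \<epsilon>] by (simp only: star_assoc)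
  qed (simp_all add: reg.lact_coeff_add reg.lact_coeff_scale)
  obtain t v where v: "v \<in> ?N" "v \<noteq> (\<lambda>_. 0)" "v \<star> ?w = (\<lambda>z. t * v z)" "e * t = t"
    by (rule eigenvector[OF fin_M sN lin self_in_lideal[OF \<epsilon>H] \<epsilon>0]) (rule that)
  define Z where "Z = {f \<in> ?N. f \<star> ?w = (\<lambda>z. t * f z)}"
  have "reg.stable Z"
    unfolding reg.stable_def subsp_def
  proof (intro conjI ballI allI)
    show "Z \<subseteq> H" using subspD(1)[OF sN] by (auto simp: Z_def)
    show "(\<lambda>_. 0) \<in> Z" using subspD(2)[OF sN] by (simp add: Z_def star_zero)
    show "(\<lambda>z. f z + g z) \<in> Z" if "f \<in> Z" "g \<in> Z" for f g
      using that subspD(3)[OF sN] by (simp add: Z_def reg.lact_coeff_add distrib_left)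
    show "(\<lambda>z. s * f z) \<in> Z" if "f \<in> Z" for s f
      using that subspD(4)[OF sN] by (simp add: Z_def reg.lact_coeff_scale mult.left_commute)
    show "reg.shift y f \<in> Z" if y: "y \<in> carrier M" and f: "f \<in> Z" for y f
    proof -
      have fH: "f \<in> H" using f subspD(1)[OF sN] by (simp add: Z_def)
      have "reg.shift y f \<star> ?w = reg.delta y \<star> (f \<star> ?w)"
        by (simp only: reg.lact_delta[OF fH y, symmetric] star_assoc)
      also have "\<dots> = (\<lambda>z. t * reg.shift y f z)"
        using f by (simp add: Z_def reg.lact_scale reg.lact_delta[OF fH y])
      finally show ?thesis using reg.stableD(2)[OF Nst y] f by (simp add: Z_def)
    qed
  qed
  moreover have "Z \<subseteq> ?N" "v \<in> Z" using v by (auto simp: Z_def)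
  ultimately have "Z = ?N" using simp v(2) unfolding reg.simple_def by blast
  then have "\<epsilon> \<in> Z" using self_in_lideal[OF \<epsilon>H] by simp
  then have "\<epsilon> \<star> ?w = (\<lambda>z. t * \<epsilon> z)" by (simp add: Z_def)
  moreover have "\<epsilon> \<star> ?w = ?w" by (simp only: star_assoc[symmetric] \<epsilon>i)
  ultimately show thesis using that[OF v(4)] by simp
qed

text \<open>Right multiplication by a nonzero \<open>x\<close> in this corner is an isomorphism
  between the two simple left ideals, and \<open>y\<close> gives the inverse. Simplicity yields
  \<open>y \<star> x = \<delta>\<close>; the other product is a scalar multiple of
  \<open>\<epsilon>\<close>, and \<open>x = x \<star> y \<star> x\<close> forces the scalar to be
  \<open>e\<close>.\<close>

lemma matrix_unit_pair:
  assumes \<epsilon>: "primitive \<epsilon>" and \<delta>: "primitive \<delta>" and x: "x \<in> H"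
    and x1: "\<epsilon> \<star> x = x" "x \<star> \<delta> = x" "x \<noteq> (\<lambda>_. 0)"
  obtains y where "y \<in> H" "\<delta> \<star> y = y" "y \<star> \<epsilon> = y" "y \<star> x = \<delta>" "x \<star> y = \<epsilon>"
proof -
  have \<epsilon>H: "\<epsilon> \<in> H" and \<delta>H: "\<delta> \<in> H" and \<epsilon>i: "\<epsilon> \<star> \<epsilon> = \<epsilon>" and \<delta>i: "\<delta> \<star> \<delta> = \<delta>"
    and simp: "reg.simple (lideal \<delta>)" using \<epsilon> \<delta> by (auto simp: primitive_def)
  have "x \<in> lideal \<delta>" using lidealI[of x \<delta>] x1(2) by simp
  then obtain a where a: "a \<star> x = \<delta>" using reg.simple_cyclic[OF simp _ x1(3) self_in_lideal[OF \<delta>H]] by blast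
  define y where "y = \<delta> \<star> a \<star> \<epsilon>"
  have yH: "y \<in> H" unfolding y_def by (rule star_closed[OF \<epsilon>H])
  have y1: "\<delta> \<star> y = y" by (simp only: y_def star_assoc[symmetric] \<delta>i)
  have y2: "y \<star> \<epsilon> = y" by (simp only: y_def star_assoc \<epsilon>i)
  have yx: "y \<star> x = \<delta>" by (simp only: y_def star_assoc x1(1) a \<delta>i)
  obtain t where t: "e * t = t" "\<epsilon> \<star> (x \<star> y) \<star> \<epsilon> = (\<lambda>z. t * \<epsilon> z)"
    using corner_scalar[OF \<epsilon> star_closed[OF yH]] by blast
  have "\<epsilon> \<star> (x \<star> y) \<star> \<epsilon> = x \<star> y" by (simp only: star_assoc y2) (simp only: star_assoc[symmetric] x1(1))
  then have xy: "x \<star> y = (\<lambda>z. t * \<epsilon> z)" using t by simp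
  have "x = x \<star> y \<star> x" by (simp only: star_assoc yx x1(2))
  also have "\<dots> = (\<lambda>z. t * x z)" by (simp add: xy reg.lact_coeff_scale x1(1))
  finally have tx: "x z = t * x z" for z by (rule fun_cong)
  obtain z where z: "x z \<noteq> 0" using x1(3) by auto
  obtain s where s: "x z * s = e" using inverse_exists[OF vecsD(1)[OF x] z] by blast
  have "t * e = e" using tx[of z] s by (metis mult.assoc)
  then have "t = e" using t(1) by (simp add: mult.commute)
  then have "x \<star> y = \<epsilon>" using xy vecsD(1)[OF \<epsilon>H] by simp
  then show thesis using that[OF yH y1 y2 yx] by blast
qed

text \<open>This is the decomposition into matrix algebras, stated through one row for each. The
  idempotent \<open>r j\<close> represents the isomorphism class of \<open>j\<close>, and
  \<open>u j\<close>, \<open>v j\<close> are mutually inverse elements between \<open>j\<close> and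
  \<open>r j\<close>. By the last property, the row of \<open>r k\<close>, that is all
  \<open>r k \<star> h\<close>, is spanned by the \<open>v j\<close> with
  \<open>r j = r k\<close>.\<close>

lemma matrix_units:
  assumes n: "m * (of_nat (card (carrier M)) * e) = e"
  obtains \<Lambda> r u v where "finite \<Lambda>" "(\<lambda>z. \<Sum>j\<in>\<Lambda>. j z) = unity"
    "\<And>j. j \<in> \<Lambda> \<Longrightarrow> j \<in> H \<and> j \<noteq> (\<lambda>_. 0) \<and> j \<star> j = j \<and> r j \<in> \<Lambda> \<and> r (r j) = r j \<and> u j \<in> H \<and> v j \<in> H \<and>
       u j \<star> v j = j \<and> v j \<star> u j = r j \<and> j \<star> u j = u j \<and> u j \<star> r j = u j \<and> v j \<star> j = v j \<and> r j \<star> v j = v j"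
    "\<And>j k. j \<in> \<Lambda> \<Longrightarrow> k \<in> \<Lambda> \<Longrightarrow> j \<noteq> k \<Longrightarrow> j \<star> k = (\<lambda>_. 0)"
    "\<And>h j k. h \<in> H \<Longrightarrow> j \<in> \<Lambda> \<Longrightarrow> k \<in> \<Lambda> \<Longrightarrow> \<exists>t. r k \<star> h \<star> j = (\<lambda>z. t * v j z) \<and> (r k \<noteq> r j \<longrightarrow> t = 0)"
proof -
  obtain \<Lambda> where fin: "finite \<Lambda>" and prim: "\<And>j. j \<in> \<Lambda> \<Longrightarrow> primitive j"
    and orth: "\<And>j k. j \<in> \<Lambda> \<Longrightarrow> k \<in> \<Lambda> \<Longrightarrow> j \<noteq> k \<Longrightarrow> j \<star> k = (\<lambda>_. 0)"
    and sum1: "(\<lambda>z. \<Sum>j\<in>\<Lambda>. j z) = unity" by (rule primitive_decomposition[OF n]) (rule that)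
  have jH: "j \<in> H" and j0: "j \<noteq> (\<lambda>_. 0)" and ji: "j \<star> j = j" if "j \<in> \<Lambda>" for j
    using prim[OF that] by (auto simp: primitive_def)
  \<comment> \<open>By \<open>matrix_unit_pair\<close> the members of \<open>U j k\<close> are the
    isomorphisms between the left ideals of \<open>j\<close> and \<open>k\<close>; so
    \<open>rel\<close> is isomorphism.\<close>
  define U where "U j k = {x \<in> H. j \<star> x = x \<and> x \<star> k = x \<and> x \<noteq> (\<lambda>_. 0)}" for j k :: "'b \<Rightarrow> 'a"
  define rel where "rel j k \<longleftrightarrow> U j k \<noteq> {}" for j k :: "'b \<Rightarrow> 'a"
  have pair: "\<exists>y\<in>U k j. y \<star> x = k \<and> x \<star> y = j" if xU: "x \<in> U j k" and j: "j \<in> \<Lambda>" and k: "k \<in> \<Lambda>" for x j k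
  proof -
    have x: "x \<in> H" "j \<star> x = x" "x \<star> k = x" "x \<noteq> (\<lambda>_. 0)" using xU by (auto simp: U_def)
    obtain y where y: "y \<in> H" "k \<star> y = y" "y \<star> j = y" "y \<star> x = k" "x \<star> y = j"
      by (rule matrix_unit_pair[OF prim[OF j] prim[OF k] x]) (rule that)
    have "y \<noteq> (\<lambda>_. 0)" using y(5) j0[OF j] star_zero(1) by auto
    then show ?thesis using y by (auto simp: U_def)
  qed
  have refl: "rel j j" if "j \<in> \<Lambda>" for j using jH[OF that] j0[OF that] ji[OF that] by (auto simp: rel_def U_def)
  have sym: "rel k j" if "rel j k" "j \<in> \<Lambda>" "k \<in> \<Lambda>" for j k using that pair unfolding rel_def by blast
  have trans: "rel i k" if ij: "rel i j" and jk: "rel j k" and I: "i \<in> \<Lambda>" "j \<in> \<Lambda>" "k \<in> \<Lambda>" for i j k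
  proof -
    obtain x z where xz: "x \<in> U i j" "z \<in> U j k" using ij jk by (auto simp: rel_def)
    obtain y where y: "y \<star> x = j" using pair[OF xz(1) I(1,2)] by blast
    have "y \<star> (x \<star> z) = z" using xz(2) by (simp add: star_assoc[symmetric] y U_def)
    then have "x \<star> z \<noteq> (\<lambda>_. 0)" using xz(2) star_zero(1) by (auto simp: U_def)
    moreover have "i \<star> (x \<star> z) = x \<star> z" using xz(1) by (simp add: star_assoc[symmetric] U_def)
    moreover have "x \<star> z \<star> k = x \<star> z" using xz(2) by (simp add: star_assoc U_def)
    moreover have "x \<star> z \<in> H" using xz(2) star_closed by (simp add: U_def)
    ultimately show ?thesis by (auto simp: rel_def U_def)
  qed
  define r where "r j = (SOME k. k \<in> \<Lambda> \<and> rel j k)" for j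
  have r: "r j \<in> \<Lambda>" "rel j (r j)" if "j \<in> \<Lambda>" for j
    using someI_ex[of "\<lambda>k. k \<in> \<Lambda> \<and> rel j k"] refl[OF that] that unfolding r_def by blast+
  have r_eq: "r j = r k" if "rel j k" "j \<in> \<Lambda>" "k \<in> \<Lambda>" for j k
  proof -
    \<comment> \<open>The choice in \<open>r\<close> is made from the class only, so related
      idempotents receive the same representative.\<close>
    have "(\<lambda>i. i \<in> \<Lambda> \<and> rel j i) = (\<lambda>i. i \<in> \<Lambda> \<and> rel k i)"
      using trans[OF that(1)] trans[OF sym[OF that]] that(2,3) by (intro ext) blast
    then show ?thesis by (simp add: r_def)
  qed
  have rr: "r (r j) = r j" if "j \<in> \<Lambda>" for j using r_eq[OF r(2)[OF that] that r(1)[OF that]] by simp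
  have "\<exists>x y. x \<in> U j (r j) \<and> y \<in> U (r j) j \<and> x \<star> y = j \<and> y \<star> x = r j" if j: "j \<in> \<Lambda>" for j
  proof -
    obtain x where x: "x \<in> U j (r j)" using r(2)[OF j] by (auto simp: rel_def)
    then show ?thesis using pair[OF x j r(1)[OF j]] by blast
  qed
  then obtain u v where uv: "\<And>j. j \<in> \<Lambda> \<Longrightarrow> u j \<in> U j (r j) \<and> v j \<in> U (r j) j \<and> u j \<star> v j = j \<and> v j \<star> u j = r j"
    by metis
  have last: "\<exists>t. r k \<star> h \<star> j = (\<lambda>z. t * v j z) \<and> (r k \<noteq> r j \<longrightarrow> t = 0)" if h: "h \<in> H" and j: "j \<in> \<Lambda>" and k: "k \<in> \<Lambda>" for h j k
  proof (cases "r k \<star> h \<star> j = (\<lambda>_. 0)")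
    case True
    then show ?thesis by (intro exI[of _ 0]) simp
  next
    case False
    have "r k \<star> h \<star> j \<in> U (r k) j"
      using False star_closed[OF jH[OF j]] ji[OF j] ji[OF r(1)[OF k]]
      by (simp add: U_def) (simp only: star_assoc, simp only: star_assoc[symmetric])
    then have "rel (r k) j" by (auto simp: rel_def)
    then have eq: "r k = r j" using r_eq[OF _ r(1)[OF k] j] rr[OF k] by simp
    have vj: "r j \<star> v j = v j" "v j \<star> u j = r j" "u j \<star> v j = j" "u j \<star> r j = u j" "u j \<in> H"
      using uv[OF j] by (auto simp: U_def)
    obtain t where t: "r j \<star> (h \<star> j \<star> u j) \<star> r j = (\<lambda>z. t * r j z)"
      using corner_scalar[OF prim[OF r(1)[OF j]] star_closed[OF vj(5), of "h \<star> j"]] by blast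
    have "r k \<star> h \<star> j = r j \<star> (h \<star> (j \<star> j))" by (simp only: eq star_assoc ji[OF j])
    also have "\<dots> = r j \<star> (h \<star> j \<star> u j) \<star> r j \<star> v j"
      by (simp only: star_assoc vj(1)) (simp only: vj(3))
    also have "\<dots> = (\<lambda>z. t * v j z)" by (simp add: t reg.lact_coeff_scale vj(1))
    finally show ?thesis using eq by blast
  qed
  show thesis
  proof (rule that[of \<Lambda> r u v, OF fin sum1 _ orth last])
    fix j assume j: "j \<in> \<Lambda>"
    show "j \<in> H \<and> j \<noteq> (\<lambda>_. 0) \<and> j \<star> j = j \<and> r j \<in> \<Lambda> \<and> r (r j) = r j \<and> u j \<in> H \<and> v j \<in> H \<and>
       u j \<star> v j = j \<and> v j \<star> u j = r j \<and> j \<star> u j = u j \<and> u j \<star> r j = u j \<and> v j \<star> j = v j \<and> r j \<star> v j = v j"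
      using uv[OF j] jH[OF j] j0[OF j] ji[OF j] r(1)[OF j] rr[OF j] by (simp add: U_def)
  qed auto
qed

end

section \<open>Functions on words over a group\<close>

abbreviation iv :: "('i \<Rightarrow> 'i) \<Rightarrow> 'i \<Rightarrow> 'i" where
  "iv \<sigma> \<equiv> inv_into UNIV \<sigma>"

text \<open>\<open>\<tau>\<close> reverses each cycle of \<open>\<sigma>\<close>, fixing a chosen base point of the cycle.\<close>
lemma permutation_conjugate_to_inverse:
  assumes "finite D" "\<sigma> permutes D"
  obtains \<tau> where "\<tau> permutes D" "\<tau> \<circ> \<sigma> \<circ> iv \<tau> = iv \<sigma>"
    "\<And>i. \<exists>k. (\<sigma> ^^ k) (\<tau> i) = i"
proof -
  define \<rho> where "\<rho> = iv \<sigma>"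
  have \<rho>\<sigma>: "\<rho> (\<sigma> x) = x" and \<sigma>\<rho>: "\<sigma> (\<rho> x) = x" for x
    using permutes_inverses[OF assms(2)] by (simp_all add: \<rho>_def)
  have ps: "(\<rho> ^^ k) ((\<sigma> ^^ k) x) = x" and sp: "(\<sigma> ^^ k) ((\<rho> ^^ k) x) = x" for k x
    by (induction k arbitrary: x) (simp_all add: funpow_swap1 \<rho>\<sigma> \<sigma>\<rho>)
  have pow_perm: "(\<sigma> ^^ k) permutes D" for k
    using permutes_compose[OF _ assms(2)] by (induction k) (simp_all add: permutes_id[unfolded id_def] id_def)
  \<comment> \<open>All powers of \<open>\<sigma>\<close> lie in the finite set of permutations of
    \<open>D\<close>; two equal powers give a positive \<open>N\<close> whose power is the
    identity.\<close>
  have "\<not> inj (\<lambda>k::nat. \<sigma> ^^ k)"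
  proof
    assume "inj (\<lambda>k::nat. \<sigma> ^^ k)"
    then have "infinite (range (\<lambda>k::nat. \<sigma> ^^ k))" using finite_imageD by blast
    moreover have "range (\<lambda>k::nat. \<sigma> ^^ k) \<subseteq> {p. p permutes D}" using pow_perm by auto
    ultimately show False using finite_permutations[OF assms(1)] finite_subset by blast
  qed
  then obtain k l :: nat where kl: "\<sigma> ^^ k = \<sigma> ^^ l" "k < l"
    by (auto simp: inj_on_def) (metis linorder_neqE_nat)
  define N where "N = l - k"
  have N0: "N > 0" using kl by (simp add: N_def)
  have N: "(\<sigma> ^^ N) x = x" for x
  proof -
    have "(\<sigma> ^^ k) ((\<sigma> ^^ N) x) = (\<sigma> ^^ (k + N)) x" by (simp add: funpow_add)
    also have "k + N = l" using kl(2) by (simp add: N_def)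
    finally have "(\<sigma> ^^ k) ((\<sigma> ^^ N) x) = (\<sigma> ^^ k) x" using kl(1) by simp
    then have "(\<rho> ^^ k) ((\<sigma> ^^ k) ((\<sigma> ^^ N) x)) = (\<rho> ^^ k) ((\<sigma> ^^ k) x)" by simp
    then show ?thesis by (simp only: ps)
  qed
  define conn where "conn x y \<longleftrightarrow> (\<exists>k. (\<sigma> ^^ k) x = y)" for x y
  have conn_sym: "conn y x" if xy: "conn x y" for x y
  proof -
    obtain k where k: "(\<sigma> ^^ k) x = y" using xy by (auto simp: conn_def)
    have NN: "(\<sigma> ^^ (N * j)) x = x" for j by (induction j) (simp_all add: funpow_add N)
    have "(\<sigma> ^^ (N * k - k)) y = (\<sigma> ^^ (N * k - k + k)) x" using k by (simp add: funpow_add)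
    also have "N * k - k + k = N * k" using N0 by (cases N) auto
    finally show ?thesis using NN by (auto simp: conn_def)
  qed
  have conn_trans: "conn x z" if xy: "conn x y" and yz: "conn y z" for x y z
  proof -
    obtain k l where "(\<sigma> ^^ k) x = y" "(\<sigma> ^^ l) y = z" using xy yz by (auto simp: conn_def)
    then have "(\<sigma> ^^ (l + k)) x = z" by (simp add: funpow_add)
    then show ?thesis unfolding conn_def by blast
  qed
  define b where "b x = (SOME y. conn x y)" for x
  have conn_b: "conn (b x) x" for x
  proof -
    have "conn x x" unfolding conn_def by (rule exI[of _ 0]) simp
    then show ?thesis unfolding b_def by (rule conn_sym[OF someI])
  qed
  have b_eq: "b x = b y" if "conn x y" for x y
  proof -
    have "conn x z \<longleftrightarrow> conn y z" for z
      using conn_trans[OF that, of z] conn_trans[OF conn_sym[OF that], of z] by (rule iffI[rotated])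
    then have "conn x = conn y" by (rule ext)
    then show ?thesis by (simp add: b_def)
  qed
  define \<tau> where "\<tau> x = (\<rho> ^^ (SOME k. (\<sigma> ^^ k) (b x) = x)) (b x)" for x
  \<comment> \<open>The exponent that leads from the base point to \<open>x\<close> is unique only
    modulo the cycle length. This makes \<open>\<tau>\<close> independent of the chosen
    exponent.\<close>
  have swap: "(\<rho> ^^ k) z = (\<rho> ^^ l) z" if "(\<sigma> ^^ k) z = (\<sigma> ^^ l) z" for k l z
  proof -
    have c: "(\<rho> ^^ (k + l)) ((\<sigma> ^^ k) z) = (\<rho> ^^ l) z" for k l
      by (simp add: add.commute[of k] funpow_add ps)
    then show ?thesis using c[of k l] c[of l k] that by (simp add: add.commute)
  qed
  have \<tau>: "\<tau> x = (\<rho> ^^ k) (b x)" if "(\<sigma> ^^ k) (b x) = x" for x k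
    unfolding \<tau>_def
  proof (rule swap)
    have "(\<sigma> ^^ (SOME k. (\<sigma> ^^ k) (b x) = x)) (b x) = x" using that by (rule someI)
    then show "(\<sigma> ^^ (SOME k. (\<sigma> ^^ k) (b x) = x)) (b x) = (\<sigma> ^^ k) (b x)" using that by simp
  qed
  have ex: "\<exists>k. (\<sigma> ^^ k) (b x) = x" for x using conn_b by (simp add: conn_def)
  have \<tau>\<sigma>: "\<tau> (\<sigma> x) = \<rho> (\<tau> x)" for x
  proof -
    obtain k where k: "(\<sigma> ^^ k) (b x) = x" using ex by blast
    have "conn x (\<sigma> x)" unfolding conn_def by (rule exI[of _ 1]) simp
    then have "b (\<sigma> x) = b x" using b_eq by metis
    then have "\<tau> (\<sigma> x) = (\<rho> ^^ Suc k) (b x)" using \<tau>[of "Suc k" "\<sigma> x"] k by simp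
    then show ?thesis using \<tau>[OF k] by simp
  qed
  have \<tau>\<tau>: "\<tau> (\<tau> x) = x" for x
  proof -
    obtain k where k: "(\<sigma> ^^ k) (b x) = x" using ex by blast
    have "(\<sigma> ^^ k) (\<tau> x) = b x" using \<tau>[OF k] sp by simp
    then have "conn (\<tau> x) (b x)" by (auto simp: conn_def)
    then have bb: "b (\<tau> x) = b x" using b_eq[OF conn_trans[OF _ conn_b]] b_eq[of "\<tau> x" "b x"] b_eq[OF conn_b[of x]] by simp
    obtain m where m: "(\<sigma> ^^ m) (b x) = \<tau> x" using ex[of "\<tau> x"] bb by auto
    have "\<tau> (\<tau> x) = (\<rho> ^^ m) (b x)" using \<tau>[of m "\<tau> x"] m bb by simp
    moreover have "(\<sigma> ^^ k) ((\<sigma> ^^ m) (b x)) = b x" using m \<tau>[OF k] sp by simp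
    then have "(\<sigma> ^^ m) ((\<sigma> ^^ k) (b x)) = b x"
      by (simp add: add.commute flip: funpow_add[THEN fun_cong, unfolded comp_apply])
    then have "(\<rho> ^^ m) (b x) = (\<rho> ^^ m) ((\<sigma> ^^ m) ((\<sigma> ^^ k) (b x)))" by simp
    ultimately show ?thesis using ps k by simp
  qed
  have \<tau>out: "\<tau> x = x" if "x \<notin> D" for x
  proof -
    have s: "\<sigma> x = x" using assms(2) that by (simp add: permutes_def)
    have sk: "(\<sigma> ^^ k) x = x" for k by (induction k) (simp_all add: s)
    have "conn x (b x)" using conn_sym[OF conn_b] .
    then have "b x = x" using sk by (auto simp: conn_def)
    then show ?thesis using \<tau>[of 0 x] by simp
  qed
  have perm: "\<tau> permutes D" unfolding permutes_def
    using \<tau>out \<tau>\<tau> by metis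
  have iv\<tau>: "iv \<tau> = \<tau>" using \<tau>\<tau> by (intro Hilbert_Choice.inv_equality)
  show thesis
  proof (rule that[OF perm])
    show "\<tau> \<circ> \<sigma> \<circ> iv \<tau> = iv \<sigma>"
      unfolding iv\<tau> using \<tau>\<sigma> \<tau>\<tau> by (simp add: fun_eq_iff \<rho>_def)
    show "\<exists>k. (\<sigma> ^^ k) (\<tau> i) = i" for i
    proof -
      obtain k where k: "(\<sigma> ^^ k) (b i) = i" using ex by blast
      have "(\<sigma> ^^ (k + k)) (\<tau> i) = i" using \<tau>[OF k] sp k by (simp add: funpow_add)
      then show ?thesis by (rule exI)
    qed
  qed
qed

section \<open>Permutations acting on words\<close>

definition wperm :: "'i set \<Rightarrow> ('i \<Rightarrow> 'i) \<Rightarrow> ('i \<Rightarrow> 'b) \<Rightarrow> ('i \<Rightarrow> 'b)" where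
  "wperm D \<sigma> w = (\<lambda>i\<in>D. w (iv \<sigma> i))"

lemma wperm_closed: "\<sigma> permutes D \<Longrightarrow> w \<in> D \<rightarrow>\<^sub>E A \<Longrightarrow> wperm D \<sigma> w \<in> D \<rightarrow>\<^sub>E A"
  using permutes_in_image[OF permutes_inv, of \<sigma> D] by (auto simp: wperm_def PiE_iff)

lemma wperm_id: "w \<in> D \<rightarrow>\<^sub>E A \<Longrightarrow> wperm D id w = w"
  by (auto simp: wperm_def fun_eq_iff PiE_def extensional_def)

lemma wperm_comp:
  assumes "\<sigma> permutes D" "\<tau> permutes D"
  shows "wperm D (\<sigma> \<circ> \<tau>) w = wperm D \<sigma> (wperm D \<tau> w)"
proof -
  have "iv (\<sigma> \<circ> \<tau>) = iv \<tau> \<circ> iv \<sigma>"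
    using assms by (intro o_inv_distrib permutes_bij)
  then show ?thesis using assms permutes_in_image[OF permutes_inv[OF assms(1)]]
    by (auto simp: wperm_def fun_eq_iff)
qed

lemma iv_permutes: "\<sigma> permutes D \<Longrightarrow> iv \<sigma> permutes D" "\<sigma> permutes D \<Longrightarrow> iv (iv \<sigma>) = \<sigma>"
  by (rule permutes_inv, assumption) (rule inv_inv_eq, rule permutes_bij)

section \<open>The group algebra of a power of \<open>G\<close> as a tensor power\<close>

locale word_algebra = idem_alg_closed_field e + G: group G
  for e :: "'a::comm_ring_1" and G :: "('g, 'b) monoid_scheme" +
  fixes D :: "'i set"
  assumes fin_G: "finite (carrier G)" and fin_D: "finite D"
begin

definition GD :: "('i \<Rightarrow> 'g) monoid" where "GD = product_group D (\<lambda>_. G)"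

abbreviation W :: "('i \<Rightarrow> 'g) set" where "W \<equiv> carrier GD"

lemma W_eq: "W = D \<rightarrow>\<^sub>E carrier G" by (simp add: GD_def)

lemma W_iff [simp]: "x \<in> W \<longleftrightarrow> x \<in> D \<rightarrow>\<^sub>E carrier G" by (simp add: GD_def)

lemma GD_mult [simp]: "x \<otimes>\<^bsub>GD\<^esub> y = (\<lambda>i\<in>D. x i \<otimes>\<^bsub>G\<^esub> y i)" by (simp add: GD_def)

lemma GD_one [simp]: "\<one>\<^bsub>GD\<^esub> = (\<lambda>i\<in>D. \<one>\<^bsub>G\<^esub>)" by (simp add: GD_def)

lemma GD_inv [simp]: "x \<in> D \<rightarrow>\<^sub>E carrier G \<Longrightarrow> inv\<^bsub>GD\<^esub> x = (\<lambda>i\<in>D. inv\<^bsub>G\<^esub> (x i))"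
  unfolding GD_def by (rule inv_product_group) (simp_all add: G.is_group)

lemma finW: "finite W" unfolding W_eq by (auto intro: finite_PiE simp: fin_D fin_G)

sublocale g: closed_group_algebra e G
  by unfold_locales (simp_all add: fin_G)

sublocale w: group_algebra e GD
proof -
  interpret P: group GD by (simp add: GD_def G.is_group)
  show "group_algebra e GD" by unfold_locales (rule finW)
qed

lemma w_star: "w.star a b z = (if z \<in> W then \<Sum>y\<in>W. a y * b (\<lambda>i\<in>D. inv\<^bsub>G\<^esub> (y i) \<otimes>\<^bsub>G\<^esub> z i) else 0)"
proof -
  have "a y * w.reg.shift y b z = a y * b (\<lambda>i\<in>D. inv\<^bsub>G\<^esub> (y i) \<otimes>\<^bsub>G\<^esub> z i)" if "y \<in> W" "z \<in> W" for y
  proof -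
    have "(\<lambda>i\<in>D. (\<lambda>i\<in>D. inv\<^bsub>G\<^esub> y i) i \<otimes>\<^bsub>G\<^esub> z i) = (\<lambda>i\<in>D. inv\<^bsub>G\<^esub> (y i) \<otimes>\<^bsub>G\<^esub> z i)"
      by (rule restrict_ext) simp
    then show ?thesis using that by (simp add: w.reg.shift_def cong: restrict_cong)
  qed
  then show ?thesis by (simp add: w.reg.lact_def w.reg.shift_def)
qed

text \<open>The pure tensor of the functions \<open>h i\<close>, with the tensor power read as
  functions on words. The factor \<open>e\<close> forces the value into the field, also for empty
  \<open>D\<close>.\<close>

definition ten :: "('i \<Rightarrow> 'g \<Rightarrow> 'a) \<Rightarrow> ('i \<Rightarrow> 'g) \<Rightarrow> 'a" where
  "ten h = (\<lambda>x. if x \<in> W then e * (\<Prod>i\<in>D. h i (x i)) else 0)"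

lemma ten_closed: "ten h \<in> vecs W"
  using idem by (auto simp: ten_def vecs_def mult.assoc[symmetric])

lemma ten_cong: "(\<And>i. i \<in> D \<Longrightarrow> h i = k i) \<Longrightarrow> ten h = ten k"
  by (auto simp: ten_def fun_eq_iff intro!: arg_cong[of _ _ "\<lambda>x. e * x"] prod.cong)

lemma ten_star: "w.star (ten h) (ten k) = ten (\<lambda>i. g.star (h i) (k i))"
proof
  fix z
  show "w.star (ten h) (ten k) z = ten (\<lambda>i. g.star (h i) (k i)) z"
  proof (cases "z \<in> W")
    case True
    have "w.star (ten h) (ten k) z = (\<Sum>y\<in>W. e * (\<Prod>i\<in>D. h i (y i) * k i (inv\<^bsub>G\<^esub> (y i) \<otimes>\<^bsub>G\<^esub> z i)))"
      unfolding w_star using True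
    proof (simp, intro sum.cong refl)
      fix y assume y: "y \<in> W"
      have "(\<lambda>i\<in>D. inv\<^bsub>G\<^esub> (y i) \<otimes>\<^bsub>G\<^esub> z i) \<in> W" using y True by (auto simp: PiE_iff)
      then have "ten h y * ten k (\<lambda>i\<in>D. inv\<^bsub>G\<^esub> (y i) \<otimes>\<^bsub>G\<^esub> z i) =
          e * e * ((\<Prod>i\<in>D. h i (y i)) * (\<Prod>i\<in>D. k i (inv\<^bsub>G\<^esub> (y i) \<otimes>\<^bsub>G\<^esub> z i)))"
        using y by (simp add: ten_def ac_simps)
      then show "ten h y * ten k (\<lambda>i\<in>D. inv\<^bsub>G\<^esub> (y i) \<otimes>\<^bsub>G\<^esub> z i) =
          e * (\<Prod>i\<in>D. h i (y i) * k i (inv\<^bsub>G\<^esub> (y i) \<otimes>\<^bsub>G\<^esub> z i))"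
        by (simp add: idem prod.distrib)
    qed
    also have "\<dots> = e * (\<Prod>i\<in>D. \<Sum>a\<in>carrier G. h i a * k i (inv\<^bsub>G\<^esub> a \<otimes>\<^bsub>G\<^esub> z i))"
      unfolding W_eq by (simp add: sum_distrib_left[symmetric] prod_sum_PiE[OF fin_D fin_G])
    also have "\<dots> = ten (\<lambda>i. g.star (h i) (k i)) z"
      using True by (simp add: ten_def g.reg.lact_def g.reg.shift_def PiE_iff)
    finally show ?thesis .
  next
    case False
    then show ?thesis by (simp add: w_star ten_def)
  qed
qed

lemma ten_zero: "i \<in> D \<Longrightarrow> h i = (\<lambda>_. 0) \<Longrightarrow> ten h = (\<lambda>_. 0)"
proof -
  assume "i \<in> D" "h i = (\<lambda>_. 0)"
  then have z: "(\<Prod>i\<in>D. h i (x i)) = 0" for x :: "'i \<Rightarrow> 'g" using fin_D by (intro prod_zero bexI[of _ i]) auto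
  show "ten h = (\<lambda>_. 0)" unfolding ten_def by (rule ext) (simp add: z)
qed

lemma e_prod: "e * (\<Prod>i\<in>I. e * f i) = e * (\<Prod>i\<in>I. f i)"
proof (induction I rule: infinite_finite_induct)
  case (insert i I)
  have "e * (\<Prod>i\<in>insert i I. e * f i) = (e * f i) * (e * (\<Prod>i\<in>I. e * f i))"
    using insert.hyps by (simp add: ac_simps)
  also have "\<dots> = (e * e) * (f i * (\<Prod>i\<in>I. f i))" unfolding insert.IH by (simp only: ac_simps)
  finally show ?case using insert.hyps by (simp add: idem)
qed auto

lemma ten_delta: assumes "x \<in> W" shows "ten (\<lambda>i. g.reg.delta (x i)) = w.reg.delta x"
proof
  fix z
  show "ten (\<lambda>i. g.reg.delta (x i)) z = w.reg.delta x z"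
  proof (cases "z = x")
    case True
    have "(\<Prod>i\<in>D. g.reg.delta (x i) (z i)) = (\<Prod>i\<in>D. e * 1)" using True by (simp add: g.reg.delta_def)
    then show ?thesis using True assms e_prod[of "\<lambda>_. 1" D] by (simp add: ten_def w.reg.delta_def)
  next
    case False
    show ?thesis
    proof (cases "z \<in> W")
      case zW: True
      have "\<exists>i\<in>D. z i \<noteq> x i"
      proof (rule ccontr)
        assume n: "\<not> (\<exists>i\<in>D. z i \<noteq> x i)"
        have "z = x" by (rule PiE_ext[of _ D "\<lambda>_. carrier G"]) (use n zW assms in auto)
        then show False using False by simp
      qed
      then have "(\<Prod>i\<in>D. g.reg.delta (x i) (z i)) = 0"
        using fin_D by (intro prod_zero) (auto simp: g.reg.delta_def)
      then show ?thesis using False by (simp add: ten_def w.reg.delta_def)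
    qed (use False in \<open>simp add: ten_def w.reg.delta_def\<close>)
  qed
qed

lemma ten_unity: "ten (\<lambda>_. g.unity) = w.unity"
proof -
  have "ten (\<lambda>_. g.unity) = ten (\<lambda>i. g.reg.delta ((\<lambda>i\<in>D. \<one>\<^bsub>G\<^esub>) i))" by (rule ten_cong) simp
  then show ?thesis using ten_delta[of "\<lambda>i\<in>D. \<one>\<^bsub>G\<^esub>"] by simp
qed

lemma ten_sum: "finite \<Lambda> \<Longrightarrow> ten (\<lambda>_ z. \<Sum>j\<in>\<Lambda>. j z) = (\<lambda>x. \<Sum>w\<in>D \<rightarrow>\<^sub>E \<Lambda>. ten w x)"
  by (auto simp: ten_def fun_eq_iff prod_sum_PiE[OF fin_D] sum_distrib_left)

lemma ten_scale: "ten (\<lambda>i z. t i * h i z) = (\<lambda>x. (\<Prod>i\<in>D. t i) * ten h x)"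
  by (auto simp: ten_def fun_eq_iff prod.distrib mult.left_commute)

lemma ten_nonzero:
  assumes "\<And>i. i \<in> D \<Longrightarrow> h i \<in> g.H" "\<And>i. i \<in> D \<Longrightarrow> h i \<noteq> (\<lambda>_. 0)"
  shows "ten h \<noteq> (\<lambda>_. 0)"
proof -
  have "\<exists>a. h i a \<noteq> 0 \<and> a \<in> carrier G" if i: "i \<in> D" for i
  proof -
    obtain a where "h i a \<noteq> 0" using assms(2)[OF i] by auto
    then show ?thesis using vecsD(2)[OF assms(1)[OF i]] by blast
  qed
  then obtain x where x: "\<And>i. i \<in> D \<Longrightarrow> h i (x i) \<noteq> 0 \<and> x i \<in> carrier G" by metis
  have "e * (\<Prod>i\<in>D. h i (x i)) \<noteq> 0"
    using fin_D by (rule prod_nonzero) (use x vecsD(1)[OF assms(1)] in auto)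
  then have "ten h (restrict x D) \<noteq> 0" using x by (simp add: ten_def)
  then show ?thesis by auto
qed

text \<open>On pure tensors this moves the factor at position \<open>i\<close> to position
  \<open>\<sigma> i\<close>, see \<open>perm_ten\<close>.\<close>

definition perm :: "('i \<Rightarrow> 'i) \<Rightarrow> (('i \<Rightarrow> 'g) \<Rightarrow> 'a) \<Rightarrow> (('i \<Rightarrow> 'g) \<Rightarrow> 'a)" where
  "perm \<sigma> f = (\<lambda>x. if x \<in> W then f (\<lambda>i\<in>D. x (\<sigma> i)) else 0)"

lemma perm_comp:
  assumes "\<sigma> permutes D" "\<tau> permutes D"
  shows "perm (\<sigma> \<circ> \<tau>) f = perm \<sigma> (perm \<tau> f)"
proof -
  have "(\<lambda>i\<in>D. (\<lambda>i\<in>D. x (\<sigma> i)) (\<tau> i)) = (\<lambda>i\<in>D. x (\<sigma> (\<tau> i)))" for x :: "'i \<Rightarrow> 'g"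
    using permutes_in_image[OF assms(2)] by auto
  moreover have "(\<lambda>i\<in>D. x (\<sigma> i)) \<in> W" if "x \<in> W" for x
    using that permutes_in_image[OF assms(1)] by (auto simp: PiE_iff)
  ultimately show ?thesis unfolding perm_def by (intro ext) (auto simp del: W_iff)
qed

lemma perm_sum: "perm \<sigma> (\<lambda>x. \<Sum>i\<in>I. t i * f i x) = (\<lambda>x. \<Sum>i\<in>I. t i * perm \<sigma> (f i) x)"
  by (auto simp: perm_def)

lemma perm_ten:
  assumes "\<sigma> permutes D"
  shows "perm \<sigma> (ten h) = ten (\<lambda>i. h (iv \<sigma> i))"
proof
  fix x
  show "perm \<sigma> (ten h) x = ten (\<lambda>i. h (iv \<sigma> i)) x"
  proof (cases "x \<in> W")
    case True
    then have "(\<lambda>i\<in>D. x (\<sigma> i)) \<in> W" using permutes_in_image[OF assms] by (auto simp: PiE_iff)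
    moreover have "(\<Prod>i\<in>D. h i (x (\<sigma> i))) = (\<Prod>i\<in>D. h (iv \<sigma> (\<sigma> i)) (x (\<sigma> i)))"
      using assms by (simp add: permutes_inverses)
    moreover have "\<dots> = (\<Prod>i\<in>D. h (iv \<sigma> i) (x i))"
      by (rule prod.reindex_bij_betw[OF permutes_imp_bij[OF assms]])
    ultimately show ?thesis using True by (simp add: perm_def ten_def)
  qed (simp add: perm_def ten_def)
qed

lemma bij_perm_words:
  assumes "\<sigma> permutes D"
  shows "bij_betw (\<lambda>x. \<lambda>i\<in>D. x (\<sigma> i)) (D \<rightarrow>\<^sub>E A) (D \<rightarrow>\<^sub>E A)"
proof (rule bij_betw_byWitness[of _ "\<lambda>x. \<lambda>i\<in>D. x (iv \<sigma> i)"])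
  have im: "\<sigma> i \<in> D \<longleftrightarrow> i \<in> D" "iv \<sigma> i \<in> D \<longleftrightarrow> i \<in> D" for i
    using permutes_in_image[OF assms] permutes_in_image[OF iv_permutes(1)[OF assms]] by auto
  have r: "(\<lambda>i\<in>D. x i) = x" if "x \<in> D \<rightarrow>\<^sub>E A" for x using that by (simp add: PiE_restrict)
  show "\<forall>x\<in>D \<rightarrow>\<^sub>E A. (\<lambda>i\<in>D. (\<lambda>i\<in>D. x (\<sigma> i)) (iv \<sigma> i)) = x"
    "\<forall>x\<in>D \<rightarrow>\<^sub>E A. (\<lambda>i\<in>D. (\<lambda>i\<in>D. x (iv \<sigma> i)) (\<sigma> i)) = x"
    by (simp_all add: im permutes_inverses[OF assms] r cong: restrict_cong)
  show "(\<lambda>x. \<lambda>i\<in>D. x (\<sigma> i)) ` (D \<rightarrow>\<^sub>E A) \<subseteq> D \<rightarrow>\<^sub>E A"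
    "(\<lambda>x. \<lambda>i\<in>D. x (iv \<sigma> i)) ` (D \<rightarrow>\<^sub>E A) \<subseteq> D \<rightarrow>\<^sub>E A"
    by (auto simp: PiE_iff im)
qed

text \<open>Permuting positions is an automorphism of the group \<open>GD\<close>, hence of its
  group algebra.\<close>

lemma perm_star:
  assumes "\<sigma> permutes D"
  shows "perm \<sigma> (w.star a b) = w.star (perm \<sigma> a) (perm \<sigma> b)"
proof
  fix z
  show "perm \<sigma> (w.star a b) z = w.star (perm \<sigma> a) (perm \<sigma> b) z"
  proof (cases "z \<in> W")
    case True
    have im: "(\<lambda>i\<in>D. x (\<sigma> i)) \<in> W" if "x \<in> W" for x
      using that permutes_in_image[OF assms] by (auto simp: PiE_iff)
    have "perm \<sigma> (w.star a b) z = (\<Sum>y\<in>W. a y * b (\<lambda>i\<in>D. inv\<^bsub>G\<^esub> (y i) \<otimes>\<^bsub>G\<^esub> z (\<sigma> i)))"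
      using True im[OF True] by (simp add: perm_def w_star cong: restrict_cong)
    also have "\<dots> = (\<Sum>y\<in>W. a (\<lambda>i\<in>D. y (\<sigma> i)) * b (\<lambda>i\<in>D. inv\<^bsub>G\<^esub> ((\<lambda>i\<in>D. y (\<sigma> i)) i) \<otimes>\<^bsub>G\<^esub> z (\<sigma> i)))"
      unfolding W_eq by (rule sum.reindex_bij_betw[OF bij_perm_words[OF assms], symmetric])
    also have "\<dots> = (\<Sum>y\<in>W. perm \<sigma> a y * perm \<sigma> b (\<lambda>i\<in>D. inv\<^bsub>G\<^esub> (y i) \<otimes>\<^bsub>G\<^esub> z i))"
    proof (rule sum.cong[OF refl])
      fix y assume y: "y \<in> W"
      have "(\<lambda>i\<in>D. inv\<^bsub>G\<^esub> (y i) \<otimes>\<^bsub>G\<^esub> z i) \<in> W" using y True by (auto simp: PiE_iff)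
      then show "a (\<lambda>i\<in>D. y (\<sigma> i)) * b (\<lambda>i\<in>D. inv\<^bsub>G\<^esub> ((\<lambda>i\<in>D. y (\<sigma> i)) i) \<otimes>\<^bsub>G\<^esub> z (\<sigma> i)) =
          perm \<sigma> a y * perm \<sigma> b (\<lambda>i\<in>D. inv\<^bsub>G\<^esub> (y i) \<otimes>\<^bsub>G\<^esub> z i)"
        using y permutes_in_image[OF assms] by (simp add: perm_def cong: restrict_cong)
    qed
    also have "\<dots> = w.star (perm \<sigma> a) (perm \<sigma> b) z" using True by (simp add: w_star)
    finally show ?thesis .
  qed (simp add: perm_def w_star)
qed

end

section \<open>Young subgroups\<close>

definition young :: "'i set \<Rightarrow> ('i \<Rightarrow> 'b) \<Rightarrow> ('i \<Rightarrow> 'i) monoid" where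
  "young D s = \<lparr>carrier = {\<sigma>. \<sigma> permutes D \<and> (\<forall>i. s (\<sigma> i) = s i)}, monoid.mult = (\<circ>), one = id\<rparr>"

lemma young_simps [simp]:
  "\<sigma> \<in> carrier (young D s) \<longleftrightarrow> \<sigma> permutes D \<and> (\<forall>i. s (\<sigma> i) = s i)"
  "\<sigma> \<otimes>\<^bsub>young D s\<^esub> \<tau> = \<sigma> \<circ> \<tau>" "\<one>\<^bsub>young D s\<^esub> = id"
  by (simp_all add: young_def)

lemma young_iv_closed: "\<sigma> \<in> carrier (young D s) \<Longrightarrow> iv \<sigma> \<in> carrier (young D s)"
  by (auto simp: permutes_inv) (metis permutes_inverses(1))

lemma young_group: "group (young D s)"
proof (rule groupI)
  fix \<sigma> assume \<sigma>: "\<sigma> \<in> carrier (young D s)"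
  then show "\<exists>\<tau>\<in>carrier (young D s). \<tau> \<otimes>\<^bsub>young D s\<^esub> \<sigma> = \<one>\<^bsub>young D s\<^esub>"
    by (intro bexI[OF _ young_iv_closed[OF \<sigma>]]) (auto simp: permutes_inv_o)
qed (auto simp: permutes_compose permutes_id permutes_id[unfolded id_def])

lemma young_inv: "\<sigma> \<in> carrier (young D s) \<Longrightarrow> inv\<^bsub>young D s\<^esub> \<sigma> = iv \<sigma>"
  by (rule group.inv_equality[OF young_group]) (use young_iv_closed[of \<sigma> D s] in \<open>auto simp: permutes_inv_o\<close>)

section \<open>Construction of a symmetric element\<close>

context word_algebra
begin

text \<open>Tensors of matrix units reduce \<open>L\<close> to coefficient functions on words of
  idempotents whose isomorphism types \<open>s\<close> are prescribed position by position. There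
  the label-preserving permutations act as on a permutation module, and a coefficient function fixed
  by the stabilizer of a word \<open>w1\<close> exists. It is lifted to \<open>L\<close> and spread
  over the orbit of \<open>w1\<close>; multiplication by the tensor of the \<open>v (w1 i)\<close>
  isolates one summand and shows that the sum is not 0.\<close>

theorem symmetric_element:
  assumes n: "m * (of_nat (card (carrier G)) * e) = e" and L: "w.reg.stable L" and L0: "L \<noteq> {\<lambda>_. 0}"
    and Lperm: "\<And>\<sigma> f. \<sigma> permutes D \<Longrightarrow> f \<in> L \<Longrightarrow> perm \<sigma> f \<in> L"
  obtains F where "F \<in> L" "F \<noteq> (\<lambda>_. 0)" "\<And>\<sigma>. \<sigma> permutes D \<Longrightarrow> perm \<sigma> F = F"
proof -
  have sL: "subsp W L" by (rule w.reg.stableD(1)[OF L])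
  have Lstar: "w.star a f \<in> L" if "f \<in> L" for a f by (rule w.reg.lact_in[OF L that])
  obtain \<Lambda> r u v where fin: "finite \<Lambda>" and sum1: "(\<lambda>z. \<Sum>j\<in>\<Lambda>. j z) = g.unity"
    and mu: "\<And>j. j \<in> \<Lambda> \<Longrightarrow> j \<in> g.H \<and> j \<noteq> (\<lambda>_. 0) \<and> g.star j j = j \<and> r j \<in> \<Lambda> \<and> r (r j) = r j \<and> u j \<in> g.H \<and> v j \<in> g.H \<and>
       g.star (u j) (v j) = j \<and> g.star (v j) (u j) = r j \<and> g.star j (u j) = u j \<and> g.star (u j) (r j) = u j \<and>
       g.star (v j) j = v j \<and> g.star (r j) (v j) = v j"
    and orth: "\<And>j k. j \<in> \<Lambda> \<Longrightarrow> k \<in> \<Lambda> \<Longrightarrow> j \<noteq> k \<Longrightarrow> g.star j k = (\<lambda>_. 0)"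
    and corner: "\<And>h j k. h \<in> g.H \<Longrightarrow> j \<in> \<Lambda> \<Longrightarrow> k \<in> \<Lambda> \<Longrightarrow>
      \<exists>t. g.star (g.star (r k) h) j = (\<lambda>z. t * v j z) \<and> (r k \<noteq> r j \<longrightarrow> t = 0)"
    by (rule g.matrix_units[OF n]) (rule that)
  have vu: "g.star (v j) (u k) = (\<lambda>_. 0)" and vk: "g.star (v j) k = (\<lambda>_. 0)"
    if j: "j \<in> \<Lambda>" and k: "k \<in> \<Lambda>" and jk: "j \<noteq> k" for j k
  proof -
    have vj: "g.star (v j) j = v j" and uk: "g.star k (u k) = u k" using mu[OF j] mu[OF k] by auto
    have "g.star (v j) k = g.star (v j) (g.star j k)" by (simp only: g.star_assoc[symmetric] vj)
    then show *: "g.star (v j) k = (\<lambda>_. 0)" by (simp only: orth[OF j k jk] g.star_zero)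
    have "g.star (v j) (u k) = g.star (g.star (v j) k) (u k)" by (simp only: g.star_assoc uk)
    then show "g.star (v j) (u k) = (\<lambda>_. 0)" by (simp only: * g.star_zero)
  qed
  have unit: "w.unity = (\<lambda>x. \<Sum>w\<in>D \<rightarrow>\<^sub>E \<Lambda>. ten w x)"
    using ten_sum[OF fin] unfolding sum1 ten_unity .
  have inL: "w i \<in> \<Lambda>" if "w \<in> D \<rightarrow>\<^sub>E \<Lambda>" "i \<in> D" for w i using that by auto
  obtain f where f: "f \<in> L" "f \<noteq> (\<lambda>_. 0)" using w.reg.nonzero_element[OF sL L0] by blast
  have fH: "f \<in> w.H" by (rule subspD(1)[OF sL f(1)])
  \<comment> \<open>The unit is the sum of the pure tensors of idempotents, so one of them does not
    kill \<open>f\<close>.\<close>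
  have "\<exists>w\<in>D \<rightarrow>\<^sub>E \<Lambda>. w.star (ten w) f \<noteq> (\<lambda>_. 0)"
  proof (rule ccontr)
    assume "\<not> (\<exists>w\<in>D \<rightarrow>\<^sub>E \<Lambda>. w.star (ten w) f \<noteq> (\<lambda>_. 0))"
    then have "(\<lambda>x. \<Sum>w\<in>D \<rightarrow>\<^sub>E \<Lambda>. w.star (ten w) f x) = (\<lambda>_. 0)" by simp
    then have "w.star w.unity f = (\<lambda>_. 0)" unfolding unit w.star_sum_left .
    then show False using w.unity_star[OF fH] f(2) by simp
  qed
  then obtain w0 where w0: "w0 \<in> D \<rightarrow>\<^sub>E \<Lambda>" "w.star (ten w0) f \<noteq> (\<lambda>_. 0)" by blast
  \<comment> \<open>\<open>s\<close> records the isomorphism type of the idempotent in each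
    position. Passing from \<open>ten w0\<close> to \<open>ten s\<close> by the elements
    \<open>v\<close> loses nothing, since the elements \<open>u\<close> undo it.\<close>
  define s where "s i = r (w0 i)" for i
  define f1 where "f1 = w.star (ten (\<lambda>i. v (w0 i))) f"
  have f1L: "f1 \<in> L" unfolding f1_def by (rule Lstar[OF f(1)])
  have "w.star (ten (\<lambda>i. u (w0 i))) f1 = w.star (ten w0) f"
  proof -
    have "w.star (ten (\<lambda>i. u (w0 i))) f1 = w.star (w.star (ten (\<lambda>i. u (w0 i))) (ten (\<lambda>i. v (w0 i)))) f"
      by (simp only: f1_def w.star_assoc)
    also have "w.star (ten (\<lambda>i. u (w0 i))) (ten (\<lambda>i. v (w0 i))) = ten w0"
      unfolding ten_star by (rule ten_cong) (use mu inL[OF w0(1)] in auto)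
    finally show ?thesis .
  qed
  then have f10: "f1 \<noteq> (\<lambda>_. 0)" using w0(2) w.star_zero(1) by auto
  have sf1: "w.star (ten s) f1 = f1"
  proof -
    have "w.star (ten s) f1 = w.star (w.star (ten s) (ten (\<lambda>i. v (w0 i)))) f"
      by (simp only: f1_def w.star_assoc)
    also have "w.star (ten s) (ten (\<lambda>i. v (w0 i))) = ten (\<lambda>i. v (w0 i))"
      unfolding ten_star by (rule ten_cong) (use mu inL[OF w0(1)] in \<open>auto simp: s_def\<close>)
    finally show ?thesis by (simp only: f1_def)
  qed
  define Xs where "Xs = {w \<in> D \<rightarrow>\<^sub>E \<Lambda>. \<forall>i\<in>D. r (w i) = s i}"
  have finLW: "finite (D \<rightarrow>\<^sub>E \<Lambda>)" by (rule finite_PiE[OF fin_D]) (rule fin)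
  have finX: "finite Xs" using finLW by (simp add: Xs_def)
  define tv where "tv w = ten (\<lambda>i. v (w i))" for w
  have tvH: "tv w \<in> vecs W" for w unfolding tv_def by (rule ten_closed)
  \<comment> \<open>Split the unit on the right into the tensors \<open>ten w\<close> and apply
    \<open>corner\<close> in each position: what remains of \<open>h\<close> is a multiple of
    \<open>tv w\<close>, and it is 0 unless \<open>w\<close> has type \<open>s\<close>.\<close>
  have comb: "\<exists>k. (\<forall>w. e * k w = k w) \<and> h = (\<lambda>x. \<Sum>w\<in>Xs. k w * tv w x)"
    if hL: "h \<in> L" and hs: "w.star (ten s) h = h" for h
  proof -
    have hH: "h \<in> w.H" by (rule subspD(1)[OF sL hL])
    have hx: "h = (\<lambda>y. \<Sum>x\<in>W. h x * w.reg.delta x y)"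
    proof
      fix y
      have "(\<Sum>x\<in>W. h x * w.reg.delta x y) = (\<Sum>x\<in>W. if x = y then h x * e else 0)"
        by (intro sum.cong) (auto simp: w.reg.delta_def)
      also have "\<dots> = h y" using finW vecsD[OF hH, of y] by (simp add: mult.commute del: W_iff)
      finally show "h y = (\<Sum>x\<in>W. h x * w.reg.delta x y)" by simp
    qed
    have T: "\<exists>t. w.star (w.star (ten s) (w.reg.delta x)) (ten w) = (\<lambda>z. t * tv w z) \<and> (w \<notin> Xs \<longrightarrow> t = 0)"
      if x: "x \<in> W" and w: "w \<in> D \<rightarrow>\<^sub>E \<Lambda>" for x w
    proof -
      have "\<exists>t. g.star (g.star (s i) (g.reg.delta (x i))) (w i) = (\<lambda>z. t * v (w i) z) \<and> (s i \<noteq> r (w i) \<longrightarrow> t = 0)"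
        if "i \<in> D" for i unfolding s_def
        using that inL[OF w] inL[OF w0(1)] x by (intro corner g.reg.delta_vecs) auto
      then obtain t where t: "\<And>i. i \<in> D \<Longrightarrow>
          g.star (g.star (s i) (g.reg.delta (x i))) (w i) = (\<lambda>z. t i * v (w i) z) \<and> (s i \<noteq> r (w i) \<longrightarrow> t i = 0)"
        by metis
      have "w.star (w.star (ten s) (w.reg.delta x)) (ten w) = ten (\<lambda>i z. t i * v (w i) z)"
        unfolding ten_delta[OF x, symmetric] ten_star by (rule ten_cong) (use t in auto)
      also have "\<dots> = (\<lambda>z. (\<Prod>i\<in>D. t i) * tv w z)" unfolding tv_def by (rule ten_scale)
      finally have 1: "w.star (w.star (ten s) (w.reg.delta x)) (ten w) = (\<lambda>z. (\<Prod>i\<in>D. t i) * tv w z)" .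
      have "(\<Prod>i\<in>D. t i) = 0" if nX: "w \<notin> Xs"
      proof -
        obtain i where "i \<in> D" "r (w i) \<noteq> s i" using nX w by (auto simp: Xs_def)
        then have "i \<in> D" "t i = 0" using t[of i] by auto
        then show ?thesis using fin_D by (intro prod_zero bexI[of _ i])
      qed
      then show ?thesis using 1 by blast
    qed
    then obtain t where t: "\<And>x w. x \<in> W \<Longrightarrow> w \<in> D \<rightarrow>\<^sub>E \<Lambda> \<Longrightarrow>
        w.star (w.star (ten s) (w.reg.delta x)) (ten w) = (\<lambda>z. t x w * tv w z) \<and> (w \<notin> Xs \<longrightarrow> t x w = 0)"
      by metis
    have sh: "w.star (w.star (ten s) h) (ten w) = (\<lambda>z. (\<Sum>x\<in>W. h x * t x w) * tv w z)" if w: "w \<in> D \<rightarrow>\<^sub>E \<Lambda>" for w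
    proof -
      have "w.star (ten s) h = (\<lambda>z. \<Sum>x\<in>W. h x * w.star (ten s) (w.reg.delta x) z)"
        by (subst hx) (simp only: w.star_sum_right w.reg.lact_scale)
      then have "w.star (w.star (ten s) h) (ten w) =
          w.star (\<lambda>z. \<Sum>x\<in>W. h x * w.star (ten s) (w.reg.delta x) z) (ten w)" by (rule arg_cong)
      also have "\<dots> = (\<lambda>z. \<Sum>x\<in>W. h x * w.star (w.star (ten s) (w.reg.delta x)) (ten w) z)"
        by (simp only: w.star_sum_left w.reg.lact_coeff_scale)
      also have "\<dots> = (\<lambda>z. (\<Sum>x\<in>W. h x * t x w) * tv w z)"
        unfolding sum_distrib_right using t[OF _ w] by (intro ext sum.cong) (auto simp: mult.assoc simp del: W_iff)
      finally show ?thesis .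
    qed
    define k where "k w = (\<Sum>x\<in>W. h x * t x w)" for w
    have ek: "e * k w = k w" for w
      unfolding k_def sum_distrib_left using vecsD(1)[OF hH] by (simp add: mult.assoc[symmetric])
    have "h = w.star (w.star (ten s) h) w.unity" using hs w.star_unity[OF hH] by simp
    also have "\<dots> = (\<lambda>z. \<Sum>w\<in>D \<rightarrow>\<^sub>E \<Lambda>. w.star (w.star (ten s) h) (ten w) z)"
      unfolding unit by (rule w.star_sum_right)
    also have "\<dots> = (\<lambda>z. \<Sum>w\<in>D \<rightarrow>\<^sub>E \<Lambda>. k w * tv w z)"
      using sh by (intro ext sum.cong) (auto simp: k_def)
    also have "\<dots> = (\<lambda>z. \<Sum>w\<in>Xs. k w * tv w z)"
    proof
      fix z
      have "k w = 0" if "w \<in> (D \<rightarrow>\<^sub>E \<Lambda>) - Xs" for w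
        unfolding k_def using that t by (intro sum.neutral) (auto simp del: W_iff)
      then show "(\<Sum>w\<in>D \<rightarrow>\<^sub>E \<Lambda>. k w * tv w z) = (\<Sum>w\<in>Xs. k w * tv w z)"
        by (intro sum.mono_neutral_right[OF finLW]) (auto simp: Xs_def)
    qed
    finally show ?thesis using ek by blast
  qed
  \<comment> \<open>The coefficient functions of the elements of \<open>L\<close> that are
    combinations of the tensors \<open>tv w\<close>. By \<open>permcomb\<close> below, a
    label-preserving permutation acts on them through its action on the words in
    \<open>Xs\<close>.\<close>
  define C where "C = {k \<in> vecs Xs. (\<lambda>x. \<Sum>w\<in>Xs. k w * tv w x) \<in> L}"
  have C: "subsp Xs C" unfolding subsp_def
  proof (intro conjI ballI allI)
    show "C \<subseteq> vecs Xs" by (auto simp: C_def)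
    show "(\<lambda>_. 0) \<in> C" using subspD(2)[OF sL] subspD(2)[OF subsp_vecs] by (simp add: C_def)
    show "(\<lambda>w. k w + l w) \<in> C" if "k \<in> C" "l \<in> C" for k l
      using that subspD(3)[OF sL] subspD(3)[OF subsp_vecs, of k Xs l] by (simp add: C_def distrib_right sum.distrib)
    show "(\<lambda>w. t * k w) \<in> C" if "k \<in> C" for t k
      using that subspD(4)[OF sL, of "\<lambda>x. \<Sum>w\<in>Xs. k w * tv w x" t] subspD(4)[OF subsp_vecs, of k Xs t]
      by (simp add: C_def sum_distrib_left mult.assoc)
  qed
  have C0: "C \<noteq> {\<lambda>_. 0}"
  proof -
    obtain k where k: "\<And>w. e * k w = k w" "f1 = (\<lambda>x. \<Sum>w\<in>Xs. k w * tv w x)" using comb[OF f1L sf1] by blast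
    define k' where "k' w = (if w \<in> Xs then k w else 0)" for w
    have "f1 = (\<lambda>x. \<Sum>w\<in>Xs. k' w * tv w x)" unfolding k(2) by (intro ext sum.cong) (auto simp: k'_def)
    moreover have "k' \<in> vecs Xs" using k(1) by (auto simp: k'_def vecs_def)
    ultimately have "k' \<in> C" "k' \<noteq> (\<lambda>_. 0)" using f1L f10 by (auto simp: C_def)
    then show ?thesis by auto
  qed
  let ?Y = "young D (\<lambda>i. if i \<in> D then s i else undefined)"
  interpret YG: group ?Y by (rule young_group)
  have Ycar: "\<sigma> \<in> carrier ?Y \<longleftrightarrow> \<sigma> permutes D \<and> (\<forall>i\<in>D. s (\<sigma> i) = s i)" for \<sigma>
  proof (cases "\<sigma> permutes D")
    case True
    have "(\<forall>i. (if \<sigma> i \<in> D then s (\<sigma> i) else undefined) = (if i \<in> D then s i else undefined)) \<longleftrightarrow>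
        (\<forall>i\<in>D. s (\<sigma> i) = s i)"
      using permutes_in_image[OF True] permutes_not_in[OF True] by auto
    then show ?thesis using True by simp
  qed simp
  interpret Y: closed_action e ?Y "wperm D" Xs
  proof unfold_locales
    show "finite (carrier ?Y)"
      by (rule finite_subset[OF _ finite_permutations[OF fin_D]]) auto
    show "finite Xs" by (rule finX)
    show "wperm D \<one>\<^bsub>?Y\<^esub> x = x" if "x \<in> Xs" for x
      using that wperm_id[of x D \<Lambda>] by (simp add: Xs_def)
    show "wperm D (y \<otimes>\<^bsub>?Y\<^esub> z) x = wperm D y (wperm D z x)"
      if "y \<in> carrier ?Y" "z \<in> carrier ?Y" for x y z
      using that wperm_comp[of y D z] by simp
    show "wperm D y x \<in> Xs" if y: "y \<in> carrier ?Y" and x: "x \<in> Xs" for y x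
    proof -
      have yD: "y permutes D" using y by simp
      have iy: "iv y \<in> carrier ?Y" by (rule young_iv_closed[OF y])
      have "iv y i \<in> D \<and> s (iv y i) = s i" if "i \<in> D" for i
        using iy[unfolded Ycar] that permutes_in_image[of "iv y" D] by blast
      then show ?thesis using x wperm_closed[OF yD, of x \<Lambda>] by (auto simp: Xs_def wperm_def)
    qed
  qed
  have permtv: "perm \<sigma> (tv w) = tv (wperm D \<sigma> w)" if "\<sigma> permutes D" for \<sigma> w
    unfolding tv_def perm_ten[OF that] by (rule ten_cong) (simp add: wperm_def)
  have permcomb: "perm \<sigma> (\<lambda>x. \<Sum>w\<in>Xs. k w * tv w x) = (\<lambda>x. \<Sum>w\<in>Xs. Y.shift \<sigma> k w * tv w x)"
    if \<sigma>: "\<sigma> \<in> carrier ?Y" for \<sigma> k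
  proof
    fix x
    have \<sigma>D: "\<sigma> permutes D" using \<sigma> by simp
    have bij: "bij_betw (wperm D \<sigma>) Xs Xs"
    proof (rule bij_betw_byWitness[of _ "wperm D (inv\<^bsub>?Y\<^esub> \<sigma>)"])
      show "\<forall>a\<in>Xs. wperm D (inv\<^bsub>?Y\<^esub> \<sigma>) (wperm D \<sigma> a) = a" "\<forall>a\<in>Xs. wperm D \<sigma> (wperm D (inv\<^bsub>?Y\<^esub> \<sigma>) a) = a"
        using \<sigma> Y.act_mult[symmetric] Y.act_one by (simp_all del: young_simps)
      show "wperm D \<sigma> ` Xs \<subseteq> Xs" "wperm D (inv\<^bsub>?Y\<^esub> \<sigma>) ` Xs \<subseteq> Xs"
        using Y.act_closed[OF \<sigma>] Y.act_closed[OF YG.inv_closed[OF \<sigma>]] by auto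
    qed
    have "perm \<sigma> (\<lambda>x. \<Sum>w\<in>Xs. k w * tv w x) x = (\<Sum>w\<in>Xs. k w * tv (wperm D \<sigma> w) x)"
      by (simp only: perm_sum permtv[OF \<sigma>D])
    also have "\<dots> = (\<Sum>w\<in>Xs. Y.shift \<sigma> k (wperm D \<sigma> w) * tv (wperm D \<sigma> w) x)"
    proof (rule sum.cong[OF refl])
      fix w assume w: "w \<in> Xs"
      have "wperm D (inv\<^bsub>?Y\<^esub> \<sigma>) (wperm D \<sigma> w) = w"
        using \<sigma> w Y.act_mult[symmetric] Y.act_one by (simp del: young_simps)
      then have "Y.shift \<sigma> k (wperm D \<sigma> w) = k w" using Y.act_closed[OF \<sigma> w] by (simp add: Y.shift_def)
      then show "k w * tv (wperm D \<sigma> w) x = Y.shift \<sigma> k (wperm D \<sigma> w) * tv (wperm D \<sigma> w) x" by simp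
    qed
    also have "\<dots> = (\<Sum>w\<in>Xs. Y.shift \<sigma> k w * tv w x)" by (rule sum.reindex_bij_betw[OF bij])
    finally show "perm \<sigma> (\<lambda>x. \<Sum>w\<in>Xs. k w * tv w x) x = (\<Sum>w\<in>Xs. Y.shift \<sigma> k w * tv w x)" .
  qed
  have Cst: "Y.stable C" unfolding Y.stable_def
  proof (intro conjI ballI C)
    show "Y.shift \<sigma> k \<in> C" if \<sigma>: "\<sigma> \<in> carrier ?Y" and k: "k \<in> C" for \<sigma> k
      using Lperm[of \<sigma> "\<lambda>x. \<Sum>w\<in>Xs. k w * tv w x"] \<sigma> k Y.shift_vecs[of k \<sigma>] unfolding permcomb[OF \<sigma>] C_def by simp
  qed
  have amb: "\<exists>\<tau>\<in>carrier ?Y. \<tau> \<otimes>\<^bsub>?Y\<^esub> \<sigma> \<otimes>\<^bsub>?Y\<^esub> inv\<^bsub>?Y\<^esub> \<tau> = inv\<^bsub>?Y\<^esub> \<sigma>" if \<sigma>: "\<sigma> \<in> carrier ?Y" for \<sigma>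
  proof -
    let ?s = "\<lambda>i. if i \<in> D then s i else undefined"
    have \<sigma>D: "\<sigma> permutes D" and \<sigma>s: "\<And>i. ?s (\<sigma> i) = ?s i" using \<sigma> by simp_all
    obtain \<tau> where \<tau>: "\<tau> permutes D" "\<tau> \<circ> \<sigma> \<circ> iv \<tau> = iv \<sigma>" "\<And>i. \<exists>k. (\<sigma> ^^ k) (\<tau> i) = i"
      by (rule permutation_conjugate_to_inverse[OF fin_D \<sigma>D]) (rule that)
    \<comment> \<open>\<open>\<tau>\<close> keeps every position inside its cycle under
      \<open>\<sigma>\<close>, so it preserves the labels and the conjugation takes place within the
      Young subgroup.\<close>
    have "?s ((\<sigma> ^^ k) i) = ?s i" for k i by (induction k) (simp_all only: funpow.simps comp_apply id_apply \<sigma>s)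
    then have \<tau>s: "?s (\<tau> i) = ?s i" for i using \<tau>(3)[of i] by metis
    have \<tau>Y: "\<tau> \<in> carrier ?Y" unfolding young_simps using \<tau>(1) \<tau>s by blast
    then show ?thesis using \<tau>(2) young_inv[OF \<sigma>] young_inv[OF \<tau>Y]
      by (intro bexI[of _ \<tau>]) (simp_all only: young_simps(2))
  qed
  obtain w1 k where w1: "w1 \<in> Xs" and k: "k \<in> C" "k \<noteq> (\<lambda>_. 0)"
    and kfix: "\<And>\<sigma>. \<sigma> \<in> carrier ?Y \<Longrightarrow> wperm D \<sigma> w1 = w1 \<Longrightarrow> Y.shift \<sigma> k = k"
    by (rule Y.fixed_by_stabilizer[OF Cst C0 amb]) (assumption, rule that)
  have w1L: "w1 \<in> D \<rightarrow>\<^sub>E \<Lambda>" and w1s: "\<And>i. i \<in> D \<Longrightarrow> r (w1 i) = s i" using w1 by (auto simp: Xs_def)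
  have kv: "k \<in> vecs Xs" using k(1) by (simp add: C_def)
  define f2 where "f2 = (\<lambda>x. \<Sum>w\<in>Xs. k w * tv w x)"
  have f2L: "f2 \<in> L" using k(1) by (simp add: C_def f2_def)
  have f20: "f2 \<noteq> (\<lambda>_. 0)"
  proof
    assume z: "f2 = (\<lambda>_. 0)"
    obtain w' where w': "k w' \<noteq> 0" using k(2) by auto
    have w'X: "w' \<in> Xs" using w' vecsD(2)[OF kv] by blast
    have w'L: "w' \<in> D \<rightarrow>\<^sub>E \<Lambda>" using w'X by (simp add: Xs_def)
    \<comment> \<open>Right multiplication by \<open>ten w'\<close> extracts the summand at
      \<open>w'\<close>; so the tensors \<open>tv w\<close> are linearly independent.\<close>
    have tvw: "w.star (tv w) (ten w') = (if w = w' then tv w' else (\<lambda>_. 0))" if w: "w \<in> Xs" for w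
    proof (cases "w = w'")
      case True
      have "w.star (tv w') (ten w') = tv w'" unfolding tv_def ten_star
        by (rule ten_cong) (use mu inL[OF w'L] in auto)
      then show ?thesis using True by simp
    next
      case False
      have wL: "w \<in> D \<rightarrow>\<^sub>E \<Lambda>" using w by (simp add: Xs_def)
      have "\<exists>i\<in>D. w i \<noteq> w' i"
      proof (rule ccontr)
        assume n: "\<not> (\<exists>i\<in>D. w i \<noteq> w' i)"
        have "w = w'" by (rule PiE_ext[OF wL w'L]) (use n in auto)
        then show False using False by simp
      qed
      then obtain i where i: "i \<in> D" "w i \<noteq> w' i" by blast
      have "w.star (tv w) (ten w') = (\<lambda>_. 0)" unfolding tv_def ten_star
        by (rule ten_zero[OF i(1)]) (rule vk[OF inL[OF wL i(1)] inL[OF w'L i(1)] i(2)])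
      then show ?thesis using False by simp
    qed
    have "(\<lambda>_. 0) = w.star f2 (ten w')" using z w.star_zero(2) by simp
    also have "\<dots> = (\<lambda>x. \<Sum>w\<in>Xs. k w * w.star (tv w) (ten w') x)"
      unfolding f2_def by (simp only: w.star_sum_left w.reg.lact_coeff_scale)
    also have "\<dots> = (\<lambda>x. \<Sum>w\<in>Xs. if w = w' then k w' * tv w' x else 0)"
      using tvw by (intro ext sum.cong) auto
    also have "\<dots> = (\<lambda>x. k w' * tv w' x)" using finX w'X by simp
    finally have zero: "k w' * tv w' x = 0" for x by (rule fun_cong[THEN sym])
    have "tv w' \<noteq> (\<lambda>_. 0)"
    proof
      assume tz: "tv w' = (\<lambda>_. 0)"
      have "w.star (ten (\<lambda>i. u (w' i))) (tv w') = ten w'" unfolding tv_def ten_star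
        by (rule ten_cong) (use mu inL[OF w'L] in auto)
      moreover have "ten w' \<noteq> (\<lambda>_. 0)" by (rule ten_nonzero) (use mu inL[OF w'L] in auto)
      ultimately show False using tz w.star_zero(1) by simp
    qed
    then obtain x where x: "tv w' x \<noteq> 0" by auto
    show False using mult_nonzero[OF vecsD(1)[OF kv] vecsD(1)[OF tvH] w' x] zero by simp
  qed
  \<comment> \<open>A permutation that fixes \<open>w1\<close> preserves the types \<open>s\<close>
    of its letters. So it belongs to the Young subgroup, and the choice of \<open>k\<close>
    applies.\<close>
  have stab: "perm \<sigma> f2 = f2" if \<sigma>: "\<sigma> permutes D" and fx: "wperm D \<sigma> w1 = w1" for \<sigma>
  proof -
    have "w1 (\<sigma> i) = w1 i" if i: "i \<in> D" for i
    proof -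
      have "\<sigma> i \<in> D" using permutes_in_image[OF \<sigma>] i by simp
      then have "wperm D \<sigma> w1 (\<sigma> i) = w1 i" by (simp add: wperm_def permutes_inverses[OF \<sigma>])
      then show ?thesis using fx by simp
    qed
    then have "s (\<sigma> i) = s i" if i: "i \<in> D" for i
      using w1s[OF i] w1s[of "\<sigma> i"] permutes_in_image[OF \<sigma>] i by simp
    then have "\<sigma> \<in> carrier ?Y" using \<sigma> Ycar by blast
    then show ?thesis unfolding f2_def permcomb[OF \<open>\<sigma> \<in> carrier ?Y\<close>] using kfix fx by simp
  qed
  define tu where "tu w = ten (\<lambda>i. u (w i))" for w
  have permtu: "perm \<sigma> (tu w) = tu (wperm D \<sigma> w)" if "\<sigma> permutes D" for \<sigma> w
    unfolding tu_def perm_ten[OF that] by (rule ten_cong) (simp add: wperm_def)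
  \<comment> \<open>Multiplying by the tensor of the \<open>u (w1 i)\<close> ties the vector to the
    word \<open>w1\<close>: the image of \<open>g0\<close> under a permutation
    \<open>\<sigma>\<close> depends only on \<open>wperm D \<sigma> w1\<close>.\<close>
  define g0 where "g0 = w.star (tu w1) f2"
  have g0L: "g0 \<in> L" unfolding g0_def by (rule Lstar[OF f2L])
  have g0eq: "perm \<sigma> g0 = perm \<tau> g0" if \<sigma>: "\<sigma> permutes D" and \<tau>: "\<tau> permutes D" and eq: "wperm D \<sigma> w1 = wperm D \<tau> w1" for \<sigma> \<tau>
  proof -
    have i\<tau>: "iv \<tau> permutes D" by (rule iv_permutes(1)[OF \<tau>])
    let ?q = "iv \<tau> \<circ> \<sigma>"
    have q: "?q permutes D" by (rule permutes_compose[OF \<sigma> i\<tau>])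
    have "wperm D ?q w1 = wperm D (iv \<tau> \<circ> \<tau>) w1" by (simp only: wperm_comp[OF i\<tau> \<sigma>] wperm_comp[OF i\<tau> \<tau>] eq)
    then have qw: "wperm D ?q w1 = w1" using wperm_id[OF w1L] permutes_inv_o[OF \<tau>] by simp
    have "perm ?q g0 = g0" unfolding g0_def perm_star[OF q] permtu[OF q] qw stab[OF q qw] ..
    then have "perm \<tau> (perm ?q g0) = perm \<tau> g0" by simp
    moreover have "perm \<tau> (perm ?q g0) = perm \<sigma> g0"
    proof -
      have "\<tau> \<circ> ?q = \<sigma>" using permutes_inv_o(1)[OF \<tau>] by (simp add: comp_assoc[symmetric])
      then show ?thesis using perm_comp[OF \<tau> q, of g0] by simp
    qed
    ultimately show ?thesis by simp
  qed
  define Orb where "Orb = (\<lambda>\<sigma>. wperm D \<sigma> w1) ` {\<sigma>. \<sigma> permutes D}"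
  have finO: "finite Orb" unfolding Orb_def by (rule finite_imageI[OF finite_permutations[OF fin_D]])
  have "\<exists>\<sigma>. \<sigma> permutes D \<and> wperm D \<sigma> w1 = w" if "w \<in> Orb" for w using that by (auto simp: Orb_def)
  then obtain p where p: "\<And>w. w \<in> Orb \<Longrightarrow> p w permutes D" "\<And>w. w \<in> Orb \<Longrightarrow> wperm D (p w) w1 = w" by metis
  \<comment> \<open>There is one summand for each point of the orbit. A sum over all permutations
    would count each of them as often as the stabilizer has elements, a number that may be 0 in the
    field.\<close>
  define F where "F = (\<lambda>x. \<Sum>w\<in>Orb. perm (p w) g0 x)"
  have FL: "F \<in> L" unfolding F_def by (rule subsp_sum[OF sL]) (rule Lperm[OF p(1) g0L])
  have OrbL: "w \<in> D \<rightarrow>\<^sub>E \<Lambda>" if "w \<in> Orb" for w using that wperm_closed[OF _ w1L] by (auto simp: Orb_def)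
  have Fsym: "perm \<pi> F = F" if \<pi>: "\<pi> permutes D" for \<pi>
  proof
    fix x
    have mem: "wperm D \<rho> w \<in> Orb" if \<rho>: "\<rho> permutes D" and w: "w \<in> Orb" for \<rho> w
    proof -
      have "wperm D (\<rho> \<circ> p w) w1 = wperm D \<rho> w" by (simp only: wperm_comp[OF \<rho> p(1)[OF w]] p(2)[OF w])
      then show ?thesis using permutes_compose[OF p(1)[OF w] \<rho>] unfolding Orb_def by (metis imageI mem_Collect_eq)
    qed
    have i\<pi>: "iv \<pi> permutes D" by (rule iv_permutes(1)[OF \<pi>])
    have c: "wperm D (iv \<pi>) (wperm D \<pi> w) = w" "wperm D \<pi> (wperm D (iv \<pi>) w) = w" if "w \<in> Orb" for w
      using wperm_comp[OF i\<pi> \<pi>, of w] wperm_comp[OF \<pi> i\<pi>, of w] wperm_id[OF OrbL[OF that]] permutes_inv_o[OF \<pi>] by simp_all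
    have bij: "bij_betw (wperm D \<pi>) Orb Orb"
      by (rule bij_betw_byWitness[of _ "wperm D (iv \<pi>)"]) (auto simp: c mem[OF \<pi>] mem[OF i\<pi>])
    have "perm \<pi> F x = (\<Sum>w\<in>Orb. perm \<pi> (perm (p w) g0) x)"
      by (simp add: F_def perm_def)
    also have "\<dots> = (\<Sum>w\<in>Orb. perm (p (wperm D \<pi> w)) g0 x)"
    proof (rule sum.cong[OF refl])
      fix w assume w: "w \<in> Orb"
      have "perm \<pi> (perm (p w) g0) = perm (\<pi> \<circ> p w) g0" by (rule perm_comp[OF \<pi> p(1)[OF w], symmetric])
      also have "\<dots> = perm (p (wperm D \<pi> w)) g0"
        by (rule g0eq[OF permutes_compose[OF p(1)[OF w] \<pi>] p(1)[OF mem[OF \<pi> w]]])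
          (simp only: wperm_comp[OF \<pi> p(1)[OF w]] p(2)[OF w] p(2)[OF mem[OF \<pi> w]])
      finally show "perm \<pi> (perm (p w) g0) x = perm (p (wperm D \<pi> w)) g0 x" by simp
    qed
    also have "\<dots> = F x" unfolding F_def by (rule sum.reindex_bij_betw[OF bij])
    finally show "perm \<pi> F x = F x" .
  qed
  have w1O: "w1 \<in> Orb" unfolding Orb_def using wperm_id[OF w1L] permutes_id
    by (intro image_eqI[of _ _ id]) auto
  have sf2: "w.star (ten s) f2 = f2"
  proof -
    have "w.star (ten s) (tv w) = tv w" if w: "w \<in> Xs" for w
      unfolding tv_def ten_star
    proof (rule ten_cong)
      fix i assume i: "i \<in> D"
      have "w i \<in> \<Lambda>" "s i = r (w i)" using w i by (auto simp: Xs_def)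
      then show "g.star (s i) (v (w i)) = v (w i)" using mu[of "w i"] by simp
    qed
    then show ?thesis unfolding f2_def by (simp add: w.star_sum_right w.reg.lact_scale)
  qed
  \<comment> \<open>As \<open>v j \<star> u k\<close> is 0 for distinct idempotents, all summands
    except that of \<open>w1\<close> are killed, and that one returns \<open>f2\<close>.\<close>
  have key: "w.star (tv w1) (perm (p w) g0) = (if w = w1 then f2 else (\<lambda>_. 0))" if w: "w \<in> Orb" for w
  proof -
    have "w.star (tv w1) (perm (p w) g0) = w.star (w.star (tv w1) (tu w)) (perm (p w) f2)"
      unfolding g0_def perm_star[OF p(1)[OF w]] permtu[OF p(1)[OF w]] p(2)[OF w] by (simp only: w.star_assoc)
    also have "\<dots> = (if w = w1 then f2 else (\<lambda>_. 0))"
    proof (cases "w = w1")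
      case True
      have "w.star (tv w1) (tu w1) = ten s" unfolding tv_def tu_def ten_star
        by (rule ten_cong) (use mu inL[OF w1L] w1s in auto)
      moreover have "perm (p w1) f2 = f2" by (rule stab[OF p[OF w1O]])
      ultimately show ?thesis using True sf2 by simp
    next
      case False
      have "\<exists>i\<in>D. w1 i \<noteq> w i"
      proof (rule ccontr)
        assume n: "\<not> (\<exists>i\<in>D. w1 i \<noteq> w i)"
        have "w = w1" by (rule PiE_ext[OF OrbL[OF w] w1L]) (use n in auto)
        then show False using False by simp
      qed
      then obtain i where i: "i \<in> D" "w1 i \<noteq> w i" by blast
      have "w.star (tv w1) (tu w) = (\<lambda>_. 0)" unfolding tv_def tu_def ten_star
        by (rule ten_zero[OF i(1)]) (rule vu[OF inL[OF w1L i(1)] inL[OF OrbL[OF w] i(1)] i(2)])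
      then show ?thesis using False by (simp add: w.star_zero)
    qed
    finally show ?thesis .
  qed
  have "w.star (tv w1) F = (\<lambda>x. \<Sum>w\<in>Orb. w.star (tv w1) (perm (p w) g0) x)"
    unfolding F_def by (rule w.star_sum_right)
  also have "\<dots> = (\<lambda>x. \<Sum>w\<in>Orb. if w = w1 then f2 x else 0)" using key by (intro ext sum.cong) auto
  also have "\<dots> = f2" using finO w1O by simp
  finally have "F \<noteq> (\<lambda>_. 0)" using f20 w.star_zero(1) by auto
  then show thesis using that FL Fsym by blast
qed

end

section \<open>Fields as ideals of one commutative ring\<close>

text \<open>
  The product of all commutative rings carried by the type \<open>'f\<close>, and of \<open>\<int>\<close> (so that \<open>0 \<noteq> 1\<close>).
  Every field on \<open>'f\<close> is an ideal of it, generated by an idempotent; this makes the type class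
  reasoning of \<open>comm_ring_1\<close> available for fields whose carrier is not a whole type.
\<close>

typedef 'f fam = "{p :: ('f ring \<Rightarrow> 'f) \<times> int.
  \<forall>R. (cring R \<longrightarrow> fst p R \<in> carrier R) \<and> (\<not> cring R \<longrightarrow> fst p R = undefined)}"
proof
  show "(\<lambda>R. if cring R then \<zero>\<^bsub>R\<^esub> else undefined, 0) \<in> {p :: ('f ring \<Rightarrow> 'f) \<times> int.
    \<forall>R. (cring R \<longrightarrow> fst p R \<in> carrier R) \<and> (\<not> cring R \<longrightarrow> fst p R = undefined)}"
    by (auto simp: cring_def ring.ring_simprules)
qed

definition comp :: "'f ring \<Rightarrow> 'f fam \<Rightarrow> 'f" where "comp R a = fst (Rep_fam a) R"

definition ipart :: "'f fam \<Rightarrow> int" where "ipart a = snd (Rep_fam a)"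

definition mk_fam :: "('f ring \<Rightarrow> 'f) \<Rightarrow> int \<Rightarrow> 'f fam" where
  "mk_fam h n = Abs_fam (\<lambda>R. if cring R then h R else undefined, n)"

lemma comp_closed: "cring R \<Longrightarrow> comp R a \<in> carrier R"
  using Rep_fam[of a] by (simp add: comp_def)

lemma fam_eqI: "(\<And>R. cring R \<Longrightarrow> comp R a = comp R b) \<Longrightarrow> ipart a = ipart b \<Longrightarrow> a = b"
proof (intro Rep_fam_inject[THEN iffD1] prod_eqI ext)
  fix R
  assume "\<And>R. cring R \<Longrightarrow> comp R a = comp R b"
  then show "fst (Rep_fam a) R = fst (Rep_fam b) R"
    using Rep_fam[of a] Rep_fam[of b] by (cases "cring R") (auto simp: comp_def)
qed (simp add: ipart_def)

lemma mk_fam: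
  assumes "\<And>R. cring R \<Longrightarrow> h R \<in> carrier R"
  shows "cring R \<Longrightarrow> comp R (mk_fam h n) = h R" "ipart (mk_fam h n) = n"
  using assms by (simp_all add: comp_def ipart_def mk_fam_def Abs_fam_inverse)

instantiation fam :: (type) comm_ring_1
begin

definition zero_fam :: "'a fam" where "zero_fam = mk_fam (\<lambda>R. \<zero>\<^bsub>R\<^esub>) 0"
definition one_fam :: "'a fam" where "one_fam = mk_fam (\<lambda>R. \<one>\<^bsub>R\<^esub>) 1"
definition plus_fam :: "'a fam \<Rightarrow> 'a fam \<Rightarrow> 'a fam" where
  "plus_fam a b = mk_fam (\<lambda>R. comp R a \<oplus>\<^bsub>R\<^esub> comp R b) (ipart a + ipart b)"
definition times_fam :: "'a fam \<Rightarrow> 'a fam \<Rightarrow> 'a fam" where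
  "times_fam a b = mk_fam (\<lambda>R. comp R a \<otimes>\<^bsub>R\<^esub> comp R b) (ipart a * ipart b)"
definition uminus_fam :: "'a fam \<Rightarrow> 'a fam" where
  "uminus_fam a = mk_fam (\<lambda>R. \<ominus>\<^bsub>R\<^esub> comp R a) (- ipart a)"
definition minus_fam :: "'a fam \<Rightarrow> 'a fam \<Rightarrow> 'a fam" where
  "minus_fam a b = mk_fam (\<lambda>R. comp R a \<ominus>\<^bsub>R\<^esub> comp R b) (ipart a - ipart b)"

lemma comp_simps:
  assumes "cring R"
  shows "comp R 0 = \<zero>\<^bsub>R\<^esub>" "comp R 1 = \<one>\<^bsub>R\<^esub>" "comp R (a + b) = comp R a \<oplus>\<^bsub>R\<^esub> comp R b"
    "comp R (a * b) = comp R a \<otimes>\<^bsub>R\<^esub> comp R b" "comp R (- a) = \<ominus>\<^bsub>R\<^esub> comp R a"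
    "comp R (a - b) = comp R a \<ominus>\<^bsub>R\<^esub> comp R b"
proof -
  have c: "comp R a \<oplus>\<^bsub>R\<^esub> comp R b \<in> carrier R" "comp R a \<otimes>\<^bsub>R\<^esub> comp R b \<in> carrier R"
    "\<ominus>\<^bsub>R\<^esub> comp R a \<in> carrier R" "comp R a \<ominus>\<^bsub>R\<^esub> comp R b \<in> carrier R" "\<zero>\<^bsub>R\<^esub> \<in> carrier R" "\<one>\<^bsub>R\<^esub> \<in> carrier R"
    if R: "cring R" for R
  proof -
    interpret R: cring R by (rule R)
    show "comp R a \<oplus>\<^bsub>R\<^esub> comp R b \<in> carrier R" "comp R a \<otimes>\<^bsub>R\<^esub> comp R b \<in> carrier R"
      "\<ominus>\<^bsub>R\<^esub> comp R a \<in> carrier R" "comp R a \<ominus>\<^bsub>R\<^esub> comp R b \<in> carrier R" "\<zero>\<^bsub>R\<^esub> \<in> carrier R" "\<one>\<^bsub>R\<^esub> \<in> carrier R"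
      using comp_closed[OF R] by auto
  qed
  show "comp R 0 = \<zero>\<^bsub>R\<^esub>" unfolding zero_fam_def by (rule mk_fam(1)[OF c(5) assms])
  show "comp R 1 = \<one>\<^bsub>R\<^esub>" unfolding one_fam_def by (rule mk_fam(1)[OF c(6) assms])
  show "comp R (a + b) = comp R a \<oplus>\<^bsub>R\<^esub> comp R b" unfolding plus_fam_def by (rule mk_fam(1)[OF c(1) assms])
  show "comp R (a * b) = comp R a \<otimes>\<^bsub>R\<^esub> comp R b" unfolding times_fam_def by (rule mk_fam(1)[OF c(2) assms])
  show "comp R (- a) = \<ominus>\<^bsub>R\<^esub> comp R a" unfolding uminus_fam_def by (rule mk_fam(1)[OF c(3) assms])
  show "comp R (a - b) = comp R a \<ominus>\<^bsub>R\<^esub> comp R b" unfolding minus_fam_def by (rule mk_fam(1)[OF c(4) assms])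
qed

lemma ipart_simps:
  "ipart (0 :: 'a fam) = 0" "ipart (1 :: 'a fam) = 1" "ipart (a + b) = ipart a + ipart b"
  "ipart (a * b) = ipart a * ipart b" "ipart (- a) = - ipart a" "ipart (a - b) = ipart a - ipart b"
  for a b :: "'a fam"
  by (simp_all add: zero_fam_def one_fam_def plus_fam_def times_fam_def uminus_fam_def minus_fam_def
      ipart_def mk_fam_def Abs_fam_inverse comp_closed cring.cring_simprules)

instance
proof
  fix a b c :: "'a fam"
  have cl: "comp R x \<in> carrier R" if "cring R" for R and x :: "'a fam" using that by (rule comp_closed)
  note s = comp_simps ipart_simps cl cring.cring_simprules
  show "a * b * c = a * (b * c)" by (rule fam_eqI) (simp_all add: s)
  show "a * b = b * a" by (rule fam_eqI) (simp_all add: s)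
  show "1 * a = a" by (rule fam_eqI) (simp_all add: s)
  show "a + b + c = a + (b + c)" by (rule fam_eqI) (simp_all add: s)
  show "a + b = b + a" by (rule fam_eqI) (simp_all add: s)
  show "0 + a = a" by (rule fam_eqI) (simp_all add: s)
  show "- a + a = 0" by (rule fam_eqI) (simp_all add: s)
  show "a - b = a + - b" by (rule fam_eqI) (simp_all add: s)
  show "(a + b) * c = a * c + b * c" by (rule fam_eqI) (simp_all add: s distrib_right)
  have "ipart (0 :: 'a fam) \<noteq> ipart (1 :: 'a fam)" by (simp add: ipart_simps)
  then show "(0 :: 'a fam) \<noteq> 1" by metis
qed

end

section \<open>Fields as ideals of the product ring\<close>

definition emb :: "'f ring \<Rightarrow> 'f \<Rightarrow> 'f fam" where
  "emb R x = mk_fam (\<lambda>S. if S = R then x else \<zero>\<^bsub>S\<^esub>) 0"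

lemma emb_comp: "cring T \<Longrightarrow> cring R \<Longrightarrow> x \<in> carrier R \<Longrightarrow> comp T (emb R x) = (if T = R then x else \<zero>\<^bsub>T\<^esub>)"
  unfolding emb_def by (intro mk_fam(1)) (auto simp: cring_def ring.ring_simprules)

lemma emb_ipart: "cring R \<Longrightarrow> x \<in> carrier R \<Longrightarrow> ipart (emb R x) = 0"
  unfolding emb_def by (intro mk_fam(2)) (auto simp: cring_def ring.ring_simprules)

lemma emb_inject: "cring R \<Longrightarrow> x \<in> carrier R \<Longrightarrow> y \<in> carrier R \<Longrightarrow> emb R x = emb R y \<longleftrightarrow> x = y"
  by (metis emb_comp)

lemma emb_zero: "cring R \<Longrightarrow> emb R \<zero>\<^bsub>R\<^esub> = 0"
  by (rule fam_eqI) (simp_all add: emb_comp emb_ipart comp_simps ipart_simps cring.cring_simprules)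

lemma emb_add: "cring R \<Longrightarrow> x \<in> carrier R \<Longrightarrow> y \<in> carrier R \<Longrightarrow> emb R (x \<oplus>\<^bsub>R\<^esub> y) = emb R x + emb R y"
  by (rule fam_eqI) (simp_all add: emb_comp emb_ipart comp_simps ipart_simps cring.cring_simprules)

lemma emb_mult: "cring R \<Longrightarrow> x \<in> carrier R \<Longrightarrow> y \<in> carrier R \<Longrightarrow> emb R (x \<otimes>\<^bsub>R\<^esub> y) = emb R x * emb R y"
  by (rule fam_eqI) (simp_all add: emb_comp emb_ipart comp_simps ipart_simps cring.cring_simprules)

abbreviation idm :: "'f ring \<Rightarrow> 'f fam" where "idm R \<equiv> emb R \<one>\<^bsub>R\<^esub>"

text \<open>Multiplication by \<open>idm R\<close> is the projection to the component at
  \<open>R\<close>; through it, fixed points of this multiplication correspond to elements of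
  \<open>R\<close>.\<close>

lemma idm_mult: "cring R \<Longrightarrow> idm R * a = emb R (comp R a)"
  by (rule fam_eqI)
    (simp_all add: emb_comp emb_ipart comp_simps ipart_simps comp_closed cring.cring_simprules)

lemma idm_emb: "cring R \<Longrightarrow> x \<in> carrier R \<Longrightarrow> idm R * emb R x = emb R x"
  by (simp add: idm_mult emb_comp)

lemma idem_field_idm:
  assumes "field R" shows "idem_field (idm R)"
proof -
  interpret R: field R by (rule assms)
  have R: "cring R" by unfold_locales
  show ?thesis
  proof
    show "idm R * idm R = idm R" by (simp add: idm_emb[OF R])
    show "idm R \<noteq> 0" using emb_inject[OF R R.one_closed R.zero_closed] emb_zero[OF R] by simp
    fix x :: "'a fam" assume x: "idm R * x = x" "x \<noteq> 0"
    let ?c = "comp R x"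
    have xe: "x = emb R ?c" using x(1) idm_mult[OF R] by simp
    have c: "?c \<in> carrier R" by (rule comp_closed[OF R])
    have "?c \<noteq> \<zero>\<^bsub>R\<^esub>" using xe x(2) emb_zero[OF R] by auto
    then have u: "?c \<in> Units R" using c R.field_Units by simp
    let ?y = "emb R (inv\<^bsub>R\<^esub> ?c)"
    have iy: "inv\<^bsub>R\<^esub> ?c \<in> carrier R" using u by simp
    have "x * ?y = emb R (?c \<otimes>\<^bsub>R\<^esub> inv\<^bsub>R\<^esub> ?c)" by (subst xe) (simp add: emb_mult[OF R c iy])
    then have "x * ?y = idm R" using u by simp
    then show "\<exists>y. idm R * y = y \<and> x * y = idm R" using idm_emb[OF R iy] by blast
  qed
qed

lemma emb_pow: "cring R \<Longrightarrow> x \<in> carrier R \<Longrightarrow> idm R * emb R x ^ k = emb R (x [^]\<^bsub>R\<^esub> k)"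
proof (induction k)
  case (Suc k)
  then interpret R: cring R by simp
  have "idm R * emb R x ^ Suc k = (idm R * emb R x ^ k) * emb R x" by (simp add: ac_simps)
  then show ?case using Suc by (simp add: emb_mult)
qed simp

text \<open>The coefficients of the monic polynomial are projected to \<open>R\<close>, and a root
  there is embedded back.\<close>

lemma idem_alg_closed_field_idm:
  assumes "algebraically_closed R" shows "idem_alg_closed_field (idm R)"
proof -
  interpret R: algebraically_closed R by (rule assms)
  have R: "cring R" by unfold_locales
  interpret I: idem_field "idm R" by (rule idem_field_idm) unfold_locales
  show ?thesis
  proof
    fix m :: nat and a :: "nat \<Rightarrow> 'a fam" assume m: "0 < m"
    \<comment> \<open>Polynomials over \<open>R\<close> are lists of coefficients with the leading
      one first, hence the reversal.\<close>
    define q where "q n = rev (map (\<lambda>k. comp R (a k)) [0..<n])" for n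
    have qc: "set (q n) \<subseteq> carrier R" for n using comp_closed[OF R] by (auto simp: q_def)
    have ev: "emb R (R.eval (q n) t) = idm R * (\<Sum>k<n. a k * emb R t ^ k)" if t: "t \<in> carrier R" for n t
    proof (induction n)
      case 0
      then show ?case by (simp add: q_def emb_zero[OF R])
    next
      case (Suc n)
      have "R.eval (q (Suc n)) t = comp R (a n) \<otimes>\<^bsub>R\<^esub> t [^]\<^bsub>R\<^esub> n \<oplus>\<^bsub>R\<^esub> R.eval (q n) t"
        by (simp add: q_def)
      moreover have "R.eval (q n) t \<in> carrier R" using R.eval_in_carrier[OF qc t] .
      ultimately have "emb R (R.eval (q (Suc n)) t) =
          emb R (comp R (a n)) * emb R (t [^]\<^bsub>R\<^esub> n) + idm R * (\<Sum>k<n. a k * emb R t ^ k)"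
        using t comp_closed[OF R] Suc by (simp add: emb_add[OF R] emb_mult[OF R])
      also have "emb R (comp R (a n)) * emb R (t [^]\<^bsub>R\<^esub> n) = idm R * (a n * emb R t ^ n)"
        unfolding idm_mult[OF R, symmetric] emb_pow[OF R t, symmetric] using I.idem
        by (metis mult.assoc mult.left_commute)
      finally show ?case by (simp add: distrib_left)
    qed
    let ?p = "\<one>\<^bsub>R\<^esub> # q m"
    have pol: "?p \<in> carrier (poly_ring R)"
      using qc[of m] by (simp add: univ_poly_carrier[symmetric] polynomial_def)
    have "size (R.roots ?p) = m"
      using R.roots_over_carrier[OF pol] by (simp add: R.splitted_def q_def)
    then have "R.roots ?p \<noteq> {#}" using m by auto
    then obtain t where "t \<in># R.roots ?p" by (meson multiset_nonemptyE)
    then have "R.is_root ?p t" using R.roots_mem_iff_is_root[OF pol] by blast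
    then have t: "t \<in> carrier R" "R.eval ?p t = \<zero>\<^bsub>R\<^esub>" by (auto simp: R.is_root_def)
    have qt: "R.eval (q m) t \<in> carrier R" using R.eval_in_carrier[OF qc t(1)] .
    have "\<zero>\<^bsub>R\<^esub> = t [^]\<^bsub>R\<^esub> m \<oplus>\<^bsub>R\<^esub> R.eval (q m) t" using t by (simp add: q_def)
    then have "0 = emb R (t [^]\<^bsub>R\<^esub> m) + emb R (R.eval (q m) t)"
      using emb_add[OF R _ qt, of "t [^]\<^bsub>R\<^esub> m"] t(1) emb_zero[OF R] by simp
    then have "idm R * (emb R t ^ m + (\<Sum>k<m. a k * emb R t ^ k)) = 0"
      by (simp add: ev[OF t(1)] emb_pow[OF R t(1), symmetric] distrib_left)
    then show "\<exists>t. idm R * t = t \<and> idm R * (t ^ m + (\<Sum>k<m. a k * t ^ k)) = 0"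
      using idm_emb[OF R t(1)] by blast
  qed
qed

text \<open>\<open>fam\<close> is indexed by records of type \<open>ring\<close>. Further fields of
  a record, such as the scalar multiplication of an algebra, are dropped to obtain an index.\<close>

definition plain_ring :: "('k, 'l) ring_scheme \<Rightarrow> 'k ring" where
  "plain_ring R = \<lparr>carrier = carrier R, monoid.mult = monoid.mult R, one = one R, ring.zero = ring.zero R, ring.add = add R\<rparr>"

lemma plain_ring_simps [simp]:
  "carrier (plain_ring R) = carrier R" "monoid.mult (plain_ring R) = monoid.mult R" "one (plain_ring R) = one R"
  "ring.zero (plain_ring R) = ring.zero R" "add (plain_ring R) = add R"
  by (simp_all add: plain_ring_def)

lemma cring_plain_ring: assumes "cring R" shows "cring (plain_ring R)"
proof -
  interpret R: cring R by (rule assms)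
  show ?thesis
  proof (rule cringI)
    show "abelian_group (plain_ring R)"
      by (rule abelian_groupI) (auto simp: R.add.m_assoc R.add.m_comm R.add.m_lcomm intro: R.l_neg R.a_inv_closed bexI[of _ "\<ominus>\<^bsub>R\<^esub> x" for x])
    show "comm_monoid (plain_ring R)"
      by (rule comm_monoidI) (auto simp: R.m_ac)
  qed (simp add: R.l_distr)
qed

lemma field_plain_ring: assumes "field R" shows "field (plain_ring R)"
proof -
  interpret R: field R by (rule assms)
  interpret P: cring "plain_ring R" by (rule cring_plain_ring) unfold_locales
  show ?thesis
  proof (rule P.cring_fieldI2)
    show "\<exists>b\<in>carrier (plain_ring R). a \<otimes>\<^bsub>plain_ring R\<^esub> b = \<one>\<^bsub>plain_ring R\<^esub>"
      if "a \<in> carrier (plain_ring R)" "a \<noteq> \<zero>\<^bsub>plain_ring R\<^esub>" for a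
    proof -
      have "a \<in> Units R" using that R.field_Units by simp
      then show ?thesis by (intro bexI[of _ "inv\<^bsub>R\<^esub> a"]) auto
    qed
  qed simp
qed

section \<open>Multilinear invariants\<close>

text \<open>
  The functionals on the multilinear forms in variables indexed by \<open>D\<close> and \<open>G\<close> that are invariant
  and vanish on all products of invariants of lower degree; the word \<open>x\<close> stands for the monomial
  whose \<open>i\<close>-th factor carries the index \<open>(x i)\<^sup>-\<^sup>1\<close>.
\<close>
definition prims :: "'a::comm_ring_1 \<Rightarrow> ('g, 'b) monoid_scheme \<Rightarrow> 'i set \<Rightarrow> (('i \<Rightarrow> 'g) \<Rightarrow> 'a) set" where
  "prims e G D = {f. (\<forall>x. e * f x = f x) \<and> (\<forall>x. x \<notin> D \<rightarrow>\<^sub>E carrier G \<longrightarrow> f x = 0) \<and>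
     (\<forall>x \<in> D \<rightarrow>\<^sub>E carrier G. \<forall>g\<in>carrier G. f (\<lambda>i\<in>D. x i \<otimes>\<^bsub>G\<^esub> g) = f x) \<and>
     (\<forall>A. A \<subseteq> D \<longrightarrow> A \<noteq> {} \<longrightarrow> A \<noteq> D \<longrightarrow> (\<forall>x \<in> D \<rightarrow>\<^sub>E carrier G.
        (\<Sum>h\<in>carrier G. f (\<lambda>i\<in>D. if i \<in> A then x i else x i \<otimes>\<^bsub>G\<^esub> h)) = 0))}"

lemma primsD:
  assumes "f \<in> prims e G D"
  shows "e * f x = f x" "x \<notin> D \<rightarrow>\<^sub>E carrier G \<Longrightarrow> f x = 0"
    "x \<in> D \<rightarrow>\<^sub>E carrier G \<Longrightarrow> g \<in> carrier G \<Longrightarrow> f (\<lambda>i\<in>D. x i \<otimes>\<^bsub>G\<^esub> g) = f x"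
    "A \<subseteq> D \<Longrightarrow> A \<noteq> {} \<Longrightarrow> A \<noteq> D \<Longrightarrow> x \<in> D \<rightarrow>\<^sub>E carrier G \<Longrightarrow>
      (\<Sum>h\<in>carrier G. f (\<lambda>i\<in>D. if i \<in> A then x i else x i \<otimes>\<^bsub>G\<^esub> h)) = 0"
  using assms unfolding prims_def by blast+

lemma primsI:
  assumes "\<And>x. e * f x = f x" "\<And>x. x \<notin> D \<rightarrow>\<^sub>E carrier G \<Longrightarrow> f x = 0"
    "\<And>x g. x \<in> D \<rightarrow>\<^sub>E carrier G \<Longrightarrow> g \<in> carrier G \<Longrightarrow> f (\<lambda>i\<in>D. x i \<otimes>\<^bsub>G\<^esub> g) = f x"
    "\<And>A x. A \<subseteq> D \<Longrightarrow> A \<noteq> {} \<Longrightarrow> A \<noteq> D \<Longrightarrow> x \<in> D \<rightarrow>\<^sub>E carrier G \<Longrightarrow>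
      (\<Sum>h\<in>carrier G. f (\<lambda>i\<in>D. if i \<in> A then x i else x i \<otimes>\<^bsub>G\<^esub> h)) = 0"
  shows "f \<in> prims e G D"
  using assms unfolding prims_def by blast

section \<open>Symmetries of the space of functionals\<close>

context word_algebra
begin

text \<open>The defining conditions involve right multiplication of letters, which commutes with the
  left translations by elements of \<open>W\<close>.\<close>

lemma prims_stable: "w.reg.stable (prims e G D)"
  unfolding w.reg.stable_def subsp_def
proof (intro conjI ballI allI)
  show "prims e G D \<subseteq> vecs W"
  proof
    fix f assume f: "f \<in> prims e G D"
    show "f \<in> vecs W" unfolding vecs_def
      by (intro CollectI conjI allI impI) (simp_all only: primsD(1)[OF f] W_iff primsD(2)[OF f] not_False_eq_True)
  qed
  show "(\<lambda>_. 0) \<in> prims e G D" by (rule primsI) auto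
  show "(\<lambda>x. f x + g x) \<in> prims e G D" if "f \<in> prims e G D" "g \<in> prims e G D" for f g
    using primsD[OF that(1)] primsD[OF that(2)] by (intro primsI) (simp_all add: distrib_left sum.distrib)
  show "(\<lambda>x. t * f x) \<in> prims e G D" if "f \<in> prims e G D" for t f
    using primsD[OF that]
    by (intro primsI) (simp_all add: mult.left_commute[of e] sum_distrib_left[symmetric])
  show "w.reg.shift z f \<in> prims e G D" if z: "z \<in> W" and f: "f \<in> prims e G D" for z f
  proof -
    have sh: "w.reg.shift z f x = f (\<lambda>i\<in>D. inv\<^bsub>G\<^esub> (z i) \<otimes>\<^bsub>G\<^esub> x i)" if "x \<in> D \<rightarrow>\<^sub>E carrier G" for x
      using that z by (simp add: w.reg.shift_def cong: restrict_cong)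
    have zi: "z i \<in> carrier G" if "i \<in> D" for i using z that by auto
    have zx: "(\<lambda>i\<in>D. inv\<^bsub>G\<^esub> (z i) \<otimes>\<^bsub>G\<^esub> x i) \<in> D \<rightarrow>\<^sub>E carrier G" if "x \<in> D \<rightarrow>\<^sub>E carrier G" for x
      using that zi by (auto simp: PiE_iff)
    show ?thesis
    proof (rule primsI)
      show "e * w.reg.shift z f x = w.reg.shift z f x" for x
        by (simp add: w.reg.shift_def primsD(1)[OF f] del: W_iff)
      show "w.reg.shift z f x = 0" if "x \<notin> D \<rightarrow>\<^sub>E carrier G" for x
        using that by (simp add: w.reg.shift_def)
      show "w.reg.shift z f (\<lambda>i\<in>D. x i \<otimes>\<^bsub>G\<^esub> g) = w.reg.shift z f x"
        if x: "x \<in> D \<rightarrow>\<^sub>E carrier G" and g: "g \<in> carrier G" for x g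
      proof -
        have xg: "(\<lambda>i\<in>D. x i \<otimes>\<^bsub>G\<^esub> g) \<in> D \<rightarrow>\<^sub>E carrier G" using x g by (auto simp: PiE_iff)
        have "(\<lambda>i\<in>D. inv\<^bsub>G\<^esub> (z i) \<otimes>\<^bsub>G\<^esub> (\<lambda>i\<in>D. x i \<otimes>\<^bsub>G\<^esub> g) i) =
            (\<lambda>i\<in>D. (\<lambda>i\<in>D. inv\<^bsub>G\<^esub> (z i) \<otimes>\<^bsub>G\<^esub> x i) i \<otimes>\<^bsub>G\<^esub> g)"
          using x g zi by (intro restrict_ext) (auto simp: G.m_assoc PiE_iff)
        then show ?thesis using primsD(3)[OF f zx[OF x] g] by (simp only: sh[OF xg] sh[OF x])
      qed
      show "(\<Sum>h\<in>carrier G. w.reg.shift z f (\<lambda>i\<in>D. if i \<in> A then x i else x i \<otimes>\<^bsub>G\<^esub> h)) = 0"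
        if A: "A \<subseteq> D" "A \<noteq> {}" "A \<noteq> D" and x: "x \<in> D \<rightarrow>\<^sub>E carrier G" for A x
      proof -
        have "w.reg.shift z f (\<lambda>i\<in>D. if i \<in> A then x i else x i \<otimes>\<^bsub>G\<^esub> h) =
            f (\<lambda>i\<in>D. if i \<in> A then (\<lambda>i\<in>D. inv\<^bsub>G\<^esub> (z i) \<otimes>\<^bsub>G\<^esub> x i) i
              else (\<lambda>i\<in>D. inv\<^bsub>G\<^esub> (z i) \<otimes>\<^bsub>G\<^esub> x i) i \<otimes>\<^bsub>G\<^esub> h)" if h: "h \<in> carrier G" for h
        proof -
          have xh: "(\<lambda>i\<in>D. if i \<in> A then x i else x i \<otimes>\<^bsub>G\<^esub> h) \<in> D \<rightarrow>\<^sub>E carrier G" using x h by (auto simp: PiE_iff)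
          have "(\<lambda>i\<in>D. inv\<^bsub>G\<^esub> (z i) \<otimes>\<^bsub>G\<^esub> (\<lambda>i\<in>D. if i \<in> A then x i else x i \<otimes>\<^bsub>G\<^esub> h) i) =
            (\<lambda>i\<in>D. if i \<in> A then (\<lambda>i\<in>D. inv\<^bsub>G\<^esub> (z i) \<otimes>\<^bsub>G\<^esub> x i) i
              else (\<lambda>i\<in>D. inv\<^bsub>G\<^esub> (z i) \<otimes>\<^bsub>G\<^esub> x i) i \<otimes>\<^bsub>G\<^esub> h)"
            using x h zi by (intro restrict_ext) (auto simp: G.m_assoc PiE_iff)
          then show ?thesis by (simp only: sh[OF xh])
        qed
        then show ?thesis using primsD(4)[OF f A zx[OF x]] by simp
      qed
    qed
  qed
qed

lemma prims_perm:
  assumes \<sigma>: "\<sigma> permutes D" and f: "f \<in> prims e G D"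
  shows "perm \<sigma> f \<in> prims e G D"
proof -
  have im: "\<sigma> i \<in> D \<longleftrightarrow> i \<in> D" for i by (rule permutes_in_image[OF \<sigma>])
  have xs: "(\<lambda>i\<in>D. x (\<sigma> i)) \<in> D \<rightarrow>\<^sub>E carrier G" if "x \<in> D \<rightarrow>\<^sub>E carrier G" for x
    using that by (auto simp: PiE_iff im)
  have p: "perm \<sigma> f x = f (\<lambda>i\<in>D. x (\<sigma> i))" if "x \<in> D \<rightarrow>\<^sub>E carrier G" for x
    using that by (simp add: perm_def)
  show ?thesis
  proof (rule primsI)
    show "e * perm \<sigma> f x = perm \<sigma> f x" for x by (simp add: perm_def primsD(1)[OF f] del: W_iff)
    show "perm \<sigma> f x = 0" if "x \<notin> D \<rightarrow>\<^sub>E carrier G" for x using that by (simp add: perm_def)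
    show "perm \<sigma> f (\<lambda>i\<in>D. x i \<otimes>\<^bsub>G\<^esub> g) = perm \<sigma> f x"
      if x: "x \<in> D \<rightarrow>\<^sub>E carrier G" and g: "g \<in> carrier G" for x g
    proof -
      have xg: "(\<lambda>i\<in>D. x i \<otimes>\<^bsub>G\<^esub> g) \<in> D \<rightarrow>\<^sub>E carrier G" using x g by (auto simp: PiE_iff)
      have "(\<lambda>i\<in>D. (\<lambda>i\<in>D. x i \<otimes>\<^bsub>G\<^esub> g) (\<sigma> i)) = (\<lambda>i\<in>D. (\<lambda>i\<in>D. x (\<sigma> i)) i \<otimes>\<^bsub>G\<^esub> g)"
        by (intro restrict_ext) (simp add: im)
      then show ?thesis using primsD(3)[OF f xs[OF x] g] by (simp only: p[OF xg] p[OF x])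
    qed
    show "(\<Sum>h\<in>carrier G. perm \<sigma> f (\<lambda>i\<in>D. if i \<in> A then x i else x i \<otimes>\<^bsub>G\<^esub> h)) = 0"
      if A: "A \<subseteq> D" "A \<noteq> {}" "A \<noteq> D" and x: "x \<in> D \<rightarrow>\<^sub>E carrier G" for A x
    proof -
      \<comment> \<open>The vanishing condition of \<open>perm \<sigma> f\<close> at
        \<open>A\<close> is that of \<open>f\<close> at the preimage of \<open>A\<close>.\<close>
      define B where "B = {i\<in>D. \<sigma> i \<in> A}"
      have "B \<noteq> {}"
      proof -
        obtain a where "a \<in> A" using A by blast
        then have "iv \<sigma> a \<in> B" using A permutes_in_image[OF iv_permutes(1)[OF \<sigma>]] permutes_inverses(1)[OF \<sigma>]
          by (auto simp: B_def)
        then show ?thesis by blast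
      qed
      moreover have "B \<noteq> D"
      proof -
        obtain a where "a \<in> D" "a \<notin> A" using A by blast
        then have "iv \<sigma> a \<in> D - B" using permutes_in_image[OF iv_permutes(1)[OF \<sigma>]] permutes_inverses(1)[OF \<sigma>]
          by (auto simp: B_def)
        then show ?thesis by blast
      qed
      moreover have "B \<subseteq> D" by (auto simp: B_def)
      ultimately have z: "(\<Sum>h\<in>carrier G. f (\<lambda>i\<in>D. if i \<in> B then (\<lambda>i\<in>D. x (\<sigma> i)) i
          else (\<lambda>i\<in>D. x (\<sigma> i)) i \<otimes>\<^bsub>G\<^esub> h)) = 0"
        using primsD(4)[OF f _ _ _ xs[OF x]] by blast
      have "perm \<sigma> f (\<lambda>i\<in>D. if i \<in> A then x i else x i \<otimes>\<^bsub>G\<^esub> h) =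
          f (\<lambda>i\<in>D. if i \<in> B then (\<lambda>i\<in>D. x (\<sigma> i)) i else (\<lambda>i\<in>D. x (\<sigma> i)) i \<otimes>\<^bsub>G\<^esub> h)" if h: "h \<in> carrier G" for h
      proof -
        have xh: "(\<lambda>i\<in>D. if i \<in> A then x i else x i \<otimes>\<^bsub>G\<^esub> h) \<in> D \<rightarrow>\<^sub>E carrier G" using x h by (auto simp: PiE_iff)
        have "(\<lambda>i\<in>D. (\<lambda>i\<in>D. if i \<in> A then x i else x i \<otimes>\<^bsub>G\<^esub> h) (\<sigma> i)) =
            (\<lambda>i\<in>D. if i \<in> B then (\<lambda>i\<in>D. x (\<sigma> i)) i else (\<lambda>i\<in>D. x (\<sigma> i)) i \<otimes>\<^bsub>G\<^esub> h)"
          by (intro restrict_ext) (simp add: im B_def)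
        then show ?thesis by (simp only: p[OF xh])
      qed
      then show ?thesis using z by simp
    qed
  qed
qed

theorem prims_symmetric:
  assumes "m * (of_nat (card (carrier G)) * e) = e" and "prims e G D \<noteq> {\<lambda>_. 0}"
  obtains f where "f \<in> prims e G D" "f \<noteq> (\<lambda>_. 0)"
    "\<And>\<sigma> x. \<sigma> permutes D \<Longrightarrow> x \<in> D \<rightarrow>\<^sub>E carrier G \<Longrightarrow> f (\<lambda>i\<in>D. x (\<sigma> i)) = f x"
proof -
  obtain f where f: "f \<in> prims e G D" "f \<noteq> (\<lambda>_. 0)" "\<And>\<sigma>. \<sigma> permutes D \<Longrightarrow> perm \<sigma> f = f"
    by (rule symmetric_element[OF assms(1) prims_stable assms(2) prims_perm]) (assumption, assumption, rule that)
  have "f (\<lambda>i\<in>D. x (\<sigma> i)) = f x" if "\<sigma> permutes D" "x \<in> D \<rightarrow>\<^sub>E carrier G" for \<sigma> x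
    using fun_cong[OF f(3)[OF that(1)], of x] that(2) by (simp add: perm_def)
  then show thesis using that f(1,2) by blast
qed

end

text \<open>Splits an invariant multilinear monomial into products of invariants of lower degree.\<close>
theorem (in idem_field) multilinear_decomposition:
  fixes G :: "('g, 'b) monoid_scheme" and D :: "'i set"
  assumes G: "group G" and finG: "finite (carrier G)" and finD: "finite D" and L0: "prims e G D = {\<lambda>_. 0}"
  defines "J \<equiv> {(A, y). A \<subseteq> D \<and> A \<noteq> {} \<and> A \<noteq> D \<and> y \<in> D \<rightarrow>\<^sub>E carrier G}"
  obtains c where "\<And>(\<Psi> :: 'a \<Rightarrow> 'c::comm_ring_1) \<alpha>. (\<And>x y. \<Psi> (x + y) = \<Psi> x + \<Psi> y) \<Longrightarrow>
    (\<Sum>g\<in>carrier G. \<Psi> e * (\<Prod>i\<in>D. \<alpha> i g)) =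
    (\<Sum>(A, y)\<in>J. \<Psi> (c (A, y)) * ((\<Sum>g\<in>carrier G. \<Prod>i\<in>A. \<alpha> i (y i \<otimes>\<^bsub>G\<^esub> g)) *
       (\<Sum>h\<in>carrier G. \<Prod>i\<in>D - A. \<alpha> i (y i \<otimes>\<^bsub>G\<^esub> h))))"
proof -
  interpret G: group G by (rule G)
  let ?W = "D \<rightarrow>\<^sub>E carrier G"
  have finW: "finite ?W" using finD finG by (intro finite_PiE) auto
  have finJ: "finite J"
    by (rule finite_subset[of _ "Pow D \<times> ?W"]) (use finD finW in \<open>auto simp: J_def\<close>)
  define con where "con g = (\<lambda>i\<in>D. g)" for g :: 'g
  define mix where "mix A y g h = (\<lambda>i\<in>D. if i \<in> A then y i \<otimes>\<^bsub>G\<^esub> g else y i \<otimes>\<^bsub>G\<^esub> h)" for A y g h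
  have conW: "con g \<in> ?W" if "g \<in> carrier G" for g using that by (auto simp: con_def)
  have mixW: "mix A y g h \<in> ?W" if "y \<in> ?W" "g \<in> carrier G" "h \<in> carrier G" for A y g h
    using that by (auto simp: mix_def PiE_iff)
  \<comment> \<open>Multilinear forms are functions on words. \<open>w\<close> is the transfer of
    the monomial at the unit word, and \<open>t (A, y)\<close> is the product of the transfers of
    the two parts into which \<open>A\<close> cuts the monomial of \<open>y\<close>. The claim is
    that \<open>w\<close> lies in the span of these products.\<close>
  define w where "w x = (\<Sum>g\<in>carrier G. if x = con g then e else 0)" for x
  define t where "t j x = (case j of (A, y) \<Rightarrow> \<Sum>g\<in>carrier G. \<Sum>h\<in>carrier G. if x = mix A y g h then e else 0)" for j x
  have ew: "e * (if P then e else 0) = (if P then e else 0)" for P by (simp add: idem)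
  have wv: "w \<in> vecs ?W"
    unfolding vecs_def
  proof (intro CollectI conjI allI impI)
    show "e * w x = w x" for x by (simp only: w_def sum_distrib_left ew)
    show "w x = 0" if "x \<notin> ?W" for x
    proof -
      have "x \<noteq> con g" if "g \<in> carrier G" for g using conW[OF that] \<open>x \<notin> ?W\<close> by blast
      then show ?thesis unfolding w_def by (intro sum.neutral) simp
    qed
  qed
  have tv: "t j \<in> vecs ?W" if j: "j \<in> J" for j
    unfolding vecs_def
  proof (intro CollectI conjI allI impI)
    obtain A y where Ay: "j = (A, y)" "y \<in> ?W" using j by (auto simp: J_def)
    show "e * t j x = t j x" for x by (simp only: t_def case_prod_beta sum_distrib_left ew)
    show "t j x = 0" if "x \<notin> ?W" for x
    proof -
      have "x \<noteq> mix A y g h" if "g \<in> carrier G" "h \<in> carrier G" for g h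
        using mixW[OF Ay(2) that] \<open>x \<notin> ?W\<close> by blast
      then show ?thesis unfolding t_def Ay by (simp add: sum.neutral)
    qed
  qed
  define T where "T = {\<lambda>x. \<Sum>j\<in>J. c j * t j x | c. True}"
  have TI: "(\<lambda>x. \<Sum>j\<in>J. c j * t j x) \<in> T" for c
    unfolding T_def by (rule CollectI) (rule exI[of _ c], simp)
  have TE: "\<exists>c. f = (\<lambda>x. \<Sum>j\<in>J. c j * t j x)" if "f \<in> T" for f
    using that unfolding T_def by (rule CollectE) (elim exE conjE, rule exI)
  have T: "subsp ?W T" unfolding subsp_def
  proof (intro conjI ballI allI subsetI)
    show "f \<in> vecs ?W" if "f \<in> T" for f
    proof -
      obtain c where "f = (\<lambda>x. \<Sum>j\<in>J. c j * t j x)" using TE[OF \<open>f \<in> T\<close>] by (rule exE)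
      then show ?thesis using subsp_lincomb[OF subsp_vecs tv, where t=c and I=J] by simp
    qed
    show "(\<lambda>_. 0) \<in> T" using TI[of "\<lambda>_. 0"] by simp
    show "(\<lambda>x. f x + g x) \<in> T" if "f \<in> T" "g \<in> T" for f g
    proof -
      obtain c where f: "f = (\<lambda>x. \<Sum>j\<in>J. c j * t j x)" using TE[OF \<open>f \<in> T\<close>] by (rule exE)
      obtain d where "g = (\<lambda>x. \<Sum>j\<in>J. d j * t j x)" using TE[OF \<open>g \<in> T\<close>] by (rule exE)
      then show ?thesis using f TI[of "\<lambda>j. c j + d j"] by (simp add: distrib_right sum.distrib)
    qed
    show "(\<lambda>x. s * f x) \<in> T" if "f \<in> T" for s f
    proof -
      obtain c where "f = (\<lambda>x. \<Sum>j\<in>J. c j * t j x)" using TE[OF \<open>f \<in> T\<close>] by (rule exE)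
      then show ?thesis using TI[of "\<lambda>j. s * c j"] by (simp add: sum_distrib_left mult.assoc)
    qed
  qed
  have pd: "(\<Sum>x\<in>?W. l x * (\<Sum>g\<in>B. if x = p g then e else 0)) = (\<Sum>g\<in>B. l (p g))"
    if l: "l \<in> vecs ?W" and p: "\<And>g. g \<in> B \<Longrightarrow> p g \<in> ?W" for l B and p :: "'z \<Rightarrow> 'i \<Rightarrow> 'g"
  proof -
    have "(\<Sum>x\<in>?W. l x * (\<Sum>g\<in>B. if x = p g then e else 0)) = (\<Sum>g\<in>B. \<Sum>x\<in>?W. if x = p g then l x * e else 0)"
      unfolding sum_distrib_left by (subst sum.swap) (intro sum.cong, auto)
    also have "\<dots> = (\<Sum>g\<in>B. l (p g))"
      using finW p vecsD(1)[OF l] by (intro sum.cong) (auto simp: mult.commute)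
    finally show ?thesis .
  qed
  have "w \<in> T"
  proof (rule ccontr)
    \<comment> \<open>A functional \<open>l\<close> that vanishes on \<open>T\<close> but not at
      \<open>w\<close> is summed over right translations. The resulting \<open>f\<close> belongs to
      \<open>prims\<close>, and its value at the unit word is the value of \<open>l\<close> at
      \<open>w\<close>.\<close>
    assume "w \<notin> T"
    then obtain l where l: "l \<in> vecs ?W" "\<And>f. f \<in> T \<Longrightarrow> pairing ?W l f = 0" "pairing ?W l w \<noteq> 0"
      using separating_functional[OF finW T wv] by blast
    have lt: "(\<Sum>g\<in>carrier G. \<Sum>h\<in>carrier G. l (mix A y g h)) = 0" if Ay: "(A, y) \<in> J" for A y
    proof -
      have "t (A, y) = (\<lambda>x. \<Sum>j\<in>J. (if j = (A, y) then 1 else 0) * t j x)"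
        using finJ Ay by (simp add: if_distrib if_distribR cong: if_cong)
      then have "t (A, y) \<in> T" using TI[of "\<lambda>j. if j = (A, y) then 1 else 0"] by simp
      then have "0 = pairing ?W l (t (A, y))" using l(2) by simp
      also have "\<dots> = (\<Sum>x\<in>?W. l x * (\<Sum>p\<in>carrier G \<times> carrier G. if x = mix A y (fst p) (snd p) then e else 0))"
        by (simp add: pairing_def t_def sum.cartesian_product case_prod_beta)
      also have "\<dots> = (\<Sum>p\<in>carrier G \<times> carrier G. l (mix A y (fst p) (snd p)))"
      proof (rule pd[OF l(1)])
        have "y \<in> ?W" using Ay by (simp add: J_def)
        then show "mix A y (fst p) (snd p) \<in> ?W" if "p \<in> carrier G \<times> carrier G" for p
          using that by (intro mixW) auto
      qed
      finally show ?thesis by (simp add: sum.cartesian_product case_prod_beta)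
    qed
    define f where "f x = (if x \<in> ?W then \<Sum>g\<in>carrier G. l (\<lambda>i\<in>D. x i \<otimes>\<^bsub>G\<^esub> g) else 0)" for x
    have bl: "bij_betw (\<lambda>z. g \<otimes>\<^bsub>G\<^esub> z) (carrier G) (carrier G)" if "g \<in> carrier G" for g
      using that by (intro bij_betw_byWitness[of _ "\<lambda>z. inv\<^bsub>G\<^esub> g \<otimes>\<^bsub>G\<^esub> z"]) (auto simp: G.m_assoc[symmetric])
    have "f \<in> prims e G D"
    proof (rule primsI)
      show "e * f x = f x" for x by (simp add: f_def sum_distrib_left vecsD(1)[OF l(1)])
      show "f x = 0" if "x \<notin> ?W" for x using that by (simp add: f_def)
      show "f (\<lambda>i\<in>D. x i \<otimes>\<^bsub>G\<^esub> g) = f x" if x: "x \<in> ?W" and g: "g \<in> carrier G" for x g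
      proof -
        have xg: "(\<lambda>i\<in>D. x i \<otimes>\<^bsub>G\<^esub> g) \<in> ?W" using x g by (auto simp: PiE_iff)
        have "f (\<lambda>i\<in>D. x i \<otimes>\<^bsub>G\<^esub> g) = (\<Sum>h\<in>carrier G. l (\<lambda>i\<in>D. x i \<otimes>\<^bsub>G\<^esub> (g \<otimes>\<^bsub>G\<^esub> h)))"
        proof -
          have "(\<lambda>i\<in>D. (\<lambda>i\<in>D. x i \<otimes>\<^bsub>G\<^esub> g) i \<otimes>\<^bsub>G\<^esub> h) = (\<lambda>i\<in>D. x i \<otimes>\<^bsub>G\<^esub> (g \<otimes>\<^bsub>G\<^esub> h))"
            if "h \<in> carrier G" for h
            using x g that by (intro restrict_ext) (auto simp: G.m_assoc PiE_iff)
          then show ?thesis using xg by (simp only: f_def if_True cong: sum.cong)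
        qed
        also have "\<dots> = (\<Sum>h\<in>carrier G. l (\<lambda>i\<in>D. x i \<otimes>\<^bsub>G\<^esub> h))"
          by (rule sum.reindex_bij_betw[OF bl[OF g]])
        finally show ?thesis using x by (simp add: f_def)
      qed
      show "(\<Sum>h\<in>carrier G. f (\<lambda>i\<in>D. if i \<in> A then x i else x i \<otimes>\<^bsub>G\<^esub> h)) = 0"
        if A: "A \<subseteq> D" "A \<noteq> {}" "A \<noteq> D" and x: "x \<in> ?W" for A x
      proof -
        have "f (\<lambda>i\<in>D. if i \<in> A then x i else x i \<otimes>\<^bsub>G\<^esub> h) = (\<Sum>g\<in>carrier G. l (mix A x g (h \<otimes>\<^bsub>G\<^esub> g)))"
          if h: "h \<in> carrier G" for h
        proof -
          have xh: "(\<lambda>i\<in>D. if i \<in> A then x i else x i \<otimes>\<^bsub>G\<^esub> h) \<in> ?W" using x h by (auto simp: PiE_iff)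
          have "(\<lambda>i\<in>D. (\<lambda>i\<in>D. if i \<in> A then x i else x i \<otimes>\<^bsub>G\<^esub> h) i \<otimes>\<^bsub>G\<^esub> g) = mix A x g (h \<otimes>\<^bsub>G\<^esub> g)"
            if "g \<in> carrier G" for g
            unfolding mix_def using x h that by (intro restrict_ext) (auto simp: G.m_assoc PiE_iff)
          then show ?thesis using xh by (simp only: f_def if_True cong: sum.cong)
        qed
        then have "(\<Sum>h\<in>carrier G. f (\<lambda>i\<in>D. if i \<in> A then x i else x i \<otimes>\<^bsub>G\<^esub> h)) =
            (\<Sum>h\<in>carrier G. \<Sum>g\<in>carrier G. l (mix A x g (h \<otimes>\<^bsub>G\<^esub> g)))"
          by (rule sum.cong[OF refl])
        also have "\<dots> = (\<Sum>g\<in>carrier G. \<Sum>h\<in>carrier G. l (mix A x g (h \<otimes>\<^bsub>G\<^esub> g)))"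
          by (rule sum.swap)
        \<comment> \<open>For fixed \<open>g\<close> the product of \<open>h\<close> and
          \<open>g\<close> runs through the group. This yields the double sum that \<open>lt\<close>
          shows to be 0.\<close>
        also have "\<dots> = (\<Sum>g\<in>carrier G. \<Sum>h\<in>carrier G. l (mix A x g h))"
        proof (rule sum.cong[OF refl])
          fix g assume g: "g \<in> carrier G"
          have "bij_betw (\<lambda>z. z \<otimes>\<^bsub>G\<^esub> g) (carrier G) (carrier G)"
            using g by (intro bij_betw_byWitness[of _ "\<lambda>z. z \<otimes>\<^bsub>G\<^esub> inv\<^bsub>G\<^esub> g"]) (auto simp: G.m_assoc)
          then show "(\<Sum>h\<in>carrier G. l (mix A x g (h \<otimes>\<^bsub>G\<^esub> g))) = (\<Sum>h\<in>carrier G. l (mix A x g h))"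
            by (rule sum.reindex_bij_betw)
        qed
        also have "\<dots> = 0" using A x by (intro lt) (simp add: J_def)
        finally show ?thesis .
      qed
    qed
    then have "f (con \<one>\<^bsub>G\<^esub>) = 0" using L0 by auto
    moreover have "f (con \<one>\<^bsub>G\<^esub>) = (\<Sum>g\<in>carrier G. l (con g))"
    proof -
      have "(\<lambda>i\<in>D. con \<one>\<^bsub>G\<^esub> i \<otimes>\<^bsub>G\<^esub> g) = con g" if "g \<in> carrier G" for g
        unfolding con_def using that by (intro restrict_ext) simp
      then show ?thesis using conW[OF G.one_closed] by (simp only: f_def if_True cong: sum.cong)
    qed
    moreover have "(\<Sum>g\<in>carrier G. l (con g)) = pairing ?W l w"
      unfolding pairing_def w_def by (rule pd[OF l(1) conW, symmetric])
    ultimately show False using l(3) by simp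
  qed
  then obtain c0 where c0: "w = (\<lambda>x. \<Sum>j\<in>J. c0 j * t j x)" by (rule exE[OF TE])
  \<comment> \<open>With coefficients in the field, \<open>e\<close> is absorbed, and each
    coefficient can be fed to \<open>\<Psi>\<close> as a single element.\<close>
  define c where "c j = e * c0 j" for j
  have ce: "c j * e = c j" for j using idem by (simp add: c_def ac_simps) (simp flip: mult.assoc)
  show thesis
  proof (rule that[of c])
    fix \<Psi> :: "'a \<Rightarrow> 'c" and \<alpha> :: "'i \<Rightarrow> 'g \<Rightarrow> 'c"
    \<comment> \<open>The identity is linear in the elements of the field, so an additive
      \<open>\<Psi>\<close> carries it into any commutative ring. Monomials are formed in the target
      ring.\<close>
    assume add: "\<And>x y. \<Psi> (x + y) = \<Psi> x + \<Psi> y"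
    have z: "\<Psi> 0 = 0" using add[of 0 0] by simp
    have sum: "\<Psi> (\<Sum>i\<in>I. f i) = (\<Sum>i\<in>I. \<Psi> (f i))" for f and I :: "'z set"
      by (induction I rule: infinite_finite_induct) (simp_all add: z add)
    let ?M = "\<lambda>x. \<Prod>i\<in>D. \<alpha> i (x i)"
    have pick: "(\<Sum>x\<in>?W. (if x = p then k else 0) * ?M x) = k * ?M p" if "p \<in> ?W" for p k
      using finW that by (simp add: if_distribR if_distrib[of "\<lambda>z. z * _"] cong: if_cong)
    have if0: "\<Psi> (if P then k else 0) = (if P then \<Psi> k else 0)" for P k by (simp add: z)
    have "(\<Sum>x\<in>?W. \<Psi> (w x) * ?M x) = (\<Sum>g\<in>carrier G. \<Sum>x\<in>?W. (if x = con g then \<Psi> e else 0) * ?M x)"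
      unfolding w_def sum if0 sum_distrib_right by (rule sum.swap)
    also have "\<dots> = (\<Sum>g\<in>carrier G. \<Psi> e * (\<Prod>i\<in>D. \<alpha> i g))"
      using conW by (intro sum.cong refl) (simp add: pick, simp add: con_def)
    finally have lhs: "(\<Sum>x\<in>?W. \<Psi> (w x) * ?M x) = (\<Sum>g\<in>carrier G. \<Psi> e * (\<Prod>i\<in>D. \<alpha> i g))" .
    have "w x = (\<Sum>j\<in>J. \<Sum>g\<in>carrier G. \<Sum>h\<in>carrier G. if x = mix (fst j) (snd j) g h then c j else 0)" for x
    proof -
      have "e * w x = w x" using vecsD(1)[OF wv] .
      then have "w x = (\<Sum>j\<in>J. c j * t j x)" using c0 by (simp add: c_def sum_distrib_left mult.assoc)
      also have "\<dots> = (\<Sum>j\<in>J. \<Sum>g\<in>carrier G. \<Sum>h\<in>carrier G. if x = mix (fst j) (snd j) g h then c j else 0)"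
        unfolding t_def case_prod_beta sum_distrib_left
        by (intro sum.cong refl) (simp add: ce)
      finally show ?thesis .
    qed
    then have "(\<Sum>x\<in>?W. \<Psi> (w x) * ?M x) = (\<Sum>x\<in>?W. \<Sum>j\<in>J. \<Sum>g\<in>carrier G. \<Sum>h\<in>carrier G.
        (if x = mix (fst j) (snd j) g h then \<Psi> (c j) else 0) * ?M x)"
      by (simp only: sum if0 sum_distrib_right)
    also have "\<dots> = (\<Sum>j\<in>J. \<Sum>g\<in>carrier G. \<Sum>h\<in>carrier G. \<Sum>x\<in>?W.
        (if x = mix (fst j) (snd j) g h then \<Psi> (c j) else 0) * ?M x)"
      by (simp only: sum.swap[of _ _ ?W])
    also have "\<dots> = (\<Sum>j\<in>J. \<Sum>g\<in>carrier G. \<Sum>h\<in>carrier G. \<Psi> (c j) * ?M (mix (fst j) (snd j) g h))"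
    proof (intro sum.cong refl pick mixW)
      show "snd j \<in> ?W" if "j \<in> J" for j using that by (auto simp: J_def)
    qed
    also have "\<dots> = (\<Sum>(A, y)\<in>J. \<Psi> (c (A, y)) * ((\<Sum>g\<in>carrier G. \<Prod>i\<in>A. \<alpha> i (y i \<otimes>\<^bsub>G\<^esub> g)) *
       (\<Sum>h\<in>carrier G. \<Prod>i\<in>D - A. \<alpha> i (y i \<otimes>\<^bsub>G\<^esub> h))))"
    proof (rule sum.cong[OF refl], clarify)
      fix A y assume "(A, y) \<in> J"
      then have A: "A \<subseteq> D" by (simp add: J_def)
      have M: "?M (mix A y g h) = (\<Prod>i\<in>A. \<alpha> i (y i \<otimes>\<^bsub>G\<^esub> g)) * (\<Prod>i\<in>D - A. \<alpha> i (y i \<otimes>\<^bsub>G\<^esub> h))" for g h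
      proof -
        have "?M (mix A y g h) = (\<Prod>i\<in>D - A. \<alpha> i (mix A y g h i)) * (\<Prod>i\<in>A. \<alpha> i (mix A y g h i))"
          by (rule prod.subset_diff[OF A finD])
        also have "(\<Prod>i\<in>D - A. \<alpha> i (mix A y g h i)) = (\<Prod>i\<in>D - A. \<alpha> i (y i \<otimes>\<^bsub>G\<^esub> h))"
          by (rule prod.cong) (auto simp: mix_def)
        also have "(\<Prod>i\<in>A. \<alpha> i (mix A y g h i)) = (\<Prod>i\<in>A. \<alpha> i (y i \<otimes>\<^bsub>G\<^esub> g))"
          using A by (intro prod.cong) (auto simp: mix_def)
        finally show ?thesis by (simp only: mult.commute)
      qed
      show "(\<Sum>g\<in>carrier G. \<Sum>h\<in>carrier G. \<Psi> (c (A, y)) * ?M (mix (fst (A, y)) (snd (A, y)) g h)) =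
        \<Psi> (c (A, y)) * ((\<Sum>g\<in>carrier G. \<Prod>i\<in>A. \<alpha> i (y i \<otimes>\<^bsub>G\<^esub> g)) *
       (\<Sum>h\<in>carrier G. \<Prod>i\<in>D - A. \<alpha> i (y i \<otimes>\<^bsub>G\<^esub> h)))"
        unfolding fst_conv snd_conv M sum_product by (simp add: sum_distrib_left)
    qed
    finally show "(\<Sum>g\<in>carrier G. \<Psi> e * (\<Prod>i\<in>D. \<alpha> i g)) =
      (\<Sum>(A, y)\<in>J. \<Psi> (c (A, y)) * ((\<Sum>g\<in>carrier G. \<Prod>i\<in>A. \<alpha> i (y i \<otimes>\<^bsub>G\<^esub> g)) *
       (\<Sum>h\<in>carrier G. \<Prod>i\<in>D - A. \<alpha> i (y i \<otimes>\<^bsub>G\<^esub> h))))" unfolding lhs .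
  qed
qed

section \<open>The graded algebra of polynomial functions\<close>

context idem_field
begin

text \<open>Induction on the degree: a root \<open>s\<close> is split off by synthetic division. At
  every other element of \<open>T\<close> the quotient vanishes, since its difference to
  \<open>s\<close> is a nonzero element of the field and may be cancelled.\<close>

lemma poly_zero_of_infinite_roots:
  assumes "infinite T" "\<And>t. t \<in> T \<Longrightarrow> e * t = t" "Polynomial.smult e p = p" "\<And>t. t \<in> T \<Longrightarrow> poly p t = 0"
  shows "p = 0"
  using assms
proof (induction "Polynomial.degree p" arbitrary: p T)
  case 0
  then obtain c where c: "p = [:c:]" by (metis degree_eq_zeroE)
  obtain t where "t \<in> T" using 0(2) by (metis finite.emptyI equals0I)
  then show ?case using 0(5) c by force
next
  case (Suc n)
  obtain s where s: "s \<in> T" using Suc(3) by (metis finite.emptyI equals0I)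
  define q where "q = synthetic_div p s"
  have r: "poly p s = 0" using Suc(6)[OF s] .
  have pq: "p + Polynomial.smult s q = pCons 0 q"
    using synthetic_div_correct[of p s] by (simp add: q_def r)
  have "Polynomial.smult e (p + Polynomial.smult s q) = Polynomial.smult e (pCons 0 q)" using pq by simp
  then have "p + Polynomial.smult s (Polynomial.smult e q) = pCons 0 (Polynomial.smult e q)"
    using Suc(5) by (simp add: smult_add_right mult.commute)
  then have eq: "Polynomial.smult e q = q" unfolding q_def by (rule synthetic_div_unique[THEN conjunct2])
  have "poly q t = 0" if t: "t \<in> T - {s}" for t
  proof (rule ccontr)
    assume n: "poly q t \<noteq> 0"
    have "poly (p + Polynomial.smult s q) t = poly (pCons 0 q) t" using pq by simp
    then have "(t - s) * poly q t = 0" using Suc(6)[of t] t by (simp add: left_diff_distrib)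
    moreover have "e * (t - s) = t - s" using Suc(4)[of t] Suc(4)[OF s] t by (simp add: right_diff_distrib)
    moreover have "e * poly q t = poly q t" using arg_cong[OF eq, of "\<lambda>q. poly q t"] by simp
    moreover have "t - s \<noteq> 0" using t by simp
    ultimately show False using mult_nonzero n by blast
  qed
  moreover have "infinite (T - {s})" using Suc(3) by simp
  moreover have "n = Polynomial.degree q" using Suc(2) by (simp add: q_def degree_synthetic_div)
  ultimately have "q = 0" using Suc(1)[of q "T - {s}"] Suc(4) eq by blast
  then have "p = 0" using pq by simp
  then show ?case .
qed

lemma power_sum_zero:
  assumes inf: "infinite {t. e * t = t}" and a: "\<And>k. e * a k = a k"
    and z: "\<And>t. e * t = t \<Longrightarrow> (\<Sum>k\<le>n. a k * t ^ k) = 0" and k: "k \<le> n"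
  shows "a k = 0"
proof -
  define p where "p = (\<Sum>k\<le>n. Polynomial.monom (a k) k)"
  have "p = 0"
  proof (rule poly_zero_of_infinite_roots[OF inf])
    show "Polynomial.smult e p = p" unfolding p_def by (rule poly_eqI) (simp add: coeff_sum a)
    show "poly p t = 0" if "t \<in> {t. e * t = t}" for t
      using z that by (simp add: p_def poly_sum poly_monom)
  qed simp
  moreover have "Polynomial.coeff p k = a k" using k by (simp add: p_def coeff_sum)
  ultimately show ?thesis by simp
qed

text \<open>The exponents of one variable after the other are fixed to those of
  \<open>\<beta>\<close>. As a polynomial in the value at one variable, the sum has coefficients
  that collect the terms with a given exponent there; \<open>power_sum_zero\<close> makes each of
  them 0.\<close>

lemma monomials_independent:
  assumes inf: "infinite {t. e * t = t}" and I: "finite I" and A: "finite A" "A \<subseteq> I \<rightarrow>\<^sub>E UNIV"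
    and c: "\<And>\<alpha>. e * c \<alpha> = c \<alpha>"
    and z: "\<And>v. (\<And>i. i \<in> I \<Longrightarrow> e * v i = v i) \<Longrightarrow> (\<Sum>\<alpha>\<in>A. c \<alpha> * (\<Prod>i\<in>I. v i ^ \<alpha> i)) = 0"
    and \<beta>: "\<beta> \<in> A"
  shows "c (\<beta> :: 'i \<Rightarrow> nat) = 0"
proof -
  \<comment> \<open>\<open>I'\<close> holds the variables whose exponents are already fixed. For
    \<open>I' = I\<close> the term of \<open>\<beta>\<close> alone is left.\<close>
  have main: "(\<Sum>\<alpha>\<in>{\<alpha>\<in>A. \<forall>i\<in>I'. \<alpha> i = \<beta> i}. c \<alpha> * (\<Prod>i\<in>I. v i ^ \<alpha> i)) = 0"
    if "I' \<subseteq> I" "finite I'" "\<And>i. i \<in> I \<Longrightarrow> e * v i = v i" for I' v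
    using that(2,1,3)
  proof (induction I' arbitrary: v rule: finite_induct)
    case empty
    then show ?case using z by simp
  next
    case (insert i I')
    let ?B = "{\<alpha>\<in>A. \<forall>i\<in>I'. \<alpha> i = \<beta> i}"
    have finB: "finite ?B" using A by simp
    define n where "n = (\<Sum>\<alpha>\<in>?B. \<alpha> i) + \<beta> i"
    have ai: "\<alpha> i \<le> n" if "\<alpha> \<in> ?B" for \<alpha>
    proof -
      have "\<alpha> i \<le> (\<Sum>\<alpha>\<in>?B. \<alpha> i)" using finB that by (intro member_le_sum) auto
      then show ?thesis by (simp add: n_def)
    qed
    define a where "a k = (\<Sum>\<alpha>\<in>{\<alpha>\<in>?B. \<alpha> i = k}. c \<alpha> * (\<Prod>j\<in>I - {i}. v j ^ \<alpha> j))" for k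
    have iI: "i \<in> I" using insert.prems by simp
    have split: "(\<Prod>j\<in>I. w j ^ \<alpha> j) = w i ^ \<alpha> i * (\<Prod>j\<in>I - {i}. w j ^ \<alpha> j)" for w and \<alpha> :: "'i \<Rightarrow> nat"
      using I iI by (rule prod.remove)
    have ak: "e * a k = a k" for k by (simp add: a_def sum_distrib_left mult.assoc[symmetric] c)
    have "(\<Sum>k\<le>n. a k * t ^ k) = 0" if t: "e * t = t" for t
    proof -
      have "(\<Sum>k\<le>n. a k * t ^ k) = (\<Sum>k\<le>n. \<Sum>\<alpha>\<in>{\<alpha>\<in>?B. \<alpha> i = k}. c \<alpha> * (\<Prod>j\<in>I. (v(i := t)) j ^ \<alpha> j))"
        unfolding a_def sum_distrib_right by (intro sum.cong refl) (simp add: split mult_ac)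
      also have "\<dots> = (\<Sum>\<alpha>\<in>?B. c \<alpha> * (\<Prod>j\<in>I. (v(i := t)) j ^ \<alpha> j))"
        using finB ai by (intro sum.group) auto
      also have "\<dots> = 0" using insert.prems t by (intro insert.IH) auto
      finally show ?thesis .
    qed
    then have "a (\<beta> i) = 0" by (rule power_sum_zero[OF inf ak]) (simp_all add: n_def)
    moreover have "(\<Sum>\<alpha>\<in>{\<alpha>\<in>A. \<forall>j\<in>insert i I'. \<alpha> j = \<beta> j}. c \<alpha> * (\<Prod>i\<in>I. v i ^ \<alpha> i)) = v i ^ \<beta> i * a (\<beta> i)"
      unfolding a_def sum_distrib_left by (rule sum.cong) (auto simp: split mult_ac)
    ultimately show ?case by simp
  qed
  have "{\<alpha>\<in>A. \<forall>i\<in>I. \<alpha> i = \<beta> i} = {\<beta>}"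
  proof
    show "{\<alpha>\<in>A. \<forall>i\<in>I. \<alpha> i = \<beta> i} \<subseteq> {\<beta>}"
    proof
      fix \<alpha> assume a: "\<alpha> \<in> {\<alpha>\<in>A. \<forall>i\<in>I. \<alpha> i = \<beta> i}"
      have "\<alpha> = \<beta>" by (rule PiE_ext[of _ I "\<lambda>_. UNIV"]) (use a A \<beta> in auto)
      then show "\<alpha> \<in> {\<beta>}" by simp
    qed
  qed (use \<beta> in simp)
  \<comment> \<open>Evaluation at the point with all coordinates \<open>e\<close> leaves the
    coefficient itself.\<close>
  then have "c \<beta> * (\<Prod>i\<in>I. e ^ \<beta> i) = 0" using main[of I "\<lambda>_. e"] I idem by simp
  moreover have "c \<beta> * (\<Prod>i\<in>J. e ^ \<beta> i) = c \<beta>" if "finite J" for J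
    using that
  proof (induction J rule: finite_induct)
    case (insert i J)
    have "c \<beta> * e ^ k = c \<beta>" for k
      by (induction k) (simp_all add: c mult.commute mult.left_commute)
    then show ?case using insert by (simp flip: mult.assoc)
  qed simp
  ultimately show ?thesis using I by simp
qed

end

section \<open>Polynomial functions and their coefficients\<close>

locale poly_rep = field K for K :: "('k, 'l) ring_scheme" (structure) +
  fixes I :: "'i set"
  assumes infK: "infinite (carrier K)" and finI: "finite I"
begin

abbreviation E :: "'k \<Rightarrow> 'k fam" where "E \<equiv> emb (plain_ring K)"
abbreviation cp :: "'k fam \<Rightarrow> 'k" where "cp \<equiv> comp (plain_ring K)"
abbreviation ee :: "'k fam" where "ee \<equiv> E \<one>"

lemma field_pl: "field (plain_ring K)" by (rule field_plain_ring) unfold_locales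

lemma cring_pl: "cring (plain_ring K)" by (rule cring_plain_ring) unfold_locales

sublocale F: idem_field ee
  using idem_field_idm[OF field_pl] by simp

lemma E_simps:
  shows "E \<zero> = 0" "x \<in> carrier K \<Longrightarrow> y \<in> carrier K \<Longrightarrow> E (x \<oplus> y) = E x + E y"
    "x \<in> carrier K \<Longrightarrow> y \<in> carrier K \<Longrightarrow> E (x \<otimes> y) = E x * E y" "x \<in> carrier K \<Longrightarrow> ee * E x = E x"
    "x \<in> carrier K \<Longrightarrow> cp (E x) = x" "x \<in> carrier K \<Longrightarrow> y \<in> carrier K \<Longrightarrow> E x = E y \<longleftrightarrow> x = y"
  using emb_zero[OF cring_pl] emb_add[OF cring_pl] emb_mult[OF cring_pl] idm_emb[OF cring_pl]
    emb_comp[OF cring_pl cring_pl] emb_inject[OF cring_pl] by simp_all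

lemma cp_closed: "cp z \<in> carrier K" using comp_closed[OF cring_pl] by simp

lemma E_cp: "ee * z = z \<Longrightarrow> E (cp z) = z" using idm_mult[OF cring_pl, of z] by simp

lemma infinite_E: "infinite {t. ee * t = t}"
proof
  assume "finite {t. ee * t = t}"
  moreover have "E ` carrier K \<subseteq> {t. ee * t = t}" using E_simps(4) by auto
  ultimately have "finite (E ` carrier K)" by (rule finite_subset[rotated])
  moreover have "inj_on E (carrier K)" by (auto simp: inj_on_def E_simps(6))
  ultimately show False using infK finite_imageD by blast
qed

lemma E_finsum: "finite A \<Longrightarrow> (\<And>a. a \<in> A \<Longrightarrow> f a \<in> carrier K) \<Longrightarrow> E (\<Oplus>a\<in>A. f a) = (\<Sum>a\<in>A. E (f a))"
proof (induction A rule: finite_induct)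
  case (insert a A)
  then have "(\<Oplus>a\<in>insert a A. f a) = f a \<oplus> (\<Oplus>a\<in>A. f a)" by (intro finsum_insert) auto
  moreover have "(\<Oplus>a\<in>A. f a) \<in> carrier K" using insert by (intro finsum_closed) auto
  ultimately show ?case using insert by (simp add: E_simps)
qed (simp add: E_simps)

lemma E_pow: "x \<in> carrier K \<Longrightarrow> E (x [^] (n::nat)) = ee * E x ^ n"
proof (induction n)
  case (Suc n)
  then show ?case by (simp add: E_simps mult_ac)
qed simp

lemma E_finprod:
  "finite A \<Longrightarrow> (\<And>a. a \<in> A \<Longrightarrow> f a \<in> carrier K) \<Longrightarrow> E (\<Otimes>a\<in>A. f a) = ee * (\<Prod>a\<in>A. E (f a))"
proof (induction A rule: finite_induct)
  case (insert a A)
  then have "(\<Otimes>a\<in>insert a A. f a) = f a \<otimes> (\<Otimes>a\<in>A. f a)" by (intro finprod_insert) auto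
  moreover have "(\<Otimes>a\<in>A. f a) \<in> carrier K" using insert by (intro finprod_closed) auto
  ultimately show ?case using insert by (simp add: E_simps mult_ac)
qed simp

abbreviation V :: "('i \<Rightarrow> 'k) set" where "V \<equiv> coord_space K I"

lemma V_closed: "v \<in> V \<Longrightarrow> i \<in> I \<Longrightarrow> v i \<in> carrier K" by (auto simp: coord_space_def)

definition mono :: "('i \<Rightarrow> nat) \<Rightarrow> ('i \<Rightarrow> 'k) \<Rightarrow> 'k fam" where
  "mono \<alpha> v = (\<Prod>i\<in>I. E (v i) ^ \<alpha> i)"

definition supp :: "(('i \<Rightarrow> nat) \<Rightarrow> 'k fam) \<Rightarrow> ('i \<Rightarrow> nat) set" where
  "supp c = {\<alpha>. c \<alpha> \<noteq> 0}"

text \<open>\<open>c\<close> is the coefficient function of \<open>p\<close>, with values in the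
  copy of \<open>K\<close> inside the product ring. It is unique as \<open>K\<close> is infinite
  (\<open>rep_unique\<close>), so degrees and the group action can be read off from it.\<close>

definition rep :: "(('i \<Rightarrow> 'k) \<Rightarrow> 'k) \<Rightarrow> (('i \<Rightarrow> nat) \<Rightarrow> 'k fam) \<Rightarrow> bool" where
  "rep p c \<longleftrightarrow> (\<forall>\<alpha>. ee * c \<alpha> = c \<alpha>) \<and> finite (supp c) \<and> supp c \<subseteq> I \<rightarrow>\<^sub>E UNIV \<and> p \<in> V \<rightarrow>\<^sub>E carrier K \<and>
     (\<forall>v\<in>V. E (p v) = (\<Sum>\<alpha>\<in>supp c. c \<alpha> * mono \<alpha> v))"

lemma repD:
  assumes "rep p c"
  shows "ee * c \<alpha> = c \<alpha>" "finite (supp c)" "supp c \<subseteq> I \<rightarrow>\<^sub>E UNIV" "p \<in> V \<rightarrow>\<^sub>E carrier K"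
    "v \<in> V \<Longrightarrow> E (p v) = (\<Sum>\<alpha>\<in>supp c. c \<alpha> * mono \<alpha> v)" "v \<in> V \<Longrightarrow> p v \<in> carrier K"
  using assms unfolding rep_def by auto

lemma sum_supp: "finite A \<Longrightarrow> supp c \<subseteq> A \<Longrightarrow> (\<Sum>\<alpha>\<in>supp c. c \<alpha> * h \<alpha>) = (\<Sum>\<alpha>\<in>A. c \<alpha> * h \<alpha>)"
  by (rule sum.mono_neutral_left) (auto simp: supp_def)

lemma repI:
  assumes "\<And>\<alpha>. ee * c \<alpha> = c \<alpha>" "finite A" "supp c \<subseteq> A" "A \<subseteq> I \<rightarrow>\<^sub>E UNIV" "p \<in> V \<rightarrow>\<^sub>E carrier K"
    "\<And>v. v \<in> V \<Longrightarrow> E (p v) = (\<Sum>\<alpha>\<in>A. c \<alpha> * mono \<alpha> v)"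
  shows "rep p c"
  unfolding rep_def
proof (intro conjI allI ballI)
  show "E (p v) = (\<Sum>\<alpha>\<in>supp c. c \<alpha> * mono \<alpha> v)" if "v \<in> V" for v
    unfolding sum_supp[OF assms(2,3)] by (rule assms(6)[OF that])
qed (use assms(1,3,4,5) finite_subset[OF assms(3,2)] in simp_all)

lemma rep_eval: "rep p c \<Longrightarrow> finite A \<Longrightarrow> supp c \<subseteq> A \<Longrightarrow> v \<in> V \<Longrightarrow> E (p v) = (\<Sum>\<alpha>\<in>A. c \<alpha> * mono \<alpha> v)"
  by (simp only: repD(5) sum_supp)

lemma rep_exists:
  assumes "\<And>\<alpha>. ee * c \<alpha> = c \<alpha>" "finite (supp c)" "supp c \<subseteq> I \<rightarrow>\<^sub>E UNIV"
  obtains p where "rep p c"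
proof -
  define p where "p = (\<lambda>v\<in>V. cp (\<Sum>\<alpha>\<in>supp c. c \<alpha> * mono \<alpha> v))"
  have "rep p c"
  proof (rule repI[OF assms(1,2) subset_refl assms(3)])
    show "p \<in> V \<rightarrow>\<^sub>E carrier K" using cp_closed by (simp add: p_def)
    fix v assume v: "v \<in> V"
    have "ee * (\<Sum>\<alpha>\<in>supp c. c \<alpha> * mono \<alpha> v) = (\<Sum>\<alpha>\<in>supp c. c \<alpha> * mono \<alpha> v)"
      by (simp add: sum_distrib_left mult.assoc[symmetric] assms(1))
    then show "E (p v) = (\<Sum>\<alpha>\<in>supp c. c \<alpha> * mono \<alpha> v)" using v E_cp by (simp add: p_def)
  qed
  then show thesis by (rule that)
qed

lemma rep_function_unique:
  assumes "rep p c" "rep q c" shows "p = q"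
proof (rule PiE_ext[OF repD(4)[OF assms(1)] repD(4)[OF assms(2)]])
  fix v assume v: "v \<in> V"
  have "E (p v) = E (q v)" using repD(5)[OF assms(1) v] repD(5)[OF assms(2) v] by simp
  then show "p v = q v" using repD(6)[OF assms(1) v] repD(6)[OF assms(2) v] by (simp add: E_simps)
qed

lemma rep_unique:
  assumes p: "rep p c" and q: "rep p d" shows "c = d"
proof
  fix \<beta>
  let ?A = "supp c \<union> supp d"
  have fin: "finite ?A" and sub: "?A \<subseteq> I \<rightarrow>\<^sub>E UNIV" using repD[OF p] repD[OF q] by auto
  show "c \<beta> = d \<beta>"
  proof (cases "\<beta> \<in> ?A")
    case True
    have "c \<beta> - d \<beta> = 0"
    proof (rule F.monomials_independent[OF infinite_E finI fin sub _ _ True])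
      show "ee * (c \<alpha> - d \<alpha>) = c \<alpha> - d \<alpha>" for \<alpha> using repD(1)[OF p] repD(1)[OF q] by (simp add: right_diff_distrib)
      fix v :: "'i \<Rightarrow> 'k fam" assume v: "\<And>i. i \<in> I \<Longrightarrow> ee * v i = v i"
      define u where "u = (\<lambda>i\<in>I. cp (v i))"
      have u: "u \<in> V" using cp_closed by (auto simp: u_def coord_space_def)
      have m: "mono \<alpha> u = (\<Prod>i\<in>I. v i ^ \<alpha> i)" for \<alpha>
        unfolding mono_def using v by (intro prod.cong) (auto simp: u_def E_cp)
      have "(\<Sum>\<alpha>\<in>?A. c \<alpha> * mono \<alpha> u) = (\<Sum>\<alpha>\<in>?A. d \<alpha> * mono \<alpha> u)"
        using rep_eval[OF p fin _ u] rep_eval[OF q fin _ u] by simp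
      then show "(\<Sum>\<alpha>\<in>?A. (c \<alpha> - d \<alpha>) * (\<Prod>i\<in>I. v i ^ \<alpha> i)) = 0"
        by (simp add: m left_diff_distrib sum_subtractf)
    qed
    then show ?thesis by simp
  qed (simp add: supp_def)
qed

lemma rep_zero: "rep (\<lambda>v\<in>V. \<zero>) (\<lambda>_. 0)"
  by (rule repI[of _ "{}"]) (auto simp: supp_def E_simps)

lemma rep_add:
  assumes p: "rep p c" and q: "rep q d"
  shows "rep (\<lambda>v\<in>V. p v \<oplus> q v) (\<lambda>\<alpha>. c \<alpha> + d \<alpha>)"
proof (rule repI[of _ "supp c \<union> supp d"])
  have fin: "finite (supp c \<union> supp d)" using repD[OF p] repD[OF q] by auto
  then show "finite (supp c \<union> supp d)" .
  show "E ((\<lambda>v\<in>V. p v \<oplus> q v) v) = (\<Sum>\<alpha>\<in>supp c \<union> supp d. (c \<alpha> + d \<alpha>) * mono \<alpha> v)" if v: "v \<in> V" for v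
    using rep_eval[OF p fin _ v] rep_eval[OF q fin _ v] repD(6)[OF p v] repD(6)[OF q v] v
    by (simp add: E_simps distrib_right sum.distrib)
qed (use repD[OF p] repD[OF q] in \<open>auto simp: supp_def distrib_left\<close>)

lemma rep_smult:
  assumes p: "rep p c" and a: "a \<in> carrier K"
  shows "rep (\<lambda>v\<in>V. a \<otimes> p v) (\<lambda>\<alpha>. E a * c \<alpha>)"
proof (rule repI[of _ "supp c"])
  show "E ((\<lambda>v\<in>V. a \<otimes> p v) v) = (\<Sum>\<alpha>\<in>supp c. E a * c \<alpha> * mono \<alpha> v)" if v: "v \<in> V" for v
    using repD(5)[OF p v] repD(6)[OF p v] v a by (simp add: E_simps sum_distrib_left mult.assoc)
qed (use repD[OF p] a in \<open>auto simp: supp_def mult.left_commute[of ee]\<close>)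

definition eadd :: "('i \<Rightarrow> nat) \<Rightarrow> ('i \<Rightarrow> nat) \<Rightarrow> 'i \<Rightarrow> nat" where
  "eadd \<alpha> \<beta> = (\<lambda>i\<in>I. \<alpha> i + \<beta> i)"

lemma mono_eadd: "mono (eadd \<alpha> \<beta>) v = mono \<alpha> v * mono \<beta> v"
  by (simp add: mono_def eadd_def power_add prod.distrib cong: prod.cong)

definition cmult :: "(('i \<Rightarrow> nat) \<Rightarrow> 'k fam) \<Rightarrow> (('i \<Rightarrow> nat) \<Rightarrow> 'k fam) \<Rightarrow> ('i \<Rightarrow> nat) \<Rightarrow> 'k fam" where
  "cmult c d \<gamma> = (\<Sum>(\<alpha>, \<beta>)\<in>{p \<in> supp c \<times> supp d. eadd (fst p) (snd p) = \<gamma>}. c \<alpha> * d \<beta>)"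

lemma supp_cmult: "supp (cmult c d) \<subseteq> (\<lambda>p. eadd (fst p) (snd p)) ` (supp c \<times> supp d)"
proof
  fix \<gamma> assume \<gamma>: "\<gamma> \<in> supp (cmult c d)"
  show "\<gamma> \<in> (\<lambda>p. eadd (fst p) (snd p)) ` (supp c \<times> supp d)"
  proof (rule ccontr)
    assume "\<gamma> \<notin> (\<lambda>p. eadd (fst p) (snd p)) ` (supp c \<times> supp d)"
    then have "{p \<in> supp c \<times> supp d. eadd (fst p) (snd p) = \<gamma>} = {}" by blast
    then have "cmult c d \<gamma> = 0" unfolding cmult_def by (simp only: sum.empty)
    then show False using \<gamma> by (simp add: supp_def)
  qed
qed

text \<open>The additive map \<open>H\<close> covers two uses: the identity, to evaluate a product
  of polynomials, and a map of the coefficients into another field, to apply a functional to the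
  product.\<close>

lemma sum_cmult:
  assumes "finite (supp c)" "finite (supp d)" and h: "\<And>x y. H (x + y) = H x + (H y :: 'z::comm_ring_1)"
  shows "(\<Sum>\<gamma>\<in>(\<lambda>p. eadd (fst p) (snd p)) ` (supp c \<times> supp d). H (cmult c d \<gamma>) * w \<gamma>) =
    (\<Sum>\<alpha>\<in>supp c. \<Sum>\<beta>\<in>supp d. H (c \<alpha> * d \<beta>) * w (eadd \<alpha> \<beta>))"
proof -
  have H0: "H 0 = 0" using h[of 0 0] by simp
  have Hs: "H (\<Sum>x\<in>B. g x) = (\<Sum>x\<in>B. H (g x))" for g and B :: "(('i \<Rightarrow> nat) \<times> ('i \<Rightarrow> nat)) set"
    by (induction B rule: infinite_finite_induct) (simp_all add: H0 h)
  let ?T = "(\<lambda>p. eadd (fst p) (snd p)) ` (supp c \<times> supp d)"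
  have "(\<Sum>\<gamma>\<in>?T. H (cmult c d \<gamma>) * w \<gamma>) =
      (\<Sum>\<gamma>\<in>?T. \<Sum>p\<in>{p \<in> supp c \<times> supp d. eadd (fst p) (snd p) = \<gamma>}. H (c (fst p) * d (snd p)) * w (eadd (fst p) (snd p)))"
    unfolding cmult_def Hs sum_distrib_right by (intro sum.cong refl) (auto simp: case_prod_beta)
  also have "\<dots> = (\<Sum>p\<in>supp c \<times> supp d. H (c (fst p) * d (snd p)) * w (eadd (fst p) (snd p)))"
    using assms by (intro sum.group) auto
  finally show ?thesis by (simp add: sum.cartesian_product case_prod_beta)
qed

lemma rep_mult:
  assumes p: "rep p c" and q: "rep q d"
  shows "rep (\<lambda>v\<in>V. p v \<otimes> q v) (cmult c d)"
proof (rule repI[OF _ _ supp_cmult])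
  have fin: "finite (supp c)" "finite (supp d)" using repD[OF p] repD[OF q] by auto
  show "ee * cmult c d \<gamma> = cmult c d \<gamma>" for \<gamma>
    unfolding cmult_def sum_distrib_left case_prod_beta by (simp add: mult.assoc[symmetric] repD(1)[OF p])
  show "finite ((\<lambda>p. eadd (fst p) (snd p)) ` (supp c \<times> supp d))" using fin by simp
  show "(\<lambda>p. eadd (fst p) (snd p)) ` (supp c \<times> supp d) \<subseteq> I \<rightarrow>\<^sub>E UNIV" by (auto simp: eadd_def)
  show "(\<lambda>v\<in>V. p v \<otimes> q v) \<in> V \<rightarrow>\<^sub>E carrier K" using repD(6)[OF p] repD(6)[OF q] by simp
  fix v assume v: "v \<in> V"
  have "E ((\<lambda>v\<in>V. p v \<otimes> q v) v) = (\<Sum>\<alpha>\<in>supp c. \<Sum>\<beta>\<in>supp d. c \<alpha> * d \<beta> * mono (eadd \<alpha> \<beta>) v)"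
    using v repD(5,6)[OF p v] repD(5,6)[OF q v]
    by (simp add: E_simps sum_product mono_eadd mult_ac)
  then show "E ((\<lambda>v\<in>V. p v \<otimes> q v) v) =
      (\<Sum>\<gamma>\<in>(\<lambda>p. eadd (fst p) (snd p)) ` (supp c \<times> supp d). cmult c d \<gamma> * mono \<gamma> v)"
    using sum_cmult[OF fin, of "\<lambda>x. x" "\<lambda>\<gamma>. mono \<gamma> v"] by simp
qed

lemma rep_one: "rep (\<lambda>v\<in>V. \<one>) (\<lambda>\<alpha>. if \<alpha> = (\<lambda>i\<in>I. 0) then ee else 0)"
proof (rule repI[of _ "{\<lambda>i\<in>I. 0}"])
  show "ee * (if \<alpha> = (\<lambda>i\<in>I. 0) then ee else 0) = (if \<alpha> = (\<lambda>i\<in>I. 0) then ee else 0)" for \<alpha> :: "'i \<Rightarrow> nat"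
    by (simp add: F.idem)
qed (auto simp: supp_def mono_def)

lemma finite_exponents: "finite (exponents I {..n})" "finite (exponents I {n})"
proof -
  have "exponents I {..n} \<subseteq> I \<rightarrow>\<^sub>E {..n}"
  proof
    fix \<alpha> assume a: "\<alpha> \<in> exponents I {..n}"
    have "\<alpha> i \<le> n" if i: "i \<in> I" for i
    proof -
      have "\<alpha> i \<le> (\<Sum>i\<in>I. \<alpha> i)" using finI i by (intro member_le_sum) auto
      then show ?thesis using a by (simp add: exponents_def)
    qed
    then show "\<alpha> \<in> I \<rightarrow>\<^sub>E {..n}" using a by (auto simp: exponents_def PiE_iff)
  qed
  moreover have "finite (I \<rightarrow>\<^sub>E {..n})" using finI by (intro finite_PiE) auto
  ultimately show 1: "finite (exponents I {..n})" by (rule finite_subset)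
  show "finite (exponents I {n})" by (rule finite_subset[OF _ 1]) (auto simp: exponents_def)
qed

lemma rep_poly_fun:
  assumes fin: "finite (exponents I N)" and c: "c \<in> exponents I N \<rightarrow> carrier K"
  shows "rep (poly_fun K I N c) (\<lambda>\<alpha>. if \<alpha> \<in> exponents I N then E (c \<alpha>) else 0)"
proof (rule repI[OF _ fin])
  have m: "(\<Otimes>i\<in>I. v i [^] \<alpha> i) \<in> carrier K" if "v \<in> V" for v and \<alpha> :: "'i \<Rightarrow> nat"
    using V_closed[OF that] by (intro finprod_closed) auto
  have cm: "c \<alpha> \<otimes> (\<Otimes>i\<in>I. v i [^] \<alpha> i) \<in> carrier K" if "v \<in> V" "\<alpha> \<in> exponents I N" for v \<alpha>
    using m[OF that(1)] c that(2) by auto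
  have Em: "c' * E (\<Otimes>i\<in>I. v i [^] \<alpha> i) = c' * mono \<alpha> v" if v: "v \<in> V" and c': "ee * c' = c'" for v c' and \<alpha> :: "'i \<Rightarrow> nat"
  proof -
    have "E (\<Otimes>i\<in>I. v i [^] \<alpha> i) = ee * (\<Prod>i\<in>I. ee * E (v i) ^ \<alpha> i)"
      using V_closed[OF v] by (subst E_finprod[OF finI]) (auto simp: E_pow)
    also have "\<dots> = ee * mono \<alpha> v"
    proof -
      \<comment> \<open>The image of a power carries a factor \<open>ee\<close>, as the power with
        exponent 0 goes to \<open>ee\<close> and not to 1. A single \<open>ee\<close> in front
        absorbs all of them.\<close>
      have "ee * (\<Prod>i\<in>J. ee * E (v i) ^ \<alpha> i) = ee * (\<Prod>i\<in>J. E (v i) ^ \<alpha> i)" if "finite J" for J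
        using that
      proof (induction J rule: finite_induct)
        case (insert i J)
        have "ee * (\<Prod>i\<in>insert i J. ee * E (v i) ^ \<alpha> i) = (ee * E (v i) ^ \<alpha> i) * (ee * (\<Prod>i\<in>J. ee * E (v i) ^ \<alpha> i))"
          using insert.hyps by (simp add: mult_ac)
        also have "\<dots> = (ee * ee) * (E (v i) ^ \<alpha> i * (\<Prod>i\<in>J. E (v i) ^ \<alpha> i))"
          unfolding insert.IH by (simp only: mult_ac)
        finally show ?case using insert.hyps by (simp add: F.idem)
      qed simp
      then show ?thesis using finI by (simp add: mono_def)
    qed
    finally show ?thesis using c' by (simp add: mult.left_commute[of c'] mult.assoc[symmetric]) (simp add: mult.commute[of c'] mult.assoc)
  qed
  show "poly_fun K I N c \<in> V \<rightarrow>\<^sub>E carrier K"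
    unfolding poly_fun_def using cm by (auto intro!: finsum_closed)
  show "ee * (if \<alpha> \<in> exponents I N then E (c \<alpha>) else 0) = (if \<alpha> \<in> exponents I N then E (c \<alpha>) else 0)" for \<alpha>
    by (simp add: E_simps(4) funcset_mem[OF c])
  fix v assume v: "v \<in> V"
  have "E (poly_fun K I N c v) = (\<Sum>\<alpha>\<in>exponents I N. E (c \<alpha> \<otimes> (\<Otimes>i\<in>I. v i [^] \<alpha> i)))"
    unfolding poly_fun_def using v cm[OF v] by (simp add: E_finsum[OF fin])
  also have "\<dots> = (\<Sum>\<alpha>\<in>exponents I N. (if \<alpha> \<in> exponents I N then E (c \<alpha>) else 0) * mono \<alpha> v)"
    using c m[OF v] Em[OF v] by (intro sum.cong) (auto simp: E_simps Pi_iff)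
  finally show "E (poly_fun K I N c v) = (\<Sum>\<alpha>\<in>exponents I N. (if \<alpha> \<in> exponents I N then E (c \<alpha>) else 0) * mono \<alpha> v)" .
qed (auto simp: supp_def exponents_def)

lemma rep_imp_poly_fun:
  assumes fin: "finite (exponents I N)" and p: "rep p c" and s: "supp c \<subseteq> exponents I N"
  shows "p = poly_fun K I N (\<lambda>\<alpha>. cp (c \<alpha>))"
proof (rule rep_function_unique[OF p])
  have "(\<lambda>\<alpha>. if \<alpha> \<in> exponents I N then E (cp (c \<alpha>)) else 0) = c"
    using s E_cp[OF repD(1)[OF p]] by (auto simp: supp_def fun_eq_iff)
  then show "rep (poly_fun K I N (\<lambda>\<alpha>. cp (c \<alpha>))) c"
    using rep_poly_fun[OF fin, of "\<lambda>\<alpha>. cp (c \<alpha>)"] cp_closed by simp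
qed

abbreviation P :: "('k, ('i \<Rightarrow> 'k) \<Rightarrow> 'k) module" where "P \<equiv> poly_fun_ring K I"

lemma P_carrier: "carrier P = {p. \<exists>c. rep p c}"
proof
  show "carrier P \<subseteq> {p. \<exists>c. rep p c}"
    using rep_poly_fun[OF finite_exponents(1)] by (auto simp: poly_fun_ring_def)
  show "{p. \<exists>c. rep p c} \<subseteq> carrier P"
  proof clarify
    fix p c assume p: "rep p c"
    define n where "n = (\<Sum>\<alpha>\<in>supp c. \<Sum>i\<in>I. \<alpha> i)"
    have "supp c \<subseteq> exponents I {..n}"
    proof
      fix \<alpha> assume a: "\<alpha> \<in> supp c"
      have "(\<Sum>i\<in>I. \<alpha> i) \<le> n" unfolding n_def
        using repD(2)[OF p] a by (intro member_le_sum) auto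
      then show "\<alpha> \<in> exponents I {..n}" using repD(3)[OF p] a by (auto simp: exponents_def)
    qed
    then have "p = poly_fun K I {..n} (\<lambda>\<alpha>. cp (c \<alpha>))" by (rule rep_imp_poly_fun[OF finite_exponents(1) p])
    then show "p \<in> carrier P" using cp_closed by (auto simp: poly_fun_ring_def)
  qed
qed

lemma homog_iff: "p \<in> homog_poly_funs K I d \<longleftrightarrow> (\<exists>c. rep p c \<and> supp c \<subseteq> exponents I {d})"
proof
  assume "p \<in> homog_poly_funs K I d"
  then obtain c where c: "p = poly_fun K I {d} c" "c \<in> exponents I {d} \<rightarrow> carrier K"
    by (auto simp: homog_poly_funs_def)
  then show "\<exists>c. rep p c \<and> supp c \<subseteq> exponents I {d}"
    using rep_poly_fun[OF finite_exponents(2) c(2)] by (intro exI conjI) (auto simp: supp_def split: if_splits)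
next
  assume "\<exists>c. rep p c \<and> supp c \<subseteq> exponents I {d}"
  then obtain c where "p = poly_fun K I {d} (\<lambda>\<alpha>. cp (c \<alpha>))"
    using rep_imp_poly_fun[OF finite_exponents(2)] by blast
  then show "p \<in> homog_poly_funs K I d" using cp_closed by (auto simp: homog_poly_funs_def)
qed

lemma P_simps [simp]:
  "p \<otimes>\<^bsub>P\<^esub> q = (\<lambda>v\<in>V. p v \<otimes> q v)" "\<one>\<^bsub>P\<^esub> = (\<lambda>v\<in>V. \<one>)" "\<zero>\<^bsub>P\<^esub> = (\<lambda>v\<in>V. \<zero>)"
  "p \<oplus>\<^bsub>P\<^esub> q = (\<lambda>v\<in>V. p v \<oplus> q v)" "a \<odot>\<^bsub>P\<^esub> p = (\<lambda>v\<in>V. a \<otimes> p v)"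
  by (simp_all add: poly_fun_ring_def)

lemma P_closed:
  "p \<in> carrier P \<Longrightarrow> q \<in> carrier P \<Longrightarrow> (\<lambda>v\<in>V. p v \<oplus> q v) \<in> carrier P"
  "p \<in> carrier P \<Longrightarrow> q \<in> carrier P \<Longrightarrow> (\<lambda>v\<in>V. p v \<otimes> q v) \<in> carrier P"
  "a \<in> carrier K \<Longrightarrow> p \<in> carrier P \<Longrightarrow> (\<lambda>v\<in>V. a \<otimes> p v) \<in> carrier P"
  "(\<lambda>v\<in>V. \<zero>) \<in> carrier P" "(\<lambda>v\<in>V. \<one>) \<in> carrier P"
proof -
  show "p \<in> carrier P \<Longrightarrow> q \<in> carrier P \<Longrightarrow> (\<lambda>v\<in>V. p v \<oplus> q v) \<in> carrier P"
    unfolding P_carrier mem_Collect_eq by (elim exE) (rule exI, rule rep_add)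
  show "p \<in> carrier P \<Longrightarrow> q \<in> carrier P \<Longrightarrow> (\<lambda>v\<in>V. p v \<otimes> q v) \<in> carrier P"
    unfolding P_carrier mem_Collect_eq by (elim exE) (rule exI, rule rep_mult)
  show "a \<in> carrier K \<Longrightarrow> p \<in> carrier P \<Longrightarrow> (\<lambda>v\<in>V. a \<otimes> p v) \<in> carrier P"
    unfolding P_carrier mem_Collect_eq by (elim exE) (rule exI, rule rep_smult)
  show "(\<lambda>v\<in>V. \<zero>) \<in> carrier P" unfolding P_carrier mem_Collect_eq by (rule exI, rule rep_zero)
  show "(\<lambda>v\<in>V. \<one>) \<in> carrier P" unfolding P_carrier mem_Collect_eq by (rule exI, rule rep_one)
qed

lemma P_value: "p \<in> carrier P \<Longrightarrow> v \<in> V \<Longrightarrow> p v \<in> carrier K" "p \<in> carrier P \<Longrightarrow> p \<in> V \<rightarrow>\<^sub>E carrier K"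
  unfolding P_carrier mem_Collect_eq by (elim exE, rule repD(6), assumption+) (elim exE, rule repD(4))

lemma P_restrict: "p \<in> carrier P \<Longrightarrow> (\<lambda>v\<in>V. p v) = p"
  by (rule PiE_restrict) (rule P_value(2))

lemma P_cring: "cring P"
proof (rule cringI)
  show "abelian_group P"
  proof (rule abelian_groupI)
    fix p assume p: "p \<in> carrier P"
    have "(\<lambda>v\<in>V. (\<lambda>v\<in>V. \<ominus> \<one> \<otimes> p v) v \<oplus> p v) = (\<lambda>v\<in>V. \<zero>)"
      using P_value(1)[OF p] by (intro restrict_ext) (simp add: l_minus l_neg)
    then show "\<exists>q\<in>carrier P. q \<oplus>\<^bsub>P\<^esub> p = \<zero>\<^bsub>P\<^esub>"
      using P_closed(3)[OF _ p, of "\<ominus> \<one>"] by (intro bexI[of _ "\<lambda>v\<in>V. \<ominus> \<one> \<otimes> p v"]) simp_all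
    show "\<zero>\<^bsub>P\<^esub> \<oplus>\<^bsub>P\<^esub> p = p"
      using P_value(1)[OF p] P_restrict[OF p] by (simp cong: restrict_cong)
  next
    fix p q assume p: "p \<in> carrier P" and q: "q \<in> carrier P"
    show "p \<oplus>\<^bsub>P\<^esub> q = q \<oplus>\<^bsub>P\<^esub> p"
      using P_value(1)[OF p] P_value(1)[OF q] by (simp add: a_comm cong: restrict_cong)
    fix r assume r: "r \<in> carrier P"
    show "p \<oplus>\<^bsub>P\<^esub> q \<oplus>\<^bsub>P\<^esub> r = p \<oplus>\<^bsub>P\<^esub> (q \<oplus>\<^bsub>P\<^esub> r)"
      using P_value(1)[OF p] P_value(1)[OF q] P_value(1)[OF r] by (simp add: a_assoc cong: restrict_cong)
  qed (use P_closed in simp_all)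
  show "comm_monoid P"
  proof (rule comm_monoidI)
    fix p assume p: "p \<in> carrier P"
    show "\<one>\<^bsub>P\<^esub> \<otimes>\<^bsub>P\<^esub> p = p"
      using P_value(1)[OF p] P_restrict[OF p] by (simp cong: restrict_cong)
    fix q assume q: "q \<in> carrier P"
    show "p \<otimes>\<^bsub>P\<^esub> q = q \<otimes>\<^bsub>P\<^esub> p"
      using P_value(1)[OF p] P_value(1)[OF q] by (simp add: m_comm cong: restrict_cong)
    fix r assume r: "r \<in> carrier P"
    show "p \<otimes>\<^bsub>P\<^esub> q \<otimes>\<^bsub>P\<^esub> r = p \<otimes>\<^bsub>P\<^esub> (q \<otimes>\<^bsub>P\<^esub> r)"
      using P_value(1)[OF p] P_value(1)[OF q] P_value(1)[OF r] by (simp add: m_assoc cong: restrict_cong)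
  qed (use P_closed in simp_all)
  fix p q r assume p: "p \<in> carrier P" and q: "q \<in> carrier P" and r: "r \<in> carrier P"
  show "(p \<oplus>\<^bsub>P\<^esub> q) \<otimes>\<^bsub>P\<^esub> r = p \<otimes>\<^bsub>P\<^esub> r \<oplus>\<^bsub>P\<^esub> q \<otimes>\<^bsub>P\<^esub> r"
    using P_value(1)[OF p] P_value(1)[OF q] P_value(1)[OF r] by (simp add: l_distr cong: restrict_cong)
qed

end

text \<open>A group action is a homomorphism into the group of extensional bijections. Bijectivity
  comes from the inverse group element, so only closure, extensionality and the two action laws have
  to be supplied.\<close>

lemma group_actionI:
  assumes G: "group G" and ext: "\<And>g. g \<in> carrier G \<Longrightarrow> \<phi> g \<in> extensional S"
    and cl: "\<And>g x. g \<in> carrier G \<Longrightarrow> x \<in> S \<Longrightarrow> \<phi> g x \<in> S"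
    and one: "\<And>x. x \<in> S \<Longrightarrow> \<phi> \<one>\<^bsub>G\<^esub> x = x"
    and mult: "\<And>g h x. g \<in> carrier G \<Longrightarrow> h \<in> carrier G \<Longrightarrow> x \<in> S \<Longrightarrow> \<phi> (g \<otimes>\<^bsub>G\<^esub> h) x = \<phi> g (\<phi> h x)"
  shows "group_action G S \<phi>"
proof -
  interpret G: group G by (rule G)
  have inv: "\<phi> (inv\<^bsub>G\<^esub> g) (\<phi> g x) = x" "\<phi> g (\<phi> (inv\<^bsub>G\<^esub> g) x) = x" if "g \<in> carrier G" "x \<in> S" for g x
    using mult[of "inv\<^bsub>G\<^esub> g" g x] mult[of g "inv\<^bsub>G\<^esub> g" x] that one by simp_all
  have bij: "\<phi> g \<in> Bij S" if g: "g \<in> carrier G" for g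
  proof -
    have "bij_betw (\<phi> g) S S"
      by (rule bij_betw_byWitness[of _ "\<phi> (inv\<^bsub>G\<^esub> g)"]) (use inv cl g in auto)
    then show ?thesis using ext[OF g] by (simp add: Bij_def)
  qed
  have "\<phi> (g \<otimes>\<^bsub>G\<^esub> h) = compose S (\<phi> g) (\<phi> h)" if g: "g \<in> carrier G" and h: "h \<in> carrier G" for g h
  proof (rule extensionalityI[of _ S])
    show "\<phi> (g \<otimes>\<^bsub>G\<^esub> h) \<in> extensional S" using ext g h by simp
    show "compose S (\<phi> g) (\<phi> h) \<in> extensional S" by simp
    show "\<phi> (g \<otimes>\<^bsub>G\<^esub> h) x = compose S (\<phi> g) (\<phi> h) x" if "x \<in> S" for x
      using mult[OF g h that] that by (simp add: compose_def)
  qed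
  then have "\<phi> \<in> hom G (BijGroup S)"
    using bij by (auto simp: hom_def BijGroup_def)
  then show ?thesis
    by (intro group_action.intro group_hom.intro group_hom_axioms.intro G group_BijGroup)
qed

section \<open>Grading and generators of the ring of polynomial functions\<close>

context poly_rep
begin

lemma P_algebra: "algebra K P"
proof (rule algebraI)
  show "cring K" by unfold_locales
  show "cring P" by (rule P_cring)
  fix a p assume a: "a \<in> carrier K" and p: "p \<in> carrier P"
  show "a \<odot>\<^bsub>P\<^esub> p \<in> carrier P" using P_closed(3)[OF a p] by simp
  fix q assume q: "q \<in> carrier P"
  show "a \<odot>\<^bsub>P\<^esub> (p \<oplus>\<^bsub>P\<^esub> q) = a \<odot>\<^bsub>P\<^esub> p \<oplus>\<^bsub>P\<^esub> a \<odot>\<^bsub>P\<^esub> q"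
    using P_value(1)[OF p] P_value(1)[OF q] a by (simp add: r_distr cong: restrict_cong)
  show "(a \<odot>\<^bsub>P\<^esub> p) \<otimes>\<^bsub>P\<^esub> q = a \<odot>\<^bsub>P\<^esub> (p \<otimes>\<^bsub>P\<^esub> q)"
    using P_value(1)[OF p] P_value(1)[OF q] a by (simp add: m_assoc cong: restrict_cong)
next
  show "\<one> \<odot>\<^bsub>P\<^esub> p = p" if p: "p \<in> carrier P" for p
    using P_value(1)[OF p] P_restrict[OF p] by (simp cong: restrict_cong)
next
  fix a b p assume a: "a \<in> carrier K" and b: "b \<in> carrier K" and p: "p \<in> carrier P"
  show "(a \<oplus> b) \<odot>\<^bsub>P\<^esub> p = a \<odot>\<^bsub>P\<^esub> p \<oplus>\<^bsub>P\<^esub> b \<odot>\<^bsub>P\<^esub> p"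
    using P_value(1)[OF p] a b by (simp add: l_distr cong: restrict_cong)
  show "a \<otimes> b \<odot>\<^bsub>P\<^esub> p = a \<odot>\<^bsub>P\<^esub> (b \<odot>\<^bsub>P\<^esub> p)"
    using P_value(1)[OF p] a b by (simp add: m_assoc cong: restrict_cong)
qed

lemma homog_subset: "homog_poly_funs K I d \<subseteq> carrier P"
  using homog_iff P_carrier by auto

lemma homog_closed:
  shows "(\<lambda>v\<in>V. \<zero>) \<in> homog_poly_funs K I d"
    "p \<in> homog_poly_funs K I d \<Longrightarrow> q \<in> homog_poly_funs K I d \<Longrightarrow> (\<lambda>v\<in>V. p v \<oplus> q v) \<in> homog_poly_funs K I d"
    "p \<in> homog_poly_funs K I d \<Longrightarrow> a \<in> carrier K \<Longrightarrow> (\<lambda>v\<in>V. a \<otimes> p v) \<in> homog_poly_funs K I d"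
    "p \<in> homog_poly_funs K I d \<Longrightarrow> q \<in> homog_poly_funs K I d' \<Longrightarrow> (\<lambda>v\<in>V. p v \<otimes> q v) \<in> homog_poly_funs K I (d + d')"
proof -
  show "(\<lambda>v\<in>V. \<zero>) \<in> homog_poly_funs K I d"
    unfolding homog_iff by (rule exI[of _ "\<lambda>_. 0"]) (simp add: rep_zero, simp add: supp_def)
  show "(\<lambda>v\<in>V. p v \<oplus> q v) \<in> homog_poly_funs K I d" if p: "p \<in> homog_poly_funs K I d" and q: "q \<in> homog_poly_funs K I d"
  proof -
    obtain c d' where cd: "rep p c" "supp c \<subseteq> exponents I {d}" "rep q d'" "supp d' \<subseteq> exponents I {d}"
      using p q unfolding homog_iff by blast
    have "supp (\<lambda>\<alpha>. c \<alpha> + d' \<alpha>) \<subseteq> supp c \<union> supp d'" by (auto simp: supp_def)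
    then show ?thesis unfolding homog_iff using rep_add[OF cd(1,3)] cd(2,4) by (intro exI[of _ "\<lambda>\<alpha>. c \<alpha> + d' \<alpha>"]) blast
  qed
  show "(\<lambda>v\<in>V. a \<otimes> p v) \<in> homog_poly_funs K I d" if p: "p \<in> homog_poly_funs K I d" and a: "a \<in> carrier K"
  proof -
    obtain c where c: "rep p c" "supp c \<subseteq> exponents I {d}" using p unfolding homog_iff by blast
    have "supp (\<lambda>\<alpha>. E a * c \<alpha>) \<subseteq> supp c" by (auto simp: supp_def)
    then show ?thesis unfolding homog_iff using rep_smult[OF c(1) a] c(2) by (intro exI[of _ "\<lambda>\<alpha>. E a * c \<alpha>"]) blast
  qed
  show "(\<lambda>v\<in>V. p v \<otimes> q v) \<in> homog_poly_funs K I (d + d')"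
    if p: "p \<in> homog_poly_funs K I d" and q: "q \<in> homog_poly_funs K I d'"
  proof -
    obtain c e where ce: "rep p c" "supp c \<subseteq> exponents I {d}" "rep q e" "supp e \<subseteq> exponents I {d'}"
      using p q unfolding homog_iff by blast
    have "eadd \<alpha> \<beta> \<in> exponents I {d + d'}" if "\<alpha> \<in> supp c" "\<beta> \<in> supp e" for \<alpha> \<beta>
    proof -
      have "\<alpha> \<in> exponents I {d}" "\<beta> \<in> exponents I {d'}" using that ce by auto
      then show ?thesis by (simp add: exponents_def eadd_def sum.distrib)
    qed
    then have "supp (cmult c e) \<subseteq> exponents I {d + d'}" using supp_cmult[of c e] by auto
    then show ?thesis unfolding homog_iff using rep_mult[OF ce(1,3)] by (intro exI[of _ "cmult c e"]) blast
  qed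
qed

lemma P_uminus: "p \<in> carrier P \<Longrightarrow> \<ominus>\<^bsub>P\<^esub> p = (\<lambda>v\<in>V. (\<ominus> \<one>) \<otimes> p v)"
proof -
  assume p: "p \<in> carrier P"
  interpret P: cring P by (rule P_cring)
  have "(\<lambda>v\<in>V. (\<ominus> \<one>) \<otimes> p v) \<oplus>\<^bsub>P\<^esub> p = \<zero>\<^bsub>P\<^esub>"
    using P_value(1)[OF p] unfolding P_simps by (intro restrict_ext) (simp add: l_minus l_neg)
  then show ?thesis using P.minus_equality[of "\<lambda>v\<in>V. (\<ominus> \<one>) \<otimes> p v" p] p P_closed(3)[OF _ p, of "\<ominus> \<one>"] by simp
qed

lemma homog_additive_subgroup: "additive_subgroup (homog_poly_funs K I d) P"
proof (rule additive_subgroupI, rule subgroup.intro)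
  show "homog_poly_funs K I d \<subseteq> carrier (add_monoid P)" using homog_subset by simp
  show "p \<otimes>\<^bsub>add_monoid P\<^esub> q \<in> homog_poly_funs K I d" if "p \<in> homog_poly_funs K I d" "q \<in> homog_poly_funs K I d" for p q
    using homog_closed(2)[OF that] by simp
  show "\<one>\<^bsub>add_monoid P\<^esub> \<in> homog_poly_funs K I d" using homog_closed(1) by simp
  show "inv\<^bsub>add_monoid P\<^esub> p \<in> homog_poly_funs K I d" if p: "p \<in> homog_poly_funs K I d" for p
    unfolding a_inv_def[symmetric] using homog_closed(3)[OF p, of "\<ominus> \<one>"] P_uminus[OF subsetD[OF homog_subset p]] p by simp
qed

lemma rep_finsum:
  assumes "finite A" "\<And>d. d \<in> A \<Longrightarrow> rep (f d) (c d)"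
  shows "rep (\<Oplus>\<^bsub>P\<^esub>d\<in>A. f d) (\<lambda>\<alpha>. \<Sum>d\<in>A. c d \<alpha>)"
  using assms
proof (induction A rule: finite_induct)
  case empty
  interpret P: cring P by (rule P_cring)
  show ?case using rep_zero by (simp only: sum.empty P.finsum_empty P_simps)
next
  case (insert d A)
  interpret P: cring P by (rule P_cring)
  have fP: "f x \<in> carrier P" if "x \<in> insert d A" for x using insert.prems[OF that] P_carrier by blast
  have "(\<Oplus>\<^bsub>P\<^esub>d\<in>insert d A. f d) = f d \<oplus>\<^bsub>P\<^esub> (\<Oplus>\<^bsub>P\<^esub>d\<in>A. f d)"
    using insert.hyps fP by (intro P.finsum_insert) auto
  moreover have "rep (f d \<oplus>\<^bsub>P\<^esub> (\<Oplus>\<^bsub>P\<^esub>d\<in>A. f d)) (\<lambda>\<alpha>. c d \<alpha> + (\<Sum>d\<in>A. c d \<alpha>))"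
    using rep_add[OF insert.prems[OF insertI1] insert.IH] insert.prems by simp
  ultimately show ?case by (simp only: sum.insert[OF insert.hyps])
qed

definition edeg :: "('i \<Rightarrow> nat) \<Rightarrow> nat" where "edeg \<alpha> = (\<Sum>i\<in>I. \<alpha> i)"

lemma exponents_iff: "\<alpha> \<in> exponents I N \<longleftrightarrow> \<alpha> \<in> I \<rightarrow>\<^sub>E UNIV \<and> edeg \<alpha> \<in> N"
  by (auto simp: exponents_def edeg_def)

text \<open>The components arise by restricting the coefficient function to the exponents of one
  degree. Uniqueness reduces to uniqueness of coefficients, because the supports in different
  degrees are disjoint.\<close>

lemma homog_decomposition:
  assumes p: "p \<in> carrier P"
  shows "\<exists>!f. (\<forall>d. f d \<in> homog_poly_funs K I d) \<and> finite {d. f d \<noteq> \<zero>\<^bsub>P\<^esub>} \<and> p = (\<Oplus>\<^bsub>P\<^esub>d\<in>{d. f d \<noteq> \<zero>\<^bsub>P\<^esub>}. f d)"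
proof -
  obtain c where c: "rep p c" using p P_carrier by blast
  define cd where "cd d \<alpha> = (if edeg \<alpha> = d then c \<alpha> else 0)" for d \<alpha>
  have cdsupp: "supp (cd d) \<subseteq> supp c" "supp (cd d) \<subseteq> exponents I {d}" for d
    using repD(3)[OF c] by (auto simp: supp_def cd_def exponents_iff split: if_splits)
  have cde: "ee * cd d \<alpha> = cd d \<alpha>" for d \<alpha> using repD(1)[OF c] by (simp add: cd_def)
  have ex: "\<exists>q. rep q (cd d)" for d
    using rep_exists[of "cd d"] cde finite_subset[OF cdsupp(1) repD(2)[OF c]] subset_trans[OF cdsupp(1) repD(3)[OF c]] by metis
  then obtain f where f: "\<And>d. rep (f d) (cd d)" by metis
  have zero_iff: "f d = \<zero>\<^bsub>P\<^esub> \<longleftrightarrow> cd d = (\<lambda>_. 0)" for d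
  proof
    assume "f d = \<zero>\<^bsub>P\<^esub>"
    then show "cd d = (\<lambda>_. 0)" using rep_unique[OF f[of d]] rep_zero by simp
  next
    assume "cd d = (\<lambda>_. 0)"
    then show "f d = \<zero>\<^bsub>P\<^esub>" using rep_function_unique[OF f[of d]] rep_zero by simp
  qed
  have fin: "finite {d. f d \<noteq> \<zero>\<^bsub>P\<^esub>}"
  proof (rule finite_subset)
    show "{d. f d \<noteq> \<zero>\<^bsub>P\<^esub>} \<subseteq> edeg ` supp c" unfolding zero_iff by (auto simp: cd_def fun_eq_iff supp_def split: if_splits)
    show "finite (edeg ` supp c)" using repD(2)[OF c] by simp
  qed
  have sum: "p = (\<Oplus>\<^bsub>P\<^esub>d\<in>{d. f d \<noteq> \<zero>\<^bsub>P\<^esub>}. f d)"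
  proof (rule rep_function_unique[OF c])
    have "(\<Sum>d\<in>{d. f d \<noteq> \<zero>\<^bsub>P\<^esub>}. cd d \<alpha>) = c \<alpha>" for \<alpha>
    proof (cases "f (edeg \<alpha>) = \<zero>\<^bsub>P\<^esub>")
      case True
      then have "c \<alpha> = 0" unfolding zero_iff by (auto simp: cd_def dest: fun_cong[of _ _ \<alpha>])
      then show ?thesis by (auto simp: cd_def intro!: sum.neutral)
    next
      case False
      then show ?thesis using fin by (simp add: cd_def)
    qed
    then show "rep (\<Oplus>\<^bsub>P\<^esub>d\<in>{d. f d \<noteq> \<zero>\<^bsub>P\<^esub>}. f d) c" using rep_finsum[OF fin, of f cd] f by simp
  qed
  show ?thesis
  proof (rule ex1I[of _ f], intro conjI allI)
    show "f d \<in> homog_poly_funs K I d" for d unfolding homog_iff using f cdsupp(2) by blast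
    show "finite {d. f d \<noteq> \<zero>\<^bsub>P\<^esub>}" by (rule fin)
    show "p = (\<Oplus>\<^bsub>P\<^esub>d\<in>{d. f d \<noteq> \<zero>\<^bsub>P\<^esub>}. f d)" by (rule sum)
    fix h assume h: "(\<forall>d. h d \<in> homog_poly_funs K I d) \<and> finite {d. h d \<noteq> \<zero>\<^bsub>P\<^esub>} \<and> p = (\<Oplus>\<^bsub>P\<^esub>d\<in>{d. h d \<noteq> \<zero>\<^bsub>P\<^esub>}. h d)"
    then have "\<forall>d. \<exists>b. rep (h d) b \<and> supp b \<subseteq> exponents I {d}" unfolding homog_iff by blast
    then obtain b where b: "\<And>d. rep (h d) (b d)" "\<And>d. supp (b d) \<subseteq> exponents I {d}" by metis
    have b0: "b d \<alpha> = 0" if "edeg \<alpha> \<noteq> d" for d \<alpha>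
      using b(2)[of d] that by (auto simp: supp_def exponents_iff)
    have finh: "finite {d. h d \<noteq> \<zero>\<^bsub>P\<^esub>}" using h by blast
    have "rep p (\<lambda>\<alpha>. \<Sum>d\<in>{d. h d \<noteq> \<zero>\<^bsub>P\<^esub>}. b d \<alpha>)" using rep_finsum[OF finh b(1)] h by simp
    then have cs: "c = (\<lambda>\<alpha>. \<Sum>d\<in>{d. h d \<noteq> \<zero>\<^bsub>P\<^esub>}. b d \<alpha>)" by (rule rep_unique[OF c])
    have hz: "b d = (\<lambda>_. 0)" if "h d = \<zero>\<^bsub>P\<^esub>" for d
      using rep_unique[OF b(1)[of d]] rep_zero that by simp
    have "cd d \<alpha> = b d \<alpha>" for d \<alpha>
    proof (cases "edeg \<alpha> = d")
      case True
      have "c \<alpha> = (\<Sum>d'\<in>{d. h d \<noteq> \<zero>\<^bsub>P\<^esub>}. if d' = d then b d \<alpha> else 0)"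
        using True b0 by (subst cs) (intro sum.cong, auto)
      also have "\<dots> = b d \<alpha>" using finh hz[of d] by (auto simp: fun_eq_iff)
      finally show ?thesis using True by (simp add: cd_def)
    qed (simp add: cd_def b0)
    then have "cd d = b d" for d by (rule ext)
    then show "h = f" using rep_function_unique[OF b(1)] f by (intro ext) metis
  qed
qed

lemma P_graded: "graded_algebra K P (homog_poly_funs K I)"
  unfolding graded_algebra_def graded_cring_def
  using P_algebra P_cring homog_additive_subgroup homog_closed(3,4) homog_decomposition by simp

lemma sum_upto_homog: assumes "p \<in> homog_poly_funs K I d" "d \<le> n" shows "p \<in> sum_upto_deg P (homog_poly_funs K I) n"
proof -
  interpret P: cring P by (rule P_cring)
  have pP: "p \<in> carrier P" using assms homog_subset by blast
  let ?f = "\<lambda>k. if k = d then p else \<zero>\<^bsub>P\<^esub>"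
  have "?f \<in> Pi {..n} (homog_poly_funs K I)" using assms homog_closed(1) by auto
  moreover have "(\<Oplus>\<^bsub>P\<^esub>k\<in>{..n}. ?f k) = p"
    using P.finsum_singleton[of d "{..n}" "\<lambda>_. p"] assms(2) pP by (simp add: eq_commute[of d])
  ultimately show ?thesis unfolding sum_upto_deg_def by (intro CollectI exI[of _ ?f]) (simp add: eq_commute)
qed

lemma sum_upto_carrier: "sum_upto_deg P (homog_poly_funs K I) n \<subseteq> carrier P"
proof -
  interpret P: cring P by (rule P_cring)
  show ?thesis unfolding sum_upto_deg_def using homog_subset by (auto intro!: P.finsum_closed)
qed

definition tm :: "'k fam \<Rightarrow> ('i \<Rightarrow> nat) \<Rightarrow> ('i \<Rightarrow> nat) \<Rightarrow> 'k fam" where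
  "tm z \<alpha> = (\<lambda>\<beta>. if \<beta> = \<alpha> then z else 0)"

lemma supp_tm: "supp (tm z \<alpha>) \<subseteq> {\<alpha>}"
  by (auto simp: supp_def tm_def)

lemma rep_term_iff:
  assumes "ee * z = z" "\<alpha> \<in> I \<rightarrow>\<^sub>E UNIV"
  shows "rep p (tm z \<alpha>) \<longleftrightarrow> p \<in> V \<rightarrow>\<^sub>E carrier K \<and> (\<forall>v\<in>V. E (p v) = z * mono \<alpha> v)"
proof
  assume p: "rep p (tm z \<alpha>)"
  have "E (p v) = z * mono \<alpha> v" if "v \<in> V" for v
    using rep_eval[OF p _ supp_tm that] by (simp add: tm_def)
  then show "p \<in> V \<rightarrow>\<^sub>E carrier K \<and> (\<forall>v\<in>V. E (p v) = z * mono \<alpha> v)" using repD(4)[OF p] by blast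
next
  assume "p \<in> V \<rightarrow>\<^sub>E carrier K \<and> (\<forall>v\<in>V. E (p v) = z * mono \<alpha> v)"
  then show "rep p (tm z \<alpha>)" using assms by (intro repI[of _ "{\<alpha>}"]) (auto simp: supp_def tm_def)
qed

lemma term_exists: "ee * z = z \<Longrightarrow> \<alpha> \<in> I \<rightarrow>\<^sub>E UNIV \<Longrightarrow> \<exists>p. rep p (tm z \<alpha>)"
proof -
  assume z: "ee * z = z" and \<alpha>: "\<alpha> \<in> I \<rightarrow>\<^sub>E UNIV"
  have "ee * tm z \<alpha> \<beta> = tm z \<alpha> \<beta>" for \<beta> using z by (simp add: tm_def)
  moreover have "finite (supp (tm z \<alpha>))" using supp_tm by (rule finite_subset) simp
  moreover have "supp (tm z \<alpha>) \<subseteq> I \<rightarrow>\<^sub>E UNIV" using supp_tm[of z \<alpha>] \<alpha> by blast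
  ultimately obtain p where "rep p (tm z \<alpha>)" by (rule rep_exists)
  then show "\<exists>p. rep p (tm z \<alpha>)" by blast
qed

text \<open>Induction on the degree, splitting off a variable with positive exponent. The
  coefficient is kept in the remaining term and ends up in degree 0, which belongs to the generators
  as well.\<close>

lemma term_generated:
  assumes "ee * z = z" "\<alpha> \<in> I \<rightarrow>\<^sub>E UNIV" "rep p (tm z \<alpha>)"
  shows "p \<in> generate_ring P (sum_upto_deg P (homog_poly_funs K I) 1)"
  using assms
proof (induction "edeg \<alpha>" arbitrary: \<alpha> p)
  case 0
  have "p \<in> homog_poly_funs K I 0"
    unfolding homog_iff using 0 by (intro exI[of _ "tm z \<alpha>"]) (auto simp: supp_def tm_def exponents_iff)
  then show ?case by (intro generate_ring.incl sum_upto_homog) auto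
next
  case (Suc n)
  have "\<exists>i\<in>I. \<alpha> i \<noteq> 0"
  proof (rule ccontr)
    assume "\<not> (\<exists>i\<in>I. \<alpha> i \<noteq> 0)"
    then have "edeg \<alpha> = 0" by (simp add: edeg_def)
    then show False using Suc(2) by simp
  qed
  then obtain i where i: "i \<in> I" "\<alpha> i \<noteq> 0" by blast
  define \<alpha>' where "\<alpha>' = \<alpha>(i := \<alpha> i - 1)"
  define \<delta> where "\<delta> = (\<lambda>j\<in>I. if j = i then 1 else 0 :: nat)"
  have \<alpha>'I: "\<alpha>' \<in> I \<rightarrow>\<^sub>E UNIV" using Suc(4) i(1) by (auto simp: \<alpha>'_def PiE_iff extensional_def)
  have \<delta>I: "\<delta> \<in> I \<rightarrow>\<^sub>E UNIV" by (simp add: \<delta>_def)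
  have split: "\<alpha> = eadd \<alpha>' \<delta>"
    using Suc(4) i by (auto simp: eadd_def \<alpha>'_def \<delta>_def fun_eq_iff PiE_iff extensional_def)
  have d1: "edeg \<delta> = 1" using finI i by (simp add: edeg_def \<delta>_def)
  have "edeg \<alpha> = edeg \<alpha>' + edeg \<delta>" by (subst split) (simp add: edeg_def eadd_def sum.distrib)
  then have n: "n = edeg \<alpha>'" using Suc(2) d1 by simp
  obtain q where q: "rep q (tm z \<alpha>')" using term_exists[OF Suc(3) \<alpha>'I] by blast
  obtain y where y: "rep y (tm ee \<delta>)" using term_exists[OF F.idem \<delta>I] by blast
  have qg: "q \<in> generate_ring P (sum_upto_deg P (homog_poly_funs K I) 1)" by (rule Suc(1)[OF n Suc(3) \<alpha>'I q])
  have "y \<in> homog_poly_funs K I 1"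
    unfolding homog_iff using y \<delta>I d1 by (intro exI[of _ "tm ee \<delta>"]) (auto simp: supp_def tm_def exponents_iff)
  then have yg: "y \<in> generate_ring P (sum_upto_deg P (homog_poly_funs K I) 1)"
    by (intro generate_ring.incl sum_upto_homog) auto
  have "p = q \<otimes>\<^bsub>P\<^esub> y"
  proof (rule rep_function_unique[OF Suc(5)])
    have qv: "q \<in> V \<rightarrow>\<^sub>E carrier K" "\<And>v. v \<in> V \<Longrightarrow> E (q v) = z * mono \<alpha>' v"
      using q unfolding rep_term_iff[OF Suc(3) \<alpha>'I] by auto
    have yv: "y \<in> V \<rightarrow>\<^sub>E carrier K" "\<And>v. v \<in> V \<Longrightarrow> E (y v) = ee * mono \<delta> v"
      using y unfolding rep_term_iff[OF F.idem \<delta>I] by auto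
    show "rep (q \<otimes>\<^bsub>P\<^esub> y) (tm z \<alpha>)"
      unfolding rep_term_iff[OF Suc(3,4)] P_simps
    proof (intro conjI ballI)
      show "(\<lambda>v\<in>V. q v \<otimes> y v) \<in> V \<rightarrow>\<^sub>E carrier K" using qv(1) yv(1) by auto
      fix v assume v: "v \<in> V"
      have "q v \<in> carrier K" "y v \<in> carrier K" using qv(1) yv(1) v by auto
      then have "E (q v \<otimes> y v) = (ee * z) * (mono \<alpha>' v * mono \<delta> v)"
        by (simp add: E_simps qv(2)[OF v] yv(2)[OF v] mult_ac)
      then show "E ((\<lambda>v\<in>V. q v \<otimes> y v) v) = z * mono \<alpha> v"
        using v Suc(3) by (subst split) (simp add: mono_eadd)
    qed
  qed
  then show ?case using generate_ring.eng_mult[OF qg yg] by simp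
qed

lemma P_generated: "generate_ring P (sum_upto_deg P (homog_poly_funs K I) 1) = carrier P"
proof -
  interpret P: cring P by (rule P_cring)
  let ?S = "generate_ring P (sum_upto_deg P (homog_poly_funs K I) 1)"
  have main: "p \<in> ?S" if "finite A" "A \<subseteq> I \<rightarrow>\<^sub>E UNIV" "rep p c" "supp c \<subseteq> A" for A p c
    using that
  proof (induction A arbitrary: p c rule: finite_induct)
    case empty
    then have "c = (\<lambda>_. 0)" by (auto simp: supp_def)
    then have "p = \<zero>\<^bsub>P\<^esub>" using rep_function_unique[OF empty(2)] rep_zero by simp
    then show ?case by (rule ssubst) (rule P.zero_in_generate)
  next
    case (insert \<alpha> A)
    have \<alpha>: "\<alpha> \<in> I \<rightarrow>\<^sub>E UNIV" using insert.prems(1) by simp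
    note r = repD[OF insert.prems(2)]
    obtain q where q: "rep q (tm (c \<alpha>) \<alpha>)" using term_exists[OF r(1) \<alpha>] by blast
    let ?c = "c(\<alpha> := 0)"
    have sc: "supp ?c \<subseteq> supp c" "supp ?c \<subseteq> A" using insert.prems(3) by (auto simp: supp_def)
    obtain p' where p': "rep p' ?c"
      by (rule rep_exists[of ?c]) (use r(1) finite_subset[OF sc(1) r(2)] subset_trans[OF sc(1) r(3)] in auto)
    have "p = q \<oplus>\<^bsub>P\<^esub> p'"
    proof (rule rep_function_unique[OF insert.prems(2)])
      have "(\<lambda>\<beta>. tm (c \<alpha>) \<alpha> \<beta> + ?c \<beta>) = c" by (auto simp: tm_def)
      then show "rep (q \<oplus>\<^bsub>P\<^esub> p') c" using rep_add[OF q p'] by simp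
    qed
    moreover have "p' \<in> ?S" using insert.IH[OF _ p' sc(2)] insert.prems(1) by simp
    ultimately show ?case using generate_ring.eng_add[OF term_generated[OF r(1) \<alpha> q], of p'] by (simp only:)
  qed
  show ?thesis
  proof
    show "?S \<subseteq> carrier P" by (rule P.generate_ring_incl[OF sum_upto_carrier])
    show "carrier P \<subseteq> ?S"
    proof
      fix p assume "p \<in> carrier P"
      then obtain c where c: "rep p c" using P_carrier by blast
      show "p \<in> ?S" by (rule main[OF repD(2)[OF c] repD(3)[OF c] c subset_refl])
    qed
  qed
qed

lemma P_gen_degree: "gen_degree P (homog_poly_funs K I) \<le> 1"
  unfolding gen_degree_def by (rule Inf_lower) (use P_generated in \<open>auto simp: one_enat_def\<close>)

end

section \<open>The regular representation\<close>

locale regular_rep = poly_rep K "carrier G" + G: group G for K :: "('k, 'l) ring_scheme" (structure) and G :: "('g, 'h) monoid_scheme"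
begin

abbreviation act :: "'g \<Rightarrow> (('g \<Rightarrow> 'k) \<Rightarrow> 'k) \<Rightarrow> ('g \<Rightarrow> 'k) \<Rightarrow> 'k" where
  "act \<equiv> regular_poly_action K G"

text \<open>The action of the inverse of \<open>g\<close> on \<open>R\<close> in coordinates;
  \<open>act g p\<close> is \<open>p\<close> composed with it.\<close>

definition sh :: "'g \<Rightarrow> ('g \<Rightarrow> 'k) \<Rightarrow> 'g \<Rightarrow> 'k" where
  "sh g v = (\<lambda>x\<in>carrier G. v (g \<otimes>\<^bsub>G\<^esub> x))"

lemma sh_closed: "g \<in> carrier G \<Longrightarrow> v \<in> V \<Longrightarrow> sh g v \<in> V"
  by (auto simp: sh_def coord_space_def)

lemma act_eq: "g \<in> carrier G \<Longrightarrow> p \<in> carrier P \<Longrightarrow> act g p = (\<lambda>v\<in>V. p (sh g v))"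
  unfolding regular_poly_action_def regular_action_def sh_def by (simp cong: restrict_cong)

text \<open>\<open>g\<close> sends the coordinate function at \<open>x\<close> to the one at the
  product of \<open>g\<close> and \<open>x\<close>; this is the effect on exponents.\<close>

definition eact :: "'g \<Rightarrow> ('g \<Rightarrow> nat) \<Rightarrow> 'g \<Rightarrow> nat" where
  "eact g \<alpha> = (\<lambda>x\<in>carrier G. \<alpha> (inv\<^bsub>G\<^esub> g \<otimes>\<^bsub>G\<^esub> x))"

lemma eact_closed: "eact g \<alpha> \<in> carrier G \<rightarrow>\<^sub>E UNIV" by (simp add: eact_def)

lemma eact_mult: "g \<in> carrier G \<Longrightarrow> h \<in> carrier G \<Longrightarrow> eact (g \<otimes>\<^bsub>G\<^esub> h) \<alpha> = eact g (eact h \<alpha>)"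
  by (auto simp: eact_def fun_eq_iff G.inv_mult_group G.m_assoc)

lemma eact_one: "\<alpha> \<in> carrier G \<rightarrow>\<^sub>E UNIV \<Longrightarrow> eact \<one>\<^bsub>G\<^esub> \<alpha> = \<alpha>"
  by (auto simp: eact_def fun_eq_iff PiE_iff extensional_def)

lemma eact_inv:
  assumes "g \<in> carrier G" "\<alpha> \<in> carrier G \<rightarrow>\<^sub>E UNIV"
  shows "eact (inv\<^bsub>G\<^esub> g) (eact g \<alpha>) = \<alpha>" "eact g (eact (inv\<^bsub>G\<^esub> g) \<alpha>) = \<alpha>"
  using eact_mult[of "inv\<^bsub>G\<^esub> g" g \<alpha>] eact_mult[of g "inv\<^bsub>G\<^esub> g" \<alpha>] assms by (simp_all add: eact_one)

lemma bij_left: "g \<in> carrier G \<Longrightarrow> bij_betw (\<lambda>x. g \<otimes>\<^bsub>G\<^esub> x) (carrier G) (carrier G)"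
  by (intro bij_betw_byWitness[of _ "\<lambda>x. inv\<^bsub>G\<^esub> g \<otimes>\<^bsub>G\<^esub> x"]) (auto simp: G.m_assoc[symmetric])

lemma edeg_eact: "g \<in> carrier G \<Longrightarrow> edeg (eact g \<alpha>) = edeg \<alpha>"
  unfolding edeg_def eact_def
  using sum.reindex_bij_betw[OF bij_left[of "inv\<^bsub>G\<^esub> g"], of \<alpha>] by (simp cong: sum.cong)

lemma mono_sh: assumes g: "g \<in> carrier G" shows "mono \<alpha> (sh g v) = mono (eact g \<alpha>) v"
proof -
  have "mono (eact g \<alpha>) v = (\<Prod>x\<in>carrier G. E (v (g \<otimes>\<^bsub>G\<^esub> x)) ^ eact g \<alpha> (g \<otimes>\<^bsub>G\<^esub> x))"
    unfolding mono_def by (rule prod.reindex_bij_betw[OF bij_left[OF g], symmetric])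
  also have "\<dots> = mono \<alpha> (sh g v)"
    unfolding mono_def sh_def eact_def using g by (intro prod.cong) (auto simp: G.m_assoc[symmetric])
  finally show ?thesis by simp
qed

definition cact :: "'g \<Rightarrow> (('g \<Rightarrow> nat) \<Rightarrow> 'k fam) \<Rightarrow> ('g \<Rightarrow> nat) \<Rightarrow> 'k fam" where
  "cact g c \<alpha> = (if \<alpha> \<in> carrier G \<rightarrow>\<^sub>E UNIV then c (eact (inv\<^bsub>G\<^esub> g) \<alpha>) else 0)"

lemma rep_act:
  assumes g: "g \<in> carrier G" and p: "rep p c"
  shows "rep (act g p) (cact g c)"
proof (rule repI)
  have pP: "p \<in> carrier P" using p P_carrier by blast
  show "ee * cact g c \<alpha> = cact g c \<alpha>" for \<alpha> using repD(1)[OF p] by (simp add: cact_def)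
  show "finite (eact g ` supp c)" using repD(2)[OF p] by simp
  show "supp (cact g c) \<subseteq> eact g ` supp c"
  proof
    fix \<alpha> assume "\<alpha> \<in> supp (cact g c)"
    then have "\<alpha> \<in> carrier G \<rightarrow>\<^sub>E UNIV" "eact (inv\<^bsub>G\<^esub> g) \<alpha> \<in> supp c" by (auto simp: supp_def cact_def split: if_splits)
    then show "\<alpha> \<in> eact g ` supp c" using eact_inv(2)[OF g] by (metis imageI)
  qed
  show "eact g ` supp c \<subseteq> carrier G \<rightarrow>\<^sub>E UNIV" using eact_closed by blast
  show "act g p \<in> V \<rightarrow>\<^sub>E carrier K" unfolding act_eq[OF g pP] using repD(6)[OF p] sh_closed[OF g] by simp
  fix v assume v: "v \<in> V"
  have inj: "inj_on (eact g) (supp c)"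
    by (rule inj_on_inverseI[of _ "eact (inv\<^bsub>G\<^esub> g)"]) (use eact_inv(1)[OF g] repD(3)[OF p] in blast)
  have "E (act g p v) = (\<Sum>\<alpha>\<in>supp c. c \<alpha> * mono \<alpha> (sh g v))"
    using v repD(5)[OF p sh_closed[OF g v]] by (simp add: act_eq[OF g pP])
  also have "\<dots> = (\<Sum>\<alpha>\<in>supp c. cact g c (eact g \<alpha>) * mono (eact g \<alpha>) v)"
  proof (rule sum.cong[OF refl])
    fix \<alpha> assume "\<alpha> \<in> supp c"
    then have "\<alpha> \<in> carrier G \<rightarrow>\<^sub>E UNIV" using repD(3)[OF p] by blast
    then have "cact g c (eact g \<alpha>) = c \<alpha>" using eact_inv(1)[OF g] eact_closed by (simp add: cact_def)
    then show "c \<alpha> * mono \<alpha> (sh g v) = cact g c (eact g \<alpha>) * mono (eact g \<alpha>) v" by (simp add: mono_sh[OF g])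
  qed
  also have "\<dots> = (\<Sum>\<alpha>\<in>eact g ` supp c. cact g c \<alpha> * mono \<alpha> v)"
    using inj by (simp add: sum.reindex)
  finally show "E (act g p v) = (\<Sum>\<alpha>\<in>eact g ` supp c. cact g c \<alpha> * mono \<alpha> v)" .
qed

lemma act_closed: "g \<in> carrier G \<Longrightarrow> p \<in> carrier P \<Longrightarrow> act g p \<in> carrier P"
proof -
  assume g: "g \<in> carrier G" and "p \<in> carrier P"
  then obtain c where "rep p c" using P_carrier by blast
  then have "rep (act g p) (cact g c)" by (rule rep_act[OF g])
  then show ?thesis using P_carrier by blast
qed

lemma P_group_action: "group_action G (carrier P) act"
proof (rule group_actionI)
  show "group G" by (rule G.is_group)
  show "act g \<in> extensional (carrier P)" for g by (simp add: regular_poly_action_def)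
  show "act g p \<in> carrier P" if "g \<in> carrier G" "p \<in> carrier P" for g p using that by (rule act_closed)
  show "act \<one>\<^bsub>G\<^esub> p = p" if p: "p \<in> carrier P" for p
  proof -
    have "sh \<one>\<^bsub>G\<^esub> v = v" if "v \<in> V" for v using that by (auto simp: sh_def coord_space_def fun_eq_iff PiE_iff extensional_def)
    then show ?thesis using P_restrict[OF p] by (simp add: act_eq[OF G.one_closed p] cong: restrict_cong)
  qed
  show "act (g \<otimes>\<^bsub>G\<^esub> h) p = act g (act h p)" if g: "g \<in> carrier G" and h: "h \<in> carrier G" and p: "p \<in> carrier P" for g h p
  proof -
    have "sh (g \<otimes>\<^bsub>G\<^esub> h) v = sh h (sh g v)" if "v \<in> V" for v
      using g h by (auto simp: sh_def fun_eq_iff G.m_assoc)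
    then show ?thesis
      by (subst act_eq[OF g act_closed[OF h p]], unfold act_eq[OF G.m_closed[OF g h] p] act_eq[OF h p])
        (intro restrict_ext, simp add: sh_closed[OF g])
  qed
qed

lemma P_graded_G_algebra: "graded_G_algebra K G P (homog_poly_funs K (carrier G)) act"
  unfolding graded_G_algebra_def
proof (intro conjI ballI allI)
  show "graded_algebra K P (homog_poly_funs K (carrier G))" by (rule P_graded)
  show "group_action G (carrier P) act" by (rule P_group_action)
  fix g assume g: "g \<in> carrier G"
  show "act g \<in> ring_hom P P"
  proof (rule ring_hom_memI)
    show "act g p \<in> carrier P" if "p \<in> carrier P" for p by (rule act_closed[OF g that])
    show "act g (p \<otimes>\<^bsub>P\<^esub> q) = act g p \<otimes>\<^bsub>P\<^esub> act g q" if "p \<in> carrier P" "q \<in> carrier P" for p q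
      using that sh_closed[OF g] P_closed(2)[OF that] by (simp add: act_eq[OF g] cong: restrict_cong)
    show "act g (p \<oplus>\<^bsub>P\<^esub> q) = act g p \<oplus>\<^bsub>P\<^esub> act g q" if "p \<in> carrier P" "q \<in> carrier P" for p q
      using that sh_closed[OF g] P_closed(1)[OF that] by (simp add: act_eq[OF g] cong: restrict_cong)
    show "act g \<one>\<^bsub>P\<^esub> = \<one>\<^bsub>P\<^esub>"
      using sh_closed[OF g] P_closed(5) by (simp add: act_eq[OF g] cong: restrict_cong)
  qed
  show "act g (a \<odot>\<^bsub>P\<^esub> p) = a \<odot>\<^bsub>P\<^esub> act g p" if a: "a \<in> carrier K" and p: "p \<in> carrier P" for a p
    using sh_closed[OF g] P_closed(3)[OF a p] p by (simp add: act_eq[OF g] cong: restrict_cong)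
  show "act g ` homog_poly_funs K (carrier G) d \<subseteq> homog_poly_funs K (carrier G) d" for d
  proof (rule image_subsetI)
    fix p assume "p \<in> homog_poly_funs K (carrier G) d"
    then obtain c where c: "rep p c" "supp c \<subseteq> exponents (carrier G) {d}" unfolding homog_iff by blast
    have "supp (cact g c) \<subseteq> exponents (carrier G) {d}"
    proof
      fix \<alpha> assume "\<alpha> \<in> supp (cact g c)"
      then have a: "\<alpha> \<in> carrier G \<rightarrow>\<^sub>E UNIV" "eact (inv\<^bsub>G\<^esub> g) \<alpha> \<in> supp c" by (auto simp: supp_def cact_def split: if_splits)
      then have "edeg (eact (inv\<^bsub>G\<^esub> g) \<alpha>) = d" using c(2) by (auto simp: exponents_iff)
      then show "\<alpha> \<in> exponents (carrier G) {d}" using a(1) edeg_eact[of "inv\<^bsub>G\<^esub> g" \<alpha>] g by (simp add: exponents_iff)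
    qed
    then show "act g p \<in> homog_poly_funs K (carrier G) d" unfolding homog_iff using rep_act[OF g c(1)] by blast
  qed
qed

end

section \<open>Rings of invariants, and the monomials of words\<close>

lemma inv_ring_simps [simp]:
  "monoid.mult (inv_ring G A \<phi>) = monoid.mult A" "one (inv_ring G A \<phi>) = one A"
  "ring.zero (inv_ring G A \<phi>) = ring.zero A" "add (inv_ring G A \<phi>) = add A"
  by (simp_all add: inv_ring_def)

lemma inv_ring_carrier:
  "group G \<Longrightarrow> x \<in> carrier (inv_ring G A \<phi>) \<longleftrightarrow> x \<in> carrier A \<and> (\<forall>g\<in>carrier G. \<phi> g x = x)"
  using monoid.one_closed[OF group.is_monoid, of G] by (auto simp: inv_ring_def invariants_def)

lemma cring_inv_ring:
  assumes A: "cring A" and G: "group G" and \<phi>: "\<And>g. g \<in> carrier G \<Longrightarrow> \<phi> g \<in> ring_hom A A"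
  shows "cring (inv_ring G A \<phi>)"
proof -
  interpret A: cring A by (rule A)
  note c = inv_ring_carrier[OF G, of _ A \<phi>]
  have hom: "\<phi> g (x \<oplus>\<^bsub>A\<^esub> y) = \<phi> g x \<oplus>\<^bsub>A\<^esub> \<phi> g y" "\<phi> g (x \<otimes>\<^bsub>A\<^esub> y) = \<phi> g x \<otimes>\<^bsub>A\<^esub> \<phi> g y"
    "\<phi> g \<one>\<^bsub>A\<^esub> = \<one>\<^bsub>A\<^esub>" "\<phi> g \<zero>\<^bsub>A\<^esub> = \<zero>\<^bsub>A\<^esub>" "\<phi> g (\<ominus>\<^bsub>A\<^esub> x) = \<ominus>\<^bsub>A\<^esub> \<phi> g x"
    if g: "g \<in> carrier G" and x: "x \<in> carrier A" "y \<in> carrier A" for g x y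
  proof -
    interpret h: ring_hom_ring A A "\<phi> g" by (rule ring_hom_ringI2) (use \<phi>[OF g] in \<open>auto intro: A.ring_axioms\<close>)
    show "\<phi> g (x \<oplus>\<^bsub>A\<^esub> y) = \<phi> g x \<oplus>\<^bsub>A\<^esub> \<phi> g y" "\<phi> g (x \<otimes>\<^bsub>A\<^esub> y) = \<phi> g x \<otimes>\<^bsub>A\<^esub> \<phi> g y"
      "\<phi> g \<one>\<^bsub>A\<^esub> = \<one>\<^bsub>A\<^esub>" "\<phi> g \<zero>\<^bsub>A\<^esub> = \<zero>\<^bsub>A\<^esub>" "\<phi> g (\<ominus>\<^bsub>A\<^esub> x) = \<ominus>\<^bsub>A\<^esub> \<phi> g x" using x by simp_all
  qed
  show ?thesis
  proof (rule cringI)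
    show "abelian_group (inv_ring G A \<phi>)"
    proof (rule abelian_groupI)
      fix x assume x: "x \<in> carrier (inv_ring G A \<phi>)"
      then have "\<ominus>\<^bsub>A\<^esub> x \<in> carrier (inv_ring G A \<phi>)" unfolding c using hom(5) by auto
      then show "\<exists>y\<in>carrier (inv_ring G A \<phi>). y \<oplus>\<^bsub>inv_ring G A \<phi>\<^esub> x = \<zero>\<^bsub>inv_ring G A \<phi>\<^esub>"
        using x by (intro bexI[of _ "\<ominus>\<^bsub>A\<^esub> x"]) (auto simp: c A.l_neg)
    qed (auto simp: c hom hom(4)[OF _ A.zero_closed A.zero_closed] hom(3)[OF _ A.zero_closed A.zero_closed] A.add.m_ac)
    show "comm_monoid (inv_ring G A \<phi>)"
      by (rule comm_monoidI) (auto simp: c hom hom(3)[OF _ A.zero_closed A.zero_closed] A.m_ac)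
  qed (auto simp: c A.l_distr)
qed

context regular_rep
begin

abbreviation PG :: "('k, ('g \<Rightarrow> 'k) \<Rightarrow> 'k) module" where "PG \<equiv> inv_ring G P act"

lemma PG_carrier: "p \<in> carrier PG \<longleftrightarrow> p \<in> carrier P \<and> (\<forall>g\<in>carrier G. act g p = p)"
  by (rule inv_ring_carrier[OF G.is_group])

lemma PG_cring: "cring PG"
  by (rule cring_inv_ring[OF P_cring G.is_group]) (use P_graded_G_algebra in \<open>auto simp: graded_G_algebra_def\<close>)

lemma PG_finsum: "finite A \<Longrightarrow> (\<And>a. a \<in> A \<Longrightarrow> f a \<in> carrier PG) \<Longrightarrow> (\<Oplus>\<^bsub>PG\<^esub>a\<in>A. f a) = (\<Oplus>\<^bsub>P\<^esub>a\<in>A. f a)"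
proof (induction A rule: finite_induct)
  interpret P: cring P by (rule P_cring)
  interpret PG: cring PG by (rule PG_cring)
  case empty
  show ?case by (simp only: P.finsum_empty PG.finsum_empty inv_ring_simps)
next
  interpret P: cring P by (rule P_cring)
  interpret PG: cring PG by (rule PG_cring)
  case (insert a A)
  have 1: "(\<Oplus>\<^bsub>PG\<^esub>a\<in>insert a A. f a) = f a \<oplus>\<^bsub>PG\<^esub> (\<Oplus>\<^bsub>PG\<^esub>a\<in>A. f a)"
    using insert by (intro PG.finsum_insert) auto
  have 2: "(\<Oplus>\<^bsub>P\<^esub>a\<in>insert a A. f a) = f a \<oplus>\<^bsub>P\<^esub> (\<Oplus>\<^bsub>P\<^esub>a\<in>A. f a)"
    using insert by (intro P.finsum_insert) (auto simp: PG_carrier)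
  have "(\<Oplus>\<^bsub>PG\<^esub>a\<in>A. f a) = (\<Oplus>\<^bsub>P\<^esub>a\<in>A. f a)" using insert by blast
  then show ?case by (simp only: 1 2 inv_ring_simps)
qed

definition cinv :: "(('g \<Rightarrow> nat) \<Rightarrow> 'k fam) \<Rightarrow> bool" where
  "cinv c \<longleftrightarrow> (\<forall>g\<in>carrier G. \<forall>\<alpha>\<in>carrier G \<rightarrow>\<^sub>E UNIV. c (eact g \<alpha>) = c \<alpha>)"

lemma PG_cinv: "rep p c \<Longrightarrow> p \<in> carrier PG \<longleftrightarrow> cinv c"
proof
  assume p: "rep p c"
  show "cinv c" if inv: "p \<in> carrier PG" unfolding cinv_def
  proof (intro ballI)
    fix g \<alpha> assume g: "g \<in> carrier G" and \<alpha>: "\<alpha> \<in> carrier G \<rightarrow>\<^sub>E (UNIV :: nat set)"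
    have "act g p = p" using inv g by (simp add: PG_carrier)
    then have "cact g c = c" using rep_unique[OF rep_act[OF g p]] p by simp
    then have "c (eact g \<alpha>) = cact g c (eact g \<alpha>)" by simp
    also have "\<dots> = c \<alpha>" using eact_closed[of g \<alpha>] eact_inv(1)[OF g \<alpha>] by (simp only: cact_def if_True)
    finally show "c (eact g \<alpha>) = c \<alpha>" .
  qed
  show "p \<in> carrier PG" if inv: "cinv c" unfolding PG_carrier
  proof (intro conjI ballI)
    show "p \<in> carrier P" using p P_carrier by blast
    fix g assume g: "g \<in> carrier G"
    have "cact g c = c"
    proof
      fix \<alpha> show "cact g c \<alpha> = c \<alpha>"
      proof (cases "\<alpha> \<in> carrier G \<rightarrow>\<^sub>E (UNIV :: nat set)")
        case True
        then show ?thesis using inv g by (simp add: cact_def cinv_def)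
      next
        case False
        then have "\<alpha> \<notin> supp c" using repD(3)[OF p] by blast
        then show ?thesis using False by (simp add: cact_def supp_def)
      qed
    qed
    then show "act g p = p" using rep_function_unique[OF rep_act[OF g p]] p by simp
  qed
qed

text \<open>The inverse turns the translation of variables by \<open>g\<close> into right
  multiplication of the letters by the inverse of \<open>g\<close>, and right multiplication is the
  side on which members of \<open>prims\<close> are invariant.\<close>

definition word_exp :: "'i set \<Rightarrow> ('i \<Rightarrow> 'g) \<Rightarrow> 'g \<Rightarrow> nat" where
  "word_exp A x = (\<lambda>g\<in>carrier G. card {i\<in>A. inv\<^bsub>G\<^esub> (x i) = g})"

lemma edeg_word_exp:
  assumes "finite A" "\<And>i. i \<in> A \<Longrightarrow> x i \<in> carrier G"
  shows "edeg (word_exp A x) = card A"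
proof -
  have "edeg (word_exp A x) = (\<Sum>g\<in>carrier G. \<Sum>i\<in>{i\<in>A. inv\<^bsub>G\<^esub> (x i) = g}. 1)"
    by (simp add: edeg_def word_exp_def)
  also have "\<dots> = (\<Sum>i\<in>A. 1)" using assms finI by (intro sum.group) auto
  finally show ?thesis by simp
qed

lemma eact_word_exp:
  assumes "g \<in> carrier G" "\<And>i. i \<in> A \<Longrightarrow> x i \<in> carrier G"
  shows "eact g (word_exp A x) = word_exp A (\<lambda>i. x i \<otimes>\<^bsub>G\<^esub> inv\<^bsub>G\<^esub> g)"
proof -
  have "inv\<^bsub>G\<^esub> (x i) = inv\<^bsub>G\<^esub> g \<otimes>\<^bsub>G\<^esub> y \<longleftrightarrow> inv\<^bsub>G\<^esub> (x i \<otimes>\<^bsub>G\<^esub> inv\<^bsub>G\<^esub> g) = y" if "i \<in> A" "y \<in> carrier G" for i y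
  proof -
    have "inv\<^bsub>G\<^esub> (x i \<otimes>\<^bsub>G\<^esub> inv\<^bsub>G\<^esub> g) = g \<otimes>\<^bsub>G\<^esub> inv\<^bsub>G\<^esub> (x i)" using assms that by (simp add: G.inv_mult_group)
    moreover have "inv\<^bsub>G\<^esub> (x i) = inv\<^bsub>G\<^esub> g \<otimes>\<^bsub>G\<^esub> y \<longleftrightarrow> g \<otimes>\<^bsub>G\<^esub> inv\<^bsub>G\<^esub> (x i) = y"
    proof
      assume "inv\<^bsub>G\<^esub> (x i) = inv\<^bsub>G\<^esub> g \<otimes>\<^bsub>G\<^esub> y"
      then show "g \<otimes>\<^bsub>G\<^esub> inv\<^bsub>G\<^esub> (x i) = y" using assms that by (simp add: G.m_assoc[symmetric])
    next
      assume "g \<otimes>\<^bsub>G\<^esub> inv\<^bsub>G\<^esub> (x i) = y"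
      then have "inv\<^bsub>G\<^esub> g \<otimes>\<^bsub>G\<^esub> y = inv\<^bsub>G\<^esub> g \<otimes>\<^bsub>G\<^esub> (g \<otimes>\<^bsub>G\<^esub> inv\<^bsub>G\<^esub> (x i))" by simp
      then show "inv\<^bsub>G\<^esub> (x i) = inv\<^bsub>G\<^esub> g \<otimes>\<^bsub>G\<^esub> y" using assms that by (simp add: G.m_assoc[symmetric])
    qed
    ultimately show ?thesis by simp
  qed
  then have "{i\<in>A. inv\<^bsub>G\<^esub> (x i) = inv\<^bsub>G\<^esub> g \<otimes>\<^bsub>G\<^esub> y} = {i\<in>A. inv\<^bsub>G\<^esub> (x i \<otimes>\<^bsub>G\<^esub> inv\<^bsub>G\<^esub> g) = y}" if "y \<in> carrier G" for y
    using that by blast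
  then show ?thesis using assms(1) unfolding eact_def word_exp_def by (intro restrict_ext) simp
qed

lemma word_exp_cong: "(\<And>i. i \<in> A \<Longrightarrow> x i = y i) \<Longrightarrow> word_exp A x = word_exp A y"
  unfolding word_exp_def by (intro restrict_ext arg_cong[of _ _ card]) auto

lemma word_exp_union:
  assumes "finite A" "finite B" "A \<inter> B = {}"
  shows "word_exp (A \<union> B) x = eadd (word_exp A x) (word_exp B x)"
proof -
  have "card {i\<in>A \<union> B. inv\<^bsub>G\<^esub> (x i) = g} = card {i\<in>A. inv\<^bsub>G\<^esub> (x i) = g} + card {i\<in>B. inv\<^bsub>G\<^esub> (x i) = g}" for g
  proof -
    have "{i\<in>A \<union> B. inv\<^bsub>G\<^esub> (x i) = g} = {i\<in>A. inv\<^bsub>G\<^esub> (x i) = g} \<union> {i\<in>B. inv\<^bsub>G\<^esub> (x i) = g}" by auto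
    moreover have "{i\<in>A. inv\<^bsub>G\<^esub> (x i) = g} \<inter> {i\<in>B. inv\<^bsub>G\<^esub> (x i) = g} = {}" using assms by auto
    ultimately show ?thesis using assms by (simp add: card_Un_disjoint)
  qed
  then show ?thesis unfolding word_exp_def eadd_def by (intro restrict_ext) simp
qed

lemma word_of_exp:
  assumes "finite A" "\<alpha> \<in> carrier G \<rightarrow>\<^sub>E UNIV" "edeg \<alpha> = card A"
  shows "\<exists>x. (\<forall>i\<in>A. x i \<in> carrier G) \<and> word_exp A x = \<alpha>"
  using assms
proof (induction A arbitrary: \<alpha> rule: finite_induct)
  case empty
  then have "\<forall>g\<in>carrier G. \<alpha> g = 0" using finI by (simp add: edeg_def)
  then have "word_exp {} (\<lambda>_. \<one>\<^bsub>G\<^esub>) = \<alpha>" using empty(1) by (auto simp: word_exp_def fun_eq_iff PiE_iff extensional_def)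
  then show ?case by auto
next
  case (insert j A)
  have "\<exists>g\<in>carrier G. \<alpha> g \<noteq> 0"
  proof (rule ccontr)
    assume "\<not> (\<exists>g\<in>carrier G. \<alpha> g \<noteq> 0)"
    then have "edeg \<alpha> = 0" by (simp add: edeg_def)
    then show False using insert.prems(2) insert.hyps by simp
  qed
  then obtain g where g: "g \<in> carrier G" "\<alpha> g \<noteq> 0" by blast
  define \<alpha>' where "\<alpha>' = \<alpha>(g := \<alpha> g - 1)"
  have \<alpha>'c: "\<alpha>' \<in> carrier G \<rightarrow>\<^sub>E UNIV" using insert.prems(1) g(1) by (auto simp: \<alpha>'_def PiE_iff extensional_def)
  have "edeg \<alpha> = \<alpha> g + (\<Sum>i\<in>carrier G - {g}. \<alpha> i)" unfolding edeg_def by (rule sum.remove[OF finI g(1)])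
  moreover have "edeg \<alpha>' = \<alpha>' g + (\<Sum>i\<in>carrier G - {g}. \<alpha>' i)" unfolding edeg_def by (rule sum.remove[OF finI g(1)])
  moreover have "(\<Sum>i\<in>carrier G - {g}. \<alpha>' i) = (\<Sum>i\<in>carrier G - {g}. \<alpha> i)" by (rule sum.cong) (auto simp: \<alpha>'_def)
  ultimately have "edeg \<alpha>' = card A" using insert.prems(2) insert.hyps g(2) by (simp add: \<alpha>'_def)
  then obtain x where x: "\<forall>i\<in>A. x i \<in> carrier G" "word_exp A x = \<alpha>'" using insert.IH[OF \<alpha>'c] by blast
  let ?x = "x(j := inv\<^bsub>G\<^esub> g)"
  have "word_exp (insert j A) ?x = \<alpha>"
  proof -
    have "word_exp ({j} \<union> A) ?x = eadd (word_exp {j} ?x) (word_exp A ?x)"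
      using insert.hyps by (intro word_exp_union) auto
    also have "word_exp A ?x = \<alpha>'" unfolding x(2)[symmetric] using insert.hyps by (intro word_exp_cong) auto
    also have "eadd (word_exp {j} ?x) \<alpha>' = \<alpha>"
    proof
      fix y
      have "{i \<in> {j}. inv\<^bsub>G\<^esub> (?x i) = y} = (if y = g then {j} else {})" using g(1) by auto
      then have "card {i \<in> {j}. inv\<^bsub>G\<^esub> (?x i) = y} = (if y = g then 1 else 0)" by simp
      then show "eadd (word_exp {j} ?x) \<alpha>' y = \<alpha> y"
        using insert.prems(1) g by (auto simp: eadd_def word_exp_def \<alpha>'_def PiE_iff extensional_def)
    qed
    finally show ?thesis by (simp only: insert_is_Un[symmetric])
  qed
  moreover have "\<forall>i\<in>insert j A. ?x i \<in> carrier G" using x(1) g(1) by auto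
  ultimately show ?case by blast
qed

text \<open>The two words have the same multiset of letters.\<close>

lemma word_exp_eq_imp_perm:
  assumes D: "finite D" and x: "x \<in> D \<rightarrow>\<^sub>E carrier G" and y: "y \<in> D \<rightarrow>\<^sub>E carrier G" and eq: "word_exp D x = word_exp D y"
  obtains \<tau> where "\<tau> permutes D" "x = (\<lambda>i\<in>D. y (\<tau> i))"
proof -
  have cnt: "card {i\<in>D. x i = g} = card {i\<in>D. y i = g}" for g
  proof (cases "g \<in> carrier G")
    case True
    have inj: "inv\<^bsub>G\<^esub> a = inv\<^bsub>G\<^esub> g \<longleftrightarrow> a = g" if "a \<in> carrier G" for a
      using G.inv_inv[OF that] G.inv_inv[OF True] that True by (metis (no_types))
    have "{i\<in>D. inv\<^bsub>G\<^esub> (z i) = inv\<^bsub>G\<^esub> g} = {i\<in>D. z i = g}" if z: "z \<in> D \<rightarrow>\<^sub>E carrier G" for z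
      by (intro Collect_cong conj_cong refl inj) (rule PiE_mem[OF z])
    then show ?thesis using fun_cong[OF eq, of "inv\<^bsub>G\<^esub> g"] x y True by (simp add: word_exp_def)
  next
    case False
    have "i \<notin> {i\<in>D. z i = g}" if z: "z \<in> D \<rightarrow>\<^sub>E carrier G" for z i using PiE_mem[OF z, of i] False by auto
    then have "{i\<in>D. z i = g} = {}" if "z \<in> D \<rightarrow>\<^sub>E carrier G" for z by (intro equals0I) (use that in blast)
    from this[OF x] this[OF y] show ?thesis by (simp only:)
  qed
  have "image_mset x (mset_set D) = image_mset y (mset_set D)"
  proof (rule multiset_eqI)
    fix g :: 'g
    have "count (image_mset z (mset_set D)) g = card {i\<in>D. z i = g}" for z
    proof -
      have "(\<Sum>i\<in>D \<inter> z -` {g}. count (mset_set D) i) = (\<Sum>i\<in>{i\<in>D. z i = g}. 1)"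
        using D by (intro sum.cong) auto
      then show ?thesis using D by (simp add: count_image_mset Int_commute)
    qed
    then show "count (image_mset x (mset_set D)) g = count (image_mset y (mset_set D)) g" using cnt by simp
  qed
  then obtain \<tau> where s: "\<tau> permutes D" "\<forall>i\<in>D. x i = y (\<tau> i)"
    using image_mset_eq_implies_permutes[OF D \<open>image_mset x (mset_set D) = image_mset y (mset_set D)\<close>] by blast
  have "x = (\<lambda>i\<in>D. y (\<tau> i))" using s(2) x by (auto simp: fun_eq_iff PiE_iff extensional_def)
  then show thesis using that s(1) by blast
qed

end

text \<open>
  A symmetric functional \<open>f\<close> on words of length \<open>|D|\<close> is a functional on the polynomials of degree
  \<open>|D|\<close>; its value on a product of invariants is given by a Leibniz rule at \<open>0\<close>.
\<close>
locale symmetric_functional = regular_rep K G for K :: "('k, 'l) ring_scheme" (structure) and G :: "('g, 'h) monoid_scheme" +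
  fixes D :: "'i set" and f :: "('i \<Rightarrow> 'g) \<Rightarrow> 'z::comm_ring_1" and jj :: "'k fam \<Rightarrow> 'z" and e' m :: 'z
  assumes finD: "finite D" and D0: "card D > 0"
    and jj_add: "jj (a + b) = jj a + jj b" and jj_mult: "jj (a * b) = jj a * jj b" and jj_e: "jj ee = e'"
    and m: "m * (of_nat (card (carrier G)) * e') = e'"
    and f: "f \<in> prims e' G D"
    and sym: "\<tau> permutes D \<Longrightarrow> x \<in> D \<rightarrow>\<^sub>E carrier G \<Longrightarrow> f (\<lambda>i\<in>D. x (\<tau> i)) = f x"
begin

abbreviation W where "W \<equiv> D \<rightarrow>\<^sub>E carrier G"

abbreviation n :: 'z where "n \<equiv> of_nat (card (carrier G))"

lemma jj_zero: "jj 0 = 0" using jj_add[of 0 0] by simp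

lemma jj_sum: "jj (\<Sum>i\<in>I. h i) = (\<Sum>i\<in>I. jj (h i))"
  by (induction I rule: infinite_finite_induct) (simp_all add: jj_zero jj_add)

text \<open>The functional on a monomial, read off from any word for it; the symmetry of
  \<open>f\<close> makes the value independent of the word. Exponents of other degrees get
  0.\<close>

definition \<Phi> :: "('g \<Rightarrow> nat) \<Rightarrow> 'z" where
  "\<Phi> \<alpha> = (if \<exists>x\<in>W. word_exp D x = \<alpha> then f (SOME x. x \<in> W \<and> word_exp D x = \<alpha>) else 0)"

lemma \<Phi>_word: assumes x: "x \<in> W" shows "\<Phi> (word_exp D x) = f x"
proof -
  let ?y = "SOME y. y \<in> W \<and> word_exp D y = word_exp D x"
  have "?y \<in> W \<and> word_exp D ?y = word_exp D x" by (rule someI[of _ x]) (use x in simp)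
  then have y: "?y \<in> W" "word_exp D ?y = word_exp D x" by blast+
  obtain \<tau> where s: "\<tau> permutes D" "?y = (\<lambda>i\<in>D. x (\<tau> i))" by (rule word_exp_eq_imp_perm[OF finD y(1) x y(2)]) (rule that)
  have "f ?y = f x" using sym[OF s(1) x] s(2) by simp
  then show ?thesis using x by (auto simp: \<Phi>_def)
qed

lemma \<Phi>_degree: "edeg \<alpha> \<noteq> card D \<Longrightarrow> \<Phi> \<alpha> = 0"
  unfolding \<Phi>_def using edeg_word_exp[OF finD] by auto

lemma e_\<Phi>: "e' * \<Phi> \<alpha> = \<Phi> \<alpha>" by (simp add: \<Phi>_def primsD(1)[OF f])

text \<open>The group order is invertible on the ideal of \<open>e'\<close>, where \<open>m\<close>
  is its inverse; the second premise places \<open>z\<close> there.\<close>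

lemma cancel: "n * z = 0 \<Longrightarrow> e' * z = z \<Longrightarrow> z = 0"
proof -
  assume z: "n * z = 0" "e' * z = z"
  have "z = m * (n * e') * z" using z(2) m by simp
  also have "\<dots> = m * e' * (n * z)" by (simp only: mult_ac)
  finally show "z = 0" using z(1) by simp
qed

text \<open>The linear extension of \<open>\<Phi>\<close> to polynomials over \<open>K\<close>, with
  coefficients carried by \<open>jj\<close> into the field of values of \<open>f\<close>.\<close>

definition \<Lambda> :: "(('g \<Rightarrow> nat) \<Rightarrow> 'k fam) \<Rightarrow> 'z" where
  "\<Lambda> c = (\<Sum>\<alpha>\<in>supp c. jj (c \<alpha>) * \<Phi> \<alpha>)"

lemma \<Lambda>_superset: "finite A \<Longrightarrow> supp c \<subseteq> A \<Longrightarrow> \<Lambda> c = (\<Sum>\<alpha>\<in>A. jj (c \<alpha>) * \<Phi> \<alpha>)"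
  unfolding \<Lambda>_def by (rule sum.mono_neutral_left) (auto simp: supp_def jj_zero)

lemma \<Lambda>_add:
  assumes "finite (supp c)" "finite (supp d)"
  shows "\<Lambda> (\<lambda>\<alpha>. c \<alpha> + d \<alpha>) = \<Lambda> c + \<Lambda> d"
proof -
  have fin: "finite (supp c \<union> supp d)" using assms by simp
  have "supp (\<lambda>\<alpha>. c \<alpha> + d \<alpha>) \<subseteq> supp c \<union> supp d" by (auto simp: supp_def)
  then show ?thesis
    using \<Lambda>_superset[OF fin, of c] \<Lambda>_superset[OF fin, of d] \<Lambda>_superset[OF fin, of "\<lambda>\<alpha>. c \<alpha> + d \<alpha>"]
    by (simp add: jj_add distrib_right sum.distrib)
qed

abbreviation zexp where "zexp \<equiv> (\<lambda>i\<in>carrier G. 0 :: nat)"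

lemma eact_zexp: "g \<in> carrier G \<Longrightarrow> eact g zexp = zexp" by (auto simp: eact_def)

lemma edeg_zero: "\<alpha> \<in> carrier G \<rightarrow>\<^sub>E UNIV \<Longrightarrow> edeg \<alpha> = 0 \<longleftrightarrow> \<alpha> = zexp"
  using finI by (auto simp: edeg_def fun_eq_iff PiE_iff extensional_def)

lemma edeg_eadd: "edeg (eadd \<alpha> \<beta>) = edeg \<alpha> + edeg \<beta>"
  by (simp add: edeg_def eadd_def sum.distrib)

lemma eadd_zexp: "\<alpha> \<in> carrier G \<rightarrow>\<^sub>E UNIV \<Longrightarrow> eadd zexp \<alpha> = \<alpha>" "\<alpha> \<in> carrier G \<rightarrow>\<^sub>E UNIV \<Longrightarrow> eadd \<alpha> zexp = \<alpha>"
  by (auto simp: eadd_def fun_eq_iff PiE_iff extensional_def)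

text \<open>In the degree of \<open>\<Phi>\<close>, realize \<open>\<alpha>\<close> and
  \<open>\<beta>\<close> by words on some \<open>A\<close> and on \<open>D - A\<close>; both parts
  are nonempty as neither exponent is 0. By right invariance of \<open>f\<close> only the quotient
  of the two group elements matters, and summing over it gives the vanishing condition of
  \<open>prims\<close> at \<open>A\<close>.\<close>

lemma double_orbit_sum_zero:
  assumes \<alpha>: "\<alpha> \<in> carrier G \<rightarrow>\<^sub>E UNIV" "\<alpha> \<noteq> zexp" and \<beta>: "\<beta> \<in> carrier G \<rightarrow>\<^sub>E UNIV" "\<beta> \<noteq> zexp"
  shows "(\<Sum>g\<in>carrier G. \<Sum>h\<in>carrier G. \<Phi> (eadd (eact g \<alpha>) (eact h \<beta>))) = 0"
proof (cases "edeg \<alpha> + edeg \<beta> = card D")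
  case False
  then have "\<Phi> (eadd (eact g \<alpha>) (eact h \<beta>)) = 0" if "g \<in> carrier G" "h \<in> carrier G" for g h
    using that by (intro \<Phi>_degree) (simp add: edeg_eadd edeg_eact)
  then show ?thesis by (simp add: sum.neutral)
next
  case True
  have "edeg \<alpha> \<le> card D" using True by simp
  then obtain A where A: "A \<subseteq> D" "card A = edeg \<alpha>" by (metis obtain_subset_with_card_n)
  have finA: "finite A" using A finD finite_subset by blast
  have cB: "card (D - A) = edeg \<beta>" using A finA True by (simp add: card_Diff_subset)
  obtain xa where xa: "\<forall>i\<in>A. xa i \<in> carrier G" "word_exp A xa = \<alpha>" using word_of_exp[OF finA \<alpha>(1)] A(2) by auto
  obtain xb where xb: "\<forall>i\<in>D - A. xb i \<in> carrier G" "word_exp (D - A) xb = \<beta>"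
    using word_of_exp[of "D - A", OF _ \<beta>(1)] cB finD by auto
  have A0: "A \<noteq> {}" using A(2) edeg_zero[OF \<alpha>(1)] \<alpha>(2) by auto
  have AD: "A \<noteq> D" using cB edeg_zero[OF \<beta>(1)] \<beta>(2) by auto
  define x where "x = (\<lambda>i\<in>D. if i \<in> A then xa i else xb i)"
  have xW: "x \<in> W" using xa(1) xb(1) by (auto simp: x_def)
  have xc: "x i \<in> carrier G" if "i \<in> D" for i using xW that by auto
  have xA: "word_exp A x = \<alpha>" unfolding xa(2)[symmetric] using A(1) by (intro word_exp_cong) (auto simp: x_def)
  have xB: "word_exp (D - A) x = \<beta>" unfolding xb(2)[symmetric] by (intro word_exp_cong) (auto simp: x_def)
  have val: "\<Phi> (eadd (eact g \<alpha>) (eact h \<beta>)) = f (\<lambda>i\<in>D. if i \<in> A then x i else x i \<otimes>\<^bsub>G\<^esub> (inv\<^bsub>G\<^esub> h \<otimes>\<^bsub>G\<^esub> g))"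
    if g: "g \<in> carrier G" and h: "h \<in> carrier G" for g h
  proof -
    let ?y = "\<lambda>i\<in>D. if i \<in> A then x i \<otimes>\<^bsub>G\<^esub> inv\<^bsub>G\<^esub> g else x i \<otimes>\<^bsub>G\<^esub> inv\<^bsub>G\<^esub> h"
    have yW: "?y \<in> W" using xc g h by auto
    have "eact g \<alpha> = word_exp A ?y"
    proof -
      have "eact g \<alpha> = word_exp A (\<lambda>i. x i \<otimes>\<^bsub>G\<^esub> inv\<^bsub>G\<^esub> g)" unfolding xA[symmetric]
        by (rule eact_word_exp[OF g]) (use xc A(1) in auto)
      also have "\<dots> = word_exp A ?y" using A(1) by (intro word_exp_cong) auto
      finally show ?thesis .
    qed
    moreover have "eact h \<beta> = word_exp (D - A) ?y"
    proof -
      have "eact h \<beta> = word_exp (D - A) (\<lambda>i. x i \<otimes>\<^bsub>G\<^esub> inv\<^bsub>G\<^esub> h)" unfolding xB[symmetric]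
        by (rule eact_word_exp[OF h]) (use xc in auto)
      also have "\<dots> = word_exp (D - A) ?y" by (intro word_exp_cong) auto
      finally show ?thesis .
    qed
    moreover have "A \<union> (D - A) = D" using A(1) by auto
    ultimately have "eadd (eact g \<alpha>) (eact h \<beta>) = word_exp D ?y"
      using word_exp_union[of A "D - A" ?y] finA finD by simp
    then have "\<Phi> (eadd (eact g \<alpha>) (eact h \<beta>)) = f ?y" using \<Phi>_word[OF yW] by simp
    also have "\<dots> = f (\<lambda>i\<in>D. ?y i \<otimes>\<^bsub>G\<^esub> g)" by (rule primsD(3)[OF f yW g, symmetric])
    also have "(\<lambda>i\<in>D. ?y i \<otimes>\<^bsub>G\<^esub> g) = (\<lambda>i\<in>D. if i \<in> A then x i else x i \<otimes>\<^bsub>G\<^esub> (inv\<^bsub>G\<^esub> h \<otimes>\<^bsub>G\<^esub> g))"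
      using xc g h by (intro restrict_ext) (auto simp: G.m_assoc)
    finally show ?thesis .
  qed
  have "(\<Sum>h\<in>carrier G. \<Phi> (eadd (eact g \<alpha>) (eact h \<beta>))) = 0" if g: "g \<in> carrier G" for g
  proof -
    have bij: "bij_betw (\<lambda>h. inv\<^bsub>G\<^esub> h \<otimes>\<^bsub>G\<^esub> g) (carrier G) (carrier G)"
      using g by (intro bij_betw_byWitness[of _ "\<lambda>k. g \<otimes>\<^bsub>G\<^esub> inv\<^bsub>G\<^esub> k"])
        (auto simp: G.inv_mult_group G.m_assoc[symmetric], auto simp: G.m_assoc)
    have "(\<Sum>h\<in>carrier G. \<Phi> (eadd (eact g \<alpha>) (eact h \<beta>))) =
        (\<Sum>h\<in>carrier G. f (\<lambda>i\<in>D. if i \<in> A then x i else x i \<otimes>\<^bsub>G\<^esub> (inv\<^bsub>G\<^esub> h \<otimes>\<^bsub>G\<^esub> g)))"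
      using val[OF g] by simp
    also have "\<dots> = (\<Sum>k\<in>carrier G. f (\<lambda>i\<in>D. if i \<in> A then x i else x i \<otimes>\<^bsub>G\<^esub> k))"
      by (rule sum.reindex_bij_betw[OF bij])
    also have "\<dots> = 0" by (rule primsD(4)[OF f A(1) A0 AD xW])
    finally show ?thesis .
  qed
  then show ?thesis by simp
qed

text \<open>Invariant coefficients are constant on orbits, so \<open>F\<close> may be replaced by
  its sum over translates at the cost of the factor \<open>n\<close>. No choice of orbit
  representatives is involved.\<close>

lemma orbit_average:
  assumes c: "cinv c" "supp c \<subseteq> carrier G \<rightarrow>\<^sub>E UNIV"
  shows "n * (\<Sum>\<alpha>\<in>supp c. jj (c \<alpha>) * F \<alpha>) = (\<Sum>\<alpha>\<in>supp c. jj (c \<alpha>) * (\<Sum>g\<in>carrier G. F (eact g \<alpha>)))"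
proof -
  have "(\<Sum>\<alpha>\<in>supp c. jj (c \<alpha>) * F (eact g \<alpha>)) = (\<Sum>\<alpha>\<in>supp c. jj (c \<alpha>) * F \<alpha>)" if g: "g \<in> carrier G" for g
  proof -
    have eq: "c (eact h \<alpha>) = c \<alpha>" if "h \<in> carrier G" "\<alpha> \<in> supp c" for h \<alpha> using c that by (auto simp: cinv_def)
    have bij: "bij_betw (eact g) (supp c) (supp c)"
    proof (rule bij_betw_byWitness[of _ "eact (inv\<^bsub>G\<^esub> g)"])
      show "\<forall>\<alpha>\<in>supp c. eact (inv\<^bsub>G\<^esub> g) (eact g \<alpha>) = \<alpha>" "\<forall>\<alpha>\<in>supp c. eact g (eact (inv\<^bsub>G\<^esub> g) \<alpha>) = \<alpha>"
        using eact_inv[OF g] c(2) by blast+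
      show "eact g ` supp c \<subseteq> supp c" "eact (inv\<^bsub>G\<^esub> g) ` supp c \<subseteq> supp c"
        using eq[OF g] eq[OF G.inv_closed[OF g]] by (auto simp: supp_def)
    qed
    have "(\<Sum>\<alpha>\<in>supp c. jj (c \<alpha>) * F (eact g \<alpha>)) = (\<Sum>\<alpha>\<in>supp c. jj (c (eact g \<alpha>)) * F (eact g \<alpha>))"
      using eq[OF g] by simp
    also have "\<dots> = (\<Sum>\<alpha>\<in>supp c. jj (c \<alpha>) * F \<alpha>)" by (rule sum.reindex_bij_betw[OF bij])
    finally show ?thesis .
  qed
  then have "(\<Sum>g\<in>carrier G. \<Sum>\<alpha>\<in>supp c. jj (c \<alpha>) * F (eact g \<alpha>)) = n * (\<Sum>\<alpha>\<in>supp c. jj (c \<alpha>) * F \<alpha>)" by simp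
  then show ?thesis by (simp add: sum_distrib_left sum.swap[of _ "carrier G"])
qed

text \<open>After averaging in both factors, the pairs of nonconstant terms cancel by
  \<open>double_orbit_sum_zero\<close>. What is left is the constant term of one factor times
  \<open>\<Lambda>\<close> of the other, and this is 0 by assumption.\<close>

lemma \<Lambda>_mult:
  assumes p: "rep p c" "cinv c" "\<Lambda> c = 0" and q: "rep q d" "cinv d" "\<Lambda> d = 0"
  shows "\<Lambda> (cmult c d) = 0"
proof -
  note rc = repD[OF p(1)] and rd = repD[OF q(1)]
  have "\<Lambda> (cmult c d) = (\<Sum>\<gamma>\<in>(\<lambda>p. eadd (fst p) (snd p)) ` (supp c \<times> supp d). jj (cmult c d \<gamma>) * \<Phi> \<gamma>)"
    using rc(2) rd(2) by (intro \<Lambda>_superset supp_cmult) simp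
  also have "\<dots> = (\<Sum>\<alpha>\<in>supp c. \<Sum>\<beta>\<in>supp d. jj (c \<alpha> * d \<beta>) * \<Phi> (eadd \<alpha> \<beta>))"
    by (rule sum_cmult[OF rc(2) rd(2) jj_add])
  finally have eq: "\<Lambda> (cmult c d) = (\<Sum>\<alpha>\<in>supp c. jj (c \<alpha>) * (\<Sum>\<beta>\<in>supp d. jj (d \<beta>) * \<Phi> (eadd \<alpha> \<beta>)))"
    by (simp add: jj_mult sum_distrib_left mult.assoc)
  define T where "T \<alpha> \<beta> = (\<Sum>g\<in>carrier G. \<Sum>h\<in>carrier G. \<Phi> (eadd (eact g \<alpha>) (eact h \<beta>)))" for \<alpha> \<beta>
  have "n * (n * \<Lambda> (cmult c d)) = n * (\<Sum>\<alpha>\<in>supp c. jj (c \<alpha>) * (\<Sum>g\<in>carrier G. \<Sum>\<beta>\<in>supp d. jj (d \<beta>) * \<Phi> (eadd (eact g \<alpha>) \<beta>)))"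
    unfolding eq orbit_average[OF p(2) rc(3), of "\<lambda>\<alpha>. \<Sum>\<beta>\<in>supp d. jj (d \<beta>) * \<Phi> (eadd \<alpha> \<beta>)"] ..
  also have "\<dots> = (\<Sum>\<alpha>\<in>supp c. jj (c \<alpha>) * (\<Sum>g\<in>carrier G. n * (\<Sum>\<beta>\<in>supp d. jj (d \<beta>) * \<Phi> (eadd (eact g \<alpha>) \<beta>))))"
    by (simp add: sum_distrib_left mult_ac)
  also have "\<dots> = (\<Sum>\<alpha>\<in>supp c. jj (c \<alpha>) * (\<Sum>g\<in>carrier G. \<Sum>\<beta>\<in>supp d. jj (d \<beta>) * (\<Sum>h\<in>carrier G. \<Phi> (eadd (eact g \<alpha>) (eact h \<beta>)))))"
    unfolding orbit_average[OF q(2) rd(3)] ..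
  also have "\<dots> = (\<Sum>\<alpha>\<in>supp c. jj (c \<alpha>) * (\<Sum>\<beta>\<in>supp d. jj (d \<beta>) * T \<alpha> \<beta>))"
    unfolding T_def by (simp add: sum_distrib_left sum.swap[of _ "supp d"])
  \<comment> \<open>If both exponents are 0, both conditional summands are present, but each of them
    is 0 because \<open>\<Phi> zexp = 0\<close>.\<close>
  also have "\<dots> = (\<Sum>\<alpha>\<in>supp c. jj (c \<alpha>) * (\<Sum>\<beta>\<in>supp d. jj (d \<beta>) *
      ((if \<alpha> = zexp then n * (\<Sum>h\<in>carrier G. \<Phi> (eact h \<beta>)) else 0) + (if \<beta> = zexp then n * (\<Sum>g\<in>carrier G. \<Phi> (eact g \<alpha>)) else 0))))"
  proof (intro sum.cong refl arg_cong2[of _ _ _ _ "(*)"])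
    fix \<alpha> \<beta> assume "\<alpha> \<in> supp c" "\<beta> \<in> supp d"
    then have ab: "\<alpha> \<in> carrier G \<rightarrow>\<^sub>E UNIV" "\<beta> \<in> carrier G \<rightarrow>\<^sub>E UNIV" using rc(3) rd(3) by auto
    have z: "\<Phi> zexp = 0" using D0 edeg_zero[of zexp] by (intro \<Phi>_degree) auto
    show "T \<alpha> \<beta> = (if \<alpha> = zexp then n * (\<Sum>h\<in>carrier G. \<Phi> (eact h \<beta>)) else 0) + (if \<beta> = zexp then n * (\<Sum>g\<in>carrier G. \<Phi> (eact g \<alpha>)) else 0)"
    proof (cases "\<alpha> = zexp")
      case True
      have "T \<alpha> \<beta> = (\<Sum>g\<in>carrier G. \<Sum>h\<in>carrier G. \<Phi> (eact h \<beta>))"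
        unfolding T_def True by (intro sum.cong refl) (simp only: eact_zexp eadd_zexp eact_closed)
      moreover have "(\<Sum>g\<in>carrier G. \<Phi> (eact g \<alpha>)) = 0" unfolding True using z by (intro sum.neutral) (simp add: eact_zexp)
      ultimately show ?thesis using True by simp
    next
      case \<alpha>0: False
      show ?thesis
      proof (cases "\<beta> = zexp")
        case True
        have "T \<alpha> \<beta> = (\<Sum>g\<in>carrier G. \<Sum>h\<in>carrier G. \<Phi> (eact g \<alpha>))"
          unfolding T_def True by (intro sum.cong refl) (simp only: eact_zexp eadd_zexp eact_closed)
        then show ?thesis using True \<alpha>0 by (simp add: sum_distrib_left)
      next
        case False
        then show ?thesis using double_orbit_sum_zero[OF ab(1) \<alpha>0 ab(2)] \<alpha>0 by (simp add: T_def)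
      qed
    qed
  qed
  also have "\<dots> = (\<Sum>\<alpha>\<in>supp c. if \<alpha> = zexp then jj (c \<alpha>) * n * (\<Sum>\<beta>\<in>supp d. jj (d \<beta>) * (\<Sum>h\<in>carrier G. \<Phi> (eact h \<beta>))) else 0) +
      (\<Sum>\<beta>\<in>supp d. if \<beta> = zexp then jj (d \<beta>) * n * (\<Sum>\<alpha>\<in>supp c. jj (c \<alpha>) * (\<Sum>g\<in>carrier G. \<Phi> (eact g \<alpha>))) else 0)"
  proof -
    have a: "jj (c \<alpha>) * (\<Sum>\<beta>\<in>supp d. jj (d \<beta>) * ((if \<alpha> = zexp then n * (\<Sum>h\<in>carrier G. \<Phi> (eact h \<beta>)) else 0) + (if \<beta> = zexp then n * (\<Sum>g\<in>carrier G. \<Phi> (eact g \<alpha>)) else 0))) =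
      (if \<alpha> = zexp then jj (c \<alpha>) * n * (\<Sum>\<beta>\<in>supp d. jj (d \<beta>) * (\<Sum>h\<in>carrier G. \<Phi> (eact h \<beta>))) else 0) +
      (\<Sum>\<beta>\<in>supp d. if \<beta> = zexp then jj (d \<beta>) * n * (jj (c \<alpha>) * (\<Sum>g\<in>carrier G. \<Phi> (eact g \<alpha>))) else 0)" for \<alpha>
      unfolding distrib_left sum.distrib
      by (intro arg_cong2[of _ _ _ _ "(+)"]) (auto simp: sum_distrib_left mult_ac intro!: sum.cong)
    have b: "(\<Sum>\<alpha>\<in>supp c. \<Sum>\<beta>\<in>supp d. if \<beta> = zexp then jj (d \<beta>) * n * (jj (c \<alpha>) * (\<Sum>g\<in>carrier G. \<Phi> (eact g \<alpha>))) else 0) =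
      (\<Sum>\<beta>\<in>supp d. if \<beta> = zexp then jj (d \<beta>) * n * (\<Sum>\<alpha>\<in>supp c. jj (c \<alpha>) * (\<Sum>g\<in>carrier G. \<Phi> (eact g \<alpha>))) else 0)"
      by (subst sum.swap) (auto simp: sum_distrib_left intro!: sum.cong)
    show ?thesis unfolding a sum.distrib b ..
  qed
  also have "\<dots> = 0"
    unfolding orbit_average[OF p(2) rc(3), symmetric] orbit_average[OF q(2) rd(3), symmetric]
    using p(3) q(3) unfolding \<Lambda>_def by (simp cong: if_cong)
  finally have nn: "n * (n * \<Lambda> (cmult c d)) = 0" .
  have e: "e' * \<Lambda> (cmult c d) = \<Lambda> (cmult c d)"
    unfolding \<Lambda>_def by (simp add: sum_distrib_left mult.left_commute[of e'] e_\<Phi>)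
  have e2: "e' * (n * \<Lambda> (cmult c d)) = n * \<Lambda> (cmult c d)" by (simp only: mult.left_commute[of e' n] e)
  have "n * \<Lambda> (cmult c d) = 0" by (rule cancel[OF nn e2])
  then show ?thesis by (rule cancel[OF _ e])
qed

text \<open>The invariants on which \<open>\<Lambda>\<close> vanishes are closed under the ring
  operations. They contain 1 and all invariants of degree at most \<open>N\<close>, since
  \<open>\<Phi>\<close> is supported in degree \<open>card D\<close>.\<close>

lemma \<Lambda>_generated:
  assumes N: "N < card D" and p: "p \<in> generate_ring PG (sum_upto_deg PG (\<lambda>d. homog_poly_funs K (carrier G) d \<inter> carrier PG) N)"
  shows "p \<in> carrier PG \<and> (\<forall>c. rep p c \<longrightarrow> \<Lambda> c = 0)"
  using p
proof (induction rule: generate_ring.induct)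
  interpret P: cring P by (rule P_cring)
  interpret PG: cring PG by (rule PG_cring)
  case one
  have "\<Lambda> c = 0" if "rep \<one>\<^bsub>PG\<^esub> c" for c
  proof -
    have "c = (\<lambda>\<alpha>. if \<alpha> = zexp then ee else 0)" using rep_unique[OF that] rep_one by simp
    then have "supp c \<subseteq> {zexp}" by (auto simp: supp_def)
    then have "\<Lambda> c = (\<Sum>\<alpha>\<in>{zexp}. jj (c \<alpha>) * \<Phi> \<alpha>)" by (intro \<Lambda>_superset) auto
    moreover have "\<Phi> zexp = 0" using D0 edeg_zero[of zexp] by (intro \<Phi>_degree) auto
    ultimately show ?thesis by simp
  qed
  then show ?case by blast
next
  interpret P: cring P by (rule P_cring)
  interpret PG: cring PG by (rule PG_cring)
  case (incl p)
  then obtain u where u: "p = (\<Oplus>\<^bsub>PG\<^esub>d\<in>{..N}. u d)" "u \<in> Pi {..N} (\<lambda>d. homog_poly_funs K (carrier G) d \<inter> carrier PG)"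
    by (auto simp: sum_upto_deg_def)
  have uPG: "u d \<in> carrier PG" if "d \<in> {..N}" for d using u(2) that by auto
  have pPG: "p \<in> carrier PG" unfolding u(1) using uPG by (intro PG.finsum_closed) auto
  have "\<exists>b. rep (u d) b \<and> supp b \<subseteq> exponents (carrier G) {d}" if "d \<in> {..N}" for d
    using u(2) that homog_iff[of "u d" d] by auto
  then obtain b where b: "\<And>d. d \<in> {..N} \<Longrightarrow> rep (u d) (b d)" "\<And>d. d \<in> {..N} \<Longrightarrow> supp (b d) \<subseteq> exponents (carrier G) {d}" by metis
  have "rep (\<Oplus>\<^bsub>P\<^esub>d\<in>{..N}. u d) (\<lambda>\<alpha>. \<Sum>d\<in>{..N}. b d \<alpha>)" by (rule rep_finsum[OF _ b(1)]) auto
  then have rp: "rep p (\<lambda>\<alpha>. \<Sum>d\<in>{..N}. b d \<alpha>)" unfolding u(1) using PG_finsum[of "{..N}" u] uPG by simp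
  have "\<Lambda> c = 0" if "rep p c" for c
  proof -
    have c: "c = (\<lambda>\<alpha>. \<Sum>d\<in>{..N}. b d \<alpha>)" by (rule rep_unique[OF that rp])
    have "jj (c \<alpha>) * \<Phi> \<alpha> = 0" for \<alpha>
    proof (cases "edeg \<alpha> = card D")
      case True
      have "b d \<alpha> = 0" if d: "d \<in> {..N}" for d
      proof (rule ccontr)
        assume "b d \<alpha> \<noteq> 0"
        then have "\<alpha> \<in> exponents (carrier G) {d}" using b(2)[OF d] by (auto simp: supp_def)
        then show False using True d N by (simp add: exponents_iff)
      qed
      then have "c \<alpha> = 0" unfolding c by (simp add: sum.neutral)
      then show ?thesis by (simp add: jj_zero)
    qed (simp add: \<Phi>_degree)
    then show ?thesis unfolding \<Lambda>_def by simp
  qed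
  then show ?case using pPG by blast
next
  interpret PG: cring PG by (rule PG_cring)
  case (a_inv p)
  then have pPG: "p \<in> carrier PG" by blast
  obtain c where c: "rep p c" using pPG P_carrier by (auto simp: PG_carrier)
  let ?q = "\<ominus>\<^bsub>PG\<^esub> p"
  have qPG: "?q \<in> carrier PG" using pPG by simp
  have "\<Lambda> d = 0" if d: "rep ?q d" for d
  proof -
    have "?q \<oplus>\<^bsub>PG\<^esub> p = \<zero>\<^bsub>PG\<^esub>" by (rule PG.l_neg[OF pPG])
    then have "(\<lambda>v\<in>V. ?q v \<oplus> p v) = (\<lambda>v\<in>V. \<zero>)" by (simp only: inv_ring_simps P_simps)
    then have "(\<lambda>\<alpha>. d \<alpha> + c \<alpha>) = (\<lambda>_. 0)" using rep_unique[OF rep_add[OF d c]] rep_zero by simp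
    then have "\<Lambda> d + \<Lambda> c = \<Lambda> (\<lambda>_. 0)" using \<Lambda>_add[OF repD(2)[OF d] repD(2)[OF c]] by simp
    then show ?thesis using a_inv c by (simp add: \<Lambda>_def supp_def)
  qed
  then show ?case using qPG by blast
next
  interpret PG: cring PG by (rule PG_cring)
  case (eng_add p q)
  obtain c d where cd: "rep p c" "rep q d" using eng_add P_carrier by (auto simp: PG_carrier)
  have r: "rep (p \<oplus>\<^bsub>PG\<^esub> q) (\<lambda>\<alpha>. c \<alpha> + d \<alpha>)" using rep_add[OF cd] by simp
  have "\<Lambda> (\<lambda>\<alpha>. c \<alpha> + d \<alpha>) = 0" using \<Lambda>_add[OF repD(2)[OF cd(1)] repD(2)[OF cd(2)]] eng_add cd by simp
  then have "\<forall>b. rep (p \<oplus>\<^bsub>PG\<^esub> q) b \<longrightarrow> \<Lambda> b = 0" using rep_unique[OF r] by blast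
  moreover have "p \<oplus>\<^bsub>PG\<^esub> q \<in> carrier PG" using eng_add by (intro PG.a_closed) auto
  ultimately show ?case by blast
next
  interpret PG: cring PG by (rule PG_cring)
  case (eng_mult p q)
  obtain c d where cd: "rep p c" "rep q d" using eng_mult P_carrier by (auto simp: PG_carrier)
  have r: "rep (p \<otimes>\<^bsub>PG\<^esub> q) (cmult c d)" using rep_mult[OF cd] by simp
  have "\<Lambda> (cmult c d) = 0"
    using eng_mult cd PG_cinv[OF cd(1)] PG_cinv[OF cd(2)] by (intro \<Lambda>_mult[OF cd(1) _ _ cd(2)]) auto
  then have "\<forall>b. rep (p \<otimes>\<^bsub>PG\<^esub> q) b \<longrightarrow> \<Lambda> b = 0" using rep_unique[OF r] by blast
  moreover have "p \<otimes>\<^bsub>PG\<^esub> q \<in> carrier PG" using eng_mult by (intro PG.m_closed) auto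
  ultimately show ?case by blast
qed

text \<open>\<open>\<Lambda>\<close> takes the value \<open>n * f x\<close> on the transfer of the
  monomial of a word \<open>x\<close>, and this transfer is an invariant.\<close>

theorem vanishes:
  assumes N: "N < card D"
    and gen: "generate_ring PG (sum_upto_deg PG (\<lambda>d. homog_poly_funs K (carrier G) d \<inter> carrier PG) N) = carrier PG"
  shows "f = (\<lambda>_. 0)"
proof
  fix x
  show "f x = 0"
  proof (cases "x \<in> W")
    case x: True
    have xc: "x i \<in> carrier G" if "i \<in> D" for i using x that by auto
    let ?a = "word_exp D x"
    \<comment> \<open>Summing over the group instead of over the orbit counts each monomial with the
      order of its stabilizer; so the value of \<open>\<Lambda>\<close> has the factor
      \<open>n\<close> for every \<open>x\<close>.\<close>
    define c where "c \<gamma> = (\<Sum>g\<in>carrier G. if \<gamma> = eact g ?a then ee else 0)" for \<gamma>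
    let ?A = "(\<lambda>g. eact g ?a) ` carrier G"
    have sA: "supp c \<subseteq> ?A"
    proof
      fix \<gamma> assume "\<gamma> \<in> supp c"
      show "\<gamma> \<in> ?A"
      proof (rule ccontr)
        assume "\<gamma> \<notin> ?A"
        then have "c \<gamma> = 0" unfolding c_def by (intro sum.neutral) auto
        then show False using \<open>\<gamma> \<in> supp c\<close> by (simp add: supp_def)
      qed
    qed
    have finA: "finite ?A" using finI by simp
    have AI: "?A \<subseteq> carrier G \<rightarrow>\<^sub>E UNIV" using eact_closed by blast
    obtain p where p: "rep p c"
    proof (rule rep_exists)
      show "ee * c \<alpha> = c \<alpha>" for \<alpha> by (auto simp: c_def sum_distrib_left F.idem intro!: sum.cong)
      show "finite (supp c)" by (rule finite_subset[OF sA finA])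
      show "supp c \<subseteq> carrier G \<rightarrow>\<^sub>E UNIV" using sA AI by blast
    qed
    have "cinv c" unfolding cinv_def
    proof (intro ballI)
      fix h \<alpha> assume h: "h \<in> carrier G" and \<alpha>: "\<alpha> \<in> carrier G \<rightarrow>\<^sub>E (UNIV :: nat set)"
      have "eact h \<alpha> = eact (h \<otimes>\<^bsub>G\<^esub> g) ?a \<longleftrightarrow> \<alpha> = eact g ?a" if g: "g \<in> carrier G" for g
      proof
        assume "eact h \<alpha> = eact (h \<otimes>\<^bsub>G\<^esub> g) ?a"
        then have "eact (inv\<^bsub>G\<^esub> h) (eact h \<alpha>) = eact (inv\<^bsub>G\<^esub> h) (eact h (eact g ?a))" using h g by (simp only: eact_mult)
        then show "\<alpha> = eact g ?a" using eact_inv(1)[OF h] \<alpha> eact_closed by simp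
      qed (use h g in \<open>simp add: eact_mult\<close>)
      then have "c \<alpha> = (\<Sum>g\<in>carrier G. if eact h \<alpha> = eact (h \<otimes>\<^bsub>G\<^esub> g) ?a then ee else 0)"
        unfolding c_def by (intro sum.cong) auto
      also have "\<dots> = c (eact h \<alpha>)" unfolding c_def by (rule sum.reindex_bij_betw[OF bij_left[OF h]])
      finally show "c (eact h \<alpha>) = c \<alpha>" by simp
    qed
    then have "p \<in> carrier PG" using PG_cinv[OF p] by simp
    then have "\<Lambda> c = 0" using \<Lambda>_generated[OF N, of p] gen p by blast
    moreover have "\<Lambda> c = n * f x"
    proof -
      have "\<Lambda> c = (\<Sum>\<gamma>\<in>?A. jj (c \<gamma>) * \<Phi> \<gamma>)" by (rule \<Lambda>_superset[OF finA sA])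
      also have "\<dots> = (\<Sum>\<gamma>\<in>?A. \<Sum>g\<in>carrier G. if \<gamma> = eact g ?a then e' * \<Phi> \<gamma> else 0)"
        unfolding c_def jj_sum sum_distrib_right by (intro sum.cong refl) (simp add: jj_e jj_zero)
      also have "\<dots> = (\<Sum>g\<in>carrier G. \<Sum>\<gamma>\<in>?A. if \<gamma> = eact g ?a then e' * \<Phi> \<gamma> else 0)" by (rule sum.swap)
      also have "\<dots> = (\<Sum>g\<in>carrier G. f x)"
      proof (rule sum.cong[OF refl])
        fix g assume g: "g \<in> carrier G"
        have "(\<Sum>\<gamma>\<in>?A. if \<gamma> = eact g ?a then e' * \<Phi> \<gamma> else 0) = \<Phi> (eact g ?a)" using finA g by (simp add: e_\<Phi>)
        also have "\<dots> = \<Phi> (word_exp D (\<lambda>i\<in>D. x i \<otimes>\<^bsub>G\<^esub> inv\<^bsub>G\<^esub> g))"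
          by (intro arg_cong[of _ _ \<Phi>], subst eact_word_exp[OF g]) (use xc in simp, rule word_exp_cong, simp)
        also have "\<dots> = f (\<lambda>i\<in>D. x i \<otimes>\<^bsub>G\<^esub> inv\<^bsub>G\<^esub> g)" using xc g by (intro \<Phi>_word) auto
        also have "\<dots> = f x" using primsD(3)[OF f x] g by simp
        finally show "(\<Sum>\<gamma>\<in>?A. if \<gamma> = eact g ?a then e' * \<Phi> \<gamma> else 0) = f x" .
      qed
      finally show ?thesis by simp
    qed
    ultimately show ?thesis using cancel primsD(1)[OF f] by simp
  qed (rule primsD(2)[OF f])
qed

end

section \<open>Passage to the algebraic closure\<close>

context regular_rep
begin

lemma E_add_pow: "E ([n] \<cdot> \<one>) = of_nat n * ee"
proof (induction n)
  case (Suc n)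
  have "[Suc n] \<cdot> \<one> = [n] \<cdot> \<one> \<oplus> \<one>" by simp
  then have "E ([Suc n] \<cdot> \<one>) = E ([n] \<cdot> \<one>) + ee" by (simp only: E_simps(2) add.nat_pow_closed one_closed)
  then show ?case using Suc by (simp add: distrib_right)
qed (simp add: E_simps(1))

text \<open>A nonzero member over \<open>K\<close> stays nonzero over the algebraic closure. There
  \<open>prims_symmetric\<close> would yield a symmetric one, which \<open>vanishes\<close> rules
  out; only coefficients of the functional lie in the closure, the invariants are still those over
  \<open>K\<close>.\<close>

theorem prims_trivial:
  fixes D :: "'i set"
  assumes unit: "[card (carrier G)] \<cdot> \<one> \<in> Units K" and D: "finite D" "N < card D"
    and gen: "generate_ring PG (sum_upto_deg PG (\<lambda>d. homog_poly_funs K (carrier G) d \<inter> carrier PG) N) = carrier PG"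
  shows "prims ee G D = {\<lambda>_. 0}"
proof -
  let ?F = "alg_closure"
  interpret F: algebraic_closure ?F "indexed_const ` carrier K" by (rule alg_closureE(1))
  have ic: "indexed_const \<in> ring_hom K ?F" by (rule alg_closureE(2))
  have icc: "indexed_const x \<in> carrier ?F" if "x \<in> carrier K" for x by (rule ring_hom_closed[OF ic that])
  have cF: "cring ?F" by unfold_locales
  \<comment> \<open>From the copy of \<open>K\<close> in one product ring to the copy of its closure
    in another.\<close>
  define jj where "jj z = emb ?F (indexed_const (cp z))" for z
  have jj_add: "jj (a + b) = jj a + jj b" and jj_mult: "jj (a * b) = jj a * jj b" for a b
    using ring_hom_add[OF ic cp_closed cp_closed, of a b] ring_hom_mult[OF ic cp_closed cp_closed, of a b]
      emb_add[OF cF icc[OF cp_closed] icc[OF cp_closed], of a b] emb_mult[OF cF icc[OF cp_closed] icc[OF cp_closed], of a b]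
    by (simp_all add: jj_def comp_simps[OF cring_pl])
  have jj_e: "jj ee = idm ?F" using ring_hom_one[OF ic] by (simp add: jj_def E_simps)
  have jj_zero: "jj 0 = 0" using jj_add[of 0 0] by simp
  have jj_sum: "jj (\<Sum>i\<in>S. h i) = (\<Sum>i\<in>S. jj (h i))" for S :: "'g set" and h
    by (induction S rule: infinite_finite_induct) (simp_all add: jj_zero jj_add)
  have jj_inj: "z = 0" if "jj z = 0" "ee * z = z" for z
  proof -
    have "indexed_const (cp z) = \<zero>\<^bsub>?F\<^esub>"
      using that(1) emb_inject[OF cF icc[OF cp_closed] F.zero_closed, of z] emb_zero[OF cF] by (simp add: jj_def)
    also have "\<dots> = indexed_const \<zero>" using ring_hom_zero[OF ic] F.ring_axioms ring_axioms by simp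
    finally have eq: "indexed_const (cp z) = (indexed_const \<zero> :: ('k list \<times> nat) multiset \<Rightarrow> 'k)" .
    \<comment> \<open>An embedded constant is recovered as its value at the empty monomial.\<close>
    have "cp z = \<zero>" using fun_cong[OF eq, of "{#}"] by (simp add: indexed_const_def)
    then show "z = 0" using E_cp[OF that(2)] E_simps(1) by simp
  qed
  let ?u = "inv ([card (carrier G)] \<cdot> \<one>)"
  have "E (?u \<otimes> ([card (carrier G)] \<cdot> \<one>)) = ee" using Units_l_inv[OF unit] by simp
  then have "E ?u * (of_nat (card (carrier G)) * ee) = ee"
    using E_simps(3)[OF Units_inv_closed[OF unit] Units_closed[OF unit]] by (simp only: E_add_pow)
  then have "jj (E ?u) * jj (of_nat (card (carrier G)) * ee) = idm ?F" by (simp only: jj_mult[symmetric] jj_e)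
  moreover have "jj (of_nat k * ee) = of_nat k * idm ?F" for k
    by (induction k) (simp_all add: jj_zero distrib_right jj_add jj_e)
  ultimately have m: "jj (E ?u) * (of_nat (card (carrier G)) * idm ?F) = idm ?F" by simp
  interpret w: word_algebra "idm ?F" G D
    by (intro word_algebra.intro word_algebra_axioms.intro idem_alg_closed_field_idm F.algebraically_closed_axioms G.is_group finI D(1))
  have trivial: "prims (idm ?F) G D = {\<lambda>_. 0}"
  proof (rule ccontr)
    assume neq: "prims (idm ?F) G D \<noteq> {\<lambda>_. 0}"
    obtain f where f: "f \<in> prims (idm ?F) G D" "f \<noteq> (\<lambda>_. 0)"
      "\<And>\<tau> x. \<tau> permutes D \<Longrightarrow> x \<in> D \<rightarrow>\<^sub>E carrier G \<Longrightarrow> f (\<lambda>i\<in>D. x (\<tau> i)) = f x"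
      by (rule w.prims_symmetric[OF m neq]) (rule that)
    interpret s: symmetric_functional K G D f jj "idm ?F" "jj (E ?u)"
    proof unfold_locales
      show "card D > 0" using D(2) by simp
    qed (fact D(1) jj_add jj_mult jj_e m f(1) f(3))+
    show False using s.vanishes[OF D(2) gen] f(2) by simp
  qed
  show ?thesis
  proof (intro equalityI subsetI)
    fix f assume f: "f \<in> prims ee G D"
    have "(\<lambda>x. jj (f x)) \<in> prims (idm ?F) G D"
    proof (rule primsI)
      show "idm ?F * jj (f x) = jj (f x)" for x
        using primsD(1)[OF f, of x] jj_mult[of ee "f x"] by (simp only: jj_e)
      show "jj (f x) = 0" if "x \<notin> D \<rightarrow>\<^sub>E carrier G" for x by (simp only: primsD(2)[OF f that] jj_zero)
      show "jj (f (\<lambda>i\<in>D. x i \<otimes>\<^bsub>G\<^esub> g)) = jj (f x)" if "x \<in> D \<rightarrow>\<^sub>E carrier G" "g \<in> carrier G" for x g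
        by (simp only: primsD(3)[OF f that])
      show "(\<Sum>h\<in>carrier G. jj (f (\<lambda>i\<in>D. if i \<in> A then x i else x i \<otimes>\<^bsub>G\<^esub> h))) = 0"
        if "A \<subseteq> D" "A \<noteq> {}" "A \<noteq> D" "x \<in> D \<rightarrow>\<^sub>E carrier G" for A x
        by (simp only: jj_sum[symmetric] primsD(4)[OF f that] jj_zero)
    qed
    then have "(\<lambda>x. jj (f x)) = (\<lambda>_. 0)" unfolding trivial by (rule singletonD)
    then have "f x = 0" for x using fun_cong[of _ _ x] by (intro jj_inj primsD(1)[OF f]) metis
    then show "f \<in> {\<lambda>_. 0}" by auto
  next
    fix f :: "('i \<Rightarrow> 'g) \<Rightarrow> 'k fam" assume "f \<in> {\<lambda>_. 0}"
    then have "f = (\<lambda>_. 0)" by (rule singletonD)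
    then show "f \<in> prims ee G D" by (auto intro: primsI)
  qed
qed

end

section \<open>Generators of the invariants\<close>

locale graded_action = field K + G: group G for K :: "('k, 'l) ring_scheme" (structure) and G :: "('g, 'h) monoid_scheme" +
  fixes A :: "('k, 'a, 'm) module_scheme" and D :: "nat \<Rightarrow> 'a set" and \<phi> :: "'g \<Rightarrow> 'a \<Rightarrow> 'a"
  assumes finG: "finite (carrier G)" and unit: "[card (carrier G)] \<cdot> \<one> \<in> Units K"
    and action: "graded_G_algebra K G A D \<phi>"
begin

lemma algebra: "algebra K A" and graded: "graded_cring A D"
  and smult_D: "c \<in> carrier K \<Longrightarrow> a \<in> D d \<Longrightarrow> c \<odot>\<^bsub>A\<^esub> a \<in> D d"
  and ga: "group_action G (carrier A) \<phi>" and \<phi>_hom: "g \<in> carrier G \<Longrightarrow> \<phi> g \<in> ring_hom A A"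
  and \<phi>_smult: "g \<in> carrier G \<Longrightarrow> c \<in> carrier K \<Longrightarrow> a \<in> carrier A \<Longrightarrow> \<phi> g (c \<odot>\<^bsub>A\<^esub> a) = c \<odot>\<^bsub>A\<^esub> \<phi> g a"
  and \<phi>_D: "g \<in> carrier G \<Longrightarrow> a \<in> D d \<Longrightarrow> \<phi> g a \<in> D d"
  using action unfolding graded_G_algebra_def graded_algebra_def by (auto simp: image_subset_iff)

sublocale A: cring A using graded by (simp add: graded_cring_def)

lemma smult: "c \<in> carrier K \<Longrightarrow> x \<in> carrier A \<Longrightarrow> c \<odot>\<^bsub>A\<^esub> x \<in> carrier A"
  "c \<in> carrier K \<Longrightarrow> b \<in> carrier K \<Longrightarrow> x \<in> carrier A \<Longrightarrow> (c \<oplus> b) \<odot>\<^bsub>A\<^esub> x = (c \<odot>\<^bsub>A\<^esub> x) \<oplus>\<^bsub>A\<^esub> (b \<odot>\<^bsub>A\<^esub> x)"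
  "c \<in> carrier K \<Longrightarrow> x \<in> carrier A \<Longrightarrow> y \<in> carrier A \<Longrightarrow> c \<odot>\<^bsub>A\<^esub> (x \<oplus>\<^bsub>A\<^esub> y) = (c \<odot>\<^bsub>A\<^esub> x) \<oplus>\<^bsub>A\<^esub> (c \<odot>\<^bsub>A\<^esub> y)"
  "c \<in> carrier K \<Longrightarrow> b \<in> carrier K \<Longrightarrow> x \<in> carrier A \<Longrightarrow> (c \<otimes> b) \<odot>\<^bsub>A\<^esub> x = c \<odot>\<^bsub>A\<^esub> (b \<odot>\<^bsub>A\<^esub> x)"
  "x \<in> carrier A \<Longrightarrow> \<one> \<odot>\<^bsub>A\<^esub> x = x" "x \<in> carrier A \<Longrightarrow> \<zero> \<odot>\<^bsub>A\<^esub> x = \<zero>\<^bsub>A\<^esub>"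
  "c \<in> carrier K \<Longrightarrow> c \<odot>\<^bsub>A\<^esub> \<zero>\<^bsub>A\<^esub> = \<zero>\<^bsub>A\<^esub>"
  "c \<in> carrier K \<Longrightarrow> x \<in> carrier A \<Longrightarrow> c \<odot>\<^bsub>A\<^esub> (\<ominus>\<^bsub>A\<^esub> x) = \<ominus>\<^bsub>A\<^esub> (c \<odot>\<^bsub>A\<^esub> x)"
  "c \<in> carrier K \<Longrightarrow> x \<in> carrier A \<Longrightarrow> y \<in> carrier A \<Longrightarrow> (c \<odot>\<^bsub>A\<^esub> x) \<otimes>\<^bsub>A\<^esub> y = c \<odot>\<^bsub>A\<^esub> (x \<otimes>\<^bsub>A\<^esub> y)"
proof -
  interpret M: algebra K A by (rule algebra)
  show "c \<in> carrier K \<Longrightarrow> x \<in> carrier A \<Longrightarrow> c \<odot>\<^bsub>A\<^esub> x \<in> carrier A"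
    "c \<in> carrier K \<Longrightarrow> b \<in> carrier K \<Longrightarrow> x \<in> carrier A \<Longrightarrow> (c \<oplus> b) \<odot>\<^bsub>A\<^esub> x = (c \<odot>\<^bsub>A\<^esub> x) \<oplus>\<^bsub>A\<^esub> (b \<odot>\<^bsub>A\<^esub> x)"
    "c \<in> carrier K \<Longrightarrow> x \<in> carrier A \<Longrightarrow> y \<in> carrier A \<Longrightarrow> c \<odot>\<^bsub>A\<^esub> (x \<oplus>\<^bsub>A\<^esub> y) = (c \<odot>\<^bsub>A\<^esub> x) \<oplus>\<^bsub>A\<^esub> (c \<odot>\<^bsub>A\<^esub> y)"
    "c \<in> carrier K \<Longrightarrow> b \<in> carrier K \<Longrightarrow> x \<in> carrier A \<Longrightarrow> (c \<otimes> b) \<odot>\<^bsub>A\<^esub> x = c \<odot>\<^bsub>A\<^esub> (b \<odot>\<^bsub>A\<^esub> x)"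
    "x \<in> carrier A \<Longrightarrow> \<one> \<odot>\<^bsub>A\<^esub> x = x" "x \<in> carrier A \<Longrightarrow> \<zero> \<odot>\<^bsub>A\<^esub> x = \<zero>\<^bsub>A\<^esub>"
    "c \<in> carrier K \<Longrightarrow> c \<odot>\<^bsub>A\<^esub> \<zero>\<^bsub>A\<^esub> = \<zero>\<^bsub>A\<^esub>"
    "c \<in> carrier K \<Longrightarrow> x \<in> carrier A \<Longrightarrow> c \<odot>\<^bsub>A\<^esub> (\<ominus>\<^bsub>A\<^esub> x) = \<ominus>\<^bsub>A\<^esub> (c \<odot>\<^bsub>A\<^esub> x)"
    "c \<in> carrier K \<Longrightarrow> x \<in> carrier A \<Longrightarrow> y \<in> carrier A \<Longrightarrow> (c \<odot>\<^bsub>A\<^esub> x) \<otimes>\<^bsub>A\<^esub> y = c \<odot>\<^bsub>A\<^esub> (x \<otimes>\<^bsub>A\<^esub> y)"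
    by (simp_all add: M.smult_l_distr M.smult_r_distr M.smult_assoc1 M.smult_assoc2 M.smult_r_minus)
qed

lemma D_sub: "a \<in> D d \<Longrightarrow> a \<in> carrier A"
  and D_add: "a \<in> D d \<Longrightarrow> b \<in> D d \<Longrightarrow> a \<oplus>\<^bsub>A\<^esub> b \<in> D d" and D_zero: "\<zero>\<^bsub>A\<^esub> \<in> D d"
  and D_mult: "a \<in> D d \<Longrightarrow> b \<in> D e \<Longrightarrow> a \<otimes>\<^bsub>A\<^esub> b \<in> D (d + e)"
proof -
  have "additive_subgroup (D d) A" using graded by (simp add: graded_cring_def)
  then interpret S: additive_subgroup "D d" A .
  show "a \<in> D d \<Longrightarrow> a \<in> carrier A" "a \<in> D d \<Longrightarrow> b \<in> D d \<Longrightarrow> a \<oplus>\<^bsub>A\<^esub> b \<in> D d" "\<zero>\<^bsub>A\<^esub> \<in> D d"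
    using S.a_Hcarr S.a_closed S.zero_closed by auto
  show "a \<in> D d \<Longrightarrow> b \<in> D e \<Longrightarrow> a \<otimes>\<^bsub>A\<^esub> b \<in> D (d + e)" using graded by (simp add: graded_cring_def)
qed

lemma D01: "a \<in> D 0 \<union> D 1 \<Longrightarrow> a \<in> carrier A" by (auto dest: D_sub)

lemma D_finsum: "finite S \<Longrightarrow> (\<And>s. s \<in> S \<Longrightarrow> f s \<in> D d) \<Longrightarrow> (\<Oplus>\<^bsub>A\<^esub>s\<in>S. f s) \<in> D d"
proof (induction S rule: finite_induct)
  case (insert s S)
  then have "(\<Oplus>\<^bsub>A\<^esub>s\<in>insert s S. f s) = f s \<oplus>\<^bsub>A\<^esub> (\<Oplus>\<^bsub>A\<^esub>s\<in>S. f s)" by (intro A.finsum_insert) (auto intro: D_sub)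
  then show ?case using insert D_add by simp
qed (simp add: D_zero)

lemma \<phi>: assumes g: "g \<in> carrier G"
  shows "x \<in> carrier A \<Longrightarrow> \<phi> g x \<in> carrier A"
    "x \<in> carrier A \<Longrightarrow> y \<in> carrier A \<Longrightarrow> \<phi> g (x \<oplus>\<^bsub>A\<^esub> y) = \<phi> g x \<oplus>\<^bsub>A\<^esub> \<phi> g y"
    "x \<in> carrier A \<Longrightarrow> y \<in> carrier A \<Longrightarrow> \<phi> g (x \<otimes>\<^bsub>A\<^esub> y) = \<phi> g x \<otimes>\<^bsub>A\<^esub> \<phi> g y"
    "\<phi> g \<one>\<^bsub>A\<^esub> = \<one>\<^bsub>A\<^esub>" "\<phi> g \<zero>\<^bsub>A\<^esub> = \<zero>\<^bsub>A\<^esub>" "x \<in> carrier A \<Longrightarrow> \<phi> g (\<ominus>\<^bsub>A\<^esub> x) = \<ominus>\<^bsub>A\<^esub> \<phi> g x"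
    "f \<in> S \<rightarrow> carrier A \<Longrightarrow> \<phi> g (\<Oplus>\<^bsub>A\<^esub>s\<in>S. f s) = (\<Oplus>\<^bsub>A\<^esub>s\<in>S. \<phi> g (f s))"
    "f \<in> S \<rightarrow> carrier A \<Longrightarrow> \<phi> g (\<Otimes>\<^bsub>A\<^esub>s\<in>S. f s) = (\<Otimes>\<^bsub>A\<^esub>s\<in>S. \<phi> g (f s))"
    "h \<in> carrier G \<Longrightarrow> x \<in> carrier A \<Longrightarrow> \<phi> (g \<otimes>\<^bsub>G\<^esub> h) x = \<phi> g (\<phi> h x)"
proof -
  interpret h: ring_hom_cring A A "\<phi> g"
    by (intro ring_hom_cring.intro ring_hom_cring_axioms.intro A.is_cring \<phi>_hom[OF g])
  show "x \<in> carrier A \<Longrightarrow> \<phi> g x \<in> carrier A"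
    "x \<in> carrier A \<Longrightarrow> y \<in> carrier A \<Longrightarrow> \<phi> g (x \<oplus>\<^bsub>A\<^esub> y) = \<phi> g x \<oplus>\<^bsub>A\<^esub> \<phi> g y"
    "x \<in> carrier A \<Longrightarrow> y \<in> carrier A \<Longrightarrow> \<phi> g (x \<otimes>\<^bsub>A\<^esub> y) = \<phi> g x \<otimes>\<^bsub>A\<^esub> \<phi> g y"
    "\<phi> g \<one>\<^bsub>A\<^esub> = \<one>\<^bsub>A\<^esub>" "\<phi> g \<zero>\<^bsub>A\<^esub> = \<zero>\<^bsub>A\<^esub>" "x \<in> carrier A \<Longrightarrow> \<phi> g (\<ominus>\<^bsub>A\<^esub> x) = \<ominus>\<^bsub>A\<^esub> \<phi> g x" by simp_all
  show "f \<in> S \<rightarrow> carrier A \<Longrightarrow> \<phi> g (\<Oplus>\<^bsub>A\<^esub>s\<in>S. f s) = (\<Oplus>\<^bsub>A\<^esub>s\<in>S. \<phi> g (f s))" using h.hom_finsum[of f S] by (simp add: comp_def)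
  show "f \<in> S \<rightarrow> carrier A \<Longrightarrow> \<phi> g (\<Otimes>\<^bsub>A\<^esub>s\<in>S. f s) = (\<Otimes>\<^bsub>A\<^esub>s\<in>S. \<phi> g (f s))" using h.hom_finprod[of f S] by (simp add: comp_def)
  show "h \<in> carrier G \<Longrightarrow> x \<in> carrier A \<Longrightarrow> \<phi> (g \<otimes>\<^bsub>G\<^esub> h) x = \<phi> g (\<phi> h x)" for h
    using group_action.composition_rule[OF ga _ g] by simp
qed

abbreviation AG where "AG \<equiv> inv_ring G A \<phi>"

lemma AG_carrier: "a \<in> carrier AG \<longleftrightarrow> a \<in> carrier A \<and> (\<forall>g\<in>carrier G. \<phi> g a = a)"
  by (rule inv_ring_carrier[OF G.is_group])

sublocale AG: cring AG by (rule cring_inv_ring[OF A.is_cring G.is_group \<phi>_hom])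

lemma AG_a_inv: assumes a: "a \<in> carrier AG" shows "\<ominus>\<^bsub>AG\<^esub> a = \<ominus>\<^bsub>A\<^esub> a"
proof -
  have "a \<oplus>\<^bsub>A\<^esub> \<ominus>\<^bsub>AG\<^esub> a = \<zero>\<^bsub>A\<^esub>" using AG.r_neg[OF a] by simp
  moreover have "\<ominus>\<^bsub>AG\<^esub> a \<in> carrier A" "a \<in> carrier A" using AG.a_inv_closed[OF a] a by (auto simp: AG_carrier)
  ultimately show ?thesis using A.minus_equality[of "\<ominus>\<^bsub>AG\<^esub> a" a] by (simp add: A.a_comm)
qed

definition T :: "'a \<Rightarrow> 'a" where "T a = (\<Oplus>\<^bsub>A\<^esub>g\<in>carrier G. \<phi> g a)"

lemma T_closed: assumes a: "a \<in> carrier A" shows "T a \<in> carrier AG"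
  unfolding AG_carrier
proof (intro conjI ballI)
  show "T a \<in> carrier A" unfolding T_def using \<phi>(1) a by (intro A.finsum_closed) auto
  fix h assume h: "h \<in> carrier G"
  have "\<phi> h (T a) = (\<Oplus>\<^bsub>A\<^esub>g\<in>carrier G. \<phi> h (\<phi> g a))" unfolding T_def using \<phi>(1) a by (intro \<phi>(7)[OF h]) auto
  also have "\<dots> = (\<Oplus>\<^bsub>A\<^esub>g\<in>carrier G. \<phi> (h \<otimes>\<^bsub>G\<^esub> g) a)" using \<phi>(1,9) h a by (intro A.finsum_cong') auto
  also have "\<dots> = (\<Oplus>\<^bsub>A\<^esub>g\<in>(\<lambda>g. h \<otimes>\<^bsub>G\<^esub> g) ` carrier G. \<phi> g a)"
    using \<phi>(1) h a by (intro A.finsum_reindex[symmetric]) (auto simp: inj_on_def)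
  also have "(\<lambda>g. h \<otimes>\<^bsub>G\<^esub> g) ` carrier G = carrier G" by (rule G.surj_const_mult[OF h])
  finally show "\<phi> h (T a) = T a" unfolding T_def .
qed

lemma T_D: "a \<in> D d \<Longrightarrow> T a \<in> D d" unfolding T_def by (intro D_finsum finG \<phi>_D)

lemma T_add: "a \<in> carrier A \<Longrightarrow> b \<in> carrier A \<Longrightarrow> T (a \<oplus>\<^bsub>A\<^esub> b) = T a \<oplus>\<^bsub>A\<^esub> T b"
proof -
  assume a: "a \<in> carrier A" and b: "b \<in> carrier A"
  have "T (a \<oplus>\<^bsub>A\<^esub> b) = (\<Oplus>\<^bsub>A\<^esub>g\<in>carrier G. \<phi> g a \<oplus>\<^bsub>A\<^esub> \<phi> g b)"
    unfolding T_def using \<phi>(1,2) a b by (intro A.finsum_cong') auto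
  also have "\<dots> = T a \<oplus>\<^bsub>A\<^esub> T b" unfolding T_def using \<phi>(1) a b by (intro A.finsum_addf) auto
  finally show ?thesis .
qed

abbreviation u where "u \<equiv> inv ([card (carrier G)] \<cdot> \<one>)"

lemma u_closed: "u \<in> carrier K" by (rule Units_inv_closed[OF unit])

lemma T_invariant: assumes a: "a \<in> carrier AG" shows "u \<odot>\<^bsub>A\<^esub> T a = a"
proof -
  have aA: "a \<in> carrier A" using a by (simp add: AG_carrier)
  have const: "(\<Oplus>\<^bsub>A\<^esub>g\<in>S. a) = ([card S] \<cdot> \<one>) \<odot>\<^bsub>A\<^esub> a" if "finite S" for S :: "'g set" using that
  proof (induction S rule: finite_induct)
    case (insert s S)
    have "(\<Oplus>\<^bsub>A\<^esub>g\<in>insert s S. a) = a \<oplus>\<^bsub>A\<^esub> (\<Oplus>\<^bsub>A\<^esub>g\<in>S. a)" using insert aA by (intro A.finsum_insert) auto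
    moreover have "[card (insert s S)] \<cdot> \<one> = [card S] \<cdot> \<one> \<oplus> \<one>" using insert by simp
    ultimately show ?case using insert aA by (simp only: smult(2,5) add.nat_pow_closed one_closed)
      (simp add: A.a_comm smult(1))
  qed (simp add: smult(6)[OF aA])
  have "T a = (\<Oplus>\<^bsub>A\<^esub>g\<in>carrier G. a)" unfolding T_def using a by (intro A.finsum_cong') (auto simp: AG_carrier)
  then have "u \<odot>\<^bsub>A\<^esub> T a = (u \<otimes> [card (carrier G)] \<cdot> \<one>) \<odot>\<^bsub>A\<^esub> a"
    using const[OF finG] smult(4)[OF u_closed _ aA] by simp
  then show ?thesis using Units_l_inv[OF unit] smult(5)[OF aA] by simp
qed

text \<open>\<open>multilinear_decomposition\<close> evaluates monomials in a type of class
  \<open>comm_ring_1\<close>, so \<open>A\<close> is moved into a product ring as well.\<close>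

abbreviation Ea :: "'a \<Rightarrow> 'a fam" where "Ea \<equiv> emb (plain_ring A)"

lemma cring_pA: "cring (plain_ring A)" by (rule cring_plain_ring) unfold_locales

lemma Ea: "Ea \<zero>\<^bsub>A\<^esub> = 0" "x \<in> carrier A \<Longrightarrow> y \<in> carrier A \<Longrightarrow> Ea (x \<oplus>\<^bsub>A\<^esub> y) = Ea x + Ea y"
  "x \<in> carrier A \<Longrightarrow> y \<in> carrier A \<Longrightarrow> Ea (x \<otimes>\<^bsub>A\<^esub> y) = Ea x * Ea y" "x \<in> carrier A \<Longrightarrow> Ea \<one>\<^bsub>A\<^esub> * Ea x = Ea x"
  "x \<in> carrier A \<Longrightarrow> y \<in> carrier A \<Longrightarrow> Ea x = Ea y \<longleftrightarrow> x = y"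
  using emb_zero[OF cring_pA] emb_add[OF cring_pA, of x y] emb_mult[OF cring_pA, of x y] idm_emb[OF cring_pA, of x]
    emb_inject[OF cring_pA, of x y] by simp_all

lemma Ea_finsum: "finite S \<Longrightarrow> (\<And>s. s \<in> S \<Longrightarrow> f s \<in> carrier A) \<Longrightarrow> Ea (\<Oplus>\<^bsub>A\<^esub>s\<in>S. f s) = (\<Sum>s\<in>S. Ea (f s))"
proof (induction S rule: finite_induct)
  case (insert s S)
  then have "(\<Oplus>\<^bsub>A\<^esub>s\<in>insert s S. f s) = f s \<oplus>\<^bsub>A\<^esub> (\<Oplus>\<^bsub>A\<^esub>s\<in>S. f s)" by (intro A.finsum_insert) auto
  then show ?case using insert by (simp add: Ea A.finsum_closed)
qed (simp add: Ea)

lemma Ea_finprod: "finite S \<Longrightarrow> (\<And>s. s \<in> S \<Longrightarrow> f s \<in> carrier A) \<Longrightarrow> Ea (\<Otimes>\<^bsub>A\<^esub>s\<in>S. f s) = Ea \<one>\<^bsub>A\<^esub> * (\<Prod>s\<in>S. Ea (f s))"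
proof (induction S rule: finite_induct)
  case (insert s S)
  then have "(\<Otimes>\<^bsub>A\<^esub>s\<in>insert s S. f s) = f s \<otimes>\<^bsub>A\<^esub> (\<Otimes>\<^bsub>A\<^esub>s\<in>S. f s)" by (intro A.finprod_insert) auto
  then have "Ea (\<Otimes>\<^bsub>A\<^esub>s\<in>insert s S. f s) = Ea (f s) * Ea (\<Otimes>\<^bsub>A\<^esub>s\<in>S. f s)" using insert by (simp add: Ea A.finprod_closed)
  then show ?case using insert by (simp add: mult_ac)
qed simp

text \<open>This writes a transfer as one of the sums in \<open>multilinear_decomposition\<close>:
  the factor \<open>i\<close> takes at \<open>g\<close> the value of \<open>b i\<close> under the
  inverse of \<open>g\<close>. The inverse turns right multiplication of the index into the group
  action on the value.\<close>

lemma T_prod: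
  assumes S: "finite S" and b: "\<And>i. i \<in> S \<Longrightarrow> b i \<in> carrier A"
  shows "Ea \<one>\<^bsub>A\<^esub> * (\<Sum>g\<in>carrier G. \<Prod>i\<in>S. Ea (\<phi> (inv\<^bsub>G\<^esub> g) (b i))) = Ea (T (\<Otimes>\<^bsub>A\<^esub>i\<in>S. b i))"
proof -
  have bc: "(\<Otimes>\<^bsub>A\<^esub>i\<in>S. b i) \<in> carrier A" using b by (intro A.finprod_closed) auto
  have "Ea \<one>\<^bsub>A\<^esub> * (\<Sum>g\<in>carrier G. \<Prod>i\<in>S. Ea (\<phi> (inv\<^bsub>G\<^esub> g) (b i))) = (\<Sum>g\<in>carrier G. Ea (\<phi> (inv\<^bsub>G\<^esub> g) (\<Otimes>\<^bsub>A\<^esub>i\<in>S. b i)))"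
    unfolding sum_distrib_left
  proof (rule sum.cong[OF refl])
    fix g assume "g \<in> carrier G"
    then have g: "inv\<^bsub>G\<^esub> g \<in> carrier G" by simp
    show "Ea \<one>\<^bsub>A\<^esub> * (\<Prod>i\<in>S. Ea (\<phi> (inv\<^bsub>G\<^esub> g) (b i))) = Ea (\<phi> (inv\<^bsub>G\<^esub> g) (\<Otimes>\<^bsub>A\<^esub>i\<in>S. b i))"
      using \<phi>(8)[OF g, of b S] Ea_finprod[OF S, of "\<lambda>i. \<phi> (inv\<^bsub>G\<^esub> g) (b i)"] \<phi>(1)[OF g] b by simp
  qed
  also have "\<dots> = (\<Sum>g\<in>carrier G. Ea (\<phi> g (\<Otimes>\<^bsub>A\<^esub>i\<in>S. b i)))"
    by (rule sum.reindex_bij_betw) (auto intro: bij_betw_byWitness[of _ "\<lambda>g. inv\<^bsub>G\<^esub> g"])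
  also have "\<dots> = Ea (T (\<Otimes>\<^bsub>A\<^esub>i\<in>S. b i))" unfolding T_def using \<phi>(1) bc by (intro Ea_finsum[OF finG, symmetric]) auto
  finally show ?thesis .
qed

context
  fixes N :: nat
begin

definition Rn :: "'a set" where "Rn = generate_ring AG (sum_upto_deg AG (\<lambda>d. D d \<inter> carrier AG) N)"

lemma Rn_closed: "Rn \<subseteq> carrier AG"
proof -
  have "sum_upto_deg AG (\<lambda>d. D d \<inter> carrier AG) N \<subseteq> carrier AG"
    unfolding sum_upto_deg_def by (auto intro!: AG.finsum_closed)
  then show ?thesis unfolding Rn_def by (rule AG.generate_ring_incl)
qed

lemma Rn_D: assumes a: "a \<in> D k" "a \<in> carrier AG" "k \<le> N" shows "a \<in> Rn"
  unfolding Rn_def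
proof (rule generate_ring.incl)
  let ?f = "\<lambda>d. if k = d then a else \<zero>\<^bsub>AG\<^esub>"
  have "(\<Oplus>\<^bsub>AG\<^esub>d\<in>{..N}. ?f d) = a" using a(2,3) AG.finsum_singleton[of k "{..N}" "\<lambda>_. a"] by simp
  moreover have "?f \<in> Pi {..N} (\<lambda>d. D d \<inter> carrier AG)" using a AG.zero_closed D_zero by auto
  ultimately show "a \<in> sum_upto_deg AG (\<lambda>d. D d \<inter> carrier AG) N"
    unfolding sum_upto_deg_def by (intro CollectI exI[of _ ?f] conjI) (simp_all only:)
qed

lemma Rn_ring: "\<one>\<^bsub>A\<^esub> \<in> Rn" "\<zero>\<^bsub>A\<^esub> \<in> Rn" "a \<in> Rn \<Longrightarrow> b \<in> Rn \<Longrightarrow> a \<oplus>\<^bsub>A\<^esub> b \<in> Rn" "a \<in> Rn \<Longrightarrow> b \<in> Rn \<Longrightarrow> a \<otimes>\<^bsub>A\<^esub> b \<in> Rn"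
  "a \<in> Rn \<Longrightarrow> \<ominus>\<^bsub>A\<^esub> a \<in> Rn"
proof -
  note r = generate_ring.intros[where R = AG and H = "sum_upto_deg AG (\<lambda>d. D d \<inter> carrier AG) N", folded Rn_def, simplified]
  show "\<one>\<^bsub>A\<^esub> \<in> Rn" "a \<in> Rn \<Longrightarrow> b \<in> Rn \<Longrightarrow> a \<oplus>\<^bsub>A\<^esub> b \<in> Rn" "a \<in> Rn \<Longrightarrow> b \<in> Rn \<Longrightarrow> a \<otimes>\<^bsub>A\<^esub> b \<in> Rn" by (rule r; assumption)+
  show m: "a \<in> Rn \<Longrightarrow> \<ominus>\<^bsub>A\<^esub> a \<in> Rn" for a using r(3)[of a] AG_a_inv[of a] Rn_closed by auto
  have "\<one>\<^bsub>A\<^esub> \<oplus>\<^bsub>A\<^esub> \<ominus>\<^bsub>A\<^esub> \<one>\<^bsub>A\<^esub> \<in> Rn" by (intro r(4) r(1) m)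
  then show "\<zero>\<^bsub>A\<^esub> \<in> Rn" by (simp add: A.r_neg)
qed

text \<open>\<open>Rn\<close> is generated as a ring, without reference to scalars. This is the
  largest part of \<open>Rn\<close> that is closed under them, and the coefficients of the
  decomposition act on it.\<close>

definition Rs :: "'a set" where "Rs = {r \<in> carrier A. \<forall>c\<in>carrier K. c \<odot>\<^bsub>A\<^esub> r \<in> Rn}"

lemma Rs_Rn: "r \<in> Rs \<Longrightarrow> r \<in> Rn" using smult(5)[of r] one_closed by (force simp: Rs_def)

lemma Rs: "r \<in> Rs \<Longrightarrow> r \<in> carrier A" "\<zero>\<^bsub>A\<^esub> \<in> Rs" "r \<in> Rs \<Longrightarrow> s \<in> Rs \<Longrightarrow> r \<oplus>\<^bsub>A\<^esub> s \<in> Rs"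
  "r \<in> Rs \<Longrightarrow> s \<in> Rs \<Longrightarrow> r \<otimes>\<^bsub>A\<^esub> s \<in> Rs" "c \<in> carrier K \<Longrightarrow> r \<in> Rs \<Longrightarrow> c \<odot>\<^bsub>A\<^esub> r \<in> Rs"
proof -
  show "r \<in> Rs \<Longrightarrow> r \<in> carrier A" by (simp add: Rs_def)
  show "\<zero>\<^bsub>A\<^esub> \<in> Rs" by (simp add: Rs_def smult(7) Rn_ring(2))
  show "r \<in> Rs \<Longrightarrow> s \<in> Rs \<Longrightarrow> r \<oplus>\<^bsub>A\<^esub> s \<in> Rs" by (simp add: Rs_def smult(3) Rn_ring(3))
  show "r \<in> Rs \<Longrightarrow> s \<in> Rs \<Longrightarrow> r \<otimes>\<^bsub>A\<^esub> s \<in> Rs" using Rs_Rn[of s] by (simp add: Rs_def smult(9)[symmetric] Rn_ring(4))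
  show "c \<in> carrier K \<Longrightarrow> r \<in> Rs \<Longrightarrow> c \<odot>\<^bsub>A\<^esub> r \<in> Rs" by (simp add: Rs_def smult(1) smult(4)[symmetric])
qed

lemma Rs_sum: "finite J \<Longrightarrow> (\<And>j. j \<in> J \<Longrightarrow> f j \<in> Ea ` Rs) \<Longrightarrow> (\<Sum>j\<in>J. f j) \<in> Ea ` Rs"
proof (induction J rule: finite_induct)
  case empty
  show ?case using Rs(2) Ea(1) by (metis image_eqI sum.empty)
next
  case (insert j J)
  obtain r where r: "r \<in> Rs" "f j = Ea r" using insert.prems[of j] by auto
  obtain s where s: "s \<in> Rs" "(\<Sum>j\<in>J. f j) = Ea s" using insert by auto
  have "(\<Sum>j\<in>insert j J. f j) = Ea (r \<oplus>\<^bsub>A\<^esub> s)" using insert r s by (simp add: Ea(2) Rs(1))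
  then show ?case using Rs(3)[OF r(1) s(1)] by simp
qed

context
  assumes trivial: "\<And>S :: nat set. finite S \<Longrightarrow> N < card S \<Longrightarrow> prims (emb (plain_ring K) \<one>) G S = {\<lambda>_. 0}"
begin

lemma T_Rs:
  fixes S :: "nat set"
  assumes "finite S" "S \<noteq> {}" "\<And>i. i \<in> S \<Longrightarrow> b i \<in> D 0 \<union> D 1"
  shows "T (\<Otimes>\<^bsub>A\<^esub>i\<in>S. b i) \<in> Rs"
  using assms
proof (induction "card S" arbitrary: S b rule: less_induct)
  case less
  have bA: "b i \<in> carrier A" if "i \<in> S" for i using less.prems(3)[OF that] by (auto intro: D_sub)
  show ?case
  proof (cases "card S \<le> N")
    case True
    have "\<exists>k\<le>card S'. (\<Otimes>\<^bsub>A\<^esub>i\<in>S'. b i) \<in> D k" if "finite S'" "S' \<noteq> {}" "S' \<subseteq> S" for S' using that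
    proof (induction S' rule: finite_ne_induct)
      case (singleton i)
      then have "(\<Otimes>\<^bsub>A\<^esub>i\<in>{i}. b i) = b i" using bA by simp
      then show ?case using less.prems(3)[of i] singleton by auto
    next
      case (insert i S')
      obtain k where k: "k \<le> card S'" "(\<Otimes>\<^bsub>A\<^esub>i\<in>S'. b i) \<in> D k" using insert by auto
      obtain l where l: "l \<le> 1" "b i \<in> D l" using less.prems(3)[of i] insert.prems by auto
      have "(\<Otimes>\<^bsub>A\<^esub>i\<in>insert i S'. b i) = b i \<otimes>\<^bsub>A\<^esub> (\<Otimes>\<^bsub>A\<^esub>i\<in>S'. b i)" using insert bA by (intro A.finprod_insert) auto
      then have "(\<Otimes>\<^bsub>A\<^esub>i\<in>insert i S'. b i) \<in> D (l + k)" using D_mult[OF l(2) k(2)] by simp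
      moreover have "l + k \<le> card (insert i S')" using k(1) l(1) insert.hyps by simp
      ultimately show ?case by blast
    qed
    then obtain k where k: "k \<le> card S" "(\<Otimes>\<^bsub>A\<^esub>i\<in>S. b i) \<in> D k" using less.prems by blast
    have "c \<odot>\<^bsub>A\<^esub> T (\<Otimes>\<^bsub>A\<^esub>i\<in>S. b i) \<in> Rn" if c: "c \<in> carrier K" for c
    proof (rule Rn_D)
      show "c \<odot>\<^bsub>A\<^esub> T (\<Otimes>\<^bsub>A\<^esub>i\<in>S. b i) \<in> D k" by (intro smult_D T_D k(2) c)
      show "k \<le> N" using k(1) True by simp
      show "c \<odot>\<^bsub>A\<^esub> T (\<Otimes>\<^bsub>A\<^esub>i\<in>S. b i) \<in> carrier AG" using T_closed[OF D_sub[OF k(2)]] c by (simp add: AG_carrier smult(1) \<phi>_smult)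
    qed
    then show ?thesis using T_D[OF k(2)] by (auto simp: Rs_def intro: D_sub)
  next
    case False
    have "field (plain_ring K)" by (rule field_plain_ring) unfold_locales
    then interpret F: idem_field "emb (plain_ring K) \<one>" using idem_field_idm[of "plain_ring K"] by simp
    let ?J = "{(A, y). A \<subseteq> S \<and> A \<noteq> {} \<and> A \<noteq> S \<and> y \<in> S \<rightarrow>\<^sub>E carrier G}"
    have big: "N < card S" using False by simp
    \<comment> \<open>The identity at the one target type that occurs here, as a closed formula that
      can leave the elimination rule.\<close>
    define dec where "dec c \<longleftrightarrow> (\<forall>(\<Psi> :: 'k fam \<Rightarrow> 'a fam) \<alpha>. (\<forall>x y. \<Psi> (x + y) = \<Psi> x + \<Psi> y) \<longrightarrow>
      (\<Sum>g\<in>carrier G. \<Psi> (emb (plain_ring K) \<one>) * (\<Prod>i\<in>S. \<alpha> i g)) =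
      (\<Sum>(A, y)\<in>?J. \<Psi> (c (A, y)) * ((\<Sum>g\<in>carrier G. \<Prod>i\<in>A. \<alpha> i (y i \<otimes>\<^bsub>G\<^esub> g)) *
         (\<Sum>h\<in>carrier G. \<Prod>i\<in>S - A. \<alpha> i (y i \<otimes>\<^bsub>G\<^esub> h)))))" for c
    obtain c where c: "dec c"
    proof (rule F.multilinear_decomposition[OF G.is_group finG less.prems(1) trivial[OF less.prems(1) big]])
      fix c assume H: "\<And>(\<Psi> :: 'k fam \<Rightarrow> 'a fam) \<alpha>. (\<And>x y. \<Psi> (x + y) = \<Psi> x + \<Psi> y) \<Longrightarrow>
      (\<Sum>g\<in>carrier G. \<Psi> (emb (plain_ring K) \<one>) * (\<Prod>i\<in>S. \<alpha> i g)) =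
      (\<Sum>(A, y)\<in>?J. \<Psi> (c (A, y)) * ((\<Sum>g\<in>carrier G. \<Prod>i\<in>A. \<alpha> i (y i \<otimes>\<^bsub>G\<^esub> g)) *
         (\<Sum>h\<in>carrier G. \<Prod>i\<in>S - A. \<alpha> i (y i \<otimes>\<^bsub>G\<^esub> h))))"
      have "dec c" unfolding dec_def by (intro allI impI, rule H) simp
      then show thesis by (rule that)
    qed
    have cK: "cring (plain_ring K)" by (rule cring_plain_ring) unfold_locales
    define kap where "kap z = comp (plain_ring K) z" for z :: "'k fam"
    have kap: "kap z \<in> carrier K" "kap (z + w) = kap z \<oplus> kap w" for z w
      using comp_closed[OF cK] comp_simps(3)[OF cK] by (auto simp: kap_def)
    have kap_e: "kap (emb (plain_ring K) \<one>) = \<one>" using emb_comp[OF cK cK, of \<one>] by (simp add: kap_def)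
    \<comment> \<open>A coefficient becomes the corresponding multiple of 1 in
      \<open>A\<close>.\<close>
    define \<Psi> where "\<Psi> z = Ea (kap z \<odot>\<^bsub>A\<^esub> \<one>\<^bsub>A\<^esub>)" for z
    have \<Psi>_add: "\<Psi> (x + y) = \<Psi> x + \<Psi> y" for x y
      by (simp add: \<Psi>_def kap smult Ea(2))
    define \<alpha> where "\<alpha> i g = Ea (\<phi> (inv\<^bsub>G\<^esub> g) (b i))" for i g
    \<comment> \<open>The letter \<open>y i\<close> is absorbed into the factor \<open>b i\<close>.
      This keeps the degree, so the induction hypothesis covers the transfers of products of these
      factors.\<close>
    define \<beta> where "\<beta> y i = \<phi> (inv\<^bsub>G\<^esub> (y i)) (b i)" for y :: "nat \<Rightarrow> 'g" and i
    have \<beta>: "\<beta> y i \<in> D 0 \<union> D 1" "\<beta> y i \<in> carrier A" if "y i \<in> carrier G" "i \<in> S" for y i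
    proof -
      show "\<beta> y i \<in> D 0 \<union> D 1" using less.prems(3)[OF that(2)] \<phi>_D[OF G.inv_closed[OF that(1)]] by (auto simp: \<beta>_def)
      then show "\<beta> y i \<in> carrier A" by (auto intro: D_sub)
    qed
    have eq: "\<alpha> i (y i \<otimes>\<^bsub>G\<^esub> g) = Ea (\<phi> (inv\<^bsub>G\<^esub> g) (\<beta> y i))" if "y i \<in> carrier G" "i \<in> S" "g \<in> carrier G" for y i g
      using that bA[OF that(2)] \<phi>(9)[of "inv\<^bsub>G\<^esub> g" "inv\<^bsub>G\<^esub> (y i)" "b i"] by (simp add: \<alpha>_def \<beta>_def G.inv_mult_group)
    have part: "\<exists>r\<in>Rs. Ea \<one>\<^bsub>A\<^esub> * (\<Sum>g\<in>carrier G. \<Prod>i\<in>A'. \<alpha> i (y i \<otimes>\<^bsub>G\<^esub> g)) = Ea r"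
      if A': "A' \<subset> S" "A' \<noteq> {}" and y: "y \<in> S \<rightarrow>\<^sub>E carrier G" for A' y
    proof
      have fin: "finite A'" using A'(1) less.prems(1) finite_subset by blast
      have yc: "y i \<in> carrier G" "i \<in> S" if "i \<in> A'" for i using y A'(1) that by auto
      show "T (\<Otimes>\<^bsub>A\<^esub>i\<in>A'. \<beta> y i) \<in> Rs"
        by (rule less.hyps[OF psubset_card_mono[OF less.prems(1) A'(1)] fin A'(2)]) (rule \<beta>(1)[OF yc])
      have "(\<Sum>g\<in>carrier G. \<Prod>i\<in>A'. \<alpha> i (y i \<otimes>\<^bsub>G\<^esub> g)) = (\<Sum>g\<in>carrier G. \<Prod>i\<in>A'. Ea (\<phi> (inv\<^bsub>G\<^esub> g) (\<beta> y i)))"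
        by (intro sum.cong prod.cong refl eq yc) simp_all
      then show "Ea \<one>\<^bsub>A\<^esub> * (\<Sum>g\<in>carrier G. \<Prod>i\<in>A'. \<alpha> i (y i \<otimes>\<^bsub>G\<^esub> g)) = Ea (T (\<Otimes>\<^bsub>A\<^esub>i\<in>A'. \<beta> y i))"
        using T_prod[OF fin, of "\<beta> y"] \<beta>(2)[OF yc] by simp
    qed
    have "Ea (T (\<Otimes>\<^bsub>A\<^esub>i\<in>S. b i)) = (\<Sum>g\<in>carrier G. \<Psi> (emb (plain_ring K) \<one>) * (\<Prod>i\<in>S. \<alpha> i g))"
      using T_prod[OF less.prems(1) bA] by (simp add: \<Psi>_def kap_e smult(5) \<alpha>_def sum_distrib_left)
    also have "\<dots> = (\<Sum>(A, y)\<in>?J. \<Psi> (c (A, y)) * ((\<Sum>g\<in>carrier G. \<Prod>i\<in>A. \<alpha> i (y i \<otimes>\<^bsub>G\<^esub> g)) *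
         (\<Sum>h\<in>carrier G. \<Prod>i\<in>S - A. \<alpha> i (y i \<otimes>\<^bsub>G\<^esub> h))))"
      using c \<Psi>_add unfolding dec_def by blast
    also have "\<dots> \<in> Ea ` Rs"
    proof (rule Rs_sum)
      have "finite (S \<rightarrow>\<^sub>E carrier G)" using less.prems(1) finG by (intro finite_PiE) auto
      then show "finite ?J"
        by (intro finite_subset[of ?J "Pow S \<times> (S \<rightarrow>\<^sub>E carrier G)"]) (use less.prems(1) in auto)
      fix j assume "j \<in> ?J"
      then obtain A' y where j: "j = (A', y)" "A' \<subseteq> S" "A' \<noteq> {}" "A' \<noteq> S" "y \<in> S \<rightarrow>\<^sub>E carrier G" by auto
      let ?X = "\<Sum>g\<in>carrier G. \<Prod>i\<in>A'. \<alpha> i (y i \<otimes>\<^bsub>G\<^esub> g)" and ?Y = "\<Sum>g\<in>carrier G. \<Prod>i\<in>S - A'. \<alpha> i (y i \<otimes>\<^bsub>G\<^esub> g)"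
      have "\<exists>r\<in>Rs. Ea \<one>\<^bsub>A\<^esub> * ?X = Ea r" by (rule part) (use j in auto)
      then obtain r where r: "r \<in> Rs" "Ea \<one>\<^bsub>A\<^esub> * ?X = Ea r" ..
      have "\<exists>r\<in>Rs. Ea \<one>\<^bsub>A\<^esub> * ?Y = Ea r" by (rule part) (use j in auto)
      then obtain s where s: "s \<in> Rs" "Ea \<one>\<^bsub>A\<^esub> * ?Y = Ea s" ..
      let ?c = "kap (c (A', y))"
      have c1: "?c \<odot>\<^bsub>A\<^esub> \<one>\<^bsub>A\<^esub> \<in> carrier A" by (simp add: smult kap)
      \<comment> \<open>The scalar absorbs the unit of the ideal any number of times; two copies are
        split off, one to bring each of the two sums into the image of \<open>A\<close>.\<close>
      have "\<Psi> (c (A', y)) * (?X * ?Y) = (Ea \<one>\<^bsub>A\<^esub> * (Ea \<one>\<^bsub>A\<^esub> * Ea (?c \<odot>\<^bsub>A\<^esub> \<one>\<^bsub>A\<^esub>))) * (?X * ?Y)"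
        unfolding \<Psi>_def by (simp only: Ea(4)[OF c1])
      also have "\<dots> = Ea (?c \<odot>\<^bsub>A\<^esub> \<one>\<^bsub>A\<^esub>) * ((Ea \<one>\<^bsub>A\<^esub> * ?X) * (Ea \<one>\<^bsub>A\<^esub> * ?Y))" by (simp only: mult_ac)
      also have "\<dots> = Ea (?c \<odot>\<^bsub>A\<^esub> (r \<otimes>\<^bsub>A\<^esub> s))"
      proof -
        have rs: "r \<otimes>\<^bsub>A\<^esub> s \<in> carrier A" using Rs(1) r(1) s(1) by simp
        have "Ea (?c \<odot>\<^bsub>A\<^esub> \<one>\<^bsub>A\<^esub>) * (Ea r * Ea s) = Ea ((?c \<odot>\<^bsub>A\<^esub> \<one>\<^bsub>A\<^esub>) \<otimes>\<^bsub>A\<^esub> (r \<otimes>\<^bsub>A\<^esub> s))"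
          by (simp only: Ea(3)[OF c1 rs] Ea(3)[OF Rs(1)[OF r(1)] Rs(1)[OF s(1)]])
        also have "(?c \<odot>\<^bsub>A\<^esub> \<one>\<^bsub>A\<^esub>) \<otimes>\<^bsub>A\<^esub> (r \<otimes>\<^bsub>A\<^esub> s) = ?c \<odot>\<^bsub>A\<^esub> (r \<otimes>\<^bsub>A\<^esub> s)"
          using smult(9)[OF kap(1) A.one_closed rs] rs by simp
        finally show ?thesis by (simp only: r(2) s(2))
      qed
      finally show "(case j of (A, y) \<Rightarrow> \<Psi> (c (A, y)) * ((\<Sum>g\<in>carrier G. \<Prod>i\<in>A. \<alpha> i (y i \<otimes>\<^bsub>G\<^esub> g)) *
         (\<Sum>h\<in>carrier G. \<Prod>i\<in>S - A. \<alpha> i (y i \<otimes>\<^bsub>G\<^esub> h)))) \<in> Ea ` Rs"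
        using Rs(5)[OF kap(1) Rs(4)[OF r(1) s(1)]] by (simp add: j(1))
    qed
    finally obtain r where r: "r \<in> Rs" "Ea (T (\<Otimes>\<^bsub>A\<^esub>i\<in>S. b i)) = Ea r" by blast
    have "(\<Otimes>\<^bsub>A\<^esub>i\<in>S. b i) \<in> carrier A" using bA by (intro A.finprod_closed) auto
    then have "T (\<Otimes>\<^bsub>A\<^esub>i\<in>S. b i) = r" using r(2) Ea(5)[OF _ Rs(1)[OF r(1)]] T_closed by (simp add: AG_carrier)
    then show ?thesis using r(1) by simp
  qed
qed

definition M :: "'a set" where
  "M = {\<Otimes>\<^bsub>A\<^esub>i\<in>{..<n}. b i | (n :: nat) b. \<forall>i<n. b i \<in> D 0 \<union> D 1}"

lemma M_closed: "m \<in> M \<Longrightarrow> m \<in> carrier A"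
  using D01 by (auto simp: M_def intro!: A.finprod_closed)

lemma M_one: "\<one>\<^bsub>A\<^esub> \<in> M"
proof -
  have "\<one>\<^bsub>A\<^esub> = (\<Otimes>\<^bsub>A\<^esub>i\<in>{..<0::nat}. \<zero>\<^bsub>A\<^esub>)" by simp
  then show ?thesis unfolding M_def by blast
qed

lemma M_mult: assumes "h \<in> D 0 \<union> D 1" "m \<in> M" shows "h \<otimes>\<^bsub>A\<^esub> m \<in> M"
proof -
  obtain n b where b: "m = (\<Otimes>\<^bsub>A\<^esub>i\<in>{..<n}. b i)" "\<forall>i<(n::nat). b i \<in> D 0 \<union> D 1" using assms(2) by (auto simp: M_def)
  have bA: "b i \<in> carrier A" if "i < n" for i using b(2) that by (auto intro: D_sub)
  have hA: "h \<in> carrier A" using assms(1) by (auto intro: D_sub)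
  have "(\<Otimes>\<^bsub>A\<^esub>i\<in>insert n {..<n}. (b(n := h)) i) = h \<otimes>\<^bsub>A\<^esub> (\<Otimes>\<^bsub>A\<^esub>i\<in>{..<n}. (b(n := h)) i)"
    using bA hA by (subst A.finprod_insert) auto
  also have "(\<Otimes>\<^bsub>A\<^esub>i\<in>{..<n}. (b(n := h)) i) = m" unfolding b(1) using bA by (intro A.finprod_cong') auto
  finally have "h \<otimes>\<^bsub>A\<^esub> m = (\<Otimes>\<^bsub>A\<^esub>i\<in>{..<Suc n}. (b(n := h)) i)" by (simp only: lessThan_Suc)
  moreover have "\<forall>i<Suc n. (b(n := h)) i \<in> D 0 \<union> D 1" using b(2) assms(1) by (auto simp: less_Suc_eq)
  ultimately show ?thesis unfolding M_def by blast
qed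

lemma T_M: assumes "m \<in> M" shows "u \<odot>\<^bsub>A\<^esub> T m \<in> Rn"
proof -
  obtain n b where b: "m = (\<Otimes>\<^bsub>A\<^esub>i\<in>{..<n}. b i)" "\<forall>i<(n::nat). b i \<in> D 0 \<union> D 1" using assms by (auto simp: M_def)
  show ?thesis
  proof (cases "n = 0")
    case True
    \<comment> \<open>The empty product is outside the scope of \<open>T_Rs\<close>; it is
      invariant, so its averaged transfer is 1 itself.\<close>
    then have "m = \<one>\<^bsub>A\<^esub>" using b(1) by simp
    then show ?thesis using T_invariant[of "\<one>\<^bsub>A\<^esub>"] Rn_ring(1) AG.one_closed by simp
  next
    case False
    have "T m \<in> Rs" unfolding b(1) by (rule T_Rs) (use b(2) False in auto)
    then show ?thesis using u_closed by (simp add: Rs_def)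
  qed
qed

text \<open>Instead of expanding elements into sums of monomials, \<open>Q a\<close> says that the
  averaged transfer of \<open>a\<close> times any monomial lies in \<open>Rn\<close>. The elements
  whose multiplication preserves \<open>Q\<close> form a subring that contains the generators, hence
  are all of \<open>A\<close>; starting from 1 this gives \<open>Q\<close> everywhere, and an
  invariant is its own averaged transfer.\<close>

theorem invariants_generated:
  assumes gen: "gen_degree A D \<le> 1"
  shows "Rn = carrier AG"
proof
  show "Rn \<subseteq> carrier AG" by (rule Rn_closed)
  \<comment> \<open>The infimum is attained because the set is nonempty, and it may be attained at 0
    as well as at 1.\<close>
  have gen1: "generate_ring A (sum_upto_deg A D 1) = carrier A \<or> generate_ring A (sum_upto_deg A D 0) = carrier A"
  proof -
    let ?S = "{enat n | n. generate_ring A (sum_upto_deg A D n) = carrier A}"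
    have "?S \<noteq> {}" using gen by (auto simp: gen_degree_def Inf_enat_def split: if_splits)
    moreover from this obtain s where "s \<in> ?S" by (meson ex_in_conv)
    then have "(LEAST x. x \<in> ?S) \<in> ?S" by (rule LeastI)
    ultimately have "Inf ?S \<in> ?S" by (simp only: Inf_enat_def if_False)
    then obtain n where n: "Inf ?S = enat n" "generate_ring A (sum_upto_deg A D n) = carrier A" by blast
    have "n \<le> 1" using gen n(1) by (simp add: gen_degree_def one_enat_def)
    then have "n = 0 \<or> n = 1" by auto
    then show ?thesis using n(2) by auto
  qed
  have sub: "h \<in> carrier A \<and> (\<exists>h0\<in>D 0. \<exists>h1\<in>D 1. h = h0 \<oplus>\<^bsub>A\<^esub> h1)" if hs: "h \<in> sum_upto_deg A D n" and n01: "n = 0 \<or> n = 1" for h n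
  proof -
    obtain f where f: "h = (\<Oplus>\<^bsub>A\<^esub>d\<in>{..n}. f d)" "f \<in> Pi {..n} D" using hs by (auto simp: sum_upto_deg_def)
    have f0: "f 0 \<in> D 0" using f(2) by auto
    show ?thesis
    proof (cases "n = 0")
      case True
      have "h = f 0 \<oplus>\<^bsub>A\<^esub> \<zero>\<^bsub>A\<^esub>" using f True D_sub[OF f0] by simp
      then show ?thesis using f0 D_zero[of 1] D_sub[OF f0] by (intro conjI bexI[of _ "f 0"] bexI[of _ "\<zero>\<^bsub>A\<^esub>"]) auto
    next
      case False
      then have n: "n = Suc 0" using n01 by simp
      have f1: "f 1 \<in> D 1" using f(2) n by auto
      have "{..Suc 0} = insert 1 {0}" by auto
      then have "h = (\<Oplus>\<^bsub>A\<^esub>d\<in>insert 1 {0}. f d)" using f(1) n by simp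
      also have "\<dots> = f 1 \<oplus>\<^bsub>A\<^esub> f 0" using D_sub[OF f0] D_sub[OF f1] by (subst A.finsum_insert) auto
      finally have "h = f 0 \<oplus>\<^bsub>A\<^esub> f 1" using D_sub[OF f0] D_sub[OF f1] by (simp add: A.a_comm)
      then show ?thesis using f0 f1 D_sub[OF f0] D_sub[OF f1] by (intro conjI bexI[of _ "f 0"] bexI[of _ "f 1"]) auto
    qed
  qed
  define Q where "Q a \<longleftrightarrow> a \<in> carrier A \<and> (\<forall>m\<in>M. u \<odot>\<^bsub>A\<^esub> T (a \<otimes>\<^bsub>A\<^esub> m) \<in> Rn)" for a
  have Tc: "T a \<in> carrier A" if "a \<in> carrier A" for a using T_closed[OF that] by (simp add: AG_carrier)
  have Q_add: "Q (a \<oplus>\<^bsub>A\<^esub> b)" if "Q a" "Q b" for a b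
    using that by (auto simp: Q_def A.l_distr M_closed T_add smult(3)[OF u_closed] Tc Rn_ring(3))
  have Q_neg: "Q (\<ominus>\<^bsub>A\<^esub> a)" if a: "Q a" for a unfolding Q_def
  proof (intro conjI ballI)
    have aA: "a \<in> carrier A" using a by (simp add: Q_def)
    then show "\<ominus>\<^bsub>A\<^esub> a \<in> carrier A" by simp
    fix m assume m: "m \<in> M"
    let ?x = "a \<otimes>\<^bsub>A\<^esub> m" and ?y = "\<ominus>\<^bsub>A\<^esub> a \<otimes>\<^bsub>A\<^esub> m"
    have c: "?x \<in> carrier A" "?y \<in> carrier A" using aA M_closed[OF m] by auto
    have y: "?y = \<ominus>\<^bsub>A\<^esub> ?x" using aA M_closed[OF m] by (simp add: A.l_minus)
    have "T \<zero>\<^bsub>A\<^esub> = \<zero>\<^bsub>A\<^esub>" unfolding T_def using \<phi>(5) by (intro A.add.finprod_one_eqI) auto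
    moreover have "T (?y \<oplus>\<^bsub>A\<^esub> ?x) = T ?y \<oplus>\<^bsub>A\<^esub> T ?x" by (rule T_add[OF c(2,1)])
    moreover have "?y \<oplus>\<^bsub>A\<^esub> ?x = \<zero>\<^bsub>A\<^esub>" unfolding y by (rule A.l_neg[OF c(1)])
    ultimately have "T ?y \<oplus>\<^bsub>A\<^esub> T ?x = \<zero>\<^bsub>A\<^esub>" by simp
    then have "T ?y = \<ominus>\<^bsub>A\<^esub> T ?x" using A.minus_equality[OF _ Tc[OF c(1)] Tc[OF c(2)]] by simp
    then have "u \<odot>\<^bsub>A\<^esub> T ?y = \<ominus>\<^bsub>A\<^esub> (u \<odot>\<^bsub>A\<^esub> T ?x)" using smult(8)[OF u_closed Tc[OF c(1)]] by simp
    then show "u \<odot>\<^bsub>A\<^esub> T ?y \<in> Rn" using a m Rn_ring(5) by (auto simp: Q_def)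
  qed
  have Q_hom: "Q (h \<otimes>\<^bsub>A\<^esub> a)" if h: "h \<in> D 0 \<union> D 1" and a: "Q a" for h a unfolding Q_def
  proof (intro conjI ballI)
    have c: "h \<in> carrier A" "a \<in> carrier A" using h a by (auto simp: Q_def intro: D_sub)
    then show "h \<otimes>\<^bsub>A\<^esub> a \<in> carrier A" by simp
    fix m assume m: "m \<in> M"
    have "h \<otimes>\<^bsub>A\<^esub> a \<otimes>\<^bsub>A\<^esub> m = a \<otimes>\<^bsub>A\<^esub> (h \<otimes>\<^bsub>A\<^esub> m)" using c M_closed[OF m] by (simp add: A.m_ac)
    then show "u \<odot>\<^bsub>A\<^esub> T (h \<otimes>\<^bsub>A\<^esub> a \<otimes>\<^bsub>A\<^esub> m) \<in> Rn" using a M_mult[OF h m] by (simp add: Q_def)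
  qed
  have step: "x \<in> carrier A \<and> (\<forall>a. Q a \<longrightarrow> Q (x \<otimes>\<^bsub>A\<^esub> a))" if xs: "x \<in> generate_ring A (sum_upto_deg A D n)" and n01: "n = 0 \<or> n = 1" for x n
    using xs
  proof (induction rule: generate_ring.induct)
    case one
    show ?case by (auto simp: Q_def)
  next
    case (incl h)
    obtain h0 h1 where h: "h \<in> carrier A" "h0 \<in> D 0" "h1 \<in> D 1" "h = h0 \<oplus>\<^bsub>A\<^esub> h1" using sub[OF incl n01] by blast
    have "Q (h \<otimes>\<^bsub>A\<^esub> a)" if a: "Q a" for a
    proof -
      have "h \<otimes>\<^bsub>A\<^esub> a = h0 \<otimes>\<^bsub>A\<^esub> a \<oplus>\<^bsub>A\<^esub> h1 \<otimes>\<^bsub>A\<^esub> a"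
        unfolding h(4) using a by (intro A.l_distr D_sub[OF h(2)] D_sub[OF h(3)]) (simp add: Q_def)
      then show ?thesis using Q_add[OF Q_hom[OF _ a] Q_hom[OF _ a], of h0 h1] h(2,3) by simp
    qed
    then show ?case using h(1) by blast
  next
    case (a_inv h)
    have "\<ominus>\<^bsub>A\<^esub> h \<otimes>\<^bsub>A\<^esub> a = \<ominus>\<^bsub>A\<^esub> (h \<otimes>\<^bsub>A\<^esub> a)" if "Q a" for a using a_inv that by (intro A.l_minus) (auto simp: Q_def)
    then show ?case using a_inv Q_neg by simp
  next
    case (eng_add h k)
    have "(h \<oplus>\<^bsub>A\<^esub> k) \<otimes>\<^bsub>A\<^esub> a = h \<otimes>\<^bsub>A\<^esub> a \<oplus>\<^bsub>A\<^esub> k \<otimes>\<^bsub>A\<^esub> a" if "Q a" for a using eng_add that by (intro A.l_distr) (auto simp: Q_def)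
    then show ?case using eng_add Q_add by simp
  next
    case (eng_mult h k)
    have "(h \<otimes>\<^bsub>A\<^esub> k) \<otimes>\<^bsub>A\<^esub> a = h \<otimes>\<^bsub>A\<^esub> (k \<otimes>\<^bsub>A\<^esub> a)" if "Q a" for a using eng_mult that by (intro A.m_assoc) (auto simp: Q_def)
    then show ?case using eng_mult by simp
  qed
  have Q1: "Q \<one>\<^bsub>A\<^esub>" using T_M by (simp add: Q_def M_closed)
  have Q: "Q a" if a: "a \<in> carrier A" for a
  proof -
    have "a \<otimes>\<^bsub>A\<^esub> \<one>\<^bsub>A\<^esub> = a" using a by simp
    moreover have "a \<in> generate_ring A (sum_upto_deg A D 0) \<or> a \<in> generate_ring A (sum_upto_deg A D 1)" using gen1 a by auto
    ultimately show ?thesis using step Q1 by metis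
  qed
  show "carrier AG \<subseteq> Rn"
  proof
    fix a assume a: "a \<in> carrier AG"
    then have aA: "a \<in> carrier A" by (simp add: AG_carrier)
    have "u \<odot>\<^bsub>A\<^esub> T (a \<otimes>\<^bsub>A\<^esub> \<one>\<^bsub>A\<^esub>) \<in> Rn" using Q[OF aA] M_one by (auto simp: Q_def)
    then show "a \<in> Rn" using T_invariant[OF a] aA by simp
  qed
qed

end

end

end

section \<open>Transport along injections\<close>

lemma generate_ring_image:
  assumes A: "cring A" and B: "cring B" and f: "f \<in> ring_hom A B" and H: "H \<subseteq> carrier A"
  shows "generate_ring B (f ` H) = f ` generate_ring A H"
proof -
  interpret h: ring_hom_cring A B f by (intro ring_hom_cring.intro ring_hom_cring_axioms.intro A B f)
  have c: "x \<in> carrier A" if "x \<in> generate_ring A H" for x using h.R.generate_ring_incl[OF H] that by blast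
  show ?thesis
  proof (intro equalityI subsetI)
    fix y assume "y \<in> generate_ring B (f ` H)"
    then show "y \<in> f ` generate_ring A H"
    proof (induction rule: generate_ring.induct)
      case one
      show ?case by (rule image_eqI[OF _ generate_ring.one]) simp
    next
      case (incl y)
      then show ?case using generate_ring.incl[of _ H A] by blast
    next
      case (a_inv y)
      then obtain x where x: "x \<in> generate_ring A H" "y = f x" by blast
      show ?case unfolding x(2) by (rule image_eqI[OF _ generate_ring.a_inv[OF x(1)]]) (simp add: c[OF x(1)])
    next
      case (eng_add y z)
      then obtain x w where x: "x \<in> generate_ring A H" "y = f x" "w \<in> generate_ring A H" "z = f w" by blast
      show ?case unfolding x(2,4)
        by (rule image_eqI[OF _ generate_ring.eng_add[OF x(1,3)]]) (simp add: c[OF x(1)] c[OF x(3)])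
    next
      case (eng_mult y z)
      then obtain x w where x: "x \<in> generate_ring A H" "y = f x" "w \<in> generate_ring A H" "z = f w" by blast
      show ?case unfolding x(2,4)
        by (rule image_eqI[OF _ generate_ring.eng_mult[OF x(1,3)]]) (simp add: c[OF x(1)] c[OF x(3)])
    qed
  next
    fix y assume "y \<in> f ` generate_ring A H"
    then obtain x where x: "x \<in> generate_ring A H" "y = f x" by blast
    have "f x \<in> generate_ring B (f ` H)" using x(1)
    proof (induction rule: generate_ring.induct)
      case one
      show ?case using generate_ring.one[of B "f ` H"] by simp
    next
      case (incl x)
      then show ?case by (intro generate_ring.incl imageI)
    next
      case (a_inv x)
      then show ?case using generate_ring.a_inv[of "f x" B] c by simp
    next
      case (eng_add x w)
      then show ?case using generate_ring.eng_add[of "f x" B _ "f w"] c by simp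
    next
      case (eng_mult x w)
      then show ?case using generate_ring.eng_mult[of "f x" B _ "f w"] c by simp
    qed
    then show "y \<in> generate_ring B (f ` H)" using x(2) by simp
  qed
qed

lemma gen_degree_iso:
  assumes A: "cring A" and B: "cring B" and f: "f \<in> ring_hom A B" "inj_on f (carrier A)" "f ` carrier A = carrier B"
    and D: "\<And>d. D d \<subseteq> carrier A" and D': "\<And>d. D' d = f ` D d"
  shows "gen_degree B D' = gen_degree A D"
proof -
  interpret h: ring_hom_cring A B f by (intro ring_hom_cring.intro ring_hom_cring_axioms.intro A B f(1))
  have sums: "sum_upto_deg B D' n = f ` sum_upto_deg A D n" for n
  proof (intro equalityI subsetI)
    fix y assume "y \<in> sum_upto_deg B D' n"
    then obtain w where w: "y = (\<Oplus>\<^bsub>B\<^esub>d\<in>{..n}. w d)" "w \<in> Pi {..n} D'" by (auto simp: sum_upto_deg_def)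
    then have "\<forall>d\<in>{..n}. \<exists>x. x \<in> D d \<and> w d = f x" by (auto simp: D' Pi_iff)
    then obtain v where v: "\<forall>d\<in>{..n}. v d \<in> D d \<and> w d = f (v d)" by (rule bchoice[THEN exE])
    have vc: "v d \<in> carrier A" if "d \<in> {..n}" for d using v that D by blast
    have "y = (\<Oplus>\<^bsub>B\<^esub>d\<in>{..n}. (f \<circ> v) d)" unfolding w(1)
      using v vc by (intro h.S.finsum_cong') auto
    also have "\<dots> = f (\<Oplus>\<^bsub>A\<^esub>d\<in>{..n}. v d)" using vc by (subst h.hom_finsum) auto
    finally have "y = f (\<Oplus>\<^bsub>A\<^esub>d\<in>{..n}. v d)" .
    moreover have "(\<Oplus>\<^bsub>A\<^esub>d\<in>{..n}. v d) \<in> sum_upto_deg A D n" unfolding sum_upto_deg_def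
      by (intro CollectI exI[of _ v] conjI refl Pi_I) (use v in blast)
    ultimately show "y \<in> f ` sum_upto_deg A D n" by (rule image_eqI)
  next
    fix y assume "y \<in> f ` sum_upto_deg A D n"
    then obtain v where v: "y = f (\<Oplus>\<^bsub>A\<^esub>d\<in>{..n}. v d)" "v \<in> Pi {..n} D" by (auto simp: sum_upto_deg_def)
    have "y = (\<Oplus>\<^bsub>B\<^esub>d\<in>{..n}. (f \<circ> v) d)" unfolding v(1)
      by (subst h.hom_finsum) (use v(2) D in \<open>auto simp: Pi_iff o_def\<close>)
    show "y \<in> sum_upto_deg B D' n" unfolding sum_upto_deg_def
    proof (intro CollectI exI[of _ "f \<circ> v"] conjI Pi_I)
      show "(f \<circ> v) d \<in> D' d" if "d \<in> {..n}" for d using v(2) that by (simp add: D' Pi_iff)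
    qed (fact \<open>y = (\<Oplus>\<^bsub>B\<^esub>d\<in>{..n}. (f \<circ> v) d)\<close>)
  qed
  have sub: "sum_upto_deg A D n \<subseteq> carrier A" for n
    using D by (auto simp: sum_upto_deg_def intro!: h.R.finsum_closed)
  have "generate_ring B (sum_upto_deg B D' n) = carrier B \<longleftrightarrow> generate_ring A (sum_upto_deg A D n) = carrier A" for n
    unfolding sums generate_ring_image[OF A B f(1) sub] f(3)[symmetric]
    by (rule inj_on_image_eq_iff[OF f(2) h.R.generate_ring_incl[OF sub] subset_refl])
  then show ?thesis by (simp add: gen_degree_def)
qed

text \<open>The type of the polynomial functions need not be the universe type over which the
  Noether number is formed. So the whole structure is copied along an injection \<open>f\<close> of
  the carrier.\<close>

locale transported_action = graded_action K G A D \<phi>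
  for K :: "('k, 'l) ring_scheme" (structure) and G :: "('g, 'h) monoid_scheme"
    and A :: "('k, 'a, 'm) module_scheme" and D :: "nat \<Rightarrow> 'a set" and \<phi> :: "'g \<Rightarrow> 'a \<Rightarrow> 'a" +
  fixes f :: "'a \<Rightarrow> 'u"
  assumes inj_f: "inj_on f (carrier A)"
begin

abbreviation bk :: "'u \<Rightarrow> 'a" where "bk \<equiv> inv_into (carrier A) f"

definition B :: "('k, 'u) module" where
  "B = \<lparr>carrier = f ` carrier A, monoid.mult = (\<lambda>x y. f (bk x \<otimes>\<^bsub>A\<^esub> bk y)), monoid.one = f \<one>\<^bsub>A\<^esub>,
     ring.zero = f \<zero>\<^bsub>A\<^esub>, ring.add = (\<lambda>x y. f (bk x \<oplus>\<^bsub>A\<^esub> bk y)),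
     module.smult = (\<lambda>c x. f (c \<odot>\<^bsub>A\<^esub> bk x))\<rparr>"

abbreviation DB :: "nat \<Rightarrow> 'u set" where "DB d \<equiv> f ` D d"

definition \<phi>B :: "'g \<Rightarrow> 'u \<Rightarrow> 'u" where "\<phi>B g = (\<lambda>x\<in>f ` carrier A. f (\<phi> g (bk x)))"

lemma B_simps:
  "carrier B = f ` carrier A" "\<one>\<^bsub>B\<^esub> = f \<one>\<^bsub>A\<^esub>" "\<zero>\<^bsub>B\<^esub> = f \<zero>\<^bsub>A\<^esub>"
  "a \<in> carrier A \<Longrightarrow> b \<in> carrier A \<Longrightarrow> f a \<otimes>\<^bsub>B\<^esub> f b = f (a \<otimes>\<^bsub>A\<^esub> b)"
  "a \<in> carrier A \<Longrightarrow> b \<in> carrier A \<Longrightarrow> f a \<oplus>\<^bsub>B\<^esub> f b = f (a \<oplus>\<^bsub>A\<^esub> b)"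
  "a \<in> carrier A \<Longrightarrow> c \<odot>\<^bsub>B\<^esub> f a = f (c \<odot>\<^bsub>A\<^esub> a)"
  "a \<in> carrier A \<Longrightarrow> \<phi>B g (f a) = f (\<phi> g a)"
  using inv_into_f_f[OF inj_f] by (simp_all add: B_def \<phi>B_def)

lemma f_eq: "a \<in> carrier A \<Longrightarrow> b \<in> carrier A \<Longrightarrow> f a = f b \<longleftrightarrow> a = b"
  using inj_f by (auto simp: inj_on_def)

lemma B_cring: "cring B"
proof (rule cringI)
  show "abelian_group B"
  proof (rule abelian_groupI)
    fix x assume "x \<in> carrier B"
    then obtain a where a: "a \<in> carrier A" "x = f a" by (auto simp: B_simps)
    then show "\<exists>y\<in>carrier B. y \<oplus>\<^bsub>B\<^esub> x = \<zero>\<^bsub>B\<^esub>"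
      by (intro bexI[of _ "f (\<ominus>\<^bsub>A\<^esub> a)"]) (auto simp: B_simps A.l_neg)
  qed (auto simp: B_simps A.add.m_ac)
  show "comm_monoid B" by (rule comm_monoidI) (auto simp: B_simps A.m_ac)
qed (auto simp: B_simps A.l_distr)

lemma f_hom: "f \<in> ring_hom A B"
  by (rule ring_hom_memI) (auto simp: B_simps)

lemma B_algebra: "algebra K B"
proof (rule algebraI)
  show "cring K" by unfold_locales
  show "cring B" by (rule B_cring)
qed (auto simp: B_simps smult)

lemma ne_empty: "x \<in> S \<Longrightarrow> S \<noteq> {}" by auto

lemma B_graded: "graded_cring B DB"
  unfolding graded_cring_def
proof (intro conjI allI ballI)
  interpret f: ring_hom_cring A B f
    by (intro ring_hom_cring.intro ring_hom_cring_axioms.intro A.is_cring B_cring f_hom)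
  show "cring B" by (rule B_cring)
  show "additive_subgroup (DB d) B" for d
  proof -
    have S: "additive_subgroup (D d) A" using graded by (simp add: graded_cring_def)
    have sub: "DB d \<subseteq> carrier B" unfolding B_simps(1) by (rule image_mono, rule subsetI, rule D_sub)
    have ne: "DB d \<noteq> {}" using imageI[OF D_zero, of f d] by (rule ne_empty)
    have inv: "\<ominus>\<^bsub>B\<^esub> x \<in> DB d" if x: "x \<in> DB d" for x
    proof (rule imageE[OF x])
      fix a assume a: "x = f a" "a \<in> D d"
      have "\<ominus>\<^bsub>B\<^esub> x = f (\<ominus>\<^bsub>A\<^esub> a)" unfolding a(1) by (rule f.hom_a_inv[OF D_sub[OF a(2)], symmetric])
      moreover have "\<ominus>\<^bsub>A\<^esub> a \<in> D d"
        using subgroup.m_inv_closed[OF additive_subgroup.a_subgroup[OF S] a(2)] by (simp only: a_inv_def)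
      ultimately show ?thesis by (simp only: imageI)
    qed
    have add: "x \<oplus>\<^bsub>B\<^esub> y \<in> DB d" if x: "x \<in> DB d" and y: "y \<in> DB d" for x y
    proof (rule imageE[OF x], rule imageE[OF y])
      fix a b assume ab: "x = f a" "a \<in> D d" "y = f b" "b \<in> D d"
      have "x \<oplus>\<^bsub>B\<^esub> y = f (a \<oplus>\<^bsub>A\<^esub> b)" unfolding ab(1,3) by (rule B_simps(5)[OF D_sub[OF ab(2)] D_sub[OF ab(4)]])
      then show ?thesis using imageI[OF D_add[OF ab(2,4)], of f] by (simp only:)
    qed
    have "subgroup (DB d) (add_monoid B)"
      by (rule f.S.add.subgroupI) (use sub ne inv add in \<open>simp_all add: a_inv_def\<close>)
    then show ?thesis by (rule additive_subgroup.intro)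
  qed
  show "x \<otimes>\<^bsub>B\<^esub> y \<in> DB (d + e)" if x: "x \<in> DB d" and y: "y \<in> DB e" for d e x y
  proof -
    obtain a b where ab: "a \<in> D d" "x = f a" "b \<in> D e" "y = f b" using x y by blast
    have "x \<otimes>\<^bsub>B\<^esub> y = f (a \<otimes>\<^bsub>A\<^esub> b)" unfolding ab(2,4) by (intro B_simps(4) D_sub[OF ab(1)] D_sub[OF ab(3)])
    then show ?thesis using imageI[OF D_mult[OF ab(1,3)], of f] by simp
  qed
  fix x assume "x \<in> carrier B"
  then obtain a where a: "a \<in> carrier A" "x = f a" by (auto simp: B_simps)
  let ?dec = "\<lambda>h a. (\<forall>d. h d \<in> D d) \<and> finite {d. h d \<noteq> \<zero>\<^bsub>A\<^esub>} \<and> a = (\<Oplus>\<^bsub>A\<^esub>d\<in>{d. h d \<noteq> \<zero>\<^bsub>A\<^esub>}. h d)"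
  have uniq: "\<exists>!h. ?dec h a"
    by (rule bspec[OF graded[unfolded graded_cring_def, THEN conjunct2, THEN conjunct2, THEN conjunct2] a(1)])
  obtain h where h: "?dec h a" and hu: "\<forall>k. ?dec k a \<longrightarrow> k = h" by (rule ex1E[OF uniq]) (rule that)
  have supp_eq: "{d. f (k d) \<noteq> \<zero>\<^bsub>B\<^esub>} = {d. k d \<noteq> \<zero>\<^bsub>A\<^esub>}" if k: "\<forall>d. k d \<in> D d" for k
  proof -
    have "f (k d) = \<zero>\<^bsub>B\<^esub> \<longleftrightarrow> k d = \<zero>\<^bsub>A\<^esub>" for d
      unfolding B_simps(3) by (rule f_eq[OF D_sub[OF k[rule_format]] A.zero_closed])
    then show ?thesis by (simp only:)
  qed
  have sum_eq: "f (\<Oplus>\<^bsub>A\<^esub>d\<in>S. k d) = (\<Oplus>\<^bsub>B\<^esub>d\<in>S. f (k d))" if k: "\<forall>d. k d \<in> D d" for k S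
  proof -
    have "k \<in> S \<rightarrow> carrier A" by (intro Pi_I D_sub[OF k[rule_format]])
    from f.hom_finsum[OF this] show ?thesis by (simp only: o_def)
  qed
  show "\<exists>!h'. (\<forall>d. h' d \<in> DB d) \<and> finite {d. h' d \<noteq> \<zero>\<^bsub>B\<^esub>} \<and> x = (\<Oplus>\<^bsub>B\<^esub>d\<in>{d. h' d \<noteq> \<zero>\<^bsub>B\<^esub>}. h' d)"
  proof (rule ex1I[of _ "\<lambda>d. f (h d)"])
    have hD: "\<forall>d. h d \<in> D d" by (rule h[THEN conjunct1])
    show "(\<forall>d. f (h d) \<in> DB d) \<and> finite {d. f (h d) \<noteq> \<zero>\<^bsub>B\<^esub>} \<and> x = (\<Oplus>\<^bsub>B\<^esub>d\<in>{d. f (h d) \<noteq> \<zero>\<^bsub>B\<^esub>}. f (h d))"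
    proof (intro conjI allI)
      show "f (h d) \<in> DB d" for d by (rule imageI[OF hD[rule_format]])
      show "finite {d. f (h d) \<noteq> \<zero>\<^bsub>B\<^esub>}" unfolding supp_eq[OF hD] by (rule h[THEN conjunct2, THEN conjunct1])
      show "x = (\<Oplus>\<^bsub>B\<^esub>d\<in>{d. f (h d) \<noteq> \<zero>\<^bsub>B\<^esub>}. f (h d))"
        unfolding supp_eq[OF hD] sum_eq[OF hD, symmetric] a(2) by (rule arg_cong[OF h[THEN conjunct2, THEN conjunct2]])
    qed
    \<comment> \<open>A decomposition in \<open>B\<close> is pulled back componentwise to
      \<open>A\<close>, where uniqueness is known.\<close>
    fix h' assume h': "(\<forall>d. h' d \<in> DB d) \<and> finite {d. h' d \<noteq> \<zero>\<^bsub>B\<^esub>} \<and> x = (\<Oplus>\<^bsub>B\<^esub>d\<in>{d. h' d \<noteq> \<zero>\<^bsub>B\<^esub>}. h' d)"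
    have "\<forall>d. \<exists>b. b \<in> D d \<and> h' d = f b" using h'[THEN conjunct1] unfolding image_iff Bex_def .
    then obtain k where k: "\<forall>d. k d \<in> D d \<and> h' d = f (k d)" by (rule choice[THEN exE])
    then have kD: "\<forall>d. k d \<in> D d" by simp
    have h'k: "h' = (\<lambda>d. f (k d))" by (rule ext) (rule k[THEN spec, THEN conjunct2])
    have fin: "finite {d. k d \<noteq> \<zero>\<^bsub>A\<^esub>}" using h'[THEN conjunct2, THEN conjunct1] by (simp only: h'k supp_eq[OF kD])
    have fa: "f a = f (\<Oplus>\<^bsub>A\<^esub>d\<in>{d. k d \<noteq> \<zero>\<^bsub>A\<^esub>}. k d)"
      using h'[THEN conjunct2, THEN conjunct2] by (simp only: h'k supp_eq[OF kD] sum_eq[OF kD] a(2))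
    have "(\<Oplus>\<^bsub>A\<^esub>d\<in>{d. k d \<noteq> \<zero>\<^bsub>A\<^esub>}. k d) \<in> carrier A" using kD D_sub by (intro A.finsum_closed) auto
    then have "a = (\<Oplus>\<^bsub>A\<^esub>d\<in>{d. k d \<noteq> \<zero>\<^bsub>A\<^esub>}. k d)" using fa f_eq[OF a(1)] by (simp only:)
    then have "?dec k a" by (intro conjI kD fin)
    then have "k = h" by (rule hu[THEN spec, THEN mp])
    then show "h' = (\<lambda>d. f (h d))" by (simp only: h'k)
  qed
qed

lemma B_action: "graded_G_algebra K G B DB \<phi>B"
  unfolding graded_G_algebra_def graded_algebra_def
proof (intro conjI ballI allI)
  show "algebra K B" "graded_cring B DB" by (rule B_algebra B_graded)+
  show "c \<odot>\<^bsub>B\<^esub> x \<in> DB d" if "c \<in> carrier K" "x \<in> DB d" for c x d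
    using that smult_D D_sub by (auto simp: B_simps)
  have one: "\<phi> \<one>\<^bsub>G\<^esub> a = a" if "a \<in> carrier A" for a
    using fun_cong[OF group_action.id_eq_one[OF ga], of a] that by simp
  show "group_action G (carrier B) \<phi>B"
  proof (rule group_actionI[OF G.is_group])
    show "\<phi>B g \<in> extensional (carrier B)" for g by (simp add: \<phi>B_def B_simps)
  qed (auto simp: B_simps \<phi> one)
  fix g assume g: "g \<in> carrier G"
  show "\<phi>B g \<in> ring_hom B B" by (rule ring_hom_memI) (auto simp: B_simps \<phi>[OF g])
  show "\<phi>B g (c \<odot>\<^bsub>B\<^esub> x) = c \<odot>\<^bsub>B\<^esub> \<phi>B g x" if "c \<in> carrier K" "x \<in> carrier B" for c x
    using that by (auto simp: B_simps \<phi>(1)[OF g] smult(1) \<phi>_smult[OF g])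
  show "\<phi>B g ` DB d \<subseteq> DB d" for d using \<phi>_D[OF g] D_sub by (auto simp: B_simps)
qed

lemma B_gen_degree: "gen_degree B DB = gen_degree A D"
  by (rule gen_degree_iso[OF A.is_cring B_cring f_hom inj_f]) (auto simp: B_simps D_sub)

lemma B_inv_gen_degree: "inv_gen_degree G B DB \<phi>B = inv_gen_degree G A D \<phi>"
  unfolding inv_gen_degree_def
proof (rule gen_degree_iso[OF AG.is_cring])
  have BG: "x \<in> carrier (inv_ring G B \<phi>B) \<longleftrightarrow> x \<in> carrier B \<and> (\<forall>g\<in>carrier G. \<phi>B g x = x)" for x
    by (rule inv_ring_carrier[OF G.is_group])
  show "cring (inv_ring G B \<phi>B)"
    by (rule cring_inv_ring[OF B_cring G.is_group]) (use B_action in \<open>simp add: graded_G_algebra_def\<close>)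
  have eq: "f a \<in> carrier (inv_ring G B \<phi>B) \<longleftrightarrow> a \<in> carrier AG" if a: "a \<in> carrier A" for a
    using a f_eq[OF \<phi>(1)[OF _ a] a] by (auto simp: BG AG_carrier B_simps)
  show car: "f ` carrier AG = carrier (inv_ring G B \<phi>B)"
  proof (intro equalityI subsetI)
    fix x assume "x \<in> f ` carrier AG"
    then obtain a where "a \<in> carrier AG" "x = f a" by blast
    then show "x \<in> carrier (inv_ring G B \<phi>B)" using eq[of a] by (simp add: AG_carrier)
  next
    fix x assume x: "x \<in> carrier (inv_ring G B \<phi>B)"
    then obtain a where "a \<in> carrier A" "x = f a" by (auto simp: BG B_simps)
    then show "x \<in> f ` carrier AG" using eq[of a] x by simp
  qed
  show "f \<in> ring_hom AG (inv_ring G B \<phi>B)"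
  proof (rule ring_hom_memI)
    show "f x \<in> carrier (inv_ring G B \<phi>B)" if "x \<in> carrier AG" for x using imageI[OF that, of f] by (simp only: car)
  qed (simp_all add: AG_carrier B_simps)
  have sub: "carrier AG \<subseteq> carrier A" by (auto simp: AG_carrier)
  then show "inj_on f (carrier AG)" using inj_f inj_on_subset by blast
  show "D d \<inter> carrier AG \<subseteq> carrier AG" for d by simp
  show "DB d \<inter> carrier (inv_ring G B \<phi>B) = f ` (D d \<inter> carrier AG)" for d
    unfolding car[symmetric] by (rule inj_on_image_Int[OF inj_f _ sub, symmetric]) (auto intro: D_sub)
qed

end

text \<open>A polynomial function is coded by a degree bound and the list of its coefficients up to
  that bound. As \<open>K\<close> is infinite, its square is in bijection with \<open>K\<close>, so
  pairs and hence lists can be coded by single elements.\<close>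

lemma (in poly_rep) P_embeds:
  obtains h :: "(('i \<Rightarrow> 'k) \<Rightarrow> 'k) \<Rightarrow> 'k" where "inj_on h (carrier P)" "h ` carrier P \<subseteq> carrier K"
proof -
  obtain pr where pr: "bij_betw pr (carrier K \<times> carrier K) (carrier K)"
    by (rule exE[OF card_of_ordIso[THEN iffD2, OF card_of_Times_same_infinite[OF infK]]]) (rule that)
  have prc: "pr (x, y) \<in> carrier K" if "x \<in> carrier K" "y \<in> carrier K" for x y
    using bij_betwE[OF pr] that by auto
  have pri: "x = x' \<and> y = y'" if "pr (x, y) = pr (x', y')" "x \<in> carrier K" "y \<in> carrier K" "x' \<in> carrier K" "y' \<in> carrier K" for x y x' y'
    using inj_onD[OF bij_betw_imp_inj_on[OF pr] that(1)] that(2-) by auto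
  obtain \<nu> :: "nat \<Rightarrow> 'k" where \<nu>: "inj \<nu>" "range \<nu> \<subseteq> carrier K" using infinite_countable_subset[OF infK] by blast
  \<comment> \<open>The end marker \<open>\<nu> 0\<close> is not protected against confusion with
    other codes, so the fold is shown to be injective only among lists of equal length.\<close>
  define enc where "enc xs = foldr (\<lambda>x y. pr (x, y)) xs (\<nu> 0)" for xs
  have encc: "enc xs \<in> carrier K" if "set xs \<subseteq> carrier K" for xs
    using that \<nu>(2) by (induction xs) (auto simp: enc_def prc)
  have enci: "xs = ys" if "length xs = length ys" "set xs \<subseteq> carrier K" "set ys \<subseteq> carrier K" "enc xs = enc ys" for xs ys
    using that
  proof (induction xs ys rule: list_induct2)
    case (Cons x xs y ys)
    have "pr (x, enc xs) = pr (y, enc ys)" using Cons.prems(3) by (simp add: enc_def)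
    then have "x = y \<and> enc xs = enc ys" by (rule pri) (use Cons.prems encc in auto)
    then show ?case using Cons by simp
  qed simp
  \<comment> \<open>A fixed enumeration of the exponents for each bound turns coefficient functions
    into lists.\<close>
  have "\<forall>n. \<exists>es. set es = exponents I {..n}" using finite_list[OF finite_exponents(1)] by blast
  then obtain es where es: "\<forall>n. set (es n) = exponents I {..n}" by (rule choice[THEN exE])
  have "\<forall>p\<in>carrier P. \<exists>z. p = poly_fun K I {..fst z} (snd z) \<and> snd z \<in> exponents I {..fst z} \<rightarrow> carrier K"
    by (auto simp: poly_fun_ring_def)
  then obtain z where z: "\<forall>p\<in>carrier P. p = poly_fun K I {..fst (z p)} (snd (z p)) \<and> snd (z p) \<in> exponents I {..fst (z p)} \<rightarrow> carrier K"
    by (rule bchoice[THEN exE])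
  have zp: "poly_fun K I {..fst (z p)} (snd (z p)) = p" and zc: "snd (z p) \<in> exponents I {..fst (z p)} \<rightarrow> carrier K"
    if "p \<in> carrier P" for p
    by (rule bspec[OF z that, THEN conjunct1, symmetric]) (rule bspec[OF z that, THEN conjunct2])
  define code where "code p = map (snd (z p)) (es (fst (z p)))" for p
  have codec: "set (code p) \<subseteq> carrier K" if "p \<in> carrier P" for p
    using zc[OF that] es by (auto simp: code_def)
  \<comment> \<open>Storing the degree bound determines the length of the list, which makes
    \<open>enc\<close> decodable.\<close>
  define h where "h p = pr (\<nu> (fst (z p)), enc (code p))" for p
  have \<nu>c: "\<nu> n \<in> carrier K" for n using \<nu>(2) by auto
  have "inj_on h (carrier P)"
  proof (rule inj_onI)
    fix p q assume p: "p \<in> carrier P" and q: "q \<in> carrier P" and eq: "h p = h q"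
    have "\<nu> (fst (z p)) = \<nu> (fst (z q)) \<and> enc (code p) = enc (code q)"
      by (rule pri[OF eq[unfolded h_def] \<nu>c encc[OF codec[OF p]] \<nu>c encc[OF codec[OF q]]])
    then have n: "fst (z p) = fst (z q)" and e: "enc (code p) = enc (code q)" using injD[OF \<nu>(1)] by auto
    have "length (code p) = length (code q)" by (simp add: code_def n)
    then have "code p = code q" by (rule enci[OF _ codec[OF p] codec[OF q] e])
    then have c: "snd (z p) \<alpha> = snd (z q) \<alpha>" if "\<alpha> \<in> exponents I {..fst (z q)}" for \<alpha>
      using es that by (simp add: code_def n map_eq_conv)
    have zr: "rep r (\<lambda>\<alpha>. if \<alpha> \<in> exponents I {..fst (z r)} then E (snd (z r) \<alpha>) else 0)" if r: "r \<in> carrier P" for r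
      using rep_poly_fun[OF finite_exponents(1) zc[OF r]] by (simp only: zp[OF r])
    have "rep p (\<lambda>\<alpha>. if \<alpha> \<in> exponents I {..fst (z q)} then E (snd (z p) \<alpha>) else 0)"
      "rep q (\<lambda>\<alpha>. if \<alpha> \<in> exponents I {..fst (z q)} then E (snd (z q) \<alpha>) else 0)"
      using zr[OF p] zr[OF q] by (simp_all only: n)
    moreover have "(\<lambda>\<alpha>. if \<alpha> \<in> exponents I {..fst (z q)} then E (snd (z p) \<alpha>) else 0) =
      (\<lambda>\<alpha>. if \<alpha> \<in> exponents I {..fst (z q)} then E (snd (z q) \<alpha>) else 0)" by (rule ext) (simp add: c)
    ultimately show "p = q" by (simp only: rep_function_unique)
  qed
  moreover have "h ` carrier P \<subseteq> carrier K" using \<nu>c encc codec prc by (auto simp: h_def)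
  ultimately show thesis by (rule that)
qed

section \<open>Comparison of the Noether number with the regular representation\<close>

theorem corollary7p5:
  fixes K :: "('k, 'l) ring_scheme" and G :: "('g, 'h) monoid_scheme" and \<iota> :: "'k \<Rightarrow> 'u"
  assumes "field K" and "infinite (carrier K)"
    and "group G" and "finite (carrier G)"
    and "[order G] \<cdot>\<^bsub>K\<^esub> \<one>\<^bsub>K\<^esub> \<in> Units K"
    and "char_or_inf K \<ge> ereal (3 / 8 * real (order G) + 1)"
    and universe: "inj_on \<iota> (carrier K)"
  shows "noether_number TYPE('u) K G =
    inv_gen_degree G (poly_fun_ring K (carrier G)) (homog_poly_funs K (carrier G))
      (regular_poly_action K G)"
proof -
  let ?D = "homog_poly_funs K (carrier G)"
  have unit: "[card (carrier G)] \<cdot>\<^bsub>K\<^esub> \<one>\<^bsub>K\<^esub> \<in> Units K" using assms(5) by (simp only: order_def)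
  interpret P: regular_rep K G
    by (intro regular_rep.intro poly_rep.intro poly_rep_axioms.intro assms(1-4))
  obtain h :: "(('g \<Rightarrow> 'k) \<Rightarrow> 'k) \<Rightarrow> 'k" where h: "inj_on h (carrier P.P)" "h ` carrier P.P \<subseteq> carrier K"
    by (rule P.P_embeds)
  \<comment> \<open>A copy of the ring of polynomial functions inside the universe type:
    \<open>h\<close> codes polynomial functions by elements of \<open>K\<close>, and
    \<open>\<iota>\<close> places these in the universe.\<close>
  interpret T: transported_action K G P.P ?D P.act "\<iota> \<circ> h"
  proof (intro transported_action.intro transported_action_axioms.intro graded_action.intro graded_action_axioms.intro)
    show "inj_on (\<iota> \<circ> h) (carrier P.P)" by (rule comp_inj_on[OF h(1) inj_on_subset[OF universe h(2)]])
  qed (fact assms(1) assms(3) assms(4) unit P.P_graded_G_algebra)+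
  show ?thesis
  proof (rule antisym)
    show "noether_number TYPE('u) K G \<le> inv_gen_degree G P.P ?D P.act"
      unfolding noether_number_def
    proof (rule Sup_least)
      fix b assume "b \<in> {inv_gen_degree G A D \<phi> | (A :: ('k, 'u) module) D \<phi>. graded_G_algebra K G A D \<phi> \<and> gen_degree A D \<le> 1}"
      then obtain A :: "('k, 'u) module" and D \<phi> where b: "b = inv_gen_degree G A D \<phi>"
        and A: "graded_G_algebra K G A D \<phi>" "gen_degree A D \<le> 1" by blast
      interpret A: graded_action K G A D \<phi>
        by (intro graded_action.intro graded_action_axioms.intro assms(1,3,4) unit A(1))
      show "b \<le> inv_gen_degree G P.P ?D P.act"
        unfolding inv_gen_degree_def gen_degree_def
      \<comment> \<open>Every degree bound that works for the polynomial functions works for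
        \<open>A\<close>. If there is none, the infimum on the right is infinite and nothing is to
        be shown.\<close>
      proof (rule Inf_greatest)
        fix x assume "x \<in> {enat n | n. generate_ring P.PG (sum_upto_deg P.PG (\<lambda>d. ?D d \<inter> carrier P.PG) n) = carrier P.PG}"
        then obtain N where x: "x = enat N"
          and N: "generate_ring P.PG (sum_upto_deg P.PG (\<lambda>d. ?D d \<inter> carrier P.PG) N) = carrier P.PG" by blast
        have "A.Rn N = carrier A.AG"
          by (rule A.invariants_generated[OF P.prims_trivial[OF unit _ _ N] A(2)])
        then have "enat N \<in> {enat n | n. generate_ring A.AG (sum_upto_deg A.AG (\<lambda>d. D d \<inter> carrier A.AG) n) = carrier A.AG}"
          unfolding A.Rn_def by blast
        then show "b \<le> x" unfolding b x inv_gen_degree_def gen_degree_def by (rule Inf_lower)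
      qed
    qed
    \<comment> \<open>The copy competes in the supremum, and its invariants have the same generating
      degree as those of the original.\<close>
    have "graded_G_algebra K G T.B T.DB T.\<phi>B \<and> gen_degree T.B T.DB \<le> 1"
      by (rule conjI[OF T.B_action]) (simp only: T.B_gen_degree P.P_gen_degree)
    then have "inv_gen_degree G T.B T.DB T.\<phi>B \<le> noether_number TYPE('u) K G"
      unfolding noether_number_def by (intro Sup_upper) blast
    then show "inv_gen_degree G P.P ?D P.act \<le> noether_number TYPE('u) K G"
      by (simp only: T.B_inv_gen_degree)
  qed
qed

end
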